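(* Let $p$ be a prime, $u \geq 0$ an integer, $\varepsilon > 0$ a real number, $B$ a finite abelian $p$-group, and $\alpha, \beta > 0$ real numbers such that $\alpha + \beta < 1$. For each positive integer $n$, let $M(n)$ be a random matrix valued in $\mathrm{M}_{n\times(n+u)}(\mathbb{Z}_p)$ with independent columns $M(n)_1, \ldots, M(n)_{n+u}$, and let $A_1, \ldots, A_{n+u} \in \mathrm{GL}_n(\mathbb{Z}_p)$ be (deterministic, possibly depending on $n$) matrices such that for every $j$ the random vector $\tilde{M}(n)_j := A_j M(n)_j$ has independent entries. Let $W_j \subseteq \mathbb{Z}_p^n$ be the $\varepsilon$-balanced locus of $M(n)_j$. Assume that, for each $n$, at most $\alpha n$ entries of $\tilde M(n)_j$ are $\varepsilon$-degenerate for all $j \in [n+u]$. Assume also that, for each $n$, there exists a basis $u_1, \ldots, u_n$ of $\mathbb{Z}_p^n$ such that for all $i \in [n]$ \[\#\{j \in [n+u] : u_i \notin W_j\} \leq \beta n.\] Then \[\lim_{n \to \infty} \mathbb{P}(\mathrm{cok}(M(n)) \simeq B) = \frac{\prod_{k=1}^\infty (1-p^{-k-u})}{|B|^u\,|\mathrm{Aut}(B)|}.\]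
   Context: $\mathbb{Z}_p$ denotes the $p$-adic integers and $[m] = \{1,\ldots,m\}$. For $R \in \mathrm{M}_{n\times(n+u)}(\mathbb{Z}_p)$, $\mathrm{cok}(R) := \mathbb{Z}_p^n / R\,\mathbb{Z}_p^{n+u}$. A random variable $X$ valued in $\mathbb{Z}_p$ is $\varepsilon$-balanced if $\mathbb{P}(X \equiv t \pmod p) \leq 1-\varepsilon$ for all $t \in \mathbb{Z}/p\mathbb{Z}$; otherwise it is $\varepsilon$-degenerate. Let $e_1,\ldots,e_n$ be the canonical basis of $\mathbb{Z}_p^n$ and $v_i^j := A_j^{-1} e_i$. The $\varepsilon$-balanced locus of $M(n)_j$ is the $\mathbb{Z}_p$-submodule \[W_j := \langle v_i^j : i \in [n] \text{ and } (\tilde M(n)_j)_i \text{ is } \varepsilon\text{-balanced}\rangle \subseteq \mathbb{Z}_p^n,\] where $\langle\cdot\rangle$ denotes the submodule generated. *)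

theory Defs
  imports
    "HOL-Probability.Probability"
    "HOL-Algebra.Coset"
    "HOL-Algebra.Bij"
    "Berlekamp_Zassenhaus.Finite_Field"
    "Jordan_Normal_Form.VS_Connect"
begin

(* "$" is the vector index of Jordan_Normal_Form from here on. *)
unbundle no vec_syntax

section \<open>The ring of p-adic integers\<close>

text \<open>
  The prime is carried by a type variable of class \<^class>\<open>prime_card\<close>, as for \<^typ>\<open>'p mod_ring\<close>:
  throughout, p is \<open>CARD('p)\<close>. The ring is the inverse limit of the rings of integers modulo
  \<open>p ^ k\<close>, whose elements are represented by \<open>{0..<p ^ k}\<close>; the condition below implies that
  every \<open>x k\<close> lies in this range.
\<close>

typedef (overloaded) ('p :: prime_card) padic_int =
  "{x :: nat \<Rightarrow> int. \<forall>k. x (Suc k) mod int CARD('p) ^ k = x k}"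
  morphisms padic_residue Abs_padic_int
  by (rule exI[of _ "\<lambda>_. 0"]) simp

setup_lifting type_definition_padic_int

lemma mod_mod_Suc_power: "(a mod q ^ Suc k) mod q ^ k = a mod (q ^ k :: int)"
  by (rule mod_mod_cancel) simp

lemma padic_residue_Suc:
  "padic_residue (x :: 'p :: prime_card padic_int) (Suc k) mod int CARD('p) ^ k = padic_residue x k"
  by transfer simp

lemma padic_residue_mod:
  "padic_residue (x :: 'p :: prime_card padic_int) k mod int CARD('p) ^ k = padic_residue x k"
  by (metis mod_mod_trivial padic_residue_Suc)

instantiation padic_int :: (prime_card) comm_ring_1
begin

lift_definition zero_padic_int :: "'a padic_int" is "\<lambda>_. 0" by simp

lift_definition one_padic_int :: "'a padic_int" is "\<lambda>k. 1 mod int CARD('a) ^ k"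
  by (simp only: mod_mod_Suc_power simp_thms)

lift_definition plus_padic_int :: "'a padic_int \<Rightarrow> 'a padic_int \<Rightarrow> 'a padic_int"
  is "\<lambda>x y k. (x k + y k) mod int CARD('a) ^ k"
  by (metis mod_add_eq mod_mod_Suc_power)

lift_definition minus_padic_int :: "'a padic_int \<Rightarrow> 'a padic_int \<Rightarrow> 'a padic_int"
  is "\<lambda>x y k. (x k - y k) mod int CARD('a) ^ k"
  by (metis mod_diff_eq mod_mod_Suc_power)

lift_definition uminus_padic_int :: "'a padic_int \<Rightarrow> 'a padic_int"
  is "\<lambda>x k. (- x k) mod int CARD('a) ^ k"
  by (metis mod_minus_eq mod_mod_Suc_power)

lift_definition times_padic_int :: "'a padic_int \<Rightarrow> 'a padic_int \<Rightarrow> 'a padic_int"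
  is "\<lambda>x y k. (x k * y k) mod int CARD('a) ^ k"
  by (metis mod_mult_eq mod_mod_Suc_power)

lemmas padic_residue_simps =
  zero_padic_int.rep_eq one_padic_int.rep_eq plus_padic_int.rep_eq
  minus_padic_int.rep_eq uminus_padic_int.rep_eq times_padic_int.rep_eq

instance
proof
  fix a b c :: "'a padic_int"
  note defs = padic_residue_inject[symmetric] fun_eq_iff padic_residue_simps
  show "a * b * c = a * (b * c)"
    by (simp add: defs mod_mult_left_eq mod_mult_right_eq mult.assoc)
  show "a * b = b * a"
    by (simp add: defs mult.commute)
  show "1 * a = a"
    by (simp add: defs mod_mult_left_eq padic_residue_mod)
  show "a + b + c = a + (b + c)"
    by (simp add: defs mod_add_left_eq mod_add_right_eq add.assoc)
  show "a + b = b + a"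
    by (simp add: defs add.commute)
  show "0 + a = a"
    by (simp add: defs padic_residue_mod)
  show "- a + a = 0"
    by (simp add: defs mod_add_left_eq)
  show "a - b = a + - b"
    by (simp add: defs mod_add_right_eq)
  show "(a + b) * c = a * c + b * c"
    by (simp add: defs mod_mult_left_eq mod_add_eq distrib_right)
  have "padic_residue (0 :: 'a padic_int) 1 \<noteq> padic_residue (1 :: 'a padic_int) 1"
    using prime_gt_1_nat[OF prime_card[where 'a = 'a]] by (simp add: padic_residue_simps)
  then show "(0 :: 'a padic_int) \<noteq> 1" by metis
qed

end

lemma padic_residue_of_nat:
  "padic_residue (of_nat m :: 'p :: prime_card padic_int) k = int m mod int CARD('p) ^ k"
  by (induction m) (simp_all add: padic_residue_simps mod_add_eq)

lemma p_power_dvd_iff: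
  fixes x :: "'p :: prime_card padic_int"
  shows "of_nat CARD('p) ^ k dvd x \<longleftrightarrow> padic_residue x k = 0"
proof
  assume "of_nat CARD('p) ^ k dvd x"
  then obtain y where "x = of_nat (CARD('p) ^ k) * y"
    by (auto simp: dvd_def)
  then have "padic_residue x k
      = (int (CARD('p) ^ k) mod int CARD('p) ^ k * padic_residue y k) mod int CARD('p) ^ k"
    by (simp only: times_padic_int.rep_eq padic_residue_of_nat)
  then show "padic_residue x k = 0"
    by simp
next
  let ?p = "int CARD('p)"
  assume x0: "padic_residue x k = 0"
  have p0: "?p > 0"
    using prime_gt_0_nat[OF prime_card[where 'a = 'p]] by simp
  have coh: "padic_residue x (m + j) mod ?p ^ j = padic_residue x j" for m j
  proof (induction m)
    case 0
    then show ?case by (simp add: padic_residue_mod)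
  next
    case (Suc m)
    have "padic_residue x (Suc m + j) mod ?p ^ j
        = padic_residue x (Suc (m + j)) mod ?p ^ (m + j) mod ?p ^ j"
      by (simp add: mod_mod_cancel le_imp_power_dvd)
    then show ?case using Suc by (simp only: padic_residue_Suc)
  qed
  then have dvd: "?p ^ k dvd padic_residue x (m + k)" for m
    using x0 by (simp add: dvd_eq_mod_eq_0)
  define y :: "'p padic_int" where
    "y = Abs_padic_int (\<lambda>m. padic_residue x (m + k) div ?p ^ k)"
  have step: "(padic_residue x (Suc m + k) div ?p ^ k) mod ?p ^ m
      = padic_residue x (m + k) div ?p ^ k" for m
  proof -
    obtain c where c: "padic_residue x (Suc m + k) = ?p ^ k * c"
      using dvd by (metis dvd_def)
    have "padic_residue x (m + k) = (?p ^ k * c) mod (?p ^ k * ?p ^ m)"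
      using padic_residue_Suc[of x "m + k"] c by (simp add: power_add mult.commute)
    also have "\<dots> = ?p ^ k * (c mod ?p ^ m)"
      by (rule mult_mod_right[symmetric])
    finally show ?thesis using c p0 by simp
  qed
  then have y: "padic_residue y m = padic_residue x (m + k) div ?p ^ k" for m
    unfolding y_def by (subst Abs_padic_int_inverse) auto
  have "x = of_nat (CARD('p) ^ k) * y"
  proof (rule padic_residue_inject[THEN iffD1], rule ext)
    fix m
    have "padic_residue (of_nat (CARD('p) ^ k) * y) m
        = (?p ^ k * (padic_residue x (m + k) div ?p ^ k)) mod ?p ^ m"
      by (simp only: times_padic_int.rep_eq padic_residue_of_nat y mod_mult_left_eq
            of_nat_power[where 'a = int])
    also have "\<dots> = padic_residue x (k + m) mod ?p ^ m"
      using dvd[of m] by (simp only: dvd_mult_div_cancel add.commute)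
    also have "\<dots> = padic_residue x m"
      by (rule coh)
    finally show "padic_residue x m = padic_residue (of_nat (CARD('p) ^ k) * y) m" ..
  qed
  then show "of_nat CARD('p) ^ k dvd x"
    by simp
qed

text \<open>The p-adic topology; \<^const>\<open>borel\<close> on p-adic integers refers to it.\<close>

instantiation padic_int :: (prime_card) topological_space
begin

definition open_padic_int :: "'a padic_int set \<Rightarrow> bool" where
  "open_padic_int U \<longleftrightarrow> (\<forall>x\<in>U. \<exists>k. \<forall>y. of_nat CARD('a) ^ k dvd y - x \<longrightarrow> y \<in> U)"

instance
proof
  show "open (UNIV :: 'a padic_int set)"
    by (simp add: open_padic_int_def)
next
  fix S T :: "'a padic_int set"
  assume S: "open S" and T: "open T"
  show "open (S \<inter> T)"
    unfolding open_padic_int_def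
  proof
    fix x assume "x \<in> S \<inter> T"
    then obtain k l where
      "\<forall>y. of_nat CARD('a) ^ k dvd y - x \<longrightarrow> y \<in> S" "\<forall>y. of_nat CARD('a) ^ l dvd y - x \<longrightarrow> y \<in> T"
      using S T unfolding open_padic_int_def by blast
    then show "\<exists>k. \<forall>y. of_nat CARD('a) ^ k dvd y - x \<longrightarrow> y \<in> S \<inter> T"
      by (intro exI[of _ "max k l"]) (blast intro: power_le_dvd max.cobounded1 max.cobounded2)
  qed
next
  fix K :: "'a padic_int set set"
  assume "\<forall>S\<in>K. open S"
  then show "open (\<Union>K)"
    unfolding open_padic_int_def by (meson Union_iff)
qed

end


section \<open>Matrices, cokernels and balanced loci\<close>

text \<open>Indices run over \<open>{..<n}\<close> instead of \<open>{1..n}\<close>.\<close>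

definition cok :: "'p :: prime_card padic_int Matrix.mat \<Rightarrow> 'p padic_int Matrix.vec set monoid" where
  "cok R = monoid_vec TYPE('p padic_int) (dim_row R) Mod ((*\<^sub>v) R ` carrier_vec (dim_col R))"

definition GL :: "nat \<Rightarrow> 'p :: prime_card padic_int Matrix.mat set" where
  "GL n = Units (ring_mat TYPE('p padic_int) n ())"

definition submodule_span ::
  "nat \<Rightarrow> 'p :: prime_card padic_int Matrix.vec set \<Rightarrow> 'p padic_int Matrix.vec set" where
  "submodule_span n S = module.span class_ring (module_vec TYPE('p padic_int) n) S"

definition is_basis :: "nat \<Rightarrow> (nat \<Rightarrow> 'p :: prime_card padic_int Matrix.vec) \<Rightarrow> bool" where
  "is_basis n b \<longleftrightarrow>
     b ` {..<n} \<subseteq> carrier_vec n \<and> inj_on b {..<n} \<and>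
     \<not> module.lin_dep class_ring (module_vec TYPE('p padic_int) n) (b ` {..<n}) \<and>
     submodule_span n (b ` {..<n}) = carrier_vec n"

definition eps_balanced :: "'w measure \<Rightarrow> real \<Rightarrow> ('w \<Rightarrow> 'p :: prime_card padic_int) \<Rightarrow> bool" where
  "eps_balanced P \<epsilon> X \<longleftrightarrow>
     (\<forall>t :: int. \<P>(\<omega> in P. of_nat CARD('p) dvd X \<omega> - of_int t) \<le> 1 - \<epsilon>)"

definition balanced_locus ::
  "'w measure \<Rightarrow> real \<Rightarrow> nat \<Rightarrow> 'p :: prime_card padic_int Matrix.mat \<Rightarrow>
     ('w \<Rightarrow> 'p padic_int Matrix.vec) \<Rightarrow> 'p padic_int Matrix.vec set" where
  "balanced_locus P \<epsilon> n A X =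
     submodule_span n
       {inv\<^bsub>ring_mat TYPE('p padic_int) n ()\<^esub> A *\<^sub>v unit_vec n i | i.
          i < n \<and> eps_balanced P \<epsilon> (\<lambda>\<omega>. (A *\<^sub>v X \<omega>) $ i)}"

end

theory Submission
  imports Defs "HOL-Real_Asymp.Real_Asymp" "HOL-Algebra.Product_Groups"
begin

text \<open>
  Let \<open>order B = p ^ e\<close> and \<open>q = p ^ (e + 1)\<close>. By Nakayama's lemma the cokernel of M is determined
  by M modulo q as far as being isomorphic to B is concerned: this happens iff the group \<open>\<Lambda>\<close> of
  row vectors y modulo q with \<open>y M = 0\<close> is the annihilator Y of the kernel of a surjection onto B,
  and each such Y comes from \<open>card (auto B)\<close> surjections. If \<open>Y \<subseteq> \<Lambda>\<close>, let \<open>p ^ c\<close> be the index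
  of Y in \<open>{y \<in> \<Lambda>. p y \<in> Y}\<close>; then \<open>\<Lambda> = Y\<close> iff c = 0, and the indicator of c = 0 lies between
  consecutive partial sums of a q-series in the numbers of tuples of vectors of \<open>\<Lambda>\<close> that are
  independent over Y. The expectations of these numbers are sums of probabilities that F M = 0 for
  tuples F of row vectors, and they converge because the sum over all F of
  \<open>\<bar>P (F M = 0) - card (span F) ^ (- n - u)\<bar>\<close> tends to 0.

  For the last claim, write the probability that F kills column j as the average over a group G of
  means of characters. The mean at g is at most \<open>\<rho> ^ w\<close>, where the weight w counts the balanced
  entries of column j that the character at g sees. If all weights outside the annihilator of F are
  large, the probability is close to its limit. Otherwise, for each column, the g of small weight
  contain a subgroup \<open>D j\<close> outside which the weights are still linear in n. A subgroup X maximizing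
  \<open>(\<Prod>j. card (D j \<inter> X)) / card X powr (\<theta> * n)\<close>, with \<open>\<theta>\<close> slightly above \<open>\<beta>\<close>, bounds
  the probability; at the same time boundedly many columns, sparse functions and the basis vectors
  \<open>b i\<close> determine F on X, which leaves few such F, and \<open>\<alpha> + \<theta> < 1\<close> makes the product small.
\<close>

section \<open>Subgroups and homomorphisms of finite abelian groups\<close>

text \<open>The obstacle: a single bad F may kill M with probability far above the expected power of
  its span, so this excess has to be weighed against the number of such F. Let E be generated by X
  and all \<open>D j\<close>. Once F is fixed on X, the extensions to E with the same sparse values
  number at most \<open>(card E / card X) powr (\<alpha> * n)\<close>, since only degenerate entries
  are free; each has at most \<open>(card G / card E) ^ n\<close> extensions to G. Maximality of X
  bounds the product of the \<open>card (D j)\<close> by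
  \<open>card X ^ m * (card E / card X) powr (\<theta> * n)\<close>. Relative to
  \<open>card G ^ n\<close> the index of X in E then carries the exponent
  \<open>(\<alpha> + \<theta> - 1) * n\<close>. For E = X this gains nothing; there some g in X
  outside the annihilator of F has nonzero weight in all but \<open>\<beta> * n\<close> columns, and
  each of these columns loses a constant factor.

  The exponent e + 1 in q serves twice: \<open>p ^ e\<close> kills B, so one more factor p is what
  Nakayama's lemma needs, and it makes the vectors of Y divisible by p, so that the x with p x in Y
  can be counted exactly.\<close>

lemma card_le_fibres:
  assumes "finite A" "finite Y" "f ` A \<subseteq> Y" "\<And>y. y \<in> Y \<Longrightarrow> card {x \<in> A. f x = y} \<le> k"
  shows "card A \<le> k * card Y"
proof -
  have "card A = (\<Sum>y\<in>Y. card {x \<in> A. f x = y})"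
    using sum.group[OF assms(1,2,3), of "\<lambda>_. 1::nat"] by simp
  also have "\<dots> \<le> (\<Sum>y\<in>Y. k)"
    by (rule sum_mono) (use assms in auto)
  finally show ?thesis by (simp add: mult.commute)
qed

lemma int_div_less_aux: "a < d * r \<Longrightarrow> 0 < r \<Longrightarrow> a div r < (d::int)"
proof (rule ccontr)
  assume "a < d * r" "0 < r" "\<not> a div r < d"
  then have "d * r \<le> (a div r) * r" by (intro mult_right_mono) auto
  also have "\<dots> \<le> a" using \<open>0 < r\<close> by (simp add: minus_mod_eq_div_mult[symmetric])
  finally show False using \<open>a < d * r\<close> by simp
qed

text \<open>For d = gcd k q, the elements of V are congruent modulo q div d, and
  \<open>{0..<q}\<close> contains at most d of one class. This bounds the choices for the value of a
  homomorphism at g once its value at the k-th power of g is known.\<close>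

lemma card_congruent_le:
  fixes V :: "int set"
  assumes V: "V \<subseteq> {0..<int q}" and k: "k \<ge> 1"
    and dvd: "\<And>a b. a \<in> V \<Longrightarrow> b \<in> V \<Longrightarrow> int q dvd int k * (a - b)"
  shows "card V \<le> k"
proof (cases "q = 0")
  case True
  then show ?thesis using V by simp
next
  case False
  define d where "d = gcd k q"
  define r where "r = q div d"
  have d: "d > 0" "q = r * d" "d \<le> k"
    using False k by (auto simp: d_def r_def gcd_le1_nat)
  then have r: "r > 0" using False by (cases r) auto
  have cop: "coprime (int r) (int (k div d))"
    using False unfolding r_def d_def coprime_int_iff
    by (metis coprime_commute div_gcd_coprime)
  have kd: "k = d * (k div d)" by (simp add: d_def)
  have cong: "int r dvd a - b" if "a \<in> V" "b \<in> V" for a b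
  proof -
    have "int (r * d) dvd int (d * (k div d)) * (a - b)"
      using dvd[OF that] d(2) kd by simp
    then have "int r * int d dvd (int (k div d) * (a - b)) * int d"
      by (simp add: algebra_simps)
    then have "int r dvd int (k div d) * (a - b)"
      using d(1) by (simp only: dvd_mult_cancel_right) simp
    then show ?thesis
      using cop coprime_dvd_mult_right_iff by blast
  qed
  have "inj_on (\<lambda>a. a div int r) V"
  proof (rule inj_onI)
    fix a b assume ab: "a \<in> V" "b \<in> V" "a div int r = b div int r"
    then have "a mod int r = b mod int r"
      using cong[OF ab(1,2)] by (simp add: mod_eq_dvd_iff)
    then show "a = b" using ab(3) by (metis div_mult_mod_eq)
  qed
  moreover have "(\<lambda>a. a div int r) ` V \<subseteq> {0..<int d}"
  proof
    fix y assume "y \<in> (\<lambda>a. a div int r) ` V"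
    then obtain a where a: "a \<in> V" "y = a div int r" by auto
    then have "0 \<le> a" "a < int d * int r" using V d(2) by (auto simp: mult.commute)
    then show "y \<in> {0..<int d}"
      using a(2) r by (auto simp: pos_imp_zdiv_nonneg_iff intro: int_div_less_aux)
  qed
  ultimately have "card V \<le> card {0..<int d}"
    by (metis card_inj_on_le finite_atLeastLessThan_int)
  then show ?thesis using d(3) by simp
qed

lemma (in group) mult_left_cancel_iff:
  "x \<in> carrier G \<Longrightarrow> y \<in> carrier G \<Longrightarrow> z \<in> carrier G \<Longrightarrow> x \<otimes> y = x \<otimes> z \<longleftrightarrow> y = z"
  by (metis Units_eq Units_l_cancel)

text \<open>In a finite group the inverse of x is a power of x, so closure under products
  suffices.\<close>

lemma (in group) finite_subgroupI:
  assumes "finite (carrier G)" "H \<subseteq> carrier G" "\<one> \<in> H"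
    and "\<And>x y. x \<in> H \<Longrightarrow> y \<in> H \<Longrightarrow> x \<otimes> y \<in> H"
  shows "subgroup H G"
proof (rule subgroupI)
  show "inv x \<in> H" if x: "x \<in> H" for x
  proof -
    have pow: "x [^] (k::nat) \<in> H" for k
      by (induction k) (use assms x in auto)
    have xc: "x \<in> carrier G" using x assms by auto
    have "order G > 0" using assms(1) by (simp add: order_gt_0_iff_finite)
    then have "x [^] (order G - 1) \<otimes> x = \<one>"
      using pow_order_eq_1[OF xc] by (metis Suc_diff_1 nat_pow_Suc)
    then have "inv x = x [^] (order G - 1)"
      using inv_equality xc by auto
    then show ?thesis using pow by simp
  qed
qed (use assms in auto)

section \<open>Indices of subgroups\<close>

context comm_group
begin

text \<open>The number k is the order of g modulo E: the translates of E by the powers of g with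
  exponent below k are disjoint. The inequality is the form in which this enters the counting of
  extensions.\<close>

lemma generate_index:
  assumes fin: "finite (carrier G)" and E: "subgroup E G" and g: "g \<in> carrier G"
  shows "\<exists>k\<ge>1. g [^] (k::nat) \<in> E \<and> k * card E \<le> card (generate G (insert g E))"
proof -
  define P where "P = (\<lambda>k::nat. k \<ge> 1 \<and> g [^] k \<in> E)"
  define k where "k = (LEAST k. P k)"
  have "P (order G)"
    using pow_order_eq_1[OF g] subgroup.one_closed[OF E] fin
    by (simp add: P_def Suc_leI order_gt_0_iff_finite)
  then have Pk: "P k" unfolding k_def by (rule LeastI)
  have least: "\<not> P i" if "i < k" for i
    using that not_less_Least unfolding k_def by blast
  have Ec: "E \<subseteq> carrier G" using E subgroup.subset by blast
  let ?H = "generate G (insert g E)"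
  have sub: "insert g E \<subseteq> carrier G" using g Ec by auto
  have H: "subgroup ?H G" by (rule generate_is_subgroup[OF sub])
  have gH: "g \<in> ?H" "E \<subseteq> ?H" by (auto intro: generate.incl)
  have powH: "g [^] (i::nat) \<in> ?H" for i
    by (induction i) (use H gH in \<open>auto intro: subgroup.m_closed subgroup.one_closed\<close>)
  have aux: "i = j" if "i < k" "j < k" "i \<le> j" "a \<in> E" "b \<in> E" "g [^] i \<otimes> a = g [^] j \<otimes> b"
    for i j a b
  proof (rule ccontr)
    assume "i \<noteq> j"
    have "g [^] j = g [^] i \<otimes> g [^] (j - i)"
      using that(3) g by (simp add: nat_pow_mult)
    moreover have ab: "a \<in> carrier G" "b \<in> carrier G" using that Ec by auto
    ultimately have "g [^] i \<otimes> a = g [^] i \<otimes> (g [^] (j - i) \<otimes> b)"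
      using that(6) g by (simp add: m_assoc)
    then have "a = g [^] (j - i) \<otimes> b"
      using mult_left_cancel_iff ab g by simp
    then have "g [^] (j - i) = a \<otimes> inv b"
      using ab g inv_solve_right[of "g [^] (j - i)" a b] by simp
    then have "g [^] (j - i) \<in> E"
      using that E by (simp add: subgroup.m_closed subgroup.m_inv_closed)
    then have "P (j - i)" using that \<open>i \<noteq> j\<close> by (simp add: P_def)
    moreover have "j - i < k" using that by simp
    ultimately show False using least by blast
  qed
  have "inj_on (\<lambda>(i, e). g [^] i \<otimes> e) ({..<k} \<times> E)"
  proof (rule inj_onI, clarsimp)
    fix i a j b assume *: "i < k" "a \<in> E" "j < k" "b \<in> E" "g [^] i \<otimes> a = g [^] j \<otimes> b"
    then have "i = j" using aux[of i j a b] aux[of j i b a] by (cases "i \<le> j") auto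
    then show "i = j \<and> a = b" using * g Ec mult_left_cancel_iff[of "g [^] j" a b] by auto
  qed
  moreover have "(\<lambda>(i, e). g [^] i \<otimes> e) ` ({..<k} \<times> E) \<subseteq> ?H"
    using powH gH H by (auto intro: subgroup.m_closed)
  moreover have "finite ?H" using fin H subgroup.subset finite_subset by blast
  ultimately have "card ({..<k} \<times> E) \<le> card ?H"
    using card_inj_on_le by blast
  then show ?thesis using Pk by (auto simp: P_def card_cartesian_product)
qed

text \<open>The products d z with d in \<open>D \<inter> X\<close> and z in Z lie in X, and each
  element of X has at most \<open>card (D \<inter> Z)\<close> such representations, because the
  d-parts of two of them differ by an element of \<open>D \<inter> Z\<close>. So passing from Z to X
  enlarges the trace of D at most by the index of Z in X.\<close>

lemma card_Int_subgroup_mult_le: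
  assumes fin: "finite (carrier G)" and D: "subgroup D G" and Z: "subgroup Z G"
    and X: "subgroup X G" and ZX: "Z \<subseteq> X"
  shows "card (D \<inter> X) * card Z \<le> card (D \<inter> Z) * card X"
proof -
  have c: "D \<subseteq> carrier G" "Z \<subseteq> carrier G" "X \<subseteq> carrier G"
    using D Z X subgroup.subset by auto
  have f: "finite D" "finite Z" "finite X" using c fin finite_subset by blast+
  have "card ((D \<inter> X) \<times> Z) \<le> card (D \<inter> Z) * card X"
  proof (rule card_le_fibres[where f = "\<lambda>(d, z). d \<otimes> z"])
    show "(\<lambda>(d, z). d \<otimes> z) ` ((D \<inter> X) \<times> Z) \<subseteq> X"
      using ZX X by (auto intro!: subgroup.m_closed[OF X])
    fix y assume y: "y \<in> X"
    let ?S = "{p \<in> (D \<inter> X) \<times> Z. (\<lambda>(d, z). d \<otimes> z) p = y}"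
    show "card ?S \<le> card (D \<inter> Z)"
    proof (cases "?S = {}")
      case False
      then obtain d0 z0 where dz: "d0 \<in> D" "d0 \<in> X" "z0 \<in> Z" "d0 \<otimes> z0 = y" by auto
      have "inj_on (\<lambda>(d, z). inv d0 \<otimes> d) ?S"
      proof (rule inj_onI, clarsimp)
        fix d z d' z' assume *: "d \<in> D" "d' \<in> D" "z \<in> Z" "z' \<in> Z" "inv d0 \<otimes> d = inv d0 \<otimes> d'"
          "d' \<otimes> z' = d \<otimes> z"
        have cc: "d \<in> carrier G" "d' \<in> carrier G" "z \<in> carrier G" "z' \<in> carrier G" "inv d0 \<in> carrier G"
          using * c dz by auto
        then have "d = d'" using *(5) mult_left_cancel_iff by blast
        then show "d = d' \<and> z = z'" using *(6) cc mult_left_cancel_iff by blast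
      qed
      moreover have "(\<lambda>(d, z). inv d0 \<otimes> d) ` ?S \<subseteq> D \<inter> Z"
      proof (rule image_subsetI)
        fix p assume "p \<in> ?S"
        then obtain d z where p: "p = (d, z)" and *: "d \<in> D" "z \<in> Z" "d \<otimes> z = y" by auto
        have cc: "d \<in> carrier G" "z \<in> carrier G" "d0 \<in> carrier G" "z0 \<in> carrier G"
          using * c dz by auto
        have "d = d0 \<otimes> z0 \<otimes> inv z"
          using *(3) dz(4) cc inv_solve_right[of d "d0 \<otimes> z0" z] m_closed[of d0 z0] by auto
        then have "inv d0 \<otimes> d = z0 \<otimes> inv z"
          using cc by (simp add: m_assoc[symmetric])
        moreover have "z0 \<otimes> inv z \<in> Z"
          using * dz Z by (simp add: subgroup.m_closed subgroup.m_inv_closed)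
        moreover have "inv d0 \<otimes> d \<in> D"
          using * dz D by (simp add: subgroup.m_closed subgroup.m_inv_closed)
        ultimately show "(\<lambda>(d, z). inv d0 \<otimes> d) p \<in> D \<inter> Z" by (simp add: p)
      qed
      moreover have "finite (D \<inter> Z)" using f by simp
      ultimately show ?thesis
        by (rule card_inj_on_le)
    next
      case True
      then show ?thesis by (metis card.empty le0)
    qed
  next
    show "finite ((D \<inter> X) \<times> Z)" "finite X" using f by auto
  qed
  then show ?thesis by (simp add: card_cartesian_product)
qed

end

text \<open>The dual Hom(G, Z/q). Values are representatives in \<open>{0..<int q}\<close>, so they
  can enter sums and products of plain integers, and extensionality makes homomorphisms that agree
  on G equal as functions.\<close>

definition mod_homs :: "('a, 'b) monoid_scheme \<Rightarrow> nat \<Rightarrow> ('a \<Rightarrow> int) set" where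
  "mod_homs G q = {b \<in> carrier G \<rightarrow>\<^sub>E {0..<int q}.
     \<forall>x\<in>carrier G. \<forall>y\<in>carrier G. b (x \<otimes>\<^bsub>G\<^esub> y) = (b x + b y) mod int q}"

lemma mod_homs_mult:
  "b \<in> mod_homs G q \<Longrightarrow> x \<in> carrier G \<Longrightarrow> y \<in> carrier G \<Longrightarrow>
     b (x \<otimes>\<^bsub>G\<^esub> y) = (b x + b y) mod int q"
  by (simp add: mod_homs_def)

lemma mod_homs_range: "b \<in> mod_homs G q \<Longrightarrow> x \<in> carrier G \<Longrightarrow> b x \<in> {0..<int q}"
  by (auto simp: mod_homs_def PiE_def Pi_def)

lemma finite_mod_homs: "finite (carrier G) \<Longrightarrow> finite (mod_homs G q)"
  unfolding mod_homs_def
  by (rule finite_subset[of _ "carrier G \<rightarrow>\<^sub>E {0..<int q}"]) (auto intro: finite_PiE)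

context group
begin

lemma mod_homs_one:
  assumes "b \<in> mod_homs G q" shows "b \<one> = 0"
proof -
  have r: "0 \<le> b \<one>" "b \<one> < int q" using mod_homs_range[OF assms, of \<one>] by auto
  have "b \<one> = (b \<one> + b \<one>) mod int q"
    using mod_homs_mult[OF assms, of \<one> \<one>] by simp
  then have "b \<one> mod int q = (b \<one> + b \<one>) mod int q" using r by simp
  then have "int q dvd b \<one>" by (simp add: mod_eq_dvd_iff)
  then show ?thesis using r by (metis mod_pos_pos_trivial dvd_imp_mod_0)
qed

lemma mod_homs_pow:
  assumes "b \<in> mod_homs G q" "x \<in> carrier G"
  shows "b (x [^] (k::nat)) = (int k * b x) mod int q"
proof (induction k)
  case 0
  then show ?case using mod_homs_one[OF assms(1)] by simp
next
  case (Suc k)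
  then show ?case using mod_homs_mult[OF assms(1), of "x [^] k" x] assms(2)
    by (simp add: mod_add_right_eq algebra_simps)
qed

lemma subgroup_agree:
  assumes fin: "finite (carrier G)"
    and "\<And>x y. x \<in> carrier G \<Longrightarrow> y \<in> carrier G \<Longrightarrow> f (x \<otimes> y) = (f x + f y :: int) mod int q"
    and "\<And>x y. x \<in> carrier G \<Longrightarrow> y \<in> carrier G \<Longrightarrow> h (x \<otimes> y) = (h x + h y :: int) mod int q"
    and "f \<one> = h \<one>"
  shows "subgroup {x \<in> carrier G. f x = h x} G"
  by (rule finite_subgroupI[OF fin]) (use assms in auto)

lemma mod_homs_subgroup_agree:
  assumes fin: "finite (carrier G)" and "b \<in> mod_homs G q" "c \<in> mod_homs G q"
  shows "subgroup {x \<in> carrier G. b x = c x} G"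
  using mod_homs_one[OF assms(2)] mod_homs_one[OF assms(3)] mod_homs_mult[OF assms(2)]
    mod_homs_mult[OF assms(3)] by (intro subgroup_agree[OF fin, where q = q]) auto

end

text \<open>E is enlarged by one element g at a time. With k from \<open>generate_index\<close>, the
  value at g has at most k possibilities because the value at the k-th power of g is already common
  to all of S; in return the subgroup grows by a factor of at least k.\<close>

lemma (in comm_group) card_mod_homs_agree:
  assumes fin: "finite (carrier G)"
    and S: "S \<subseteq> mod_homs G q" and E: "subgroup E G"
    and agree: "\<And>b c x. b \<in> S \<Longrightarrow> c \<in> S \<Longrightarrow> x \<in> E \<Longrightarrow> b x = c x"
  shows "card S * card E \<le> card (carrier G)"
  using assms(2-)
proof (induction "card (carrier G) - card E" arbitrary: S E rule: less_induct)
  case less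
  note S = less.prems(1) and E = less.prems(2) and agree = less.prems(3)
  have Ec: "E \<subseteq> carrier G" using E subgroup.subset by blast
  have finS: "finite S" using S finite_mod_homs[OF fin] finite_subset by blast
  show ?case
  proof (cases "E = carrier G")
    case True
    have "b = c" if "b \<in> S" "c \<in> S" for b c
    proof (rule extensionalityI[where A = "carrier G"])
      show "b \<in> extensional (carrier G)" "c \<in> extensional (carrier G)"
        using that S by (auto simp: mod_homs_def PiE_def)
    qed (use agree that True in auto)
    then have "card S \<le> 1" using finS by (simp add: card_le_Suc0_iff_eq)
    then show ?thesis using True by simp
  next
    case False
    then obtain g where g: "g \<in> carrier G" "g \<notin> E" using Ec by auto
    obtain k where k: "k \<ge> 1" "g [^] k \<in> E" "k * card E \<le> card (generate G (insert g E))"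
      using generate_index[OF fin E g(1)] by blast
    let ?E = "generate G (insert g E)"
    have sub: "insert g E \<subseteq> carrier G" using g Ec by auto
    have H: "subgroup ?E G" by (rule generate_is_subgroup[OF sub])
    have finH: "finite ?E" using fin H subgroup.subset finite_subset by blast
    have "E \<subset> ?E" using g(2) by (auto intro: generate.incl)
    then have cE: "card E < card ?E" using finH psubset_card_mono by blast
    moreover have "card ?E \<le> card (carrier G)"
      by (rule card_mono[OF fin subgroup.subset[OF H]])
    ultimately have meas: "card (carrier G) - card ?E < card (carrier G) - card E" by simp
    define V where "V = (\<lambda>b. b g) ` S"
    have "card V \<le> k"
    proof (rule card_congruent_le[OF _ k(1)])
      show "V \<subseteq> {0..<int q}"
        unfolding V_def using S g(1) by (intro image_subsetI mod_homs_range) auto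
      fix a b assume "a \<in> V" "b \<in> V"
      then obtain f h where fh: "f \<in> S" "h \<in> S" "a = f g" "b = h g" by (auto simp: V_def)
      then have "(int k * a) mod int q = (int k * b) mod int q"
        using agree[OF fh(1,2) k(2)] S g(1) mod_homs_pow by (metis subsetD)
      then show "int q dvd int k * (a - b)" by (simp add: mod_eq_dvd_iff right_diff_distrib)
    qed
    moreover have "card {b \<in> S. b g = y} * card ?E \<le> card (carrier G)" for y
    proof (rule less.hyps[OF meas _ H])
      show "{b \<in> S. b g = y} \<subseteq> mod_homs G q" using S by auto
      fix b c x assume b: "b \<in> {b \<in> S. b g = y}" and c: "c \<in> {b \<in> S. b g = y}" and x: "x \<in> ?E"
      have "subgroup {x \<in> carrier G. b x = c x} G"
        by (rule mod_homs_subgroup_agree[OF fin]) (use b c S in auto)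
      moreover have "insert g E \<subseteq> {x \<in> carrier G. b x = c x}"
        using b c g Ec agree[of b c] by auto
      ultimately have "?E \<subseteq> {x \<in> carrier G. b x = c x}"
        using generate_subgroup_incl by blast
      then show "b x = c x" using x by auto
    qed
    moreover have "card ?E > 0" using cE by simp
    ultimately have "card {b \<in> S. b g = y} \<le> card (carrier G) div card ?E" for y
      by (simp add: less_eq_div_iff_mult_less_eq)
    then have "card S \<le> (card (carrier G) div card ?E) * card V"
      using finS by (intro card_le_fibres[where f = "\<lambda>b. b g"]) (auto simp: V_def)
    also have "\<dots> \<le> (card (carrier G) div card ?E) * k"
      using \<open>card V \<le> k\<close> by simp
    finally have "card S * card E \<le> (card (carrier G) div card ?E) * (k * card E)"
      by (metis mult.assoc mult_le_mono1)
    also have "\<dots> \<le> (card (carrier G) div card ?E) * card ?E"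
      using k(3) by simp
    also have "\<dots> \<le> card (carrier G)" by simp
    finally show ?thesis .
  qed
qed

lemma (in comm_group) card_mod_homs_le:
  assumes fin: "finite (carrier G)"
  shows "card (mod_homs G q) \<le> card (carrier G)"
proof -
  have "b x = c x" if "b \<in> mod_homs G q" "c \<in> mod_homs G q" "x \<in> {\<one>}" for b c x
    using that mod_homs_one[of b q] mod_homs_one[of c q] by simp
  then have "card (mod_homs G q) * card {\<one>} \<le> card (carrier G)"
    by (intro card_mod_homs_agree[OF fin subset_refl triv_subgroup]) blast
  then show ?thesis by simp
qed

section \<open>Sparse functions and threshold subgroups\<close>

text \<open>By double counting, some j covers at least the fraction \<open>\<theta>\<close> of the
  points not yet covered. Choosing such a j in each of t steps leaves at most
  \<open>(1 - \<theta>) ^ t\<close> of P.\<close>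

lemma greedy_cover:
  assumes P: "finite P" and J: "finite J" "J \<noteq> {}" and th: "0 \<le> \<theta>" "\<theta> \<le> 1"
    and cov: "\<And>x. x \<in> P \<Longrightarrow> real (card {j \<in> J. R x j}) \<ge> \<theta> * real (card J)"
  shows "\<exists>js. length js = t \<and> set js \<subseteq> J \<and>
           real (card {x \<in> P. \<forall>j\<in>set js. \<not> R x j}) \<le> (1 - \<theta>) ^ t * real (card P)"
proof (induction t)
  case 0
  then show ?case by simp
next
  case (Suc t)
  then obtain js where js: "length js = t" "set js \<subseteq> J"
    "real (card {x \<in> P. \<forall>j\<in>set js. \<not> R x j}) \<le> (1 - \<theta>) ^ t * real (card P)" by blast
  define U where "U = {x \<in> P. \<forall>j\<in>set js. \<not> R x j}"
  have U: "finite U" "U \<subseteq> P" using P by (auto simp: U_def)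
  have "\<exists>j\<in>J. real (card {x \<in> U. R x j}) \<ge> \<theta> * real (card U)"
  proof (rule ccontr)
    assume "\<not> ?thesis"
    then have "(\<Sum>j\<in>J. real (card {x \<in> U. R x j})) < (\<Sum>j\<in>J. \<theta> * real (card U))"
      using J by (intro sum_strict_mono) (auto simp: not_le)
    moreover have "(\<Sum>j\<in>J. real (card {x \<in> U. R x j})) = (\<Sum>x\<in>U. real (card {j \<in> J. R x j}))"
    proof -
      have "(\<Sum>j\<in>J. real (card {x \<in> U. R x j})) = (\<Sum>j\<in>J. \<Sum>x\<in>U. of_bool (R x j))"
        using U by (simp add: sum.If_cases of_bool_def Int_def)
      also have "\<dots> = (\<Sum>x\<in>U. \<Sum>j\<in>J. of_bool (R x j))" by (rule sum.swap)
      also have "\<dots> = (\<Sum>x\<in>U. real (card {j \<in> J. R x j}))"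
        using J by (simp add: sum.If_cases of_bool_def Int_def)
      finally show ?thesis .
    qed
    moreover have "(\<Sum>x\<in>U. real (card {j \<in> J. R x j})) \<ge> (\<Sum>x\<in>U. \<theta> * real (card J))"
      using U cov by (intro sum_mono) auto
    ultimately show False by (simp add: algebra_simps)
  qed
  then obtain j where j: "j \<in> J" "real (card {x \<in> U. R x j}) \<ge> \<theta> * real (card U)" by blast
  have eq: "{x \<in> P. \<forall>i\<in>set (j # js). \<not> R x i} = U - {x \<in> U. R x j}"
    by (auto simp: U_def)
  have "real (card (U - {x \<in> U. R x j})) = real (card U) - real (card {x \<in> U. R x j})"
  proof -
    have "card {x \<in> U. R x j} \<le> card U" using U by (intro card_mono) auto
    moreover have "card (U - {x \<in> U. R x j}) = card U - card {x \<in> U. R x j}"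
      using U by (intro card_Diff_subset) auto
    ultimately show ?thesis by (simp add: of_nat_diff)
  qed
  also have "\<dots> \<le> (1 - \<theta>) * real (card U)" using j(2) by (simp add: algebra_simps)
  also have "\<dots> \<le> (1 - \<theta>) * ((1 - \<theta>) ^ t * real (card P))"
    using js(3) th by (intro mult_left_mono) (auto simp: U_def)
  finally show ?case
    using js j(1) eq by (intro exI[of _ "j # js"]) simp
qed

definition sparse_funs :: "nat \<Rightarrow> 'a set \<Rightarrow> 'a \<Rightarrow> real \<Rightarrow> (nat \<Rightarrow> 'a) set" where
  "sparse_funs n A z d = {f \<in> {..<n} \<rightarrow>\<^sub>E A. real (card {i. i < n \<and> f i \<noteq> z}) \<le> d * real n}"

lemma finite_sparse_funs: "finite A \<Longrightarrow> finite (sparse_funs n A z d)"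
  unfolding sparse_funs_def by (rule finite_subset[of _ "{..<n} \<rightarrow>\<^sub>E A"]) (auto intro: finite_PiE)

text \<open>Every sparse function contributes at least \<open>y powr (d * n)\<close> to the expansion of
  \<open>(1 + N * y) ^ n\<close>, which weights a function by y to the size of its support.\<close>

lemma card_sparse_funs_le:
  assumes A: "finite A" "card A \<le> N" and y: "0 < y" "y \<le> 1"
  shows "real (card (sparse_funs n A z d)) \<le> (y powr (- d) * (1 + real N * y)) ^ n"
proof -
  define w where "w = (\<lambda>a. if a = z then 1 else y)"
  have w0: "w a > 0" for a using y by (simp add: w_def)
  have "real (card (sparse_funs n A z d)) * y powr (d * real n)
      = (\<Sum>f\<in>sparse_funs n A z d. y powr (d * real n))" by simp
  also have "\<dots> \<le> (\<Sum>f\<in>sparse_funs n A z d. \<Prod>i\<in>{..<n}. w (f i))"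
  proof (rule sum_mono)
    fix f assume f: "f \<in> sparse_funs n A z d"
    have "(\<Prod>i\<in>{..<n}. w (f i)) = (\<Prod>i\<in>{i. i < n \<and> f i \<noteq> z}. y)"
      by (rule prod.mono_neutral_cong_right) (auto simp: w_def)
    also have "\<dots> = y powr real (card {i. i < n \<and> f i \<noteq> z})"
      using y by (simp add: powr_realpow)
    also have "\<dots> \<ge> y powr (d * real n)"
      using f y by (intro powr_mono') (auto simp: sparse_funs_def)
    finally show "y powr (d * real n) \<le> (\<Prod>i\<in>{..<n}. w (f i))" .
  qed
  also have "\<dots> \<le> (\<Sum>f\<in>{..<n} \<rightarrow>\<^sub>E A. \<Prod>i\<in>{..<n}. w (f i))"
    using A w0 by (intro sum_mono2 finite_PiE prod_nonneg) (auto simp: sparse_funs_def less_imp_le)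
  also have "\<dots> = (\<Prod>i\<in>{..<n}. \<Sum>a\<in>A. w a)"
    by (rule prod_sum_PiE[symmetric]) (use A in auto)
  also have "\<dots> = (\<Sum>a\<in>A. w a) ^ n" by simp
  also have "\<dots> \<le> (1 + real N * y) ^ n"
  proof (rule power_mono)
    have "(\<Sum>a\<in>A. w a) \<le> (\<Sum>a\<in>A. y + (if a = z then 1 else 0))"
      using y by (intro sum_mono) (auto simp: w_def)
    also have "\<dots> \<le> real (card A) * y + 1"
      using A by (auto simp: sum.distrib sum.delta)
    also have "\<dots> \<le> 1 + real N * y" using A y by (simp add: mult_right_mono)
    finally show "(\<Sum>a\<in>A. w a) \<le> 1 + real N * y" .
    show "0 \<le> (\<Sum>a\<in>A. w a)" by (intro sum_nonneg) (use w0 less_imp_le in auto)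
  qed
  finally have *: "real (card (sparse_funs n A z d)) * y powr (d * real n) \<le> (1 + real N * y) ^ n" .
  have "real (card (sparse_funs n A z d))
      = (real (card (sparse_funs n A z d)) * y powr (d * real n)) * y powr (- (d * real n))"
    using y by (simp add: powr_add[symmetric] mult.assoc)
  also have "\<dots> \<le> (1 + real N * y) ^ n * y powr (- (d * real n))"
    using * by (intro mult_right_mono) auto
  also have "y powr (- (d * real n)) = (y powr (- d)) ^ n"
    using y by (simp add: powr_realpow[symmetric] powr_powr)
  finally show ?thesis by (simp add: power_mult_distrib mult.commute)
qed

text \<open>Functions that differ from z on a small fraction of the coordinates have small
  exponential growth rate. In the preceding bound, y is taken so small that
  \<open>1 + N * y \<le> exp (h / 2)\<close>, and d is then solved from
  \<open>y powr (- d) = exp (h / 2)\<close>.\<close>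

lemma sparse_funs_exp_bound:
  assumes h: "h > (0::real)"
  shows "\<exists>d>0. \<forall>n A z. finite A \<longrightarrow> card A \<le> N \<longrightarrow> real (card (sparse_funs n A z d)) \<le> exp (h * real n)"
proof -
  define y where "y = min (1/2) (h / (2 * (real N + 1)))"
  have y: "0 < y" "y < 1" using h by (auto simp: y_def)
  have Ny: "real N * y \<le> h / 2"
  proof -
    have "real N * y \<le> real N * (h / (2 * (real N + 1)))" by (intro mult_left_mono) (auto simp: y_def)
    also have "\<dots> \<le> h / 2" using h by (simp add: field_simps)
    finally show ?thesis .
  qed
  define d where "d = h / (2 * (- ln y))"
  have ly: "- ln y > 0" using y by simp
  have d: "d > 0" using h ly unfolding d_def by (intro divide_pos_pos) auto
  have "y powr (- d) = exp (h / 2)" using y ly by (simp add: powr_def d_def field_simps)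
  then have "y powr (- d) * (1 + real N * y) \<le> exp (h / 2) * exp (h / 2)"
    using y order_trans[OF exp_ge_add_one_self[of "real N * y"], of "exp (h / 2)"] Ny
    by (intro mult_mono) auto
  also have "\<dots> = exp h" by (simp add: exp_add[symmetric])
  finally have b: "y powr (- d) * (1 + real N * y) \<le> exp h" .
  have "real (card (sparse_funs n A z d)) \<le> exp (h * real n)" if "finite A" "card A \<le> N"
    for n A and z :: 'a
  proof -
    have "real (card (sparse_funs n A z d)) \<le> (y powr (- d) * (1 + real N * y)) ^ n"
      using card_sparse_funs_le[OF that] y by simp
    also have "\<dots> \<le> exp h ^ n" using b y by (intro power_mono) auto
    finally show ?thesis by (simp add: exp_of_nat_mult[symmetric] mult.commute)
  qed
  then show ?thesis using d by blast
qed

text \<open>The sets of elements of weight below \<open>2 ^ l * d\<close> increase with l, so by counting two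
  consecutive ones agree, and such a set is closed under multiplication.\<close>

lemma (in group) threshold_subgroup:
  fixes w :: "'a \<Rightarrow> nat" and d :: real
  assumes fin: "finite (carrier G)" and d: "d > 0"
    and one: "w \<one> = 0"
    and sub: "\<And>x y. x \<in> carrier G \<Longrightarrow> y \<in> carrier G \<Longrightarrow> w (x \<otimes> y) \<le> w x + w y"
  shows "\<exists>D. subgroup D G \<and> (\<forall>x\<in>D. real (w x) \<le> 2 ^ card (carrier G) * d) \<and>
             (\<forall>x\<in>carrier G - D. real (w x) \<ge> d)"
proof -
  define S where "S = (\<lambda>l::nat. {x \<in> carrier G. real (w x) < 2 ^ l * d})"
  have finS: "finite (S l)" for l using fin by (simp add: S_def)
  have mono: "S l \<subseteq> S (Suc l)" for l
    using d by (auto simp: S_def intro: less_le_trans)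
  have "\<exists>l\<le>card (carrier G). S l = S (Suc l)"
  proof (rule ccontr)
    assume "\<not> ?thesis"
    then have ne: "S l \<noteq> S (Suc l)" if "l \<le> card (carrier G)" for l using that by blast
    have "card (S l) \<ge> l" if "l \<le> Suc (card (carrier G))" for l
      using that
    proof (induction l)
      case (Suc l)
      have "S l \<subset> S (Suc l)" using mono ne Suc.prems by auto
      then have "card (S l) < card (S (Suc l))" using finS psubset_card_mono by blast
      then show ?case using Suc by simp
    qed simp
    from this[of "Suc (card (carrier G))"] have "card (S (Suc (card (carrier G)))) > card (carrier G)" by simp
    moreover have "card (S (Suc (card (carrier G)))) \<le> card (carrier G)"
      by (rule card_mono[OF fin]) (auto simp: S_def)
    ultimately show False by simp
  qed
  then obtain l where l: "l \<le> card (carrier G)" "S l = S (Suc l)" by blast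
  have "subgroup (S l) G"
  proof (rule finite_subgroupI[OF fin])
    show "x \<otimes> y \<in> S l" if "x \<in> S l" "y \<in> S l" for x y
    proof -
      have "real (w (x \<otimes> y)) \<le> real (w x) + real (w y)" using that sub[of x y] by (simp add: S_def)
      also have "\<dots> < 2 ^ Suc l * d" using that by (simp add: S_def)
      finally show ?thesis using that l(2) by (simp add: S_def)
    qed
  qed (use d one in \<open>auto simp: S_def\<close>)
  moreover have "real (w x) \<le> 2 ^ card (carrier G) * d" if "x \<in> S l" for x
  proof -
    have "real (w x) \<le> 2 ^ l * d" using that by (simp add: S_def)
    also have "\<dots> \<le> 2 ^ card (carrier G) * d" using l d by (intro mult_right_mono power_increasing) auto
    finally show ?thesis .
  qed
  moreover have "real (w x) \<ge> d" if "x \<in> carrier G - S l" for x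
  proof -
    have "d \<le> 2 ^ l * d" using d by simp
    then show ?thesis using that by (auto simp: S_def)
  qed
  ultimately show ?thesis by blast
qed

section \<open>Homomorphisms killing random columns\<close>

lemma card_le_fibres_real:
  fixes K :: real
  assumes "finite A" "finite Y" "f ` A \<subseteq> Y" "\<And>y. y \<in> Y \<Longrightarrow> real (card {x \<in> A. f x = y}) \<le> K"
  shows "real (card A) \<le> K * real (card Y)"
proof -
  have "real (card A) = (\<Sum>y\<in>Y. real (card {x \<in> A. f x = y}))"
    using sum.group[OF assms(1,2,3), of "\<lambda>_. 1::real"] by simp
  also have "\<dots> \<le> (\<Sum>y\<in>Y. K)"
    by (rule sum_mono) (use assms in auto)
  finally show ?thesis by (simp add: mult.commute)
qed

text \<open>Replacing one factor at a time, the extreme case is that every factor equals c +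
  t.\<close>

lemma abs_prod_diff_power_le:
  fixes a :: "nat \<Rightarrow> real"
  assumes "c \<ge> 0" "t \<ge> 0" "\<And>j. j < m \<Longrightarrow> \<bar>a j - c\<bar> \<le> t"
  shows "\<bar>(\<Prod>j<m. a j) - c ^ m\<bar> \<le> (c + t) ^ m - c ^ m"
  using assms(3)
proof (induction m)
  case (Suc m)
  have am: "\<bar>a m - c\<bar> \<le> t" using Suc.prems by simp
  then have am': "\<bar>a m\<bar> \<le> c + t" using assms by linarith
  have eq: "(\<Prod>j<Suc m. a j) - c ^ Suc m = ((\<Prod>j<m. a j) - c ^ m) * a m + c ^ m * (a m - c)"
    by (simp add: algebra_simps)
  have "\<bar>(\<Prod>j<Suc m. a j) - c ^ Suc m\<bar> \<le> \<bar>(\<Prod>j<m. a j) - c ^ m\<bar> * \<bar>a m\<bar> + c ^ m * \<bar>a m - c\<bar>"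
    unfolding eq using abs_triangle_ineq[of "((\<Prod>j<m. a j) - c ^ m) * a m" "c ^ m * (a m - c)"] assms(1)
    by (simp add: abs_mult)
  also have "\<dots> \<le> ((c + t) ^ m - c ^ m) * (c + t) + c ^ m * t"
    using Suc.IH Suc.prems am am' assms by (intro add_mono mult_mono) auto
  also have "\<dots> = (c + t) ^ Suc m - c ^ Suc m" by (simp add: algebra_simps)
  finally show ?case .
qed simp

section \<open>Pairing a row of homomorphisms with vectors modulo q\<close>

definition in_span_mod :: "nat \<Rightarrow> nat \<Rightarrow> nat set \<Rightarrow> (nat \<Rightarrow> nat \<Rightarrow> int) \<Rightarrow> (nat \<Rightarrow> int) \<Rightarrow> bool" where
  "in_span_mod q n J w z \<longleftrightarrow> (\<exists>a. \<forall>d<n. [z d = (\<Sum>l\<in>J. a l * w l d)] (mod int q))"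

text \<open>If F is read as the linear map from (Z/q)^n to Hom(G, Z/q) that sends the c-th unit
  vector to F c, this is the value at g of the image of z.\<close>

definition pairing :: "nat \<Rightarrow> nat \<Rightarrow> (nat \<Rightarrow> 'a \<Rightarrow> int) \<Rightarrow> (nat \<Rightarrow> int) \<Rightarrow> 'a \<Rightarrow> int" where
  "pairing q n F z g = (\<Sum>c<n. F c g * z c) mod int q"

lemma pairing_span:
  assumes "finite J" "in_span_mod q n J w z"
    and agree: "\<And>l. l \<in> J \<Longrightarrow> pairing q n F (w l) g = pairing q n F' (w l) h"
  shows "pairing q n F z g = pairing q n F' z h"
proof -
  obtain a where a: "\<And>d. d < n \<Longrightarrow> [z d = (\<Sum>l\<in>J. a l * w l d)] (mod int q)"
    using assms(2) unfolding in_span_mod_def by blast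
  have eq: "pairing q n F z g = (\<Sum>l\<in>J. a l * pairing q n F (w l) g) mod int q" for F :: "nat \<Rightarrow> 'x \<Rightarrow> int" and g
  proof -
    have "[(\<Sum>c<n. F c g * z c) = (\<Sum>c<n. F c g * (\<Sum>l\<in>J. a l * w l c))] (mod int q)"
      by (intro cong_sum cong_mult cong_refl a) simp
    also have "(\<Sum>c<n. F c g * (\<Sum>l\<in>J. a l * w l c)) = (\<Sum>l\<in>J. a l * (\<Sum>c<n. F c g * w l c))"
      unfolding sum_distrib_left by (subst sum.swap) (simp add: ac_simps)
    also have "[(\<Sum>l\<in>J. a l * (\<Sum>c<n. F c g * w l c)) = (\<Sum>l\<in>J. a l * pairing q n F (w l) g)] (mod int q)"
      by (intro cong_sum cong_mult cong_refl) (simp add: pairing_def cong_def)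
    finally show ?thesis unfolding cong_def by (simp add: pairing_def)
  qed
  show ?thesis unfolding eq using agree by simp
qed

lemma pairing_unit:
  assumes "c < n" "F c g \<in> {0..<int q}"
  shows "pairing q n F (\<lambda>d. of_bool (c = d)) g = F c g"
proof -
  have "(\<Sum>d<n. F d g * of_bool (c = d)) = (\<Sum>d\<in>{c}. F d g)"
    using assms(1) by (intro sum.mono_neutral_cong_right) auto
  then show ?thesis using assms(2) by (simp add: pairing_def)
qed

lemma (in comm_group) pairing_mult:
  assumes "\<And>c. c < n \<Longrightarrow> F c \<in> mod_homs G q" "g \<in> carrier G" "h \<in> carrier G"
  shows "pairing q n F z (g \<otimes> h) = (pairing q n F z g + pairing q n F z h) mod int q"
proof -
  have "[(\<Sum>c<n. F c (g \<otimes> h) * z c) = (\<Sum>c<n. (F c g + F c h) * z c)] (mod int q)"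
    by (intro cong_sum cong_mult cong_refl)
      (simp add: mod_homs_mult[OF assms(1)] assms cong_def)
  then show ?thesis
    by (simp add: pairing_def cong_def distrib_right sum.distrib mod_add_eq)
qed

lemma (in comm_group) pairing_one:
  assumes "\<And>c. c < n \<Longrightarrow> F c \<in> mod_homs G q"
  shows "pairing q n F z \<one> = 0"
proof -
  have "F c \<one> = 0" if "c < n" for c by (rule mod_homs_one[OF assms[OF that]])
  then show ?thesis by (simp add: pairing_def)
qed

lemma (in comm_group) generate_generate_insert:
  assumes "E \<subseteq> carrier G" "g \<in> carrier G" "A \<subseteq> carrier G"
  shows "generate G (generate G (insert g E) \<union> A) = generate G (E \<union> insert g A)"
proof
  have sub: "insert g E \<subseteq> carrier G" "E \<union> insert g A \<subseteq> carrier G" using assms by auto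
  have "generate G (insert g E) \<subseteq> generate G (E \<union> insert g A)"
    by (rule mono_generate) auto
  then have "generate G (insert g E) \<union> A \<subseteq> generate G (E \<union> insert g A)"
    by (auto intro: generate.incl)
  then show "generate G (generate G (insert g E) \<union> A) \<subseteq> generate G (E \<union> insert g A)"
    using generate_subgroup_incl generate_is_subgroup[OF sub(2)] by blast
  have "generate G (insert g E) \<union> A \<subseteq> carrier G"
    using assms(3) generate_incl[OF sub(1)] by simp
  moreover have "E \<union> insert g A \<subseteq> generate G (insert g E) \<union> A"
    by (auto intro: generate.incl)
  ultimately show "generate G (E \<union> insert g A) \<subseteq> generate G (generate G (insert g E) \<union> A)"
    by (intro mono_generate)
qed

lemma (in group) card_subgroup_dvd:
  assumes "subgroup A G" "subgroup X G" "A \<subseteq> X"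
  shows "card A dvd card X"
proof -
  interpret X: group "G\<lparr>carrier := X\<rparr>" by (rule subgroup_imp_group[OF assms(2)])
  have "subgroup A (G\<lparr>carrier := X\<rparr>)" by (rule subgroup_incl[OF assms])
  from X.lagrange[OF this] have "card (rcosets\<^bsub>G\<lparr>carrier := X\<rparr>\<^esub> A) * card A = card X"
    by (simp add: order_def)
  then show ?thesis by (metis dvd_triv_right)
qed

lemma (in group) generate_of_subgroup: "subgroup E G \<Longrightarrow> generate G E = E"
  using generate_subgroup_incl[of E E] by (auto intro: generate.incl)

text \<open>The deterministic side of the problem modulo q. Here \<open>v j i\<close> stands for the
  i-th column of the inverse of A_j, \<open>I j\<close> for the balanced entries of column j, and b
  for the given basis, so that \<open>W_card\<close> speaks of membership of b i in the locus W_j.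
  The group G stays abstract; it becomes (Z/q)^r.\<close>

locale column_structure = comm_group G for G (structure) +
  fixes q n m :: nat and v :: "nat \<Rightarrow> nat \<Rightarrow> nat \<Rightarrow> int" and I :: "nat \<Rightarrow> nat set"
    and b :: "nat \<Rightarrow> nat \<Rightarrow> int" and \<alpha> \<beta> :: real
  assumes fin: "finite (carrier G)" and q: "q > 0" and n: "n > 0" and nm: "n \<le> m"
    and v_span: "\<And>j c. j < m \<Longrightarrow> c < n \<Longrightarrow> in_span_mod q n {..<n} (v j) (\<lambda>d. of_bool (c = d))"
    and b_span: "\<And>c. c < n \<Longrightarrow> in_span_mod q n {..<n} b (\<lambda>d. of_bool (c = d))"
    and I_sub: "\<And>j. j < m \<Longrightarrow> I j \<subseteq> {..<n}"
    and I_card: "\<And>j. j < m \<Longrightarrow> real (card ({..<n} - I j)) \<le> \<alpha> * real n"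
    and W_card: "\<And>i. i < n \<Longrightarrow>
      real (card {j. j < m \<and> \<not> in_span_mod q n (I j) (v j) (b i)}) \<le> \<beta> * real n"
begin

abbreviation "Psi \<equiv> mod_homs G q"
abbreviation "Fs \<equiv> {..<n} \<rightarrow>\<^sub>E Psi"
abbreviation "pr \<equiv> pairing q n"
abbreviation "inW i j \<equiv> in_span_mod q n (I j) (v j) (b i)"

definition "pairing_fun F z = (\<lambda>g\<in>carrier G. pr F z g)"
definition "zero_fun = (\<lambda>g\<in>carrier G. 0::int)"
definition "wt j F g = card {i \<in> I j. pr F (v j i) g \<noteq> 0}"
definition "Ann F = {g \<in> carrier G. \<forall>c<n. F c g = 0}"

lemma finite_Fs: "finite Fs"
  using finite_mod_homs[OF fin] by (intro finite_PiE) auto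

lemma FsD: "F \<in> Fs \<Longrightarrow> c < n \<Longrightarrow> F c \<in> Psi" by auto

lemma pairing_fun_in: assumes "F \<in> Fs" shows "pairing_fun F z \<in> Psi"
  unfolding mod_homs_def pairing_fun_def using q pairing_mult[OF FsD[OF assms]]
  by (auto simp: pairing_def)

lemma zero_fun_in: "zero_fun \<in> Psi"
  unfolding mod_homs_def zero_fun_def using q by auto

lemma subgroup_carrier: "subgroup D G \<Longrightarrow> D \<subseteq> carrier G"
  by (rule subgroup.subset)

lemma subgroup_finite: "subgroup D G \<Longrightarrow> finite D"
  using subgroup_carrier fin finite_subset by blast

lemma subgroup_card_pos: "subgroup D G \<Longrightarrow> card D > 0"
  using subgroup_finite subgroup.one_closed card_gt_0_iff by blast

lemma subgroup_card_le: "subgroup D G \<Longrightarrow> card D \<le> card (carrier G)"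
  using subgroup_carrier fin card_mono by blast

lemma agree_all_v:
  assumes "F \<in> Fs" "F' \<in> Fs" "j < m" "g \<in> carrier G" "\<And>i. i < n \<Longrightarrow> pr F (v j i) g = pr F' (v j i) g" "c < n"
  shows "F c g = F' c g"
proof -
  have "pr F (\<lambda>d. of_bool (c = d)) g = pr F' (\<lambda>d. of_bool (c = d)) g"
    by (rule pairing_span[OF _ v_span[OF assms(3,6)]]) (use assms in auto)
  then show ?thesis
    using pairing_unit[where F = F, OF assms(6) mod_homs_range[OF FsD[OF assms(1,6)] assms(4)]]
      pairing_unit[where F = F', OF assms(6) mod_homs_range[OF FsD[OF assms(2,6)] assms(4)]] by simp
qed

lemma agree_all_b:
  assumes "F \<in> Fs" "F' \<in> Fs" "g \<in> carrier G" "\<And>i. i < n \<Longrightarrow> pr F (b i) g = pr F' (b i) g" "c < n"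
  shows "F c g = F' c g"
proof -
  have "pr F (\<lambda>d. of_bool (c = d)) g = pr F' (\<lambda>d. of_bool (c = d)) g"
    by (rule pairing_span[OF _ b_span[OF assms(5)]]) (use assms in auto)
  then show ?thesis
    using pairing_unit[where F = F, OF assms(5) mod_homs_range[OF FsD[OF assms(1,5)] assms(3)]]
      pairing_unit[where F = F', OF assms(5) mod_homs_range[OF FsD[OF assms(2,5)] assms(3)]] by simp
qed

lemma zero_in_Fs: "(\<lambda>c\<in>{..<n}. zero_fun) \<in> Fs" using zero_fun_in by auto

lemma pr_zero: "g \<in> carrier G \<Longrightarrow> pr (\<lambda>c\<in>{..<n}. zero_fun) z g = 0"
  by (simp add: pairing_def zero_fun_def)

lemma agree_subgroup:
  assumes "F \<in> Fs" "F' \<in> Fs"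
  shows "subgroup {g \<in> carrier G. pr F z g = pr F' z g} G"
  by (rule subgroup_agree[OF fin, where q = q])
    (use pairing_mult[OF FsD[OF assms(1)]] pairing_mult[OF FsD[OF assms(2)]]
      pairing_one[OF FsD[OF assms(1)]] pairing_one[OF FsD[OF assms(2)]] in auto)

lemma agree_all_subgroup:
  assumes "F \<in> Fs" "F' \<in> Fs"
  shows "subgroup {g \<in> carrier G. \<forall>c<n. F c g = F' c g} G"
  by (rule finite_subgroupI[OF fin])
    (use mod_homs_mult[OF FsD[OF assms(1)]] mod_homs_mult[OF FsD[OF assms(2)]]
      mod_homs_one[OF FsD[OF assms(1)]] mod_homs_one[OF FsD[OF assms(2)]] in auto)

lemma Ann_subgroup: assumes "F \<in> Fs" shows "subgroup (Ann F) G"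
proof -
  have "Ann F = {g \<in> carrier G. \<forall>c<n. F c g = (\<lambda>c\<in>{..<n}. zero_fun) c g}"
    by (auto simp: Ann_def zero_fun_def)
  then show ?thesis using agree_all_subgroup[OF assms zero_in_Fs] by simp
qed

text \<open>Each of the n coordinates is a homomorphism with prescribed restriction to E, which
  leaves at most as many choices as the index of E.\<close>

lemma card_agree:
  assumes S: "S \<subseteq> Fs" and E: "subgroup E G"
    and agree: "\<And>F F' g c. F \<in> S \<Longrightarrow> F' \<in> S \<Longrightarrow> g \<in> E \<Longrightarrow> c < n \<Longrightarrow> F c g = F' c g"
  shows "real (card S) \<le> (real (card (carrier G)) / real (card E)) ^ n"
proof -
  have Epos: "card E > 0" by (rule subgroup_card_pos[OF E])
  have finS: "finite S" using S finite_Fs finite_subset by blast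
  have "S \<subseteq> (\<Pi>\<^sub>E c\<in>{..<n}. (\<lambda>F. F c) ` S)"
  proof
    fix F assume "F \<in> S"
    then show "F \<in> (\<Pi>\<^sub>E c\<in>{..<n}. (\<lambda>F. F c) ` S)" using S by (auto simp: PiE_def)
  qed
  then have "card S \<le> card (\<Pi>\<^sub>E c\<in>{..<n}. (\<lambda>F. F c) ` S)"
    by (rule card_mono[rotated]) (use finS in \<open>auto intro: finite_PiE\<close>)
  also have "\<dots> = (\<Prod>c<n. card ((\<lambda>F. F c) ` S))" by (simp add: card_PiE)
  finally have "real (card S) \<le> (\<Prod>c<n. real (card ((\<lambda>F. F c) ` S)))"
    by (metis of_nat_mono of_nat_prod)
  also have "\<dots> \<le> (\<Prod>c<n. real (card (carrier G)) / real (card E))"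
  proof (rule prod_mono)
    fix c assume c: "c \<in> {..<n}"
    have "card ((\<lambda>F. F c) ` S) * card E \<le> card (carrier G)"
    proof (rule card_mod_homs_agree[OF fin _ E])
      show "(\<lambda>F. F c) ` S \<subseteq> Psi" using S c by auto
    qed (use agree c in auto)
    then have "real (card ((\<lambda>F. F c) ` S)) * real (card E) \<le> real (card (carrier G))"
      by (metis of_nat_mono of_nat_mult)
    then show "0 \<le> real (card ((\<lambda>F. F c) ` S)) \<and>
        real (card ((\<lambda>F. F c) ` S)) \<le> real (card (carrier G)) / real (card E)"
      using Epos by (simp add: field_simps)
  qed
  finally show ?thesis by simp
qed

text \<open>The elements of L are adjoined to E one by one. F at g is known as soon as its pairings
  with all \<open>v j i\<close> at g are. Those with i in \<open>I j\<close> are prescribed; each of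
  the others, at most \<open>\<alpha> * n\<close> many, has at most k values, where k is the order
  of g modulo the current subgroup. The numbers k multiply to at most the index of E in the
  generated subgroup, and \<open>card_agree\<close> counts the rest of the way to G.\<close>

lemma card_agree_chain:
  assumes "S \<subseteq> Fs" "subgroup E G"
    and "\<And>F F' g c. F \<in> S \<Longrightarrow> F' \<in> S \<Longrightarrow> g \<in> E \<Longrightarrow> c < n \<Longrightarrow> F c g = F' c g"
    and "\<And>j g. (j, g) \<in> set L \<Longrightarrow> j < m \<and> g \<in> carrier G"
    and "\<And>j g F F' i. (j, g) \<in> set L \<Longrightarrow> F \<in> S \<Longrightarrow> F' \<in> S \<Longrightarrow> i \<in> I j \<Longrightarrow>
           pr F (v j i) g = pr F' (v j i) g"
  shows "real (card S) \<le> (real (card (generate G (E \<union> snd ` set L))) / real (card E)) powr (\<alpha> * real n)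
     * (real (card (carrier G)) / real (card (generate G (E \<union> snd ` set L)))) ^ n"
  using assms
proof (induction L arbitrary: S E)
  case Nil
  have "real (card S) \<le> (real (card (carrier G)) / real (card E)) ^ n"
    by (rule card_agree[OF Nil(1,2)]) (use Nil(3) in blast)
  then show ?case
    using subgroup_card_pos[OF Nil(2)] by (simp add: generate_of_subgroup[OF Nil(2)])
next
  case (Cons jg L)
  obtain j g where jg: "jg = (j, g)" by force
  note S = Cons.prems(1) and E = Cons.prems(2) and agree = Cons.prems(3)
  have j: "j < m" and g: "g \<in> carrier G" using Cons.prems(4)[of j g] jg by auto
  have Ec: "E \<subseteq> carrier G" by (rule subgroup_carrier[OF E])
  have Lc: "snd ` set L \<subseteq> carrier G"
  proof (clarsimp)
    fix i h assume "(i, h) \<in> set L"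
    then show "h \<in> carrier G" using Cons.prems(4)[of i h] by simp
  qed
  have finS: "finite S" using S finite_Fs finite_subset by blast
  obtain k where k: "k \<ge> 1" "g [^] (k::nat) \<in> E" "k * card E \<le> card (generate G (insert g E))"
    using generate_index[OF fin E g] by blast
  define E1 where "E1 = generate G (insert g E)"
  have E1: "subgroup E1 G" unfolding E1_def by (rule generate_is_subgroup) (use g Ec in auto)
  define E2 where "E2 = generate G (E \<union> snd ` set (jg # L))"
  have E2': "generate G (E1 \<union> snd ` set L) = E2"
    unfolding E1_def E2_def using generate_generate_insert[OF Ec g Lc] jg by simp
  have Epos: "card E > 0" by (rule subgroup_card_pos[OF E])
  have E1pos: "card E1 > 0" by (rule subgroup_card_pos[OF E1])
  define K where "K = (real (card E2) / real (card E1)) powr (\<alpha> * real n) *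
      (real (card (carrier G)) / real (card E2)) ^ n"
  have K0: "K \<ge> 0" by (simp add: K_def)
  \<comment> \<open>f records the pairings at g that are not prescribed. On a fibre of f all
    functions agree on E1, so the induction hypothesis applies there, and Y bounds the number of
    fibres.\<close>
  define Y where "Y = (\<Pi>\<^sub>E i\<in>{..<n} - I j. (\<lambda>F. pr F (v j i) g) ` S)"
  define f where "f = (\<lambda>F. \<lambda>i\<in>{..<n} - I j. pr F (v j i) g)"
  have finY: "finite Y" unfolding Y_def using finS by (intro finite_PiE) auto
  have "real (card S) \<le> K * real (card Y)"
  proof (rule card_le_fibres_real[OF finS finY])
    show "f ` S \<subseteq> Y" unfolding f_def Y_def by (intro image_subsetI restrict_PiE_iff[THEN iffD2]) auto
    fix y assume "y \<in> Y"
    show "real (card {F \<in> S. f F = y}) \<le> K"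
      unfolding K_def E2'[symmetric]
    proof (rule Cons.IH[OF _ E1])
      show "{F \<in> S. f F = y} \<subseteq> Fs" using S by auto
      fix F F' h c assume F: "F \<in> {F \<in> S. f F = y}" and F': "F' \<in> {F \<in> S. f F = y}"
        and h: "h \<in> E1" and c: "c < n"
      have FF: "F \<in> Fs" "F' \<in> Fs" using F F' S by auto
      have "pr F (v j i) g = pr F' (v j i) g" if "i < n" for i
      proof (cases "i \<in> I j")
        case True
        then show ?thesis using Cons.prems(5)[of j g F F' i] F F' jg by simp
      next
        case False
        have "f F i = f F' i" using F F' by simp
        then show ?thesis using False that by (simp add: f_def)
      qed
      then have "F c g = F' c g" if "c < n" for c using agree_all_v[OF FF j g] that by blast
      then have "insert g E \<subseteq> {g \<in> carrier G. \<forall>c<n. F c g = F' c g}"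
        using g Ec agree[of F F'] F F' by auto
      then have "E1 \<subseteq> {g \<in> carrier G. \<forall>c<n. F c g = F' c g}"
        unfolding E1_def using generate_subgroup_incl agree_all_subgroup[OF FF] by blast
      then show "F c h = F' c h" using h c by auto
    next
      fix j' g' assume "(j', g') \<in> set L"
      then show "j' < m \<and> g' \<in> carrier G" using Cons.prems(4)[of j' g'] by simp
    next
      fix j' g' F F' i assume "(j', g') \<in> set L" "F \<in> {F \<in> S. f F = y}" "F' \<in> {F \<in> S. f F = y}" "i \<in> I j'"
      then show "pr F (v j' i) g' = pr F' (v j' i) g'" using Cons.prems(5)[of j' g' F F' i] by simp
    qed
  qed
  also have "\<dots> \<le> K * (real (card E1) / real (card E)) powr (\<alpha> * real n)"
  proof (rule mult_left_mono[OF _ K0])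
    have "card Y = (\<Prod>i\<in>{..<n} - I j. card ((\<lambda>F. pr F (v j i) g) ` S))"
      unfolding Y_def by (simp add: card_PiE)
    also have "\<dots> \<le> (\<Prod>i\<in>{..<n} - I j. k)"
    proof (rule prod_mono, rule conjI)
      fix i assume i: "i \<in> {..<n} - I j"
      show "card ((\<lambda>F. pr F (v j i) g) ` S) \<le> k"
      proof (rule card_congruent_le[OF _ k(1)])
        show "(\<lambda>F. pr F (v j i) g) ` S \<subseteq> {0..<int q}" using q by (auto simp: pairing_def)
        fix x y assume "x \<in> (\<lambda>F. pr F (v j i) g) ` S" "y \<in> (\<lambda>F. pr F (v j i) g) ` S"
        then obtain F F' where F: "F \<in> S" "F' \<in> S" "x = pr F (v j i) g" "y = pr F' (v j i) g" by auto
        have pw: "pr H (v j i) (g [^] k) = (int k * pr H (v j i) g) mod int q" if "H \<in> S" for H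
        proof -
          have "pairing_fun H (v j i) (g [^] k) = (int k * pairing_fun H (v j i) g) mod int q"
            by (rule mod_homs_pow[OF pairing_fun_in g]) (use that S in auto)
          then show ?thesis using g by (simp add: pairing_fun_def)
        qed
        have "pr F (v j i) (g [^] k) = pr F' (v j i) (g [^] k)"
          unfolding pairing_def using agree[OF F(1,2) k(2)] by simp
        then have "(int k * x) mod int q = (int k * y) mod int q"
          using pw F by simp
        then show "int q dvd int k * (x - y)" by (simp add: mod_eq_dvd_iff right_diff_distrib)
      qed
    qed simp
    also have "\<dots> = k ^ card ({..<n} - I j)" by simp
    finally have "real (card Y) \<le> real k ^ card ({..<n} - I j)" by (metis of_nat_mono of_nat_power)
    also have "\<dots> = real k powr real (card ({..<n} - I j))" using k by (simp add: powr_realpow)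
    also have "\<dots> \<le> real k powr (\<alpha> * real n)" using k I_card[OF j] by (intro powr_mono) auto
    also have "\<dots> \<le> (real (card E1) / real (card E)) powr (\<alpha> * real n)"
    proof (rule powr_mono2)
      show "0 \<le> \<alpha> * real n" using I_card[OF j] by (meson of_nat_0_le_iff order_trans)
      have "real (k * card E) \<le> real (card E1)" using k(3) unfolding E1_def of_nat_le_iff .
      then show "real k \<le> real (card E1) / real (card E)" using Epos by (simp add: field_simps)
    qed simp
    finally show "real (card Y) \<le> (real (card E1) / real (card E)) powr (\<alpha> * real n)" .
  qed
  also have "\<dots> = (real (card E2) / real (card E)) powr (\<alpha> * real n) *
      (real (card (carrier G)) / real (card E2)) ^ n"
    using Epos E1pos by (simp add: K_def powr_divide)
  finally show ?case by (simp add: E2_def)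
qed

text \<open>The encoding of a bad F: T lists columns, Ds the subgroups of small weight attached to them,
  ts the values of F on the columns in T (these are sparse), and \<open>\<omega>\<close> the values of F at the few
  basis vectors \<open>b i\<close> for which the columns in T do not control F on X.\<close>

definition "exceptional X T Ds = {i. i < n \<and> (\<exists>Z. subgroup Z G \<and> Z \<subset> X \<and>
   (\<forall>l<length T. inW i (T ! l) \<longrightarrow> Ds ! l \<inter> X \<subseteq> Z))}"

definition "fits X T Ds ts \<omega> F \<longleftrightarrow>
   (\<forall>l<length T. \<forall>g\<in>Ds ! l. \<forall>i\<in>I (T ! l). pr F (v (T ! l) i) g = (ts ! l) i g) \<and>
   (\<forall>i\<in>exceptional X T Ds. \<forall>g\<in>carrier G. pr F (b i) g = \<omega> i g)"

text \<open>For i that is not exceptional, the elements of X at which F and F' agree on b i form a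
  subgroup. It contains \<open>Ds ! l \<inter> X\<close> for every listed column whose locus
  contains b i, since there b i is a combination of vectors with recorded values. By
  non-exceptionality it cannot be proper. For exceptional i the values are recorded in
  \<open>\<omega>\<close>.\<close>

lemma fits_agree:
  assumes F: "F \<in> Fs" "F' \<in> Fs" "fits X T Ds ts \<omega> F" "fits X T Ds ts \<omega> F'"
    and X: "subgroup X G" and T: "set T \<subseteq> {..<m}"
    and g: "g \<in> X" and c: "c < n"
  shows "F c g = F' c g"
proof (rule agree_all_b[OF F(1,2) _ _ c])
  show gc: "g \<in> carrier G" using g subgroup_carrier[OF X] by auto
  fix i assume i: "i < n"
  show "pr F (b i) g = pr F' (b i) g"
  proof (cases "i \<in> exceptional X T Ds")
    case True
    then show ?thesis using F(3,4) gc by (simp add: fits_def)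
  next
    case False
    define Z where "Z = X \<inter> {g \<in> carrier G. pr F (b i) g = pr F' (b i) g}"
    have Z: "subgroup Z G" unfolding Z_def using subgroups_Inter_pair[OF X agree_subgroup[OF F(1,2)]] .
    have "Ds ! l \<inter> X \<subseteq> Z" if l: "l < length T" "inW i (T ! l)" for l
    proof
      fix h assume h: "h \<in> Ds ! l \<inter> X"
      have Tl: "T ! l < m" using T l(1) nth_mem by blast
      have "pr F (b i) h = pr F' (b i) h"
      proof (rule pairing_span[OF _ l(2)])
        show "finite (I (T ! l))" using I_sub[OF Tl] finite_subset by blast
      qed (use F(3,4) h l in \<open>simp add: fits_def\<close>)
      then show "h \<in> Z" using h subgroup_carrier[OF X] by (auto simp: Z_def)
    qed
    then have "\<not> Z \<subset> X" using False i Z unfolding exceptional_def by blast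
    then have "Z = X" by (auto simp: Z_def)
    then show ?thesis using g by (auto simp: Z_def)
  qed
qed

lemma card_fits:
  assumes X: "subgroup X G" and T: "set T \<subseteq> {..<m}" and Ds: "length Ds = length T"
    "\<And>D. D \<in> set Ds \<Longrightarrow> D \<subseteq> carrier G"
  shows "real (card {F \<in> Fs. fits X T Ds ts \<omega> F})
    \<le> (real (card (generate G (X \<union> \<Union>(set Ds)))) / real (card X)) powr (\<alpha> * real n)
     * (real (card (carrier G)) / real (card (generate G (X \<union> \<Union>(set Ds))))) ^ n"
proof -
  \<comment> \<open>Each element of \<open>Ds ! l\<close> is adjoined together with the column T ! l
    in which its balanced pairings are recorded.\<close>
  have "finite (\<Union>l<length T. (\<lambda>g. (T ! l, g)) ` (Ds ! l))"
    using finite_subset[OF Ds(2) fin] Ds(1) by (intro finite_UN_I finite_imageI) auto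
  from finite_list[OF this] obtain L where L: "set L = (\<Union>l<length T. (\<lambda>g. (T ! l, g)) ` (Ds ! l))" ..
  have sL: "snd ` set L = \<Union>(set Ds)"
  proof -
    have "snd ` set L = (\<Union>l<length T. snd ` (\<lambda>g. (T ! l, g)) ` (Ds ! l))" unfolding L by (simp only: image_UN)
    also have "\<dots> = (\<Union>l<length T. Ds ! l)" by (simp add: image_image)
    also have "\<dots> = \<Union>(set Ds)"
    proof -
      have "set Ds = (\<lambda>l. Ds ! l) ` {..<length T}"
        using Ds(1) by (metis atLeast_upt list.set_map map_nth)
      then show ?thesis by simp
    qed
    finally show ?thesis .
  qed
  show ?thesis
    unfolding sL[symmetric]
  proof (rule card_agree_chain[OF _ X])
    fix F F' g c assume "F \<in> {F \<in> Fs. fits X T Ds ts \<omega> F}" "F' \<in> {F \<in> Fs. fits X T Ds ts \<omega> F}"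
      "g \<in> X" "c < n"
    then show "F c g = F' c g" using fits_agree[OF _ _ _ _ X T] by blast
  next
    fix j g assume "(j, g) \<in> set L"
    then obtain l where "l < length T" "j = T ! l" "g \<in> Ds ! l" by (auto simp: L)
    then show "j < m \<and> g \<in> carrier G" using T Ds nth_mem by (metis lessThan_iff subsetD)
  next
    fix j g F F' i assume "(j, g) \<in> set L" and F: "F \<in> {F \<in> Fs. fits X T Ds ts \<omega> F}"
      "F' \<in> {F \<in> Fs. fits X T Ds ts \<omega> F}" "i \<in> I j"
    then obtain l where "l < length T" "j = T ! l" "g \<in> Ds ! l" by (auto simp: L)
    then show "pr F (v j i) g = pr F' (v j i) g" using F by (simp add: fits_def)
  qed auto
qed

end

text \<open>\<open>a j F\<close> will be \<open>card G\<close> times the probability that F kills column j, and \<open>e j F g\<close> the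
  expectation of the character attached to g.\<close>

locale column_data = column_structure +
  fixes \<rho> :: real
    and a :: "nat \<Rightarrow> (nat \<Rightarrow> 'a \<Rightarrow> int) \<Rightarrow> real"
    and e :: "nat \<Rightarrow> (nat \<Rightarrow> 'a \<Rightarrow> int) \<Rightarrow> 'a \<Rightarrow> complex"
  assumes rho: "0 < \<rho>" "\<rho> < 1"
    and a_nonneg: "\<And>j F. j < m \<Longrightarrow> F \<in> Fs \<Longrightarrow> 0 \<le> a j F"
    and a_sum: "\<And>j F. j < m \<Longrightarrow> F \<in> Fs \<Longrightarrow> complex_of_real (a j F) = (\<Sum>g\<in>carrier G. e j F g)"
    and e_le: "\<And>j F g. j < m \<Longrightarrow> F \<in> Fs \<Longrightarrow> g \<in> carrier G \<Longrightarrow> norm (e j F g) \<le> \<rho> ^ wt j F g"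
    and e_Ann: "\<And>j F g. j < m \<Longrightarrow> F \<in> Fs \<Longrightarrow> g \<in> Ann F \<Longrightarrow> e j F g = 1"

text \<open>The numerical conditions are collected as assumptions, to be met in
  \<open>column_limit\<close>. The fraction \<open>\<mu>\<close> is that of the columns useful for
  one basis vector and one proper subgroup, t is the number of greedy steps, \<open>\<delta>\<close>
  the threshold for weights, and \<open>\<delta>2\<close>, \<open>\<delta>3\<close> are the
  densities of the sparse functions ts and \<open>\<omega>\<close>.\<close>

locale column_bound = column_data +
  fixes u t :: nat and \<theta> \<mu> \<delta> \<delta>2 \<delta>3 :: real
  assumes m: "m = n + u"
    and ab: "0 \<le> \<alpha>" "0 \<le> \<beta>" "\<beta> \<le> 1" "\<beta> < \<theta>" "\<alpha> + \<theta> < 1"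
    and mu: "0 \<le> \<mu>" "\<mu> \<le> 1" "\<mu> * real m \<le> (\<theta> - \<beta>) * real n"
    and d: "\<delta> > 0" "real (card (carrier G)) * (2 ^ card (carrier G) * \<delta>) \<le> \<delta>2"
    and d3: "(1 - \<mu>) ^ t * 2 ^ card (carrier G) \<le> \<delta>3"
    and tau_small: "real (card (carrier G)) * \<rho> powr (\<delta> * real n) \<le> (1 - \<rho>) / 2"
begin

abbreviation "N0 \<equiv> card (carrier G)"
abbreviation "nu F \<equiv> real (card (Ann F))"

text \<open>Bounds the joint contribution to \<open>a j F\<close> of all g with weight at least
  \<open>\<delta> * n\<close>.\<close>

definition "\<tau> = real N0 * \<rho> powr (\<delta> * real n)"
text \<open>The loss of a column that sees a nonzero weight: at least (1 - \<open>\<rho>\<close>) /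
  2 out of a quantity that is at most N0.\<close>

definition "c0 = 1 - (1 - \<rho>) / (2 * real N0)"
definition "good F \<longleftrightarrow> (\<forall>j<m. \<forall>g\<in>carrier G - Ann F. real (wt j F g) \<ge> \<delta> * real n)"

text \<open>The second case is what maximality of X gives when compared with E; for X = E it would
  be 1, and the decay comes from the columns that lose the factor c0.\<close>

definition "data_bound X E = (1 + \<tau>) ^ m * real (card X) ^ m *
   (if X = E then c0 powr ((1 - \<beta>) * real n) else (real (card E) / real (card X)) powr (\<theta> * real n))"

text \<open>The lists have length t + N0: t columns from the greedy covering, and one column for
  each element of G.\<close>

definition "Data = {X. subgroup X G} \<times> {T. set T \<subseteq> {..<m} \<and> length T = t + N0} \<times>
   {Ds. set Ds \<subseteq> {D. subgroup D G} \<and> length Ds = t + N0} \<times>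
   {ts. set ts \<subseteq> sparse_funs n Psi zero_fun \<delta>2 \<and> length ts = t + N0} \<times> sparse_funs n Psi zero_fun \<delta>3"

section \<open>Bounds for good and for bad F\<close>

lemma N0_pos: "N0 > 0"
  using fin by (metis card_gt_0_iff emptyE one_closed)

lemma m_pos: "m > 0" using m n by simp

lemma tau_nonneg: "\<tau> \<ge> 0" by (simp add: \<tau>_def)

lemma tau_le: "\<tau> \<le> (1 - \<rho>) / 2" using tau_small by (simp add: \<tau>_def)

lemma c0: "1 / 2 \<le> c0" "c0 < 1"
proof -
  have "(1 - \<rho>) / (2 * real N0) \<le> 1 / 2"
    using rho N0_pos by (simp add: field_simps)
  moreover have "(1 - \<rho>) / (2 * real N0) > 0" using rho N0_pos by simp
  ultimately show "1 / 2 \<le> c0" "c0 < 1" by (auto simp: c0_def)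
qed

lemma wt_one: "F \<in> Fs \<Longrightarrow> wt j F \<one> = 0"
proof -
  assume "F \<in> Fs"
  then have "pr F z \<one> = 0" for z using pairing_one[of n F q z] by auto
  then show ?thesis by (simp add: wt_def)
qed

lemma finite_I: "j < m \<Longrightarrow> finite (I j)"
  using I_sub finite_subset by blast

lemma wt_mult:
  assumes "j < m" "F \<in> Fs" "g \<in> carrier G" "h \<in> carrier G"
  shows "wt j F (g \<otimes> h) \<le> wt j F g + wt j F h"
proof -
  have "{i \<in> I j. pr F (v j i) (g \<otimes> h) \<noteq> 0} \<subseteq>
      {i \<in> I j. pr F (v j i) g \<noteq> 0} \<union> {i \<in> I j. pr F (v j i) h \<noteq> 0}"
    using pairing_mult[OF FsD[OF assms(2)] assms(3,4)] by auto
  then have "wt j F (g \<otimes> h) \<le> card ({i \<in> I j. pr F (v j i) g \<noteq> 0} \<union> {i \<in> I j. pr F (v j i) h \<noteq> 0})"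
    unfolding wt_def by (rule card_mono[rotated]) (use finite_I[OF assms(1)] in auto)
  also have "\<dots> \<le> wt j F g + wt j F h" unfolding wt_def by (rule card_Un_le)
  finally show ?thesis .
qed

lemma wt_Ann: "F \<in> Fs \<Longrightarrow> g \<in> Ann F \<Longrightarrow> wt j F g = 0"
  by (auto simp: wt_def Ann_def pairing_def)

lemma rho_wt_le:
  assumes "real (wt j F g) \<ge> \<delta> * real n"
  shows "\<rho> ^ wt j F g \<le> \<rho> powr (\<delta> * real n)"
proof -
  have "\<rho> ^ wt j F g = \<rho> powr real (wt j F g)" using rho by (simp add: powr_realpow)
  also have "\<dots> \<le> \<rho> powr (\<delta> * real n)" using assms rho by (intro powr_mono') auto
  finally show ?thesis .
qed

lemma sum_outside_le:
  assumes "j < m" "F \<in> Fs" "D \<subseteq> carrier G"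
    "\<And>g. g \<in> carrier G - D \<Longrightarrow> real (wt j F g) \<ge> \<delta> * real n"
  shows "(\<Sum>g\<in>carrier G - D. norm (e j F g)) \<le> \<tau>"
proof -
  have "(\<Sum>g\<in>carrier G - D. norm (e j F g)) \<le> (\<Sum>g\<in>carrier G - D. \<rho> powr (\<delta> * real n))"
    by (intro sum_mono order_trans[OF e_le rho_wt_le]) (use assms in auto)
  also have "\<dots> \<le> (\<Sum>g\<in>carrier G. \<rho> powr (\<delta> * real n))"
    by (intro sum_mono2 fin) auto
  finally show ?thesis by (simp add: \<tau>_def)
qed

lemma a_split:
  assumes "j < m" "F \<in> Fs" "D \<subseteq> carrier G"
    "\<And>g. g \<in> carrier G - D \<Longrightarrow> real (wt j F g) \<ge> \<delta> * real n"
  shows "norm (complex_of_real (a j F) - (\<Sum>g\<in>D. e j F g)) \<le> \<tau>"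
proof -
  have "complex_of_real (a j F) - (\<Sum>g\<in>D. e j F g) = (\<Sum>g\<in>carrier G - D. e j F g)"
    using a_sum[OF assms(1,2)] sum.subset_diff[OF assms(3) fin, of "e j F"] by simp
  then show ?thesis
    using order_trans[OF sum_norm_le[of "carrier G - D" "e j F"] sum_outside_le[OF assms]] by simp
qed

lemma a_le:
  assumes "j < m" "F \<in> Fs" "D \<subseteq> carrier G"
    "\<And>g. g \<in> carrier G - D \<Longrightarrow> real (wt j F g) \<ge> \<delta> * real n"
  shows "a j F \<le> (\<Sum>g\<in>D. norm (e j F g)) + \<tau>"
proof -
  have "a j F \<le> norm (complex_of_real (a j F))" by simp
  also have "\<dots> \<le> norm (\<Sum>g\<in>D. e j F g) + norm (complex_of_real (a j F) - (\<Sum>g\<in>D. e j F g))"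
    by (rule norm_triangle_sub)
  also have "\<dots> \<le> (\<Sum>g\<in>D. norm (e j F g)) + \<tau>"
    using a_split[OF assms] by (intro add_mono sum_norm_le) auto
  finally show ?thesis .
qed

lemma e_le_1: "j < m \<Longrightarrow> F \<in> Fs \<Longrightarrow> g \<in> carrier G \<Longrightarrow> norm (e j F g) \<le> 1"
  using order_trans[OF e_le power_le_one] rho by simp

text \<open>The means over the annihilator are exactly 1 and the remaining ones add up to at most
  \<open>\<tau>\<close>, so each factor is within \<open>\<tau>\<close> of \<open>nu F\<close>. As
  \<open>nu F \<ge> 1\<close>, this is also a relative error.\<close>

lemma good_bound:
  assumes "F \<in> Fs" "good F"
  shows "\<bar>(\<Prod>j<m. a j F) - nu F ^ m\<bar> \<le> nu F ^ m * ((1 + \<tau>) ^ m - 1)"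
proof -
  have A: "Ann F \<subseteq> carrier G" by (auto simp: Ann_def)
  have nu1: "nu F \<ge> 1" using subgroup_card_pos[OF Ann_subgroup[OF assms(1)]] by linarith
  have "\<bar>a j F - nu F\<bar> \<le> \<tau>" if j: "j < m" for j
  proof -
    have "norm (complex_of_real (a j F) - (\<Sum>g\<in>Ann F. e j F g)) \<le> \<tau>"
      by (rule a_split[OF j assms(1) A]) (use assms(2) j in \<open>auto simp: good_def\<close>)
    also have "(\<Sum>g\<in>Ann F. e j F g) = complex_of_real (nu F)"
      using e_Ann[OF j assms(1)] by simp
    finally show ?thesis by (metis norm_of_real of_real_diff)
  qed
  then have "\<bar>(\<Prod>j<m. a j F) - nu F ^ m\<bar> \<le> (nu F + \<tau>) ^ m - nu F ^ m"
    by (intro abs_prod_diff_power_le) (use tau_nonneg in auto)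
  also have "\<dots> \<le> (nu F * (1 + \<tau>)) ^ m - nu F ^ m"
    using nu1 tau_nonneg mult_right_mono[OF nu1 tau_nonneg]
    by (intro diff_right_mono power_mono) (auto simp: algebra_simps)
  finally show ?thesis by (simp add: power_mult_distrib right_diff_distrib)
qed

text \<open>T is made of two lists. T1 ensures that the recorded data leave few exceptional basis
  vectors, and T2 that X and the groups in Ds generate a subgroup E containing every
  \<open>D j\<close>. The estimate compares E with X by maximality if they differ; otherwise most
  columns lose the factor c0.\<close>

lemma bad_data:
  assumes F: "F \<in> Fs" and bad: "\<not> good F"
  shows "\<exists>(X, T, Ds, ts, \<omega>) \<in> Data. fits X T Ds ts \<omega> F \<and>
     max (\<Prod>j<m. a j F) (nu F ^ m) \<le> data_bound X (generate G (X \<union> \<Union>(set Ds)))"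
proof -
  have dn: "\<delta> * real n > 0" using d n by simp
  have "\<forall>j\<in>{..<m}. \<exists>D. subgroup D G \<and> (\<forall>x\<in>D. real (wt j F x) \<le> 2 ^ N0 * (\<delta> * real n)) \<and>
             (\<forall>x\<in>carrier G - D. real (wt j F x) \<ge> \<delta> * real n)"
    by (intro ballI threshold_subgroup[OF fin dn]) (use F wt_one wt_mult in auto)
  from bchoice[OF this] obtain D where D': "\<forall>j\<in>{..<m}. subgroup (D j) G \<and>
      (\<forall>x\<in>D j. real (wt j F x) \<le> 2 ^ N0 * (\<delta> * real n)) \<and>
      (\<forall>x\<in>carrier G - D j. real (wt j F x) \<ge> \<delta> * real n)" ..
  have D: "subgroup (D j) G" if "j < m" for j using D' that by blast
  have D_in: "real (wt j F x) \<le> 2 ^ N0 * (\<delta> * real n)" if "j < m" "x \<in> D j" for j x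
    using D' that by blast
  have D_out: "real (wt j F x) \<ge> \<delta> * real n" if "j < m" "x \<in> carrier G - D j" for j x
    using D' that by blast
  have Dc: "D j \<subseteq> carrier G" if "j < m" for j by (rule subgroup_carrier[OF D[OF that]])
  have finD: "finite (D j)" if "j < m" for j by (rule subgroup_finite[OF D[OF that]])
  have DX: "subgroup (D j \<inter> X) G" if "j < m" "subgroup X G" for j X
    by (rule subgroups_Inter_pair[OF D[OF that(1)] that(2)])
  have AnnD: "Ann F \<subseteq> D j" if j: "j < m" for j
  proof
    fix g assume g: "g \<in> Ann F"
    then have "g \<in> carrier G" by (simp add: Ann_def)
    then show "g \<in> D j" using D_out[OF j, of g] wt_Ann[OF F g, of j] dn by auto
  qed
  define \<phi> where "\<phi> = (\<lambda>X. (\<Sum>j<m. ln (real (card (D j \<inter> X)))) - \<theta> * real n * ln (real (card X)))"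
  have finsub: "finite {X. subgroup X G}"
    by (rule finite_subset[of _ "Pow (carrier G)"]) (use fin subgroup_carrier in auto)
  have nesub: "{X. subgroup X G} \<noteq> {}" using triv_subgroup by auto
  obtain X where X: "subgroup X G" and Xmax: "\<And>Y. subgroup Y G \<Longrightarrow> \<phi> Y \<le> \<phi> X"
  proof -
    have "Max (\<phi> ` {X. subgroup X G}) \<in> \<phi> ` {X. subgroup X G}" using finsub nesub by (intro Max_in) auto
    then obtain X where "subgroup X G" "\<phi> X = Max (\<phi> ` {X. subgroup X G})" by auto
    then show ?thesis using that finsub by (metis Max_ge finite_imageI imageI mem_Collect_eq)
  qed
  have Xc: "X \<subseteq> carrier G" by (rule subgroup_carrier[OF X])
  have Xpos: "card X > 0" by (rule subgroup_card_pos[OF X])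

  text \<open>Maximality of X against its proper subgroups: many of the groups \<open>D j \<inter> X\<close> escape
    each of them.\<close>

  have escape: "real (card {j. j < m \<and> \<not> D j \<inter> X \<subseteq> Z}) \<ge> \<theta> * real n"
    if Z: "subgroup Z G" and ZX: "Z \<subset> X" for Z
  proof -
    have Zpos: "card Z > 0" by (rule subgroup_card_pos[OF Z])
    define l where "l = ln (real (card X)) - ln (real (card Z))"
    have "card Z < card X" using ZX subgroup_finite[OF X] psubset_card_mono by blast
    then have l: "l > 0" using Zpos by (simp add: l_def)
    \<comment> \<open>A column contributes at most the logarithm of the index of Z in X, and nothing
      unless it escapes Z. As the contributions add up to at least \<open>\<theta> * n\<close> times
      this logarithm, at least \<open>\<theta> * n\<close> columns escape.\<close>
    have term_le: "ln (real (card (D j \<inter> X))) - ln (real (card (D j \<inter> Z))) \<le> l * of_bool (\<not> D j \<inter> X \<subseteq> Z)"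
      if j: "j < m" for j
    proof (cases "D j \<inter> X \<subseteq> Z")
      case True
      then have "D j \<inter> X = D j \<inter> Z" using ZX by auto
      then show ?thesis using True by simp
    next
      case False
      have p: "card (D j \<inter> X) > 0" "card (D j \<inter> Z) > 0"
        using subgroup_card_pos[OF DX[OF j X]] subgroup_card_pos[OF DX[OF j Z]] by auto
      have "card (D j \<inter> X) * card Z \<le> card (D j \<inter> Z) * card X"
        by (rule card_Int_subgroup_mult_le[OF fin D[OF j] Z X]) (use ZX in auto)
      then have "real (card (D j \<inter> X)) * real (card Z) \<le> real (card (D j \<inter> Z)) * real (card X)"
        by (metis of_nat_mono of_nat_mult)
      then have "ln (real (card (D j \<inter> X)) * real (card Z)) \<le> ln (real (card (D j \<inter> Z)) * real (card X))"
        using p Zpos Xpos by simp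
      then show ?thesis using False p Zpos Xpos by (simp add: l_def ln_mult)
    qed
    have "\<phi> Z \<le> \<phi> X" by (rule Xmax[OF Z])
    then have "\<theta> * real n * l \<le> (\<Sum>j<m. ln (real (card (D j \<inter> X))) - ln (real (card (D j \<inter> Z))))"
      by (simp add: \<phi>_def l_def sum_subtractf algebra_simps)
    also have "\<dots> \<le> (\<Sum>j<m. l * of_bool (\<not> D j \<inter> X \<subseteq> Z))"
      by (rule sum_mono) (use term_le in auto)
    also have "\<dots> = l * real (card {j. j < m \<and> \<not> D j \<inter> X \<subseteq> Z})"
      by (simp add: sum_distrib_left[symmetric] of_bool_def sum.If_cases Int_def lessThan_def)
    finally show ?thesis using l by (simp add: mult.commute)
  qed

  \<comment> \<open>All pairs of a basis vector and a proper subgroup of X are covered by one and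
    the same choice of columns.\<close>
  define P where "P = {..<n} \<times> {Z. subgroup Z G \<and> Z \<subset> X}"
  have finP: "finite P" unfolding P_def by (intro finite_cartesian_product finite_subset[OF _ finsub]) auto
  have "card {Z. subgroup Z G \<and> Z \<subset> X} \<le> card (Pow (carrier G))"
    by (rule card_mono) (use fin subgroup_carrier in auto)
  also have "\<dots> = 2 ^ N0" using fin by (simp add: card_Pow)
  finally have "real (card {Z. subgroup Z G \<and> Z \<subset> X}) \<le> real (2 ^ N0)" by (simp only: of_nat_le_iff)
  then have cardP: "real (card P) \<le> real n * 2 ^ N0"
    unfolding P_def by (simp add: card_cartesian_product mult_left_mono)
  define R where "R = (\<lambda>(i, Z) j. inW i j \<and> \<not> D j \<inter> X \<subseteq> Z)"
  \<comment> \<open>At least \<open>\<theta> * n\<close> columns escape Z and at most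
    \<open>\<beta> * n\<close> have b i outside their locus; the difference is at least
    \<open>\<mu> * m\<close>.\<close>
  have cov: "\<mu> * real (card {..<m}) \<le> real (card {j \<in> {..<m}. R x j})" if x: "x \<in> P" for x
  proof -
    obtain i Z where iZ: "x = (i, Z)" "i < n" "subgroup Z G" "Z \<subset> X" using x by (auto simp: P_def)
    have "{j. j < m \<and> \<not> D j \<inter> X \<subseteq> Z} \<subseteq> {j \<in> {..<m}. R x j} \<union> {j. j < m \<and> \<not> inW i j}"
      by (auto simp: R_def iZ)
    then have "card {j. j < m \<and> \<not> D j \<inter> X \<subseteq> Z} \<le> card ({j \<in> {..<m}. R x j} \<union> {j. j < m \<and> \<not> inW i j})"
      by (rule card_mono[rotated]) auto
    also have "\<dots> \<le> card {j \<in> {..<m}. R x j} + card {j. j < m \<and> \<not> inW i j}" by (rule card_Un_le)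
    finally have "\<theta> * real n \<le> real (card {j \<in> {..<m}. R x j}) + \<beta> * real n"
      using escape[OF iZ(3,4)] W_card[OF iZ(2)] by linarith
    then show ?thesis using mu(3) by (simp add: algebra_simps)
  qed
  obtain T1 where T1: "length T1 = t" "set T1 \<subseteq> {..<m}"
    "real (card {x \<in> P. \<forall>j\<in>set T1. \<not> R x j}) \<le> (1 - \<mu>) ^ t * real (card P)"
    using greedy_cover[where t = t and R = R, OF finP finite_lessThan _ mu(1,2) cov] m_pos by blast

  obtain gs where gs: "set gs = carrier G" "length gs = N0"
    using finite_distinct_list[OF fin] distinct_card by metis
  \<comment> \<open>One column for each g that occurs in some \<open>D j\<close>, so that the groups
    of T2 cover all of them. The entry 0 is a filler for the other g.\<close>
  define T2 where "T2 = map (\<lambda>g. if \<exists>j<m. g \<in> D j then SOME j. j < m \<and> g \<in> D j else 0) gs"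
  have T2: "length T2 = N0" "set T2 \<subseteq> {..<m}"
    using gs m_pos by (auto simp: T2_def intro: someI2_ex)
  have T2_cov: "\<exists>l\<in>set T2. g \<in> D l" if "j < m" "g \<in> D j" for j g
  proof -
    have "g \<in> carrier G" using that Dc by auto
    then have "(SOME j. j < m \<and> g \<in> D j) \<in> set T2"
      unfolding T2_def using gs(1) that by force
    moreover have "g \<in> D (SOME j. j < m \<and> g \<in> D j)"
      using someI[of "\<lambda>j. j < m \<and> g \<in> D j" j] that by blast
    ultimately show ?thesis by blast
  qed
  define T where "T = T1 @ T2"
  have T: "set T \<subseteq> {..<m}" "length T = t + N0" using T1 T2 by (auto simp: T_def)
  define Ds where "Ds = map D T"
  have Ds: "length Ds = t + N0" "set Ds \<subseteq> {D. subgroup D G}" using T D by (auto simp: Ds_def)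
  have Ds_nth: "Ds ! l = D (T ! l)" if "l < length T" for l using that by (simp add: Ds_def)
  \<comment> \<open>Replacing the entries that vanish on \<open>D j\<close> by the zero function
    changes no value on \<open>D j\<close> at a balanced i. What remains is supported on the union,
    over g in \<open>D j\<close>, of the entries counted by the small weights, hence sparse.\<close>
  define ts1 where "ts1 = (\<lambda>j. \<lambda>i\<in>{..<n}. if i \<in> I j \<and> (\<exists>g\<in>D j. pr F (v j i) g \<noteq> 0)
       then pairing_fun F (v j i) else zero_fun)"
  define ts where "ts = map ts1 T"
  define \<omega> where "\<omega> = (\<lambda>i\<in>{..<n}. if i \<in> exceptional X T Ds then pairing_fun F (b i) else zero_fun)"

  have ts1: "ts1 j \<in> sparse_funs n Psi zero_fun \<delta>2" if j: "j < m" for j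
  proof -
    have "{i. i < n \<and> ts1 j i \<noteq> zero_fun} \<subseteq> (\<Union>g\<in>D j. {i \<in> I j. pr F (v j i) g \<noteq> 0})"
      by (auto simp: ts1_def split: if_splits)
    then have "card {i. i < n \<and> ts1 j i \<noteq> zero_fun} \<le> card (\<Union>g\<in>D j. {i \<in> I j. pr F (v j i) g \<noteq> 0})"
      by (rule card_mono[rotated]) (use finD[OF j] finite_I[OF j] in auto)
    also have "\<dots> \<le> (\<Sum>g\<in>D j. card {i \<in> I j. pr F (v j i) g \<noteq> 0})" by (rule card_UN_le[OF finD[OF j]])
    also have "\<dots> = (\<Sum>g\<in>D j. wt j F g)" by (simp add: wt_def)
    finally have "real (card {i. i < n \<and> ts1 j i \<noteq> zero_fun}) \<le> (\<Sum>g\<in>D j. real (wt j F g))"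
      by (metis of_nat_mono of_nat_sum)
    also have "\<dots> \<le> (\<Sum>g\<in>D j. 2 ^ N0 * (\<delta> * real n))" by (rule sum_mono) (use D_in[OF j] in auto)
    also have "\<dots> = real (card (D j)) * (2 ^ N0 * (\<delta> * real n))" by simp
    also have "\<dots> \<le> real N0 * (2 ^ N0 * (\<delta> * real n))"
      using subgroup_card_le[OF D[OF j]] dn by (intro mult_right_mono) auto
    also have "\<dots> = (real N0 * (2 ^ N0 * \<delta>)) * real n" by simp
    also have "\<dots> \<le> \<delta>2 * real n" using d(2) by (intro mult_right_mono) auto
    finally show ?thesis
      unfolding sparse_funs_def using pairing_fun_in[OF F] zero_fun_in by (auto simp: ts1_def)
  qed
  have ts: "set ts \<subseteq> sparse_funs n Psi zero_fun \<delta>2" "length ts = t + N0"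
    using ts1 T by (auto simp: ts_def)

  have OmP: "exceptional X T Ds \<subseteq> fst ` {x \<in> P. \<forall>j\<in>set T1. \<not> R x j}"
  proof
    fix i assume "i \<in> exceptional X T Ds"
    then obtain Z where Z: "i < n" "subgroup Z G" "Z \<subset> X"
      and *: "\<And>l. l < length T \<Longrightarrow> inW i (T ! l) \<Longrightarrow> Ds ! l \<inter> X \<subseteq> Z"
      by (auto simp: exceptional_def)
    have "\<not> R (i, Z) j" if j: "j \<in> set T1" for j
    proof -
      have "j \<in> set T" using j by (simp add: T_def)
      then obtain l where "l < length T" "T ! l = j" by (auto simp: in_set_conv_nth)
      then show ?thesis using *[of l] Ds_nth[of l] by (auto simp: R_def)
    qed
    then have "(i, Z) \<in> {x \<in> P. \<forall>j\<in>set T1. \<not> R x j}" using Z by (auto simp: P_def)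
    then show "i \<in> fst ` {x \<in> P. \<forall>j\<in>set T1. \<not> R x j}" by force
  qed
  have om: "\<omega> \<in> sparse_funs n Psi zero_fun \<delta>3"
  proof -
    have fU: "finite {x \<in> P. \<forall>j\<in>set T1. \<not> R x j}" using finP by simp
    have "{i. i < n \<and> \<omega> i \<noteq> zero_fun} \<subseteq> fst ` {x \<in> P. \<forall>j\<in>set T1. \<not> R x j}"
      using OmP by (auto simp: \<omega>_def split: if_splits)
    then have "card {i. i < n \<and> \<omega> i \<noteq> zero_fun} \<le> card (fst ` {x \<in> P. \<forall>j\<in>set T1. \<not> R x j})"
      by (rule card_mono[rotated]) (use fU in auto)
    also have "\<dots> \<le> card {x \<in> P. \<forall>j\<in>set T1. \<not> R x j}" by (rule card_image_le[OF fU])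
    finally have "real (card {i. i < n \<and> \<omega> i \<noteq> zero_fun}) \<le> (1 - \<mu>) ^ t * real (card P)"
      using T1(3) by linarith
    also have "\<dots> \<le> (1 - \<mu>) ^ t * (real n * 2 ^ N0)"
      using cardP mu by (intro mult_left_mono) auto
    also have "\<dots> = ((1 - \<mu>) ^ t * 2 ^ N0) * real n" by simp
    also have "\<dots> \<le> \<delta>3 * real n" using d3 by (intro mult_right_mono) auto
    finally show ?thesis
      unfolding sparse_funs_def using pairing_fun_in[OF F] zero_fun_in by (auto simp: \<omega>_def)
  qed
  have inData: "(X, T, Ds, ts, \<omega>) \<in> Data"
    unfolding Data_def using X T Ds ts om by simp

  have fitsF: "fits X T Ds ts \<omega> F"
    unfolding fits_def
  proof (intro conjI allI impI ballI)
    fix l g i assume l: "l < length T" and g: "g \<in> Ds ! l" and i: "i \<in> I (T ! l)"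
    have j: "T ! l < m" using T(1) l nth_mem by blast
    have "g \<in> D (T ! l)" using g Ds_nth[OF l] by simp
    moreover have "i < n" using I_sub[OF j] i by auto
    moreover have "g \<in> carrier G" using calculation Dc[OF j] by auto
    ultimately show "pr F (v (T ! l) i) g = (ts ! l) i g"
      using l i by (auto simp: ts_def ts1_def pairing_fun_def zero_fun_def)
  next
    fix i g assume "i \<in> exceptional X T Ds" "g \<in> carrier G"
    moreover have "i < n" using calculation by (simp add: exceptional_def)
    ultimately show "pr F (b i) g = \<omega> i g" by (simp add: \<omega>_def pairing_fun_def)
  qed

  define E where "E = generate G (X \<union> \<Union>(set Ds))"
  have subE: "X \<union> \<Union>(set Ds) \<subseteq> carrier G" using Xc Ds subgroup_carrier by auto
  have E: "subgroup E G" unfolding E_def by (rule generate_is_subgroup[OF subE])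
  have Epos: "card E > 0" by (rule subgroup_card_pos[OF E])
  have DE: "D j \<subseteq> E" if j: "j < m" for j
  proof
    fix g assume "g \<in> D j"
    then obtain l where "l \<in> set T2" "g \<in> D l" using T2_cov[OF j] by blast
    then have "g \<in> \<Union>(set Ds)" by (auto simp: Ds_def T_def)
    then show "g \<in> E" unfolding E_def by (auto intro: generate.incl)
  qed
  have nuD: "nu F \<le> real (card (D j))" if "j < m" for j
    using card_mono[OF finD[OF that] AnnD[OF that]] by simp
  have aD: "a j F \<le> real (card (D j)) + \<tau>" if j: "j < m" for j
  proof -
    have "a j F \<le> (\<Sum>g\<in>D j. norm (e j F g)) + \<tau>"
      by (rule a_le[OF j F Dc[OF j] D_out[OF j]])
    also have "(\<Sum>g\<in>D j. norm (e j F g)) \<le> (\<Sum>g\<in>D j. 1)"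
      by (intro sum_mono e_le_1[OF j F]) (use Dc[OF j] in auto)
    finally show ?thesis by simp
  qed
  have mul_tau: "x + \<tau> \<le> x * (1 + \<tau>)" if "x \<ge> 1" for x :: real
    using that tau_nonneg mult_right_mono[of 1 x \<tau>] by (simp add: algebra_simps)
  have Dge1: "real (card (D j)) \<ge> 1" if "j < m" for j
    using subgroup_card_pos[OF D[OF that]] by linarith
  have "max (\<Prod>j<m. a j F) (nu F ^ m) \<le> data_bound X E"
  proof (cases "X = E")
    case False
    have "(\<Prod>j<m. a j F) \<le> (\<Prod>j<m. real (card (D j)) * (1 + \<tau>))"
      by (intro prod_mono conjI a_nonneg order_trans[OF aD mul_tau]) (use F Dge1 in auto)
    moreover have "nu F ^ m \<le> (\<Prod>j<m. real (card (D j)) * (1 + \<tau>))"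
    proof -
      have "nu F ^ m = (\<Prod>j<m. nu F)" by simp
      also have "\<dots> \<le> (\<Prod>j<m. real (card (D j)) * (1 + \<tau>))"
      proof (intro prod_mono conjI)
        fix j assume "j \<in> {..<m}"
        then have "nu F * 1 \<le> real (card (D j)) * (1 + \<tau>)"
          using nuD tau_nonneg by (intro mult_mono) auto
        then show "nu F \<le> real (card (D j)) * (1 + \<tau>)" by simp
      qed simp
      finally show ?thesis .
    qed
    ultimately have "max (\<Prod>j<m. a j F) (nu F ^ m) \<le> (\<Prod>j<m. real (card (D j)) * (1 + \<tau>))"
      by simp
    also have "\<dots> = (1 + \<tau>) ^ m * (\<Prod>j<m. real (card (D j)))" by (simp add: prod.distrib mult.commute)
    \<comment> \<open>This is \<open>\<phi> E \<le> \<phi> X\<close> in exponential form, because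
      each \<open>D j\<close> lies in E.\<close>
    also have "(\<Prod>j<m. real (card (D j))) \<le>
        (\<Prod>j<m. real (card (D j \<inter> X))) * (real (card E) / real (card X)) powr (\<theta> * real n)"
    proof -
      have pos: "card (D j \<inter> X) > 0" if "j < m" for j by (rule subgroup_card_pos[OF DX[OF that X]])
      have p1: "(\<Prod>j<m. real (card (D j))) > 0" using Dge1 by (intro prod_pos) force
      have p2: "(\<Prod>j<m. real (card (D j \<inter> X))) > 0" using pos by (intro prod_pos) auto
      have "\<phi> E \<le> \<phi> X" by (rule Xmax[OF E])
      moreover have "D j \<inter> E = D j" if "j < m" for j using DE[OF that] by auto
      ultimately have "(\<Sum>j<m. ln (real (card (D j)))) \<le> (\<Sum>j<m. ln (real (card (D j \<inter> X))))
          + \<theta> * real n * (ln (real (card E)) - ln (real (card X)))"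
        by (simp add: \<phi>_def algebra_simps)
      moreover have "(\<Sum>j<m. ln (real (card (D j)))) = ln (\<Prod>j<m. real (card (D j)))"
        using Dge1 by (intro ln_prod[symmetric]) force+
      moreover have "(\<Sum>j<m. ln (real (card (D j \<inter> X)))) = ln (\<Prod>j<m. real (card (D j \<inter> X)))"
        using pos by (intro ln_prod[symmetric]) auto
      moreover have "ln ((\<Prod>j<m. real (card (D j \<inter> X))) * (real (card E) / real (card X)) powr (\<theta> * real n))
          = ln (\<Prod>j<m. real (card (D j \<inter> X))) + \<theta> * real n * (ln (real (card E)) - ln (real (card X)))"
        using pos Epos Xpos by (subst ln_mult_pos[OF p2]) (auto simp: ln_div)
      ultimately show ?thesis
        using p1 p2 Epos Xpos by (subst ln_le_cancel_iff[symmetric]) auto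
    qed
    also have "(\<Prod>j<m. real (card (D j \<inter> X))) \<le> (\<Prod>j<m. real (card X))"
      by (intro prod_mono conjI) (auto intro!: card_mono subgroup_finite[OF X])
    finally show ?thesis
      using False tau_nonneg by (simp add: data_bound_def mult_left_mono mult_right_mono mult.assoc)
  next
    case True
    have DX': "D j \<subseteq> X" if "j < m" for j using DE[OF that] True by simp
    have "Ann F \<noteq> X"
    proof
      assume eq: "Ann F = X"
      have "D j = Ann F" if "j < m" for j using DX'[OF that] AnnD[OF that] eq by auto
      then have "good F" unfolding good_def using D_out by auto
      then show False using bad by simp
    qed
    moreover have AX: "Ann F \<subseteq> X" using AnnD[OF m_pos] DX'[OF m_pos] by auto
    ultimately obtain g where g: "g \<in> X" "g \<notin> Ann F" by auto
    have gc: "g \<in> carrier G" using g Xc by auto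
    \<comment> \<open>If more than \<open>\<beta> * n\<close> columns had weight 0 at g, every b i
      would lie in the locus of one of them and F would vanish on b i at g. As the b i span, g would
      annihilate F.\<close>
    define J0 where "J0 = {j. j < m \<and> wt j F g = 0}"
    have J0: "real (card J0) \<le> \<beta> * real n"
    proof (rule ccontr)
      assume "\<not> ?thesis"
      then have big: "real (card J0) > \<beta> * real n" by simp
      have "pr F (b i) g = pr (\<lambda>c\<in>{..<n}. zero_fun) (b i) g" if i: "i < n" for i
      proof -
        have "\<not> J0 \<subseteq> {j. j < m \<and> \<not> inW i j}"
        proof
          assume "J0 \<subseteq> {j. j < m \<and> \<not> inW i j}"
          then have "card J0 \<le> card {j. j < m \<and> \<not> inW i j}" by (rule card_mono[rotated]) auto
          then show False using W_card[OF i] big by linarith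
        qed
        then obtain j where j: "j < m" "wt j F g = 0" "inW i j" by (auto simp: J0_def)
        then have "{i \<in> I j. pr F (v j i) g \<noteq> 0} = {}"
          unfolding wt_def using finite_I[OF j(1)] by simp
        then show ?thesis
          by (intro pairing_span[OF finite_I[OF j(1)] j(3)]) (use pr_zero[OF gc] in auto)
      qed
      then have "F c g = (\<lambda>c\<in>{..<n}. zero_fun) c g" if "c < n" for c
        using agree_all_b[OF F zero_in_Fs gc] that by blast
      then have "g \<in> Ann F" using gc by (auto simp: Ann_def zero_fun_def)
      then show False using g by simp
    qed
    define r where "r = real (card X)"
    have rN: "r \<le> real N0" using subgroup_card_le[OF X] by (simp add: r_def)
    have r1: "r \<ge> 1" using Xpos by (simp add: r_def)
    have rc: "r - (1 - \<rho>) / 2 \<le> r * c0"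
    proof -
      have "r * ((1 - \<rho>) / (2 * real N0)) \<le> real N0 * ((1 - \<rho>) / (2 * real N0))"
        using rN rho by (intro mult_right_mono) auto
      also have "\<dots> = (1 - \<rho>) / 2" using N0_pos by simp
      finally show ?thesis by (simp add: c0_def algebra_simps)
    qed
    have finX: "finite X" by (rule subgroup_finite[OF X])
    have cDX: "real (card (D j)) \<le> r" if "j < m" for j
      using card_mono[OF finX DX'[OF that]] by (simp add: r_def)
    have aX: "a j F \<le> r * (1 + \<tau>)" if j: "j < m" for j
      using aD[OF j] cDX[OF j] mul_tau[OF r1] by linarith
    \<comment> \<open>Either g belongs to \<open>D j\<close> and its mean has norm at most
      \<open>\<rho>\<close>, or \<open>D j\<close> is smaller than X by at least one element. Both
      lose at least 1 - \<open>\<rho>\<close> against card X, and \<open>\<tau>\<close> gives back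
      at most half of that.\<close>
    have aX': "a j F \<le> r * c0" if j: "j < m" "j \<notin> J0" for j
    proof (cases "g \<in> D j")
      case True
      have wt1: "wt j F g \<ge> 1" using j by (auto simp: J0_def)
      have "norm (e j F g) \<le> \<rho> ^ wt j F g" by (rule e_le[OF j(1) F gc])
      also have "\<dots> \<le> \<rho> ^ 1" by (rule power_decreasing[OF wt1]) (use rho in auto)
      finally have eg: "norm (e j F g) \<le> \<rho>" by simp
      have "a j F \<le> (\<Sum>g\<in>D j. norm (e j F g)) + \<tau>"
        by (rule a_le[OF j(1) F Dc[OF j(1)] D_out[OF j(1)]])
      also have "(\<Sum>g\<in>D j. norm (e j F g)) = norm (e j F g) + (\<Sum>g\<in>D j - {g}. norm (e j F g))"
        by (rule sum.remove[OF finD[OF j(1)] True])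
      also have "(\<Sum>g\<in>D j - {g}. norm (e j F g)) \<le> (\<Sum>g\<in>D j - {g}. 1)"
        by (intro sum_mono e_le_1[OF j(1) F]) (use Dc[OF j(1)] in auto)
      also have "(\<Sum>g\<in>D j - {g}. 1) = real (card (D j)) - 1"
        using True finD[OF j(1)] Dge1[OF j(1)] by (simp add: of_nat_diff)
      finally have "a j F \<le> norm (e j F g) + (real (card (D j)) - 1) + \<tau>" by simp
      then have "a j F \<le> \<rho> + (r - 1) + (1 - \<rho>) / 2" using eg cDX[OF j(1)] tau_le by linarith
      also have "\<dots> = r - (1 - \<rho>) / 2" by (simp add: field_simps)
      finally show ?thesis using rc by linarith
    next
      case False
      then have "D j \<subset> X" using DX'[OF j(1)] g by auto
      then have "card (D j) < card X" using finX psubset_card_mono by blast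
      then have "real (card (D j)) \<le> r - 1" by (simp add: r_def)
      then have "a j F \<le> (r - 1) + (1 - \<rho>) / 2" using aD[OF j(1)] tau_le by linarith
      also have "\<dots> \<le> r - (1 - \<rho>) / 2" using rho by (simp add: field_simps)
      finally show ?thesis using rc by linarith
    qed
    have finJ0: "finite J0" "J0 \<subseteq> {..<m}" by (auto simp: J0_def)
    have "(\<Prod>j<m. a j F) \<le> (\<Prod>j<m. (r * (1 + \<tau>)) * (if j \<in> J0 then 1 else c0))"
    proof (intro prod_mono conjI a_nonneg)
      fix j assume j: "j \<in> {..<m}"
      show "a j F \<le> r * (1 + \<tau>) * (if j \<in> J0 then 1 else c0)"
      proof (cases "j \<in> J0")
        case True
        then show ?thesis using aX j by simp
      next
        case False
        have "r * c0 * 1 \<le> r * c0 * (1 + \<tau>)" using r1 c0 tau_nonneg by (intro mult_left_mono) auto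
        then show ?thesis using aX'[of j] False j by (simp add: mult_ac)
      qed
    qed (use F in auto)
    also have "\<dots> = (r * (1 + \<tau>)) ^ m * (\<Prod>j<m. if j \<in> J0 then 1 else c0)"
      by (simp add: prod.distrib)
    also have "(\<Prod>j<m. if j \<in> J0 then 1 else c0) = c0 ^ card ({..<m} - J0)"
      using finJ0 by (subst prod.If_cases) (auto simp: Diff_eq Compl_eq)
    also have "\<dots> \<le> c0 powr ((1 - \<beta>) * real n)"
    proof -
      have "real (card ({..<m} - J0)) = real m - real (card J0)"
        using finJ0 card_mono[of "{..<m}" J0] by (simp add: card_Diff_subset of_nat_diff)
      also have "\<dots> \<ge> (1 - \<beta>) * real n" using J0 m by (simp add: algebra_simps)
      finally have ge: "(1 - \<beta>) * real n \<le> real (card ({..<m} - J0))" .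
      have "c0 ^ card ({..<m} - J0) = c0 powr real (card ({..<m} - J0))"
        using c0 by (simp add: powr_realpow)
      also have "\<dots> \<le> c0 powr ((1 - \<beta>) * real n)" using ge c0 by (intro powr_mono') auto
      finally show ?thesis .
    qed
    finally have 1: "(\<Prod>j<m. a j F) \<le> (r * (1 + \<tau>)) ^ m * c0 powr ((1 - \<beta>) * real n)"
      using r1 tau_nonneg by (simp add: mult_left_mono)
    have "nu F ^ m \<le> (r * (1 + \<tau>)) ^ m * c0 powr ((1 - \<beta>) * real n)"
    proof -
      \<comment> \<open>The annihilator is a proper subgroup of X, so its index is at least 2, while
        \<open>c0 \<ge> 1 / 2\<close>.\<close>
      have "real (card (Ann F)) \<le> r / 2"
      proof -
        have "card (Ann F) dvd card X"
          by (rule card_subgroup_dvd[OF Ann_subgroup[OF F] X AX])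
        then obtain k where k: "card X = card (Ann F) * k" by auto
        have "card (Ann F) < card X" using AX \<open>Ann F \<noteq> X\<close> finX psubset_card_mono by blast
        then have "k \<ge> 2" using k by (cases k rule: nat.exhaust; cases "k - 1") auto
        then have "card (Ann F) * 2 \<le> card X" unfolding k by simp
        then show ?thesis by (simp add: r_def)
      qed
      also have "\<dots> \<le> (r * (1 + \<tau>)) * c0"
      proof -
        have "r * (1/2) \<le> (r * (1 + \<tau>)) * c0" using r1 c0 tau_nonneg by (intro mult_mono) auto
        then show ?thesis by simp
      qed
      finally have "nu F ^ m \<le> ((r * (1 + \<tau>)) * c0) ^ m" by (intro power_mono) auto
      also have "\<dots> = (r * (1 + \<tau>)) ^ m * c0 powr real m"
        using c0 by (simp add: power_mult_distrib powr_realpow)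
      also have "\<dots> \<le> (r * (1 + \<tau>)) ^ m * c0 powr ((1 - \<beta>) * real n)"
      proof (intro mult_left_mono powr_mono')
        have "(1 - \<beta>) * real n \<le> 1 * real n" using ab by (intro mult_right_mono) auto
        then show "(1 - \<beta>) * real n \<le> real m" using m by simp
      qed (use c0 r1 tau_nonneg in auto)
      finally show ?thesis .
    qed
    then show ?thesis using 1 True by (simp add: data_bound_def r_def power_mult_distrib mult_ac)
  qed
  then show ?thesis using inData fitsF unfolding E_def by blast
qed

text \<open>The base of the exponential decay. The first term belongs to X different from E, where
  the index is at least 2, and the second to X = E.\<close>

definition "lam = max (2 powr (- (1 - \<alpha> - \<theta>))) (c0 powr (1 - \<beta>))"

lemma data_bound_nonneg: "data_bound X E \<ge> 0"
  using tau_nonneg by (simp add: data_bound_def)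

lemma card_data_bound_le:
  assumes X: "subgroup X G" and E: "subgroup E G" and XE: "X \<subseteq> E"
  shows "(real (card E) / real (card X)) powr (\<alpha> * real n) * (real N0 / real (card E)) ^ n * data_bound X E
     \<le> real N0 ^ n * real N0 ^ u * (1 + \<tau>) ^ m * lam ^ n"
proof -
  define x where "x = real (card X)"
  define y where "y = real (card E)"
  have x: "x > 0" "x \<le> real N0" using subgroup_card_pos[OF X] subgroup_card_le[OF X] by (auto simp: x_def)
  have y: "y > 0" using subgroup_card_pos[OF E] by (auto simp: y_def)
  have xu: "x ^ m = x ^ n * x ^ u" using m by (simp add: power_add)
  have key: "(y / x) powr (\<alpha> * real n) * (x / y) ^ n *
      (if X = E then c0 powr ((1 - \<beta>) * real n) else (y / x) powr (\<theta> * real n)) \<le> lam ^ n"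
  proof (cases "X = E")
    case True
    then have "y = x" by (simp add: x_def y_def)
    then have "(y / x) powr (\<alpha> * real n) * (x / y) ^ n * (c0 powr ((1 - \<beta>) * real n)) = (c0 powr (1 - \<beta>)) ^ n"
      using x c0 by (simp add: powr_realpow[symmetric] powr_powr)
    also have "\<dots> \<le> lam ^ n" by (intro power_mono) (auto simp: lam_def)
    finally show ?thesis using True by simp
  next
    case False
    have "card X dvd card E" by (rule card_subgroup_dvd[OF X E XE])
    then obtain k where k: "card E = card X * k" by auto
    have "card X < card E" using XE False subgroup_finite[OF E] psubset_card_mono by blast
    then have "k \<ge> 2" using k by (cases k rule: nat.exhaust; cases "k - 1") auto
    then have yx: "y / x \<ge> 2" using k x by (simp add: x_def y_def)
    have "(x / y) ^ n = (y / x) powr (- real n)"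
      using x y by (simp add: powr_minus powr_realpow power_divide)
    then have "(y / x) powr (\<alpha> * real n) * (x / y) ^ n * (y / x) powr (\<theta> * real n)
        = (y / x) powr (\<alpha> * real n + - real n + \<theta> * real n)"
      by (simp only: powr_add)
    also have "\<alpha> * real n + - real n + \<theta> * real n = - (1 - \<alpha> - \<theta>) * real n" by (simp add: algebra_simps)
    also have "(y / x) powr (- (1 - \<alpha> - \<theta>) * real n) = ((y / x) powr (- (1 - \<alpha> - \<theta>))) ^ n"
      using x y by (simp add: powr_realpow[symmetric] powr_powr)
    also have "\<dots> \<le> lam ^ n"
    proof (intro power_mono)
      have "(y / x) powr (- (1 - \<alpha> - \<theta>)) \<le> 2 powr (- (1 - \<alpha> - \<theta>))"
        using yx ab by (intro powr_mono2') auto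
      then show "(y / x) powr (- (1 - \<alpha> - \<theta>)) \<le> lam" by (simp add: lam_def)
    qed simp
    finally show ?thesis using False by simp
  qed
  define K where "K = (y / x) powr (\<alpha> * real n) * (x / y) ^ n *
      (if X = E then c0 powr ((1 - \<beta>) * real n) else (y / x) powr (\<theta> * real n))"
  have K: "0 \<le> K" "K \<le> lam ^ n" using key x y by (auto simp: K_def)
  have "(y / x) powr (\<alpha> * real n) * (real N0 / y) ^ n * data_bound X E
      = real N0 ^ n * x ^ u * (1 + \<tau>) ^ m * K"
    unfolding data_bound_def K_def x_def[symmetric] y_def[symmetric] xu by (simp add: power_divide)
  also have "\<dots> \<le> real N0 ^ n * real N0 ^ u * (1 + \<tau>) ^ m * lam ^ n"
    using x tau_nonneg K by (intro mult_mono power_mono) auto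
  finally show ?thesis by (simp add: x_def y_def)
qed

lemma finite_Data: "finite Data"
  unfolding Data_def
proof (intro finite_cartesian_product)
  show "finite {X. subgroup X G}"
    by (rule finite_subset[of _ "Pow (carrier G)"]) (use fin subgroup_carrier in auto)
  show "finite {T. set T \<subseteq> {..<m} \<and> length T = t + N0}" by (rule finite_lists_length_eq) simp
  show "finite {Ds. set Ds \<subseteq> {D. subgroup D G} \<and> length Ds = t + N0}"
    by (rule finite_lists_length_eq, rule finite_subset[of _ "Pow (carrier G)"])
      (use fin subgroup_carrier in auto)
  show "finite {ts. set ts \<subseteq> sparse_funs n Psi zero_fun \<delta>2 \<and> length ts = t + N0}"
    by (rule finite_lists_length_eq[OF finite_sparse_funs[OF finite_mod_homs[OF fin]]])
  show "finite (sparse_funs n Psi zero_fun \<delta>3)"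
    by (rule finite_sparse_funs[OF finite_mod_homs[OF fin]])
qed

lemma card_Data_le:
  assumes h: "real (card (sparse_funs n Psi zero_fun \<delta>2)) \<le> s2" "real (card (sparse_funs n Psi zero_fun \<delta>3)) \<le> s3"
  shows "real (card Data) \<le> 2 ^ N0 * real m ^ (t + N0) * (2 ^ N0) ^ (t + N0) * s2 ^ (t + N0) * s3"
proof -
  have "card {X. subgroup X G} \<le> card (Pow (carrier G))"
    by (rule card_mono) (use fin subgroup_carrier in auto)
  also have "\<dots> = 2 ^ N0" using fin by (simp add: card_Pow)
  finally have "real (card {X. subgroup X G}) \<le> real (2 ^ N0)" by (simp only: of_nat_le_iff)
  then have s: "real (card {X. subgroup X G}) \<le> 2 ^ N0" by simp
  have finsub: "finite {X. subgroup X G}"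
    by (rule finite_subset[of _ "Pow (carrier G)"]) (use fin subgroup_carrier in auto)
  have "real (card Data) = real (card {X. subgroup X G}) * (real m ^ (t + N0) *
      (real (card {X. subgroup X G}) ^ (t + N0) * (real (card (sparse_funs n Psi zero_fun \<delta>2)) ^ (t + N0) *
        real (card (sparse_funs n Psi zero_fun \<delta>3)))))"
    unfolding Data_def using finsub finite_sparse_funs[OF finite_mod_homs[OF fin]]
    by (simp add: card_cartesian_product card_lists_length_eq)
  also have "\<dots> \<le> 2 ^ N0 * (real m ^ (t + N0) * ((2 ^ N0) ^ (t + N0) * (s2 ^ (t + N0) * s3)))"
    using s h order_trans[OF _ h(1)] order_trans[OF _ h(2)]
    by (intro mult_mono power_mono mult_nonneg_nonneg zero_le_power) auto
  finally show ?thesis by (simp add: mult_ac)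
qed

text \<open>A union bound over Data: for each datum, the number of F that fit it times the bound it
  gives is controlled by one common quantity.\<close>

lemma sum_bad:
  "(\<Sum>F\<in>{F \<in> Fs. \<not> good F}. max (\<Prod>j<m. a j F) (nu F ^ m))
     \<le> real (card Data) * (real N0 ^ n * real N0 ^ u * (1 + \<tau>) ^ m * lam ^ n)"
proof -
  define B where "B = (\<lambda>(X, T :: nat list, Ds, ts :: (nat \<Rightarrow> 'a \<Rightarrow> int) list, \<omega> :: nat \<Rightarrow> 'a \<Rightarrow> int). data_bound X (generate G (X \<union> \<Union>(set Ds))))"
  define f where "f = (\<lambda>(X, T, Ds, ts, \<omega>). fits X T Ds ts \<omega> :: (nat \<Rightarrow> 'a \<Rightarrow> int) \<Rightarrow> bool)"
  have B0: "B x \<ge> 0" for x by (cases x) (auto simp: B_def data_bound_nonneg)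
  have ex: "\<exists>x\<in>Data. f x F \<and> max (\<Prod>j<m. a j F) (nu F ^ m) \<le> B x" if "F \<in> Fs" "\<not> good F" for F
    using bad_data[OF that] by (force simp: B_def f_def)
  have "(\<Sum>F\<in>{F \<in> Fs. \<not> good F}. max (\<Prod>j<m. a j F) (nu F ^ m))
      \<le> (\<Sum>F\<in>{F \<in> Fs. \<not> good F}. \<Sum>x\<in>Data. if f x F then B x else 0)"
  proof (rule sum_mono)
    fix F assume "F \<in> {F \<in> Fs. \<not> good F}"
    then obtain x where x: "x \<in> Data" "f x F" "max (\<Prod>j<m. a j F) (nu F ^ m) \<le> B x"
      using ex by blast
    have "B x = (\<Sum>y\<in>{x}. if f y F then B y else 0)" using x by simp
    also have "\<dots> \<le> (\<Sum>y\<in>Data. if f y F then B y else 0)"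
      using x B0 finite_Data by (intro sum_mono2) auto
    finally show "max (\<Prod>j<m. a j F) (nu F ^ m) \<le> (\<Sum>y\<in>Data. if f y F then B y else 0)" using x by linarith
  qed
  also have "\<dots> \<le> (\<Sum>F\<in>Fs. \<Sum>x\<in>Data. if f x F then B x else 0)"
    using finite_Fs B0 by (intro sum_mono2 sum_nonneg) auto
  also have "\<dots> = (\<Sum>x\<in>Data. \<Sum>F\<in>Fs. if f x F then B x else 0)" by (rule sum.swap)
  also have "\<dots> = (\<Sum>x\<in>Data. real (card {F \<in> Fs. f x F}) * B x)"
    using finite_Fs by (simp add: sum.If_cases Int_def)
  also have "\<dots> \<le> (\<Sum>x\<in>Data. real N0 ^ n * real N0 ^ u * (1 + \<tau>) ^ m * lam ^ n)"
  proof (rule sum_mono)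
    fix x assume "x \<in> Data"
    then obtain X T Ds ts \<omega> where x: "x = (X, T, Ds, ts, \<omega>)" and X: "subgroup X G"
      and T: "set T \<subseteq> {..<m}" "length T = t + N0"
      and Ds: "set Ds \<subseteq> {D. subgroup D G}" "length Ds = t + N0"
      by (auto simp: Data_def)
    have Dc: "D \<subseteq> carrier G" if "D \<in> set Ds" for D using Ds that subgroup_carrier by auto
    have sub: "X \<union> \<Union>(set Ds) \<subseteq> carrier G" using Dc subgroup_carrier[OF X] by auto
    have E: "subgroup (generate G (X \<union> \<Union>(set Ds))) G" by (rule generate_is_subgroup[OF sub])
    have XE: "X \<subseteq> generate G (X \<union> \<Union>(set Ds))" by (auto intro: generate.incl)
    have len: "length Ds = length T" using T Ds by simp
    have "real (card {F \<in> Fs. f x F}) * B x \<le>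
        ((real (card (generate G (X \<union> \<Union>(set Ds)))) / real (card X)) powr (\<alpha> * real n)
         * (real N0 / real (card (generate G (X \<union> \<Union>(set Ds))))) ^ n) * B x"
      unfolding f_def x using card_fits[OF X T(1) len Dc] B0[of x]
      by (intro mult_right_mono) (auto simp: x)
    also have "\<dots> \<le> real N0 ^ n * real N0 ^ u * (1 + \<tau>) ^ m * lam ^ n"
      using card_data_bound_le[OF X E XE] by (simp add: B_def x)
    finally show "real (card {F \<in> Fs. f x F}) * B x \<le> real N0 ^ n * real N0 ^ u * (1 + \<tau>) ^ m * lam ^ n" .
  qed
  finally show ?thesis by simp
qed

text \<open>Grouped by the annihilator X, at most \<open>(N0 / card X) ^ n\<close> functions
  contribute \<open>card X ^ m\<close> each. Apart from the relative error this is at most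
  \<open>N0 ^ n * N0 ^ u\<close>, and there are at most \<open>2 ^ N0\<close> subgroups.\<close>

lemma sum_good:
  "(\<Sum>F\<in>{F \<in> Fs. good F}. nu F ^ m * ((1 + \<tau>) ^ m - 1))
     \<le> 2 ^ N0 * (real N0 ^ n * real N0 ^ u * ((1 + \<tau>) ^ m - 1))"
proof -
  define S where "S = {X. subgroup X G}"
  have finS: "finite S" unfolding S_def
    by (rule finite_subset[of _ "Pow (carrier G)"]) (use fin subgroup_carrier in auto)
  have "card S \<le> card (Pow (carrier G))"
    unfolding S_def by (rule card_mono) (use fin subgroup_carrier in auto)
  also have "\<dots> = 2 ^ N0" using fin by (simp add: card_Pow)
  finally have "real (card S) \<le> real (2 ^ N0)" by (simp only: of_nat_le_iff)
  then have cS: "real (card S) \<le> 2 ^ N0" by simp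
  define w where "w = (1 + \<tau>) ^ m - 1"
  have w: "w \<ge> 0" unfolding w_def using tau_nonneg by simp
  have "(\<Sum>F\<in>{F \<in> Fs. good F}. nu F ^ m * w) \<le> (\<Sum>F\<in>Fs. nu F ^ m * w)"
    using w finite_Fs by (intro sum_mono2) auto
  also have "\<dots> = (\<Sum>X\<in>S. \<Sum>F\<in>{F \<in> Fs. Ann F = X}. nu F ^ m * w)"
    using sum.group[OF finite_Fs finS, of Ann "\<lambda>F. nu F ^ m * w"] Ann_subgroup
    by (simp add: S_def image_subset_iff)
  also have "\<dots> = (\<Sum>X\<in>S. real (card {F \<in> Fs. Ann F = X}) * (real (card X) ^ m * w))"
    by (intro sum.cong refl) simp
  also have "\<dots> \<le> (\<Sum>X\<in>S. real N0 ^ n * real N0 ^ u * w)"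
  proof (rule sum_mono)
    fix X assume "X \<in> S"
    then have X: "subgroup X G" by (simp add: S_def)
    have Xp: "card X > 0" "card X \<le> N0" by (rule subgroup_card_pos[OF X], rule subgroup_card_le[OF X])
    have "real (card {F \<in> Fs. Ann F = X}) \<le> (real N0 / real (card X)) ^ n"
    proof (rule card_agree[OF _ X])
      fix F F' g c assume "F \<in> {F \<in> Fs. Ann F = X}" "F' \<in> {F \<in> Fs. Ann F = X}" "g \<in> X" "c < n"
      then have "g \<in> Ann F" "g \<in> Ann F'" by auto
      then show "F c g = F' c g" using \<open>c < n\<close> by (simp add: Ann_def)
    qed auto
    then have "real (card {F \<in> Fs. Ann F = X}) * (real (card X) ^ m * w)
       \<le> (real N0 / real (card X)) ^ n * (real (card X) ^ m * w)"
      using w by (intro mult_right_mono) auto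
    also have "\<dots> = real N0 ^ n * (real (card X) ^ u * w)"
      using Xp m by (simp add: power_divide power_add)
    also have "\<dots> \<le> real N0 ^ n * (real N0 ^ u * w)"
      using w Xp by (intro mult_left_mono mult_right_mono power_mono) auto
    finally show "real (card {F \<in> Fs. Ann F = X}) * (real (card X) ^ m * w) \<le> real N0 ^ n * real N0 ^ u * w"
      by (simp add: mult_ac)
  qed
  also have "\<dots> = real (card S) * (real N0 ^ n * real N0 ^ u * w)" by simp
  also have "\<dots> \<le> 2 ^ N0 * (real N0 ^ n * real N0 ^ u * w)"
    using cS w by (intro mult_right_mono) auto
  finally show ?thesis by (simp add: w_def)
qed

lemma total_bound:
  "(\<Sum>F\<in>Fs. \<bar>(\<Prod>j<m. a j F) - nu F ^ m\<bar>) \<le> real N0 ^ n * (real N0 ^ u *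
     (2 ^ N0 * ((1 + \<tau>) ^ m - 1) + real (card Data) * (1 + \<tau>) ^ m * lam ^ n))"
proof -
  have "(\<Sum>F\<in>Fs. \<bar>(\<Prod>j<m. a j F) - nu F ^ m\<bar>) = (\<Sum>F\<in>{F \<in> Fs. good F}. \<bar>(\<Prod>j<m. a j F) - nu F ^ m\<bar>)
      + (\<Sum>F\<in>{F \<in> Fs. \<not> good F}. \<bar>(\<Prod>j<m. a j F) - nu F ^ m\<bar>)"
    using finite_Fs by (subst sum.union_disjoint[symmetric]) (auto intro!: sum.cong)
  also have "\<dots> \<le> (\<Sum>F\<in>{F \<in> Fs. good F}. nu F ^ m * ((1 + \<tau>) ^ m - 1))
      + (\<Sum>F\<in>{F \<in> Fs. \<not> good F}. max (\<Prod>j<m. a j F) (nu F ^ m))"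
  proof (intro add_mono sum_mono)
    fix F assume "F \<in> {F \<in> Fs. \<not> good F}"
    then have "(\<Prod>j<m. a j F) \<ge> 0" using a_nonneg by (intro prod_nonneg) auto
    moreover have "nu F ^ m \<ge> 0" by simp
    ultimately show "\<bar>(\<Prod>j<m. a j F) - nu F ^ m\<bar> \<le> max (\<Prod>j<m. a j F) (nu F ^ m)" by linarith
  qed (use good_bound in auto)
  also have "\<dots> \<le> 2 ^ N0 * (real N0 ^ n * real N0 ^ u * ((1 + \<tau>) ^ m - 1)) +
      real (card Data) * (real N0 ^ n * real N0 ^ u * (1 + \<tau>) ^ m * lam ^ n)"
    by (rule add_mono[OF sum_good sum_bad])
  finally show ?thesis by (simp add: algebra_simps)
qed

end

text \<open>The threshold n0 depends only on G and the real parameters. This uniformity lets the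
  matrices, their columns and even q vary with n.\<close>

theorem column_limit:
  fixes \<alpha> \<beta> \<rho> :: real and u :: nat and G :: "('a, 'b) monoid_scheme"
  assumes G: "comm_group G" "finite (carrier G)"
    and rho: "0 < \<rho>" "\<rho> < 1" and ab: "0 \<le> \<alpha>" "0 \<le> \<beta>" "\<alpha> + \<beta> < 1" and \<kappa>: "\<kappa> > (0::real)"
  shows "\<exists>n0. \<forall>n\<ge>n0. \<forall>q v I b a e. column_data G q n (n + u) v I b \<alpha> \<beta> \<rho> a e \<longrightarrow>
     (\<Sum>F\<in>{..<n} \<rightarrow>\<^sub>E mod_homs G q.
        \<bar>(\<Prod>j<n + u. a j F) - real (card {g \<in> carrier G. \<forall>c<n. F c g = 0}) ^ (n + u)\<bar>)
     \<le> \<kappa> * real (card (carrier G)) ^ n"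
proof -
  interpret comm_group G by (rule G(1))
  define N where "N = card (carrier G)"
  have N: "N > 0" unfolding N_def using G(2) by (metis card_gt_0_iff emptyE one_closed)
  \<comment> \<open>The midpoint between \<open>\<beta>\<close> and
    \<open>1 - \<alpha>\<close>.\<close>
  define \<theta> where "\<theta> = \<beta> + (1 - \<alpha> - \<beta>) / 2"
  have th: "\<beta> < \<theta>" "\<alpha> + \<theta> < 1" using ab by (auto simp: \<theta>_def field_simps)
  \<comment> \<open>The denominator absorbs the u surplus columns, as
    \<open>n + u \<le> (1 + u) * n\<close> for positive n.\<close>
  define \<mu> where "\<mu> = (\<theta> - \<beta>) / (1 + real u)"
  have mu: "0 < \<mu>" "\<mu> \<le> 1"
    using th ab by (auto simp: \<mu>_def divide_le_eq)
  have mum: "\<mu> * real (n + u) \<le> (\<theta> - \<beta>) * real n" if "n > 0" for n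
  proof -
    have "real u * 1 \<le> real u * real n" using that by (intro mult_left_mono) auto
    then have "real (n + u) \<le> (1 + real u) * real n" by (simp add: algebra_simps)
    then have "\<mu> * real (n + u) \<le> \<mu> * ((1 + real u) * real n)" using mu by (intro mult_left_mono) auto
    also have "\<dots> = (\<theta> - \<beta>) * real n"
    proof -
      have "\<mu> * (1 + real u) = \<theta> - \<beta>" unfolding \<mu>_def by simp
      then show ?thesis by (metis mult.assoc)
    qed
    finally show ?thesis .
  qed
  define c0 where "c0 = 1 - (1 - \<rho>) / (2 * real N)"
  have c0: "0 < c0" "c0 < 1"
  proof -
    have "(1 - \<rho>) / (2 * real N) < 1" using rho N by (simp add: field_simps)
    then show "0 < c0" by (simp add: c0_def)
    show "c0 < 1" using rho N by (simp add: c0_def)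
  qed
  define lam where "lam = max (2 powr (- (1 - \<alpha> - \<theta>))) (c0 powr (1 - \<beta>))"
  have lam: "0 < lam" "lam < 1"
  proof -
    show "0 < lam" unfolding lam_def by (simp add: less_max_iff_disj)
    have "(2::real) powr (- (1 - \<alpha> - \<theta>)) < 2 powr 0" using th by (intro powr_less_mono) auto
    moreover have "c0 powr (1 - \<beta>) < c0 powr 0" using c0 ab by (intro powr_less_mono') auto
    ultimately show "lam < 1" using c0 by (simp add: lam_def)
  qed
  \<comment> \<open>The decay \<open>lam ^ n\<close> equals \<open>exp (- 4 * h * n)\<close>. The
    functions ts and the function \<open>\<omega>\<close> may cost \<open>exp (h * n)\<close> each,
    so \<open>exp (- 2 * h * n)\<close> is left over to beat the polynomial factors.\<close>
  define h where "h = - ln lam / 4"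
  have h: "h > 0" using lam by (simp add: h_def)
  have lamn: "lam ^ n = exp (- 4 * h * real n)" for n
    using lam by (simp add: h_def powr_realpow[symmetric] powr_def mult.commute)
  \<comment> \<open>The order of the choices matters: \<open>\<delta>3\<close> depends on h, then t
    on \<open>\<delta>3\<close>, then h2 and \<open>\<delta>2\<close> on t, because t + N functions
    of density \<open>\<delta>2\<close> together may cost only \<open>exp (h * n)\<close>, and
    finally \<open>\<delta>\<close> on \<open>\<delta>2\<close>.\<close>
  have "\<exists>d>0. \<forall>n A (z :: 'a \<Rightarrow> int). finite A \<longrightarrow> card A \<le> N \<longrightarrow>
      real (card (sparse_funs n A z d)) \<le> exp (h * real n)"
    by (rule sparse_funs_exp_bound[OF h])
  then obtain \<delta>3 where d3: "\<delta>3 > 0" and d3': "\<forall>n A (z :: 'a \<Rightarrow> int). finite A \<longrightarrow> card A \<le> N \<longrightarrow>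
      real (card (sparse_funs n A z \<delta>3)) \<le> exp (h * real n)" by (elim exE conjE)
  have "\<exists>t. (1 - \<mu>) ^ t < \<delta>3 / 2 ^ N" using mu d3 by (intro real_arch_pow_inv) auto
  then obtain t where t: "(1 - \<mu>) ^ t < \<delta>3 / 2 ^ N" by blast
  have t': "(1 - \<mu>) ^ t * 2 ^ N \<le> \<delta>3" using t by (simp add: field_simps)
  define h2 where "h2 = h / (real (t + N) + 1)"
  have h2: "h2 > 0" using h by (simp add: h2_def)
  have "\<exists>d>0. \<forall>n A (z :: 'a \<Rightarrow> int). finite A \<longrightarrow> card A \<le> N \<longrightarrow>
      real (card (sparse_funs n A z d)) \<le> exp (h2 * real n)"
    by (rule sparse_funs_exp_bound[OF h2])
  then obtain \<delta>2 where d2: "\<delta>2 > 0" and d2': "\<forall>n A (z :: 'a \<Rightarrow> int). finite A \<longrightarrow> card A \<le> N \<longrightarrow>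
      real (card (sparse_funs n A z \<delta>2)) \<le> exp (h2 * real n)" by (elim exE conjE)
  define \<delta> where "\<delta> = \<delta>2 / (real N * 2 ^ N)"
  have d: "\<delta> > 0" "real N * (2 ^ N * \<delta>) \<le> \<delta>2" using d2 N by (auto simp: \<delta>_def)
  define c where "c = - \<delta> * ln \<rho>"
  have c: "c > 0" using d(1) rho by (simp add: c_def mult_neg_neg mult_pos_neg)
  define \<tau> where "\<tau> = (\<lambda>n. real N * \<rho> powr (\<delta> * real n))"
  have tau_exp: "\<tau> n = real N * exp (- c * real n)" for n
    using rho by (simp add: \<tau>_def c_def powr_def mult_ac)
  have tau0: "\<tau> n \<ge> 0" for n by (simp add: \<tau>_def)
  define C where "C = (2::real) ^ N * (2 ^ N) ^ (t + N)"
  define bound where "bound = (\<lambda>n. real N ^ u * (2 ^ N * (exp (real (n + u) * \<tau> n) - 1) +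
      C * real (n + u) ^ (t + N) * exp (- 2 * h * real n) * exp (real (n + u) * \<tau> n)))"
  have lim1: "(\<lambda>n. real (n + u) * \<tau> n) \<longlonglongrightarrow> 0"
  proof -
    have "(\<lambda>n. (real n + real u) * (real N * exp (- c * real n))) \<longlonglongrightarrow> 0"
      using c by real_asymp
    then show ?thesis by (simp add: tau_exp)
  qed
  have lim1': "(\<lambda>n. exp (real (n + u) * \<tau> n)) \<longlonglongrightarrow> 1"
    using tendsto_exp[OF lim1] by simp
  have lim2: "(\<lambda>n. real (n + u) ^ (t + N) * exp (- 2 * h * real n)) \<longlonglongrightarrow> 0"
  proof -
    have "(\<lambda>n. (real n + real u) ^ (t + N) * exp (- 2 * h * real n)) \<longlonglongrightarrow> 0"
      using h by real_asymp
    then show ?thesis by simp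
  qed
  have "bound \<longlonglongrightarrow> real N ^ u * (2 ^ N * (1 - 1) + C * 0 * 1)"
    unfolding bound_def
    by (intro tendsto_intros lim1' tendsto_mult[OF tendsto_mult[OF tendsto_const lim2, unfolded mult.assoc[symmetric]]])
  then have "bound \<longlonglongrightarrow> 0" by simp
  then have ev1: "eventually (\<lambda>n. bound n < \<kappa>) sequentially" using \<kappa> order_tendstoD(2) by blast
  have "\<tau> \<longlonglongrightarrow> 0"
  proof -
    have "(\<lambda>n. real N * exp (- c * real n)) \<longlonglongrightarrow> 0" using c by real_asymp
    then show ?thesis by (simp add: tau_exp[abs_def])
  qed
  then have ev2: "eventually (\<lambda>n. \<tau> n < (1 - \<rho>) / 2) sequentially"
    using rho by (intro order_tendstoD(2)) auto
  have "eventually (\<lambda>n. bound n < \<kappa> \<and> \<tau> n < (1 - \<rho>) / 2 \<and> n > 0) sequentially"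
    using ev1 ev2 eventually_gt_at_top[of 0] by eventually_elim auto
  then obtain n0 where n0: "\<And>n. n \<ge> n0 \<Longrightarrow> bound n < \<kappa> \<and> \<tau> n < (1 - \<rho>) / 2 \<and> n > 0"
    unfolding eventually_sequentially by blast
  have "(\<Sum>F\<in>{..<n} \<rightarrow>\<^sub>E mod_homs G q.
        \<bar>(\<Prod>j<n + u. a j F) - real (card {g \<in> carrier G. \<forall>c<n. F c g = 0}) ^ (n + u)\<bar>)
     \<le> \<kappa> * real N ^ n"
    if n: "n \<ge> n0" and cd: "column_data G q n (n + u) v I b \<alpha> \<beta> \<rho> a e" for n q v I b a e
  proof -
    interpret D: column_data G q n "n + u" v I b \<alpha> \<beta> \<rho> a e by (rule cd)
    have tn: "\<tau> n \<le> (1 - \<rho>) / 2" using n0[OF n] by simp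
    interpret B: column_bound G q n "n + u" v I b \<alpha> \<beta> \<rho> a e u t \<theta> \<mu> \<delta> \<delta>2 \<delta>3
      by unfold_locales
        (use ab th mu mum[OF D.n] d t' tn in \<open>auto simp: N_def \<tau>_def\<close>)
    have Psi: "finite (mod_homs G q)" "card (mod_homs G q) \<le> N"
      unfolding N_def by (rule finite_mod_homs[OF G(2)], rule card_mod_homs_le[OF G(2)])
    have Bt: "B.\<tau> = \<tau> n" by (simp add: B.\<tau>_def \<tau>_def N_def)
    have Bl: "B.lam = lam" by (simp add: B.lam_def lam_def B.c0_def c0_def N_def)
    have pw: "(1 + \<tau> n) ^ (n + u) \<le> exp (real (n + u) * \<tau> n)"
    proof -
      have "(1 + \<tau> n) ^ (n + u) \<le> exp (\<tau> n) ^ (n + u)"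
        using tau0[of n] by (intro power_mono) auto
      then show ?thesis by (simp only: exp_of_nat_mult)
    qed
    have e1: "exp (h2 * real n) ^ (t + N) \<le> exp (h * real n)"
    proof -
      have "h2 * real (t + N) \<le> h2 * (real (t + N) + 1)" using h2 by (intro mult_left_mono) auto
      also have "\<dots> = h" unfolding h2_def by simp
      finally have "h2 * real (t + N) * real n \<le> h * real n" by (intro mult_right_mono) auto
      then show ?thesis by (simp add: exp_of_nat_mult[symmetric] mult_ac)
    qed
    have "real (card B.Data) \<le> 2 ^ N * real (n + u) ^ (t + N) * (2 ^ N) ^ (t + N) *
        exp (h2 * real n) ^ (t + N) * exp (h * real n)"
      using B.card_Data_le[OF d2'[rule_format, OF Psi] d3'[rule_format, OF Psi]] unfolding N_def .
    also have "\<dots> = (C * real (n + u) ^ (t + N)) * (exp (h2 * real n) ^ (t + N) * exp (h * real n))"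
      unfolding C_def by (simp only: mult_ac)
    also have "\<dots> \<le> (C * real (n + u) ^ (t + N)) * (exp (h * real n) * exp (h * real n))"
      using e1 by (intro mult_left_mono mult_right_mono) (auto simp: C_def)
    also have "exp (h * real n) * exp (h * real n) = exp (2 * h * real n)"
      unfolding exp_add[symmetric] by simp
    finally have D: "real (card B.Data) \<le> C * real (n + u) ^ (t + N) * exp (2 * h * real n)"
      by (simp only: mult.assoc)
    have "real (card B.Data) * (1 + \<tau> n) ^ (n + u) * lam ^ n \<le>
        (C * real (n + u) ^ (t + N) * exp (2 * h * real n)) * exp (real (n + u) * \<tau> n) * lam ^ n"
      using D pw tau0[of n] lam by (intro mult_right_mono mult_mono) auto
    also have "\<dots> = C * real (n + u) ^ (t + N) * exp (- 2 * h * real n) * exp (real (n + u) * \<tau> n)"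
    proof -
      have "exp (2 * h * real n) * lam ^ n = exp (- 2 * h * real n)"
        unfolding lamn exp_add[symmetric] by simp
      then show ?thesis by (metis mult.assoc mult.commute)
    qed
    finally have b2: "real (card B.Data) * (1 + \<tau> n) ^ (n + u) * lam ^ n \<le>
        C * real (n + u) ^ (t + N) * exp (- 2 * h * real n) * exp (real (n + u) * \<tau> n)" .
    have "(\<Sum>F\<in>{..<n} \<rightarrow>\<^sub>E mod_homs G q. \<bar>(\<Prod>j<n + u. a j F) - real (card (D.Ann F)) ^ (n + u)\<bar>)
      \<le> real N ^ n * (real N ^ u * (2 ^ N * ((1 + \<tau> n) ^ (n + u) - 1) +
          real (card B.Data) * (1 + \<tau> n) ^ (n + u) * lam ^ n))"
      using B.total_bound unfolding Bt Bl N_def .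
    also have "\<dots> \<le> real N ^ n * bound n"
      unfolding bound_def using b2 pw by (intro mult_left_mono add_mono) auto
    also have "\<dots> \<le> real N ^ n * \<kappa>" using n0[OF n] by (intro mult_left_mono) auto
    finally show ?thesis by (simp add: D.Ann_def mult.commute)
  qed
  then show ?thesis unfolding N_def by blast
qed

section \<open>Characters and random p-adic matrices\<close>

definition chi :: "nat \<Rightarrow> int \<Rightarrow> complex" where
  "chi q t = cis (2 * pi * (real_of_int t / real q))"

lemma chi_add: "chi q (a + b) = chi q a * chi q b"
  by (simp add: chi_def cis_mult add_divide_distrib distrib_left)

lemma norm_chi [simp]: "norm (chi q t) = 1"
  by (simp add: chi_def)

lemma chi_zero [simp]: "chi q 0 = 1"
  by (simp add: chi_def)

lemma chi_eq_1_iff: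
  assumes "q > 0"
  shows "chi q t = 1 \<longleftrightarrow> int q dvd t"
proof
  assume "int q dvd t"
  then obtain k where k: "t = int q * k" by auto
  have "chi q t = cis (2 * pi * real_of_int k)" using assms by (simp add: chi_def k)
  then show "chi q t = 1" by simp
next
  assume "chi q t = 1"
  then have "cos (2 * pi * (real_of_int t / real q)) = 1"
    by (metis chi_def cis.simps(1) one_complex.simps(1))
  then obtain k :: int where "2 * pi * (real_of_int t / real q) = of_int k * 2 * pi"
    using cos_one_2pi_int by blast
  then have "real_of_int t = of_int k * real q" using assms by (simp add: field_simps)
  then have "real_of_int t = real_of_int (k * int q)" by simp
  then have "t = k * int q" by (simp only: of_int_eq_iff)
  then show "int q dvd t" by simp
qed

lemma chi_mod: "q > 0 \<Longrightarrow> chi q (a mod int q) = chi q a"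
  using chi_add[of q "a mod int q" "int q * (a div int q)"] chi_eq_1_iff[of q "int q * (a div int q)"]
  by simp

lemma chi_sum: "chi q (\<Sum>i\<in>I. f i) = (\<Prod>i\<in>I. chi q (f i))"
  by (induction I rule: infinite_finite_induct) (simp_all add: chi_add)

lemma chi_diff: "chi q (a - b) * chi q b = chi q a"
  using chi_add[of q "a - b" b] by simp

lemma chi_gap: "\<exists>s>0. s \<le> 2 \<and> (\<forall>t. \<not> int q dvd t \<longrightarrow> s \<le> norm (chi q t - 1))" if q: "q > 0"
proof -
  \<comment> \<open>The element 2 keeps the set nonempty when q = 1.\<close>
  define S where "S = insert 2 ((\<lambda>t. norm (chi q t - 1)) ` {1..<int q})"
  have S: "finite S" "S \<noteq> {}" by (auto simp: S_def)
  have pos: "x > 0" if "x \<in> S" for x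
    using that q zdvd_not_zless by (auto simp: S_def chi_eq_1_iff)
  have "Min S \<le> norm (chi q t - 1)" if t: "\<not> int q dvd t" for t
  proof -
    have "t mod int q \<noteq> 0" using t by (simp add: dvd_eq_mod_eq_0)
    moreover have "t mod int q \<ge> 0" "t mod int q < int q" using q by auto
    ultimately have "norm (chi q (t mod int q) - 1) \<in> S" unfolding S_def by (intro insertI2 imageI) auto
    then show ?thesis using S chi_mod[OF q, of t] by simp
  qed
  moreover have "Min S > 0" using S pos by simp
  moreover have "Min S \<le> 2" using S by (simp add: S_def)
  ultimately show ?thesis by blast
qed

text \<open>Translation by y with f y nonzero permutes the summands and multiplies the sum by
  \<open>chi q (f y)\<close>, which is not 1.\<close>

lemma (in comm_group) chi_orthogonality:
  assumes fin: "finite (carrier G)" and q: "q > 0"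
    and f: "\<And>x y. x \<in> carrier G \<Longrightarrow> y \<in> carrier G \<Longrightarrow> f (x \<otimes> y) = (f x + f y) mod int q"
    and f0: "\<And>x. x \<in> carrier G \<Longrightarrow> f x \<in> {0..<int q}"
  shows "(\<Sum>x\<in>carrier G. chi q (f x)) = of_nat (card (carrier G)) * of_bool (\<forall>x\<in>carrier G. f x = 0)"
proof (cases "\<forall>x\<in>carrier G. f x = 0")
  case True
  then show ?thesis by simp
next
  case False
  then obtain y where y: "y \<in> carrier G" "f y \<noteq> 0" by blast
  have ny: "chi q (f y) \<noteq> 1"
    using y f0[OF y(1)] zdvd_not_zless[of "f y" "int q"] by (auto simp: chi_eq_1_iff[OF q])
  have "(\<Sum>x\<in>carrier G. chi q (f x)) = (\<Sum>x\<in>carrier G. chi q (f (y \<otimes> x)))"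
  proof (rule sum.reindex_bij_betw[symmetric])
    show "bij_betw (\<lambda>x. y \<otimes> x) (carrier G) (carrier G)"
      by (rule bij_betwI[where g = "\<lambda>x. inv y \<otimes> x"]) (use y in \<open>auto simp: m_assoc[symmetric]\<close>)
  qed
  also have "\<dots> = (\<Sum>x\<in>carrier G. chi q (f y) * chi q (f x))"
    using y f by (intro sum.cong refl) (simp add: chi_mod[OF q] chi_add)
  also have "\<dots> = chi q (f y) * (\<Sum>x\<in>carrier G. chi q (f x))" by (simp add: sum_distrib_left)
  finally have "(chi q (f y) - 1) * (\<Sum>x\<in>carrier G. chi q (f x)) = 0" by (simp add: algebra_simps)
  then show ?thesis using ny False by simp
qed

section \<open>Residues of p-adic integers\<close>

lemma p_gt_1: "CARD('p :: prime_card) > 1"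
  using prime_gt_1_nat[OF prime_card[where 'a = 'p]] .

lemma padic_residue_range:
  "padic_residue (x :: 'p :: prime_card padic_int) k \<in> {0..<int CARD('p) ^ k}"
proof -
  have "int CARD('p) ^ k > 0" using p_gt_1[where 'p = 'p] by simp
  then show ?thesis using padic_residue_mod[of x k] by (metis atLeastLessThan_iff pos_mod_bound pos_mod_sign)
qed

lemma padic_residue_eq_iff:
  "padic_residue (x :: 'p :: prime_card padic_int) k = padic_residue y k \<longleftrightarrow> of_nat CARD('p) ^ k dvd x - y"
proof -
  have "of_nat CARD('p) ^ k dvd x - y \<longleftrightarrow> (padic_residue x k - padic_residue y k) mod int CARD('p) ^ k = 0"
    by (simp add: p_power_dvd_iff padic_residue_simps)
  also have "\<dots> \<longleftrightarrow> padic_residue x k mod int CARD('p) ^ k = padic_residue y k mod int CARD('p) ^ k"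
    by (simp add: mod_eq_dvd_iff dvd_eq_mod_eq_0)
  finally show ?thesis by (simp add: padic_residue_mod)
qed

lemma padic_residue_of_int:
  "padic_residue (of_int t :: 'p :: prime_card padic_int) k = t mod int CARD('p) ^ k"
proof (cases t)
  case (nonneg n)
  then show ?thesis by (simp add: padic_residue_of_nat)
next
  case (neg n)
  then have "of_int t = (- of_nat (Suc n) :: 'p padic_int)" by (simp only: of_int_minus of_int_of_nat_eq)
  then have "padic_residue (of_int t :: 'p padic_int) k = (- (int (Suc n) mod int CARD('p) ^ k)) mod int CARD('p) ^ k"
    by (simp only: uminus_padic_int.rep_eq padic_residue_of_nat)
  then show ?thesis using neg by (simp only: mod_minus_eq)
qed

lemma padic_residue_sum:
  "padic_residue (\<Sum>i\<in>I. f i :: 'p :: prime_card padic_int) k = (\<Sum>i\<in>I. padic_residue (f i) k) mod int CARD('p) ^ k"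
  by (induction I rule: infinite_finite_induct) (simp_all add: padic_residue_simps mod_add_right_eq)

lemma dvd_diff_of_int_residue:
  "of_nat CARD('p) ^ k dvd x - of_int (padic_residue (x :: 'p :: prime_card padic_int) k)"
  by (simp add: padic_residue_eq_iff[symmetric] padic_residue_of_int padic_residue_mod)

text \<open>Residues are locally constant, so every function g of a residue is continuous, whatever
  the topology on its target.\<close>

lemma continuous_on_padic_residue:
  fixes g :: "int \<Rightarrow> 'c :: topological_space"
  shows "continuous_on UNIV (\<lambda>x :: 'p :: prime_card padic_int. g (padic_residue x k))"
proof -
  have "open ((\<lambda>x :: 'p padic_int. g (padic_residue x k)) -` B)" for B :: "'c set"
    unfolding open_padic_int_def by (metis padic_residue_eq_iff vimage_eq)
  then show ?thesis by (simp add: continuous_on_open_vimage)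
qed

lemma borel_measurable_padic_residue [measurable]:
  fixes g :: "int \<Rightarrow> 'c :: topological_space"
  shows "(\<lambda>x :: 'p :: prime_card padic_int. g (padic_residue x k)) \<in> borel_measurable borel"
  by (rule borel_measurable_continuous_onI[OF continuous_on_padic_residue])

text \<open>The values of \<open>chi q (c * x)\<close> separate the residue classes of x modulo p, so
  for an eps-balanced variable at least eps of the mass of these values stays away from any
  fixed point w of the unit circle; w is taken in the direction of the mean.\<close>

lemma norm_expectation_chi_le:
  fixes Y :: "'w \<Rightarrow> 'p :: prime_card padic_int"
  assumes P: "prob_space P" and Y: "Y \<in> measurable P borel" and balanced_entries: "eps_balanced P \<epsilon> Y"
    and k: "q = CARD('p) ^ k" "k > 0" and c: "c mod int q \<noteq> 0" and \<epsilon>: "\<epsilon> > 0"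
    and s: "s > 0" "\<And>t. \<not> int q dvd t \<Longrightarrow> s \<le> norm (chi q t - 1)"
  shows "norm (integral\<^sup>L P (\<lambda>\<omega>. chi q (c * padic_residue (Y \<omega>) k))) \<le> 1 - \<epsilon> * s\<^sup>2 / 8"
proof -
  interpret prob_space P by (rule P)
  have q: "q > 0" using k p_gt_1[where 'p = 'p] by simp
  define Z where "Z = (\<lambda>\<omega>. chi q (c * padic_residue (Y \<omega>) k))"
  have Zm [measurable]: "Z \<in> borel_measurable P"
    unfolding Z_def by (rule measurable_compose[OF Y borel_measurable_padic_residue])
  have nZ: "norm (Z \<omega>) = 1" for \<omega> by (simp add: Z_def)
  have intZ: "integrable P Z" by (rule integrable_const_bound[where B = 1]) (auto simp: nZ)
  define \<mu> where "\<mu> = integral\<^sup>L P Z"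
  define w where "w = (if \<mu> = 0 then 1 else sgn \<mu>)"
  have nw: "norm w = 1" by (simp add: w_def norm_sgn)
  have wmu: "Re (cnj w * \<mu>) = norm \<mu>"
  proof (cases "\<mu> = 0")
    case False
    then have "cnj w * \<mu> = cnj \<mu> * \<mu> / of_real (norm \<mu>)"
      by (simp add: w_def sgn_eq)
    also have "\<dots> = of_real (norm \<mu>)"
      using False by (simp add: complex_norm_square[symmetric] mult.commute power2_eq_square[symmetric])
        (simp add: power2_eq_square)
    finally show ?thesis by simp
  qed simp
  define B where "B = {\<omega> \<in> space P. norm (Z \<omega> - w) < s / 2}"
  have Bm [measurable]: "B \<in> sets P" unfolding B_def by measurable
  have PB: "prob B \<le> 1 - \<epsilon>"
  proof (cases "B = {}")
    case True
    \<comment> \<open>If B is empty the claim is that 1 - \<open>\<epsilon>\<close> is nonnegative,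
      which the balancedness condition at residue 0 yields.\<close>
    have "0 \<le> prob {\<omega> \<in> space P. of_nat CARD('p) dvd Y \<omega> - of_int 0}" by simp
    also have "\<dots> \<le> 1 - \<epsilon>" using balanced_entries unfolding eps_balanced_def by blast
    finally show ?thesis using True by simp
  next
    case False
    then obtain \<omega>0 where o0: "\<omega>0 \<in> B" by blast
    define t where "t = padic_residue (Y \<omega>0) k"
    \<comment> \<open>Two values in B are less than s apart, hence equal, so q divides c * (r - t).
      As q is a power of p not dividing c, the prime p divides r - t: all outcomes in B lie in one
      residue class modulo p.\<close>
    have "B \<subseteq> {\<omega> \<in> space P. of_nat CARD('p) dvd Y \<omega> - of_int t}"
    proof
      fix \<omega> assume o: "\<omega> \<in> B"
      define r where "r = padic_residue (Y \<omega>) k"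
      have "norm (Z \<omega> - Z \<omega>0) \<le> norm (Z \<omega> - w) + norm (Z \<omega>0 - w)"
        using norm_triangle_ineq4[of "Z \<omega> - w" "Z \<omega>0 - w"] by simp
      also have "\<dots> < s" using o o0 by (simp add: B_def)
      finally have lt: "norm (Z \<omega> - Z \<omega>0) < s" .
      have "Z \<omega> - Z \<omega>0 = (chi q (c * r - c * t) - 1) * Z \<omega>0"
        using chi_diff[of q "c * r" "c * t"] by (simp add: Z_def r_def t_def algebra_simps)
      then have "norm (chi q (c * r - c * t) - 1) < s" using lt by (simp add: norm_mult nZ)
      then have "int q dvd c * r - c * t" using s(2) by (meson not_le)
      then have dq: "int CARD('p) ^ k dvd c * (r - t)" by (simp add: k(1) right_diff_distrib)
      have "int CARD('p) dvd r - t"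
      proof (rule ccontr)
        assume "\<not> int CARD('p) dvd r - t"
        then have "coprime (int CARD('p)) (r - t)"
          by (intro prime_imp_coprime) (use prime_card[where 'a = 'p] in auto)
        then have "coprime (int CARD('p) ^ k) (r - t)" by simp
        then have "int CARD('p) ^ k dvd c" using dq coprime_dvd_mult_left_iff by blast
        then show False using c by (simp add: k(1) dvd_eq_mod_eq_0)
      qed
      then obtain d where "r - t = int CARD('p) * d" by auto
      then have "(of_int (r - t) :: 'p padic_int) = of_nat CARD('p) * of_int d" by simp
      then have 1: "of_nat CARD('p) dvd (of_int (r - t) :: 'p padic_int)" by simp
      have "(of_nat CARD('p) :: 'p padic_int) dvd of_nat CARD('p) ^ k" using k(2) by (simp add: dvd_power)
      then have "of_nat CARD('p) dvd Y \<omega> - of_int r"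
        using dvd_diff_of_int_residue[where k = k and x = "Y \<omega>"] dvd_trans unfolding r_def by blast
      then have "of_nat CARD('p) dvd (Y \<omega> - of_int r) + of_int (r - t)" using 1 by (rule dvd_add)
      then show "\<omega> \<in> {\<omega> \<in> space P. of_nat CARD('p) dvd Y \<omega> - of_int t}"
        using o by (simp add: B_def)
    qed
    moreover have "{\<omega> \<in> space P. of_nat CARD('p) dvd Y \<omega> - of_int t} \<in> sets P"
    proof -
      have iff: "of_nat CARD('p) dvd Y \<omega> - of_int t \<longleftrightarrow> padic_residue (Y \<omega>) 1 = t mod int CARD('p)" for \<omega>
        using padic_residue_eq_iff[of "Y \<omega>" 1 "of_int t"]
        by (simp only: padic_residue_of_int power_one_right)
      have "{\<omega> \<in> space P. of_nat CARD('p) dvd Y \<omega> - of_int t} =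
          (\<lambda>\<omega>. of_bool (padic_residue (Y \<omega>) 1 = t mod int CARD('p)) :: real) -` {1} \<inter> space P"
        unfolding iff by (auto simp only: of_bool_eq_1_iff vimage_def mem_Collect_eq singleton_iff Int_iff)
      moreover have "(\<lambda>\<omega>. of_bool (padic_residue (Y \<omega>) 1 = t mod int CARD('p)) :: real) \<in> borel_measurable P"
        by (rule measurable_compose[OF Y borel_measurable_padic_residue])
      ultimately show ?thesis using measurable_sets[of _ P borel "{1::real}"] by simp
    qed
    ultimately have "prob B \<le> prob {\<omega> \<in> space P. of_nat CARD('p) dvd Y \<omega> - of_int t}"
      by (rule finite_measure_mono)
    also have "\<dots> \<le> 1 - \<epsilon>" using balanced_entries unfolding eps_balanced_def by blast
    finally show ?thesis .
  qed
  \<comment> \<open>For two unit vectors the real part of the product is 1 minus half the squared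
    distance. Outside B the distance is at least s / 2, whence the constant 8.\<close>
  have pt: "Re (cnj w * Z \<omega>) \<le> 1 - s\<^sup>2 / 8 * indicator (space P - B) \<omega>" if o: "\<omega> \<in> space P" for \<omega>
  proof -
    have "(norm (Z \<omega> - w))\<^sup>2 = 2 - 2 * Re (cnj w * Z \<omega>)"
    proof -
      have "(norm (Z \<omega> - w))\<^sup>2 = (norm (Z \<omega>))\<^sup>2 + (norm w)\<^sup>2 - 2 * Re (cnj w * Z \<omega>)"
        unfolding cmod_power2 by (simp add: power2_eq_square algebra_simps)
      then show ?thesis by (simp add: nZ nw)
    qed
    moreover have "(norm (Z \<omega> - w))\<^sup>2 \<ge> s\<^sup>2 / 4 * indicator (space P - B) \<omega>"
    proof (cases "\<omega> \<in> B")
      case False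
      then have "norm (Z \<omega> - w) \<ge> s / 2" using o by (simp add: B_def)
      then have "(s / 2)\<^sup>2 \<le> (norm (Z \<omega> - w))\<^sup>2" using s(1) by (intro power_mono) auto
      then show ?thesis using False o by (simp add: power_divide)
    qed simp
    ultimately show ?thesis by (simp add: field_simps)
  qed
  have indI: "integrable P (indicator (space P - B) :: 'w \<Rightarrow> real)"
    by (intro integrable_real_indicator) (auto simp: emeasure_eq_measure)
  have "norm \<mu> = Re (integral\<^sup>L P (\<lambda>\<omega>. cnj w * Z \<omega>))"
    using wmu intZ by (simp add: \<mu>_def)
  also have "\<dots> = integral\<^sup>L P (\<lambda>\<omega>. Re (cnj w * Z \<omega>))"
    using intZ by (intro integral_Re[symmetric]) simp
  also have "\<dots> \<le> integral\<^sup>L P (\<lambda>\<omega>. 1 - s\<^sup>2 / 8 * indicator (space P - B) \<omega>)"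
  proof (rule integral_mono[OF _ _ pt])
    show "integrable P (\<lambda>\<omega>. Re (cnj w * Z \<omega>))"
      by (intro integrable_Re integrable_mult_right) (rule intZ)
    show "integrable P (\<lambda>\<omega>. 1 - s\<^sup>2 / 8 * indicator (space P - B) \<omega>)"
      by (intro Bochner_Integration.integrable_diff integrable_mult_right integrable_const indI)
  qed
  also have "\<dots> = 1 - s\<^sup>2 / 8 * prob (space P - B)"
    using Bochner_Integration.integral_diff[OF integrable_const[of 1] integrable_mult_right[OF indI, of "s\<^sup>2 / 8"]]
    by (simp add: prob_space)
  also have "\<dots> \<le> 1 - s\<^sup>2 / 8 * \<epsilon>"
    using PB by (simp add: prob_compl mult_left_mono)
  finally show ?thesis by (simp add: \<mu>_def Z_def mult.commute)
qed

section \<open>The random matrix and its reduction modulo powers of p\<close>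

lemma inv_GL:
  assumes A: "A \<in> GL n"
  defines "V \<equiv> inv\<^bsub>ring_mat TYPE('p :: prime_card padic_int) n ()\<^esub> A"
  shows "A \<in> carrier_mat n n" "V \<in> carrier_mat n n" "V * A = 1\<^sub>m n" "A * V = 1\<^sub>m n"
proof -
  interpret R: ring "ring_mat TYPE('p padic_int) n ()" by (rule ring_mat)
  have U: "A \<in> Units (ring_mat TYPE('p padic_int) n ())" using A by (simp add: GL_def)
  show "A \<in> carrier_mat n n" using R.Units_closed[OF U] by (simp add: ring_mat_simps)
  show "V \<in> carrier_mat n n" using R.Units_inv_closed[OF U] by (simp add: ring_mat_simps V_def)
  show "V * A = 1\<^sub>m n" using R.Units_l_inv[OF U] by (simp add: ring_mat_simps V_def)
  show "A * V = 1\<^sub>m n" using R.Units_r_inv[OF U] by (simp add: ring_mat_simps V_def)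
qed

text \<open>The span offers coefficients for a set of vectors, whereas f may repeat a vector. One
  index is chosen for each vector used; the remaining indices get coefficient 0.\<close>

lemma submodule_span_coeffs:
  fixes f :: "nat \<Rightarrow> 'p :: prime_card padic_int Matrix.vec"
  assumes x: "x \<in> submodule_span n (f ` J)" and J: "finite J" and f: "\<And>i. i \<in> J \<Longrightarrow> f i \<in> carrier_vec n"
  shows "\<exists>a. \<forall>d<n. x $ d = (\<Sum>l\<in>J. a l * f l $ d)"
proof -
  interpret vec_module "TYPE('p padic_int)" n .
  from x obtain c A where A: "finite A" "A \<subseteq> f ` J" "x = lincomb c A"
    unfolding submodule_span_def span_def by auto
  obtain J' where J': "J' \<subseteq> J" "inj_on f J'" "A = f ` J'"
    using subset_image_inj[THEN iffD1, OF A(2)] by blast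
  have Ac: "A \<subseteq> carrier_vec n" using A(2) f by auto
  have "x $ d = (\<Sum>l\<in>J. (if l \<in> J' then c (f l) else 0) * f l $ d)" if d: "d < n" for d
  proof -
    have "x $ d = (\<Sum>w\<in>A. c w * w $ d)"
    proof -
      have "(\<lambda>w. c w \<cdot>\<^sub>v w) \<in> A \<rightarrow> carrier_vec n" using Ac by auto
      then have "x $ d = (\<Sum>w\<in>A. (c w \<cdot>\<^sub>v w) $ d)"
        unfolding A(3) lincomb_def by (rule finsum_index[OF d _ Ac])
      also have "\<dots> = (\<Sum>w\<in>A. c w * w $ d)" using Ac d by (intro sum.cong refl) auto
      finally show ?thesis .
    qed
    also have "\<dots> = (\<Sum>l\<in>J'. c (f l) * f l $ d)" unfolding J'(3) by (simp add: sum.reindex[OF J'(2)])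
    also have "\<dots> = (\<Sum>l\<in>J. (if l \<in> J' then c (f l) else 0) * f l $ d)"
      using J' J by (intro sum.mono_neutral_cong_left) auto
    finally show ?thesis .
  qed
  then show ?thesis by (intro exI[of _ "\<lambda>l. if l \<in> J' then c (f l) else 0"]) simp
qed

lemma in_span_mod_residueI:
  fixes x :: "'p :: prime_card padic_int Matrix.vec"
  assumes "\<And>d. d < n \<Longrightarrow> x $ d = (\<Sum>l\<in>J. a l * f l $ d)"
  shows "in_span_mod (CARD('p) ^ k) n J (\<lambda>l d. padic_residue (f l $ d) k) (\<lambda>d. padic_residue (x $ d) k)"
  unfolding in_span_mod_def
proof (intro exI[of _ "\<lambda>l. padic_residue (a l) k"] allI impI)
  fix d assume "d < n"
  then have "padic_residue (x $ d) k = (\<Sum>l\<in>J. (padic_residue (a l) k * padic_residue (f l $ d) k) mod int CARD('p) ^ k) mod int CARD('p) ^ k"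
    by (simp add: assms padic_residue_sum times_padic_int.rep_eq)
  then show "[padic_residue (x $ d) k = (\<Sum>l\<in>J. padic_residue (a l) k * padic_residue (f l $ d) k)] (mod int (CARD('p) ^ k))"
    by (simp add: cong_def mod_sum_eq)
qed

lemma in_span_mod_cong:
  assumes "\<And>d. d < n \<Longrightarrow> [z d = z' d] (mod int q)" "in_span_mod q n J w z"
  shows "in_span_mod q n J w z'"
  using assms unfolding in_span_mod_def by (meson cong_sym cong_trans)

lemma unit_vec_residue_cong:
  assumes "d < n" "c < n"
  shows "[padic_residue (unit_vec n c $ d :: 'p :: prime_card padic_int) k = of_bool (c = d)] (mod int (CARD('p) ^ k))"
  using assms by (auto simp: unit_vec_def cong_def padic_residue_simps)

definition col_residue :: "nat \<Rightarrow> 'p :: prime_card padic_int Matrix.mat \<Rightarrow> nat \<Rightarrow> nat \<Rightarrow> int" where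
  "col_residue k R j c = padic_residue (col R j $ c) k"

text \<open>The hypotheses at a single n, so that the limit theorems can be stated uniformly over
  all such matrices.\<close>

locale random_matrix = prob_space P for P :: "'w measure" +
  fixes n u :: nat and M :: "'w \<Rightarrow> 'p :: prime_card padic_int Matrix.mat"
    and A :: "nat \<Rightarrow> 'p padic_int Matrix.mat" and \<epsilon> \<alpha> \<beta> :: real
  assumes n: "n > 0" and eps: "\<epsilon> > 0"
    and M: "\<And>\<omega>. \<omega> \<in> space P \<Longrightarrow> M \<omega> \<in> carrier_mat n (n + u)"
    and indep_cols: "indep_vars (\<lambda>_. \<Pi>\<^sub>M i\<in>{..<n}. borel) (\<lambda>j \<omega>. \<lambda>i\<in>{..<n}. col (M \<omega>) j $ i) {..<n + u}"
    and A: "\<And>j. j < n + u \<Longrightarrow> A j \<in> GL n"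
    and indep_entries: "\<And>j. j < n + u \<Longrightarrow>
      indep_vars (\<lambda>_. borel) (\<lambda>i \<omega>. (A j *\<^sub>v col (M \<omega>) j) $ i) {..<n}"
    and degen: "\<And>j. j < n + u \<Longrightarrow>
      real (card {i \<in> {..<n}. \<not> eps_balanced P \<epsilon> (\<lambda>\<omega>. (A j *\<^sub>v col (M \<omega>) j) $ i)}) \<le> \<alpha> * real n"
    and basis: "\<exists>b. is_basis n b \<and> (\<forall>i<n. real (card {j \<in> {..<n + u}.
       b i \<notin> balanced_locus P \<epsilon> n (A j) (\<lambda>\<omega>. col (M \<omega>) j)}) \<le> \<beta> * real n)"
begin

definition "V j = inv\<^bsub>ring_mat TYPE('p padic_int) n ()\<^esub> (A j)"
definition "entry j i \<omega> = (A j *\<^sub>v col (M \<omega>) j) $ i"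
definition "balanced_entries j = {i \<in> {..<n}. eps_balanced P \<epsilon> (entry j i)}"
definition "V_residue k j i c = padic_residue (V j $$ (c, i)) k"

lemma V:
  assumes "j < n + u"
  shows "A j \<in> carrier_mat n n" "V j \<in> carrier_mat n n" "V j * A j = 1\<^sub>m n" "A j * V j = 1\<^sub>m n"
  using inv_GL[OF A[OF assms]] by (auto simp: V_def)

lemma col_in: "\<omega> \<in> space P \<Longrightarrow> j < n + u \<Longrightarrow> col (M \<omega>) j \<in> carrier_vec n"
  using M[of \<omega>] by auto

lemma V_residue_col: "j < n + u \<Longrightarrow> c < n \<Longrightarrow> i < n \<Longrightarrow> V_residue k j i c = padic_residue (col (V j) i $ c) k"
  using V(2)[of j] by (simp add: V_residue_def)

lemma V_unit: "j < n + u \<Longrightarrow> i < n \<Longrightarrow> V j *\<^sub>v unit_vec n i = col (V j) i"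
  using V(2)[of j] by (intro eq_vecI) auto

lemma col_eq_sum:
  assumes j: "j < n + u" and o: "\<omega> \<in> space P" and c: "c < n"
  shows "col (M \<omega>) j $ c = (\<Sum>i<n. entry j i \<omega> * col (V j) i $ c)"
proof -
  have "col (M \<omega>) j = V j *\<^sub>v (A j *\<^sub>v col (M \<omega>) j)"
    using V[OF j] col_in[OF o j] by (metis assoc_mult_mat_vec one_mult_mat_vec)
  then have "col (M \<omega>) j $ c = (V j *\<^sub>v (A j *\<^sub>v col (M \<omega>) j)) $ c" by simp
  also have "\<dots> = (\<Sum>i<n. V j $$ (c, i) * (A j *\<^sub>v col (M \<omega>) j) $ i)"
    using V[OF j] c by (simp add: scalar_prod_def lessThan_atLeast0)
  also have "\<dots> = (\<Sum>i<n. entry j i \<omega> * col (V j) i $ c)"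
    using V[OF j] c by (intro sum.cong refl) (simp add: entry_def mult.commute)
  finally show ?thesis .
qed

lemma unit_eq_sum:
  assumes j: "j < n + u" and c: "c < n" and d: "d < n"
  shows "unit_vec n c $ d = (\<Sum>i<n. A j $$ (i, c) * col (V j) i $ d)"
proof -
  have "unit_vec n c $ d = (V j * A j) $$ (d, c)" using V(3)[OF j] c d by (simp add: unit_vec_def)
  also have "\<dots> = (\<Sum>i<n. V j $$ (d, i) * A j $$ (i, c))"
    using V(1,2)[OF j] c d by (simp add: scalar_prod_def lessThan_atLeast0)
  also have "\<dots> = (\<Sum>i<n. A j $$ (i, c) * col (V j) i $ d)"
    using V[OF j] d by (intro sum.cong refl) (simp add: mult.commute)
  finally show ?thesis .
qed

lemma span_mod_cols:
  assumes "j < n + u" "J \<subseteq> {..<n}" "in_span_mod q n J (\<lambda>l d. padic_residue (col (V j) l $ d) k) z"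
  shows "in_span_mod q n J (V_residue k j) z"
proof -
  have "(\<Sum>l\<in>J. a l * padic_residue (col (V j) l $ d) k) = (\<Sum>l\<in>J. a l * V_residue k j l d)" if "d < n" for a d
    using assms that by (intro sum.cong refl) (auto simp: V_residue_col subset_eq)
  then show ?thesis using assms(3) unfolding in_span_mod_def by metis
qed

text \<open>Membership in a span survives reduction modulo \<open>p ^ k\<close>. Hence the columns j
  for which b i leaves the reduced span are among those with b i outside W_j, and the bound on their
  number carries over.\<close>

lemma column_structure:
  assumes G: "comm_group G" "finite (carrier G)"
  shows "\<exists>b. column_structure G (CARD('p) ^ k) n (n + u) (V_residue k) balanced_entries b \<alpha> \<beta>"
proof -
  interpret comm_group G by (rule G)
  obtain b where b: "is_basis n b" "\<And>i. i < n \<Longrightarrow> real (card {j \<in> {..<n + u}.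
       b i \<notin> balanced_locus P \<epsilon> n (A j) (\<lambda>\<omega>. col (M \<omega>) j)}) \<le> \<beta> * real n"
    using basis by blast
  have bc: "b i \<in> carrier_vec n" if "i \<in> {..<n}" for i using b(1) that by (auto simp: is_basis_def)
  let ?q = "CARD('p) ^ k"
  let ?b = "\<lambda>i d. padic_residue (b i $ d) k"
  have "column_structure G ?q n (n + u) (V_residue k) balanced_entries ?b \<alpha> \<beta>"
  proof unfold_locales
    show "finite (carrier G)" "0 < n" "n \<le> n + u" by (rule G, rule n, simp)
    show "?q > 0" using p_gt_1[where 'p = 'p] by simp
    fix j c assume j: "j < n + u" and c: "c < n"
    have "in_span_mod ?q n {..<n} (\<lambda>l d. padic_residue (col (V j) l $ d) k)
        (\<lambda>d. padic_residue (unit_vec n c $ d :: 'p padic_int) k)"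
      by (rule in_span_mod_residueI[where a = "\<lambda>i. A j $$ (i, c)"]) (rule unit_eq_sum[OF j c])
    then have "in_span_mod ?q n {..<n} (V_residue k j) (\<lambda>d. padic_residue (unit_vec n c $ d :: 'p padic_int) k)"
      by (rule span_mod_cols[OF j subset_refl])
    then show "in_span_mod ?q n {..<n} (V_residue k j) (\<lambda>d. of_bool (c = d))"
      by (rule in_span_mod_cong[rotated]) (rule unit_vec_residue_cong[OF _ c])
  next
    fix c assume c: "c < n"
    have "unit_vec n c \<in> submodule_span n (b ` {..<n})"
      using b(1) c by (simp add: is_basis_def)
    from submodule_span_coeffs[OF this _ bc] obtain a where
      "\<forall>d<n. unit_vec n c $ d = (\<Sum>l<n. a l * b l $ d)" by auto
    then have "in_span_mod ?q n {..<n} ?b (\<lambda>d. padic_residue (unit_vec n c $ d :: 'p padic_int) k)"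
      by (intro in_span_mod_residueI) auto
    then show "in_span_mod ?q n {..<n} ?b (\<lambda>d. of_bool (c = d))"
      by (rule in_span_mod_cong[rotated]) (rule unit_vec_residue_cong[OF _ c])
  next
    fix j assume j: "j < n + u"
    show "balanced_entries j \<subseteq> {..<n}" by (auto simp: balanced_entries_def)
    have "{..<n} - balanced_entries j = {i \<in> {..<n}. \<not> eps_balanced P \<epsilon> (\<lambda>\<omega>. (A j *\<^sub>v col (M \<omega>) j) $ i)}"
      by (auto simp: balanced_entries_def entry_def[abs_def])
    then show "real (card ({..<n} - balanced_entries j)) \<le> \<alpha> * real n" using degen[OF j] by simp
  next
    fix i assume i: "i < n"
    have "{j. j < n + u \<and> \<not> in_span_mod ?q n (balanced_entries j) (V_residue k j) (?b i)}
        \<subseteq> {j \<in> {..<n + u}. b i \<notin> balanced_locus P \<epsilon> n (A j) (\<lambda>\<omega>. col (M \<omega>) j)}"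
    proof
      fix j assume jj: "j \<in> {j. j < n + u \<and> \<not> in_span_mod ?q n (balanced_entries j) (V_residue k j) (?b i)}"
      then have j: "j < n + u" by simp
      have "b i \<notin> balanced_locus P \<epsilon> n (A j) (\<lambda>\<omega>. col (M \<omega>) j)"
      proof
        assume "b i \<in> balanced_locus P \<epsilon> n (A j) (\<lambda>\<omega>. col (M \<omega>) j)"
        moreover have "{inv\<^bsub>ring_mat TYPE('p padic_int) n ()\<^esub> A j *\<^sub>v unit_vec n i | i.
           i < n \<and> eps_balanced P \<epsilon> (\<lambda>\<omega>. (A j *\<^sub>v col (M \<omega>) j) $ i)} = (\<lambda>i. col (V j) i) ` balanced_entries j"
        proof -
          have "{inv\<^bsub>ring_mat TYPE('p padic_int) n ()\<^esub> A j *\<^sub>v unit_vec n i | i.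
             i < n \<and> eps_balanced P \<epsilon> (\<lambda>\<omega>. (A j *\<^sub>v col (M \<omega>) j) $ i)}
             = (\<lambda>i. V j *\<^sub>v unit_vec n i) ` balanced_entries j"
            by (auto simp: balanced_entries_def V_def entry_def[abs_def])
          also have "\<dots> = (\<lambda>i. col (V j) i) ` balanced_entries j"
            by (rule image_cong[OF refl]) (simp add: V_unit[OF j] balanced_entries_def)
          finally show ?thesis .
        qed
        ultimately have "b i \<in> submodule_span n ((\<lambda>i. col (V j) i) ` balanced_entries j)"
          unfolding balanced_locus_def by simp
        moreover have "finite (balanced_entries j)" by (simp add: balanced_entries_def)
        moreover have "col (V j) i \<in> carrier_vec n" if "i \<in> balanced_entries j" for i
          using V(2)[OF j] that by (auto simp: balanced_entries_def)
        ultimately obtain a where "\<forall>d<n. b i $ d = (\<Sum>l\<in>balanced_entries j. a l * col (V j) l $ d)"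
          using submodule_span_coeffs by blast
        then have "in_span_mod ?q n (balanced_entries j) (\<lambda>l d. padic_residue (col (V j) l $ d) k) (?b i)"
          by (intro in_span_mod_residueI) auto
        then have "in_span_mod ?q n (balanced_entries j) (V_residue k j) (?b i)"
          by (rule span_mod_cols[OF j, rotated]) (auto simp: balanced_entries_def)
        then show False using jj by simp
      qed
      then show "j \<in> {j \<in> {..<n + u}. b i \<notin> balanced_locus P \<epsilon> n (A j) (\<lambda>\<omega>. col (M \<omega>) j)}"
        using j by simp
    qed
    then have "card {j. j < n + u \<and> \<not> in_span_mod ?q n (balanced_entries j) (V_residue k j) (?b i)}
        \<le> card {j \<in> {..<n + u}. b i \<notin> balanced_locus P \<epsilon> n (A j) (\<lambda>\<omega>. col (M \<omega>) j)}"
      by (rule card_mono[rotated]) simp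
    then show "real (card {j. j < n + u \<and> \<not> in_span_mod ?q n (balanced_entries j) (V_residue k j) (?b i)}) \<le> \<beta> * real n"
      using b(2)[OF i] by linarith
  qed
  then show ?thesis by blast
qed

text \<open>Column j is the combination of the columns of the inverse of A_j whose coefficients are
  its independent entries. The pairing thus becomes a sum of independent terms, one for each
  entry.\<close>

lemma pairing_col:
  assumes j: "j < n + u" and o: "\<omega> \<in> space P"
  shows "pairing (CARD('p) ^ k) n F (col_residue k (M \<omega>) j) g
    = (\<Sum>i<n. pairing (CARD('p) ^ k) n F (V_residue k j i) g * padic_residue (entry j i \<omega>) k) mod int (CARD('p) ^ k)"
proof -
  let ?q = "int (CARD('p) ^ k)"
  have c: "[col_residue k (M \<omega>) j c = (\<Sum>i<n. padic_residue (entry j i \<omega>) k * V_residue k j i c)] (mod ?q)" if "c < n" for c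
    using col_eq_sum[OF j o that] V_residue_col[OF j that]
    by (simp add: cong_def col_residue_def padic_residue_sum times_padic_int.rep_eq mod_sum_eq)
  have "[(\<Sum>c<n. F c g * col_residue k (M \<omega>) j c)
      = (\<Sum>c<n. F c g * (\<Sum>i<n. padic_residue (entry j i \<omega>) k * V_residue k j i c))] (mod ?q)"
    by (intro cong_sum cong_mult cong_refl c) simp
  also have "(\<Sum>c<n. F c g * (\<Sum>i<n. padic_residue (entry j i \<omega>) k * V_residue k j i c))
      = (\<Sum>i<n. (\<Sum>c<n. F c g * V_residue k j i c) * padic_residue (entry j i \<omega>) k)"
    unfolding sum_distrib_left sum_distrib_right by (subst sum.swap) (simp add: ac_simps)
  also have "[\<dots> = (\<Sum>i<n. pairing (CARD('p) ^ k) n F (V_residue k j i) g * padic_residue (entry j i \<omega>) k)] (mod ?q)"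
    by (intro cong_sum cong_mult cong_refl) (simp add: pairing_def cong_def)
  finally show ?thesis by (simp add: cong_def pairing_def)
qed

definition "kills k G F j = {\<omega> \<in> space P. \<forall>g\<in>carrier G.
   pairing (CARD('p) ^ k) n F (col_residue k (M \<omega>) j) g = 0}"

definition "char_mean k F j g = integral\<^sup>L P (\<lambda>\<omega>.
   chi (CARD('p) ^ k) (pairing (CARD('p) ^ k) n F (col_residue k (M \<omega>) j) g))"

lemma random_variable_entry: "j < n + u \<Longrightarrow> i < n \<Longrightarrow> entry j i \<in> measurable P borel"
  using indep_entries[of j] unfolding indep_vars_def entry_def[abs_def] by auto

lemma chi_pairing_col:
  assumes "j < n + u" "\<omega> \<in> space P"
  shows "chi (CARD('p) ^ k) (pairing (CARD('p) ^ k) n F (col_residue k (M \<omega>) j) g) =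
    (\<Prod>i<n. chi (CARD('p) ^ k) (pairing (CARD('p) ^ k) n F (V_residue k j i) g * padic_residue (entry j i \<omega>) k))"
proof -
  have q: "CARD('p) ^ k > 0" using p_gt_1[where 'p = 'p] by simp
  show ?thesis by (simp only: pairing_col[OF assms] chi_mod[OF q] chi_sum)
qed

lemma char_mean_prod:
  assumes j: "j < n + u"
  shows "char_mean k F j g = (\<Prod>i<n. integral\<^sup>L P (\<lambda>\<omega>.
     chi (CARD('p) ^ k) (pairing (CARD('p) ^ k) n F (V_residue k j i) g * padic_residue (entry j i \<omega>) k)))"
proof -
  let ?q = "CARD('p) ^ k"
  have q: "?q > 0" using p_gt_1[where 'p = 'p] by simp
  define h where "h = (\<lambda>i y. chi ?q (pairing ?q n F (V_residue k j i) g * padic_residue (y :: 'p padic_int) k))"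
  have hm: "h i \<in> measurable borel borel" for i
    unfolding h_def by (rule borel_measurable_padic_residue)
  have ind: "indep_vars (\<lambda>_. borel) (\<lambda>i \<omega>. h i (entry j i \<omega>)) {..<n}"
    using indep_vars_compose2[OF indep_entries[OF j, folded entry_def[abs_def]], of h "\<lambda>_. borel"] hm
    unfolding entry_def[abs_def] by blast
  have "char_mean k F j g = integral\<^sup>L P (\<lambda>\<omega>. \<Prod>i<n. h i (entry j i \<omega>))"
    unfolding char_mean_def
    by (intro Bochner_Integration.integral_cong refl)
      (simp add: chi_pairing_col[OF j] h_def)
  also have "\<dots> = (\<Prod>i<n. integral\<^sup>L P (\<lambda>\<omega>. h i (entry j i \<omega>)))"
  proof (rule indep_vars_lebesgue_integral[OF _ ind])
    fix i assume i: "i \<in> {..<n}"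
    have "(\<lambda>\<omega>. h i (entry j i \<omega>)) \<in> borel_measurable P"
      using i by (intro measurable_compose[OF random_variable_entry[OF j] hm]) auto
    then show "integrable P (\<lambda>\<omega>. h i (entry j i \<omega>))"
      by (intro integrable_const_bound[where B = 1]) (auto simp: h_def)
  qed simp
  finally show ?thesis by (simp add: h_def)
qed

text \<open>By independence the mean is a product over the entries. A balanced entry with nonzero
  coefficient gives a factor of norm at most \<open>\<rho>\<close>, every other entry one of norm at
  most 1.\<close>

lemma norm_char_mean_le:
  assumes j: "j < n + u" and k: "k > 0"
    and s: "s > 0" "\<And>t. \<not> int (CARD('p) ^ k) dvd t \<Longrightarrow> s \<le> norm (chi (CARD('p) ^ k) t - 1)"
    and rho: "1 - \<epsilon> * s\<^sup>2 / 8 \<le> \<rho>" "0 < \<rho>" "\<rho> < 1"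
  shows "norm (char_mean k F j g) \<le> \<rho> ^ card {i \<in> balanced_entries j. pairing (CARD('p) ^ k) n F (V_residue k j i) g \<noteq> 0}"
proof -
  let ?q = "CARD('p) ^ k"
  define T where "T = {i \<in> balanced_entries j. pairing ?q n F (V_residue k j i) g \<noteq> 0}"
  have T: "T \<subseteq> {..<n}" by (auto simp: T_def balanced_entries_def)
  define h where "h = (\<lambda>i \<omega>. chi ?q (pairing ?q n F (V_residue k j i) g * padic_residue (entry j i \<omega>) k))"
  have le1: "norm (integral\<^sup>L P (h i)) \<le> 1" if i: "i < n" for i
  proof -
    have "norm (integral\<^sup>L P (h i)) \<le> integral\<^sup>L P (\<lambda>\<omega>. norm (h i \<omega>))" by (rule integral_norm_bound)
    then show ?thesis by (simp add: h_def prob_space)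
  qed
  have "norm (char_mean k F j g) = (\<Prod>i<n. norm (integral\<^sup>L P (h i)))"
    unfolding char_mean_prod[OF j] h_def by (simp add: prod_norm)
  also have "\<dots> \<le> (\<Prod>i<n. if i \<in> T then \<rho> else 1)"
  proof (intro prod_mono conjI norm_ge_zero)
    fix i assume i: "i \<in> {..<n}"
    show "norm (integral\<^sup>L P (h i)) \<le> (if i \<in> T then \<rho> else 1)"
    proof (cases "i \<in> T")
      case True
      have "norm (integral\<^sup>L P (h i)) \<le> 1 - \<epsilon> * s\<^sup>2 / 8"
        unfolding h_def
      proof (rule norm_expectation_chi_le[OF prob_space_axioms random_variable_entry[OF j] _ refl k _ eps s])
        show "eps_balanced P \<epsilon> (entry j i)" using True by (simp add: T_def balanced_entries_def)
        show "pairing ?q n F (V_residue k j i) g mod int ?q \<noteq> 0" using True by (simp add: T_def pairing_def)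
      qed (use i in auto)
      then show ?thesis using True rho by simp
    qed (use le1 i in auto)
  qed
  also have "\<dots> = \<rho> ^ card T" using T by (simp add: prod.If_cases Int_absorb1)
  finally show ?thesis by (simp add: T_def)
qed

text \<open>The event is a finite union of cylinder sets, one for each admissible residue vector r.
  Since f depends on the first n coordinates only, the restricted vector r may replace the full
  one.\<close>

lemma col_measurable:
  fixes f :: "(nat \<Rightarrow> int) \<Rightarrow> bool"
  assumes "\<And>x y. (\<And>c. c < n \<Longrightarrow> x c = y c) \<Longrightarrow> f x = f y"
  shows "{z \<in> space (\<Pi>\<^sub>M i\<in>{..<n}. borel). f (\<lambda>c. padic_residue (z c :: 'p padic_int) k)}
     \<in> sets (\<Pi>\<^sub>M i\<in>{..<n}. borel)"
proof -
  let ?N = "\<Pi>\<^sub>M i\<in>{..<n}. (borel :: 'p padic_int measure)"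
  define R where "R = ({..<n} \<rightarrow>\<^sub>E {0..<int CARD('p) ^ k})"
  have "finite R" unfolding R_def by (intro finite_PiE) auto
  have "{z \<in> space ?N. f (\<lambda>c. padic_residue (z c) k)} =
      (\<Union>r\<in>{r \<in> R. f r}. {z \<in> space ?N. \<forall>c\<in>{..<n}. padic_residue (z c) k = r c})"
  proof (rule Set.set_eqI, rule iffI)
    fix z assume z: "z \<in> {z \<in> space ?N. f (\<lambda>c. padic_residue (z c) k)}"
    define r where "r = (\<lambda>c\<in>{..<n}. padic_residue (z c) k)"
    have "r \<in> R" unfolding r_def R_def by (intro restrict_PiE_iff[THEN iffD2] ballI padic_residue_range)
    moreover have "f r = f (\<lambda>c. padic_residue (z c) k)" by (rule assms) (simp add: r_def)
    ultimately show "z \<in> (\<Union>r\<in>{r \<in> R. f r}. {z \<in> space ?N. \<forall>c\<in>{..<n}. padic_residue (z c) k = r c})"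
      using z by (intro UN_I[of r]) (auto simp: r_def)
  next
    fix z assume "z \<in> (\<Union>r\<in>{r \<in> R. f r}. {z \<in> space ?N. \<forall>c\<in>{..<n}. padic_residue (z c) k = r c})"
    then obtain r where r: "f r" "z \<in> space ?N" "\<forall>c\<in>{..<n}. padic_residue (z c) k = r c" by auto
    moreover have "f r = f (\<lambda>c. padic_residue (z c) k)" by (rule assms) (use r in simp)
    ultimately show "z \<in> {z \<in> space ?N. f (\<lambda>c. padic_residue (z c) k)}" by simp
  qed
  moreover have "{z \<in> space ?N. \<forall>c\<in>{..<n}. padic_residue (z c) k = r c} \<in> sets ?N" for r
  proof -
    have "Measurable.pred ?N (\<lambda>z. padic_residue (z c) k = r c)" if c: "c \<in> {..<n}" for c
    proof -
      have "(\<lambda>z. of_bool (padic_residue (z c) k = r c) :: real) \<in> borel_measurable ?N"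
        by (rule measurable_compose[OF measurable_component_singleton[OF c] borel_measurable_padic_residue])
      then have "(\<lambda>z. of_bool (padic_residue (z c) k = r c) :: real) -` {1} \<inter> space ?N \<in> sets ?N"
        by (rule measurable_sets) simp
      also have "(\<lambda>z. of_bool (padic_residue (z c) k = r c) :: real) -` {1} \<inter> space ?N
          = {z \<in> space ?N. padic_residue (z c) k = r c}" by auto
      finally show ?thesis by (simp add: pred_def)
    qed
    then show ?thesis by (intro sets.sets_Collect_finite_All) (auto simp: pred_def)
  qed
  ultimately show ?thesis using \<open>finite R\<close> by (simp add: sets.finite_UN)
qed

lemma pairing_local:
  assumes "\<And>c. c < n \<Longrightarrow> x c = y c"
  shows "pairing q n F x g = pairing q n F y g"
  using assms by (simp add: pairing_def)

lemma prob_kills_all: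
  shows "prob {\<omega> \<in> space P. \<forall>j<n + u. \<omega> \<in> kills k G F j} = (\<Prod>j<n + u. prob (kills k G F j))"
    and kills_sets: "\<And>j. j < n + u \<Longrightarrow> kills k G F j \<in> events"
proof -
  let ?N = "\<Pi>\<^sub>M i\<in>{..<n}. (borel :: 'p padic_int measure)"
  let ?X = "\<lambda>j \<omega>. \<lambda>i\<in>{..<n}. col (M \<omega>) j $ i"
  define B where "B = {z \<in> space ?N. \<forall>g\<in>carrier G.
    pairing (CARD('p) ^ k) n F (\<lambda>c. padic_residue (z c) k) g = 0}"
  have B: "B \<in> sets ?N"
    unfolding B_def
  proof (rule col_measurable[where f = "\<lambda>x. \<forall>g\<in>carrier G. pairing (CARD('p) ^ k) n F x g = 0"])
    fix x y :: "nat \<Rightarrow> int" assume "\<And>c. c < n \<Longrightarrow> x c = y c"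
    then have "pairing (CARD('p) ^ k) n F x g = pairing (CARD('p) ^ k) n F y g" for g by (rule pairing_local)
    then show "(\<forall>g\<in>carrier G. pairing (CARD('p) ^ k) n F x g = 0) = (\<forall>g\<in>carrier G. pairing (CARD('p) ^ k) n F y g = 0)"
      by simp
  qed
  have eq: "?X j -` B \<inter> space P = kills k G F j" for j
  proof -
    have "pairing (CARD('p) ^ k) n F (\<lambda>c. padic_residue (?X j \<omega> c) k) g
        = pairing (CARD('p) ^ k) n F (col_residue k (M \<omega>) j) g" for \<omega> g
      by (rule pairing_local) (simp add: col_residue_def)
    moreover have "?X j \<omega> \<in> space ?N" for \<omega> by (auto simp: space_PiM)
    ultimately show ?thesis unfolding B_def kills_def by auto
  qed
  have "prob (\<Inter>j\<in>{..<n + u}. ?X j -` B \<inter> space P) = (\<Prod>j\<in>{..<n + u}. prob (?X j -` B \<inter> space P))"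
    using n B by (intro indep_varsD_finite[OF indep_cols]) auto
  moreover have "(\<Inter>j\<in>{..<n + u}. kills k G F j) = {\<omega> \<in> space P. \<forall>j<n + u. \<omega> \<in> kills k G F j}"
    using n by (auto simp: kills_def)
  ultimately show "prob {\<omega> \<in> space P. \<forall>j<n + u. \<omega> \<in> kills k G F j} = (\<Prod>j<n + u. prob (kills k G F j))"
    unfolding eq by simp
  show "kills k G F j \<in> events" if j: "j < n + u" for j
  proof -
    have "?X j \<in> measurable P ?N" using indep_cols j unfolding indep_vars_def by auto
    from measurable_sets[OF this B] show ?thesis unfolding eq .
  qed
qed

text \<open>By orthogonality, summing the characters over g gives card G times the indicator that F
  kills the column; expectations turn this into \<open>a_sum\<close>. Hence the factor card G in
  front of the probability.\<close>

lemma column_data: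
  fixes G :: "('d, 'e) monoid_scheme"
  assumes G: "comm_group G" "finite (carrier G)" and k: "k > 0"
    and s: "s > 0" "\<And>t. \<not> int (CARD('p) ^ k) dvd t \<Longrightarrow> s \<le> norm (chi (CARD('p) ^ k) t - 1)"
    and rho: "1 - \<epsilon> * s\<^sup>2 / 8 \<le> \<rho>" "0 < \<rho>" "\<rho> < 1"
  shows "\<exists>b. column_data G (CARD('p) ^ k) n (n + u) (V_residue k) balanced_entries b \<alpha> \<beta> \<rho>
     (\<lambda>j F. real (card (carrier G)) * prob (kills k G F j)) (\<lambda>j F g. char_mean k F j g)"
proof -
  let ?q = "CARD('p) ^ k"
  have q: "?q > 0" using p_gt_1[where 'p = 'p] by simp
  obtain b where b: "column_structure G ?q n (n + u) (V_residue k) balanced_entries b \<alpha> \<beta>"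
    using column_structure[OF G] by blast
  interpret C: column_structure G ?q n "n + u" "V_residue k" balanced_entries b \<alpha> \<beta> by (rule b)
  interpret comm_group G by (rule G)
  have "column_data G ?q n (n + u) (V_residue k) balanced_entries b \<alpha> \<beta> \<rho>
     (\<lambda>j F. real (card (carrier G)) * prob (kills k G F j)) (\<lambda>j F g. char_mean k F j g)"
  proof (unfold_locales)
    show "0 < \<rho>" "\<rho> < 1" by (fact rho)+
    show "0 \<le> real (card (carrier G)) * prob (kills k G F j)" for F j by simp
    fix j and F :: "nat \<Rightarrow> 'd \<Rightarrow> int" assume j: "j < n + u" and F: "F \<in> C.Fs"
    let ?x = "\<lambda>\<omega>. col_residue k (M \<omega>) j"
    have chim: "(\<lambda>\<omega>. chi ?q (pairing ?q n F (?x \<omega>) g)) \<in> borel_measurable P" for g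
    proof -
      have Ym: "(\<lambda>\<omega>. chi ?q (pairing ?q n F (V_residue k j i) g * padic_residue (entry j i \<omega>) k)) \<in> borel_measurable P"
        if "i \<in> {..<n}" for i
        using that by (intro measurable_compose[OF random_variable_entry[OF j] borel_measurable_padic_residue]) auto
      have "(\<lambda>\<omega>. \<Prod>i<n. chi ?q (pairing ?q n F (V_residue k j i) g * padic_residue (entry j i \<omega>) k)) \<in> borel_measurable P"
        by (intro borel_measurable_prod Ym)
      then show ?thesis
        by (rule measurable_cong[THEN iffD1, rotated]) (simp add: chi_pairing_col[OF j])
    qed
    have int: "integrable P (\<lambda>\<omega>. chi ?q (pairing ?q n F (?x \<omega>) g))" for g
      by (rule integrable_const_bound[where B = 1]) (auto simp: chim)
    have "(\<Sum>g\<in>carrier G. char_mean k F j g)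
        = integral\<^sup>L P (\<lambda>\<omega>. \<Sum>g\<in>carrier G. chi ?q (pairing ?q n F (?x \<omega>) g))"
      unfolding char_mean_def by (subst Bochner_Integration.integral_sum) (auto intro: int)
    also have "\<dots> = integral\<^sup>L P (\<lambda>\<omega>. complex_of_real (real (card (carrier G)) * indicator (kills k G F j) \<omega>))"
    proof (rule Bochner_Integration.integral_cong[OF refl])
      fix \<omega> assume o: "\<omega> \<in> space P"
      have "(\<Sum>g\<in>carrier G. chi ?q (pairing ?q n F (?x \<omega>) g)) = of_nat (card (carrier G)) *
          of_bool (\<forall>g\<in>carrier G. pairing ?q n F (?x \<omega>) g = 0)"
      proof (rule C.chi_orthogonality[OF G(2) q])
        show "pairing ?q n F (?x \<omega>) (x \<otimes>\<^bsub>G\<^esub> y) = (pairing ?q n F (?x \<omega>) x + pairing ?q n F (?x \<omega>) y) mod int ?q"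
          if "x \<in> carrier G" "y \<in> carrier G" for x y
          by (rule C.pairing_mult[OF C.FsD[OF F] that])
      qed (use q in \<open>auto simp: pairing_def\<close>)
      then show "(\<Sum>g\<in>carrier G. chi ?q (pairing ?q n F (?x \<omega>) g))
          = complex_of_real (real (card (carrier G)) * indicator (kills k G F j) \<omega>)"
        using o by (simp add: kills_def indicator_def)
    qed
    also have "\<dots> = complex_of_real (real (card (carrier G)) * prob (kills k G F j))"
      using kills_sets[OF j, of k G F] by simp
    finally show "complex_of_real (real (card (carrier G)) * prob (kills k G F j))
        = (\<Sum>g\<in>carrier G. char_mean k F j g)" by simp
    show "norm (char_mean k F j g) \<le> \<rho> ^ C.wt j F g" if "g \<in> carrier G" for g
      unfolding C.wt_def by (rule norm_char_mean_le[OF j k s rho])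
    show "char_mean k F j g = 1" if "g \<in> C.Ann F" for g
    proof -
      have "pairing ?q n F z g = 0" for z using that by (simp add: C.Ann_def pairing_def)
      then show ?thesis by (simp add: char_mean_def prob_space)
    qed
  qed
  then show ?thesis by blast
qed

end

text \<open>Division of \<open>column_limit\<close> by \<open>card G ^ (n + u)\<close> turns the
  products into probabilities. The right-hand side there has only the exponent n, so
  \<open>\<kappa>\<close> remains an upper bound.\<close>

theorem random_matrix_limit:
  fixes G :: "('a, 'b) monoid_scheme" and \<epsilon> \<alpha> \<beta> \<kappa> :: real and u k :: nat
  assumes G: "comm_group G" "finite (carrier G)" and k: "k > 0" and \<epsilon>: "\<epsilon> > 0"
    and ab: "0 \<le> \<alpha>" "0 \<le> \<beta>" "\<alpha> + \<beta> < 1" and \<kappa>: "\<kappa> > 0"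
  shows "\<exists>n0. \<forall>n\<ge>n0. \<forall>(P :: 'w measure) (M :: 'w \<Rightarrow> 'p :: prime_card padic_int Matrix.mat) A.
     random_matrix P n u M A \<epsilon> \<alpha> \<beta> \<longrightarrow>
     (\<Sum>F\<in>{..<n} \<rightarrow>\<^sub>E mod_homs G (CARD('p) ^ k).
        \<bar>measure P {\<omega> \<in> space P. \<forall>j<n + u. \<forall>g\<in>carrier G.
             pairing (CARD('p) ^ k) n F (col_residue k (M \<omega>) j) g = 0}
         - (real (card {g \<in> carrier G. \<forall>c<n. F c g = 0}) / real (card (carrier G))) ^ (n + u)\<bar>) \<le> \<kappa>"
proof -
  let ?q = "CARD('p) ^ k"
  interpret comm_group G by (rule G(1))
  have q: "?q > 0" using p_gt_1[where 'p = 'p] by simp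
  define N where "N = real (card (carrier G))"
  have N: "N \<ge> 1" unfolding N_def using G(2) by (metis One_nat_def Suc_leI card_gt_0_iff emptyE of_nat_1 of_nat_le_iff one_closed)
  obtain s where s: "s > 0" "s \<le> 2" "\<And>t. \<not> int ?q dvd t \<Longrightarrow> s \<le> norm (chi ?q t - 1)"
    using chi_gap[OF q] by blast
  \<comment> \<open>The maximum with 1 / 2 keeps \<open>\<rho>\<close> positive, as no upper bound
    on \<open>\<epsilon>\<close> is assumed.\<close>
  define \<rho> where "\<rho> = max (1 / 2) (1 - \<epsilon> * s\<^sup>2 / 8)"
  have rho: "1 - \<epsilon> * s\<^sup>2 / 8 \<le> \<rho>" "0 < \<rho>" "\<rho> < 1"
    using \<epsilon> s by (auto simp: \<rho>_def less_max_iff_disj)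
  from column_limit[OF G rho(2,3) ab \<kappa>, of u] obtain n0 where n0: "\<forall>n\<ge>n0. \<forall>q v I b a e.
     column_data G q n (n + u) v I b \<alpha> \<beta> \<rho> a e \<longrightarrow>
     (\<Sum>F\<in>{..<n} \<rightarrow>\<^sub>E mod_homs G q.
        \<bar>(\<Prod>j<n + u. a j F) - real (card {g \<in> carrier G. \<forall>c<n. F c g = 0}) ^ (n + u)\<bar>)
     \<le> \<kappa> * N ^ n" unfolding N_def ..
  show ?thesis
  proof (intro exI[of _ n0] allI impI)
    fix n and P :: "'w measure" and M :: "'w \<Rightarrow> 'p padic_int Matrix.mat" and A
    assume nn: "n \<ge> n0" and R: "random_matrix P n u M A \<epsilon> \<alpha> \<beta>"
    interpret random_matrix P n u M A \<epsilon> \<alpha> \<beta> by (rule R)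
    define pr where "pr = (\<lambda>F. measure P {\<omega> \<in> space P. \<forall>j<n + u. \<forall>g\<in>carrier G.
             pairing ?q n F (col_residue k (M \<omega>) j) g = 0})"
    have pr: "pr F = (\<Prod>j<n + u. prob (kills k G F j))" for F
    proof -
      have "{\<omega> \<in> space P. \<forall>j<n + u. \<forall>g\<in>carrier G. pairing ?q n F (col_residue k (M \<omega>) j) g = 0}
          = {\<omega> \<in> space P. \<forall>j<n + u. \<omega> \<in> kills k G F j}" by (auto simp: kills_def)
      then show ?thesis unfolding pr_def using prob_kills_all[where k = k and G = G and F = F] by simp
    qed
    obtain b where cd: "column_data G ?q n (n + u) (V_residue k) balanced_entries b \<alpha> \<beta> \<rho>
        (\<lambda>j F. real (card (carrier G)) * prob (kills k G F j)) (\<lambda>j F g. char_mean k F j g)"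
      using column_data[OF G k s(1,3) rho] by blast
    have "(\<Sum>F\<in>{..<n} \<rightarrow>\<^sub>E mod_homs G ?q.
        \<bar>(\<Prod>j<n + u. N * prob (kills k G F j)) - real (card {g \<in> carrier G. \<forall>c<n. F c g = 0}) ^ (n + u)\<bar>)
     \<le> \<kappa> * N ^ n" unfolding N_def by (rule n0[rule_format, OF nn cd, unfolded N_def])
    also have "(\<lambda>F. \<bar>(\<Prod>j<n + u. N * prob (kills k G F j)) - real (card {g \<in> carrier G. \<forall>c<n. F c g = 0}) ^ (n + u)\<bar>)
        = (\<lambda>F. N ^ (n + u) * \<bar>pr F - (real (card {g \<in> carrier G. \<forall>c<n. F c g = 0}) / N) ^ (n + u)\<bar>)"
    proof
      fix F
      have "(\<Prod>j<n + u. N * prob (kills k G F j)) - real (card {g \<in> carrier G. \<forall>c<n. F c g = 0}) ^ (n + u)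
         = N ^ (n + u) * (pr F - (real (card {g \<in> carrier G. \<forall>c<n. F c g = 0}) / N) ^ (n + u))"
        using N by (simp add: pr prod.distrib right_diff_distrib power_divide)
      then show "\<bar>(\<Prod>j<n + u. N * prob (kills k G F j)) - real (card {g \<in> carrier G. \<forall>c<n. F c g = 0}) ^ (n + u)\<bar>
        = N ^ (n + u) * \<bar>pr F - (real (card {g \<in> carrier G. \<forall>c<n. F c g = 0}) / N) ^ (n + u)\<bar>"
        using N by (simp add: abs_mult)
    qed
    finally have *: "N ^ (n + u) * (\<Sum>F\<in>{..<n} \<rightarrow>\<^sub>E mod_homs G ?q.
        \<bar>pr F - (real (card {g \<in> carrier G. \<forall>c<n. F c g = 0}) / N) ^ (n + u)\<bar>) \<le> \<kappa> * N ^ n"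
      by (simp add: sum_distrib_left)
    also have "\<kappa> * N ^ n \<le> \<kappa> * N ^ (n + u)"
      using \<kappa> N by (intro mult_left_mono power_increasing) auto
    finally have "N ^ (n + u) * (\<Sum>F\<in>{..<n} \<rightarrow>\<^sub>E mod_homs G ?q.
        \<bar>pr F - (real (card {g \<in> carrier G. \<forall>c<n. F c g = 0}) / N) ^ (n + u)\<bar>) \<le> N ^ (n + u) * \<kappa>"
      by (simp add: mult.commute)
    then show "(\<Sum>F\<in>{..<n} \<rightarrow>\<^sub>E mod_homs G ?q.
        \<bar>measure P {\<omega> \<in> space P. \<forall>j<n + u. \<forall>g\<in>carrier G.
             pairing ?q n F (col_residue k (M \<omega>) j) g = 0}
         - (real (card {g \<in> carrier G. \<forall>c<n. F c g = 0}) / real (card (carrier G))) ^ (n + u)\<bar>) \<le> \<kappa>"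
      unfolding pr_def N_def[symmetric] using N by (subst (asm) mult_le_cancel_left_pos) auto
  qed
qed

section \<open>Duality modulo q\<close>

text \<open>The group (Z/q)^n, serving both as the space of row vectors and, with r in place of n,
  as the group G of the preceding sections.\<close>

definition zvec :: "nat \<Rightarrow> nat \<Rightarrow> (nat \<Rightarrow> int) monoid" where
  "zvec q n = product_group {..<n} (\<lambda>_. integer_mod_group q)"

definition dot :: "nat \<Rightarrow> nat \<Rightarrow> (nat \<Rightarrow> int) \<Rightarrow> (nat \<Rightarrow> int) \<Rightarrow> int" where
  "dot q n x y = (\<Sum>i<n. x i * y i) mod int q"

definition perp :: "nat \<Rightarrow> nat \<Rightarrow> (nat \<Rightarrow> int) set \<Rightarrow> (nat \<Rightarrow> int) set" where
  "perp q n K = {y \<in> carrier (zvec q n). \<forall>x\<in>K. dot q n x y = 0}"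

lemma carrier_zvec: "q > 0 \<Longrightarrow> carrier (zvec q n) = {..<n} \<rightarrow>\<^sub>E {0..<int q}"
  by (simp add: zvec_def carrier_integer_mod_group)

lemma mult_zvec: "x \<otimes>\<^bsub>zvec q n\<^esub> y = (\<lambda>i\<in>{..<n}. (x i + y i) mod int q)"
  by (simp add: zvec_def)

lemma one_zvec: "\<one>\<^bsub>zvec q n\<^esub> = (\<lambda>i\<in>{..<n}. 0)"
  by (simp add: zvec_def)

lemma comm_group_zvec: "comm_group (zvec q n)"
proof -
  have "group (zvec q n)" unfolding zvec_def by (rule product_group) simp
  then show ?thesis
    by (rule group.group_comm_groupI) (simp add: mult_zvec add.commute)
qed

lemma finite_zvec: "q > 0 \<Longrightarrow> finite (carrier (zvec q n))"
  by (simp add: carrier_zvec finite_PiE)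

lemma card_zvec: "q > 0 \<Longrightarrow> card (carrier (zvec q n)) = q ^ n"
  by (simp add: carrier_zvec card_PiE)

lemma pow_zvec: "q > 0 \<Longrightarrow> x \<in> carrier (zvec q n) \<Longrightarrow> x [^]\<^bsub>zvec q n\<^esub> (k::nat) = (\<lambda>i\<in>{..<n}. (int k * x i) mod int q)"
proof (induction k)
  case 0
  interpret comm_group "zvec q n" by (rule comm_group_zvec)
  show ?case using one_zvec by auto
next
  case (Suc k)
  interpret comm_group "zvec q n" by (rule comm_group_zvec)
  have "x [^]\<^bsub>zvec q n\<^esub> Suc k = x [^]\<^bsub>zvec q n\<^esub> k \<otimes>\<^bsub>zvec q n\<^esub> x" by simp
  then show ?case using Suc by (auto simp: mult_zvec fun_eq_iff mod_simps algebra_simps)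
qed

lemma dot_commute: "dot q n x y = dot q n y x"
  by (simp add: dot_def mult.commute)

lemma dot_cong:
  assumes "\<And>i. i < n \<Longrightarrow> [x i = x' i] (mod int q)"
  shows "dot q n x y = dot q n x' y"
proof -
  have "[(\<Sum>i<n. x i * y i) = (\<Sum>i<n. x' i * y i)] (mod int q)"
    by (intro cong_sum cong_mult cong_refl assms) simp
  then show ?thesis by (simp add: dot_def cong_def)
qed

lemma dot_mult: "dot q n (x \<otimes>\<^bsub>zvec q n\<^esub> y) z = (dot q n x z + dot q n y z) mod int q"
proof -
  have "dot q n (x \<otimes>\<^bsub>zvec q n\<^esub> y) z = dot q n (\<lambda>i. x i + y i) z"
    by (rule dot_cong) (simp add: mult_zvec cong_def)
  also have "\<dots> = (dot q n x z + dot q n y z) mod int q"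
    by (simp add: dot_def distrib_right sum.distrib mod_simps)
  finally show ?thesis .
qed

lemma dot_one: "dot q n \<one>\<^bsub>zvec q n\<^esub> z = 0"
  by (simp add: dot_def one_zvec)

lemma dot_range: "q > 0 \<Longrightarrow> dot q n x y \<in> {0..<int q}"
  by (simp add: dot_def)

definition uvec :: "nat \<Rightarrow> nat \<Rightarrow> nat \<Rightarrow> nat \<Rightarrow> int" where
  "uvec q n a = (\<lambda>i\<in>{..<n}. of_bool (i = a))"

lemma uvec_in: "q > 1 \<Longrightarrow> uvec q n a \<in> carrier (zvec q n)"
  by (auto simp: uvec_def carrier_zvec)

lemma dot_uvec: "a < n \<Longrightarrow> y a \<in> {0..<int q} \<Longrightarrow> dot q n (uvec q n a) y = y a"
proof -
  assume a: "a < n" and y: "y a \<in> {0..<int q}"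
  have "(\<Sum>i<n. uvec q n a i * y i) = (\<Sum>i\<in>{a}. y i)"
    using a by (intro sum.mono_neutral_cong_right) (auto simp: uvec_def)
  then show ?thesis using y by (simp add: dot_def)
qed

lemma subgroup_perp: assumes "q > 0" shows "subgroup (perp q n K) (zvec q n)"
proof -
  interpret comm_group "zvec q n" by (rule comm_group_zvec)
  show ?thesis
  proof (rule finite_subgroupI[OF finite_zvec[OF assms]])
    show "\<one>\<^bsub>zvec q n\<^esub> \<in> perp q n K" using dot_one by (simp add: perp_def dot_commute[of q n _ "\<one>\<^bsub>zvec q n\<^esub>"])
    fix x y assume x: "x \<in> perp q n K" and y: "y \<in> perp q n K"
    have "dot q n z (x \<otimes>\<^bsub>zvec q n\<^esub> y) = 0" if z: "z \<in> K" for z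
    proof -
      have "dot q n z x = 0" "dot q n z y = 0" using x y z by (auto simp: perp_def)
      then show ?thesis
        unfolding dot_commute[of q n z] by (simp add: dot_mult)
    qed
    then show "x \<otimes>\<^bsub>zvec q n\<^esub> y \<in> perp q n K" using x y by (simp add: perp_def)
  qed (auto simp: perp_def)
qed

lemma (in comm_group) subgroup_comm_group:
  assumes "subgroup K G"
  shows "comm_group (G\<lparr>carrier := K\<rparr>)"
  by (rule group.group_comm_groupI[OF subgroup_imp_group[OF assms]])
    (use subgroup.subset[OF assms] in \<open>auto intro!: m_comm\<close>)

text \<open>Both inequalities come from the bound on the number of homomorphisms into the integers
  modulo q: apply it to the homomorphisms killing K on the full group, and to the homomorphisms
  on K.\<close>

lemma card_perp:
  assumes q: "q > 1" and K: "subgroup K (zvec q n)"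
  shows "card (perp q n K) * card K = q ^ n"
proof (rule antisym)
  interpret comm_group "zvec q n" by (rule comm_group_zvec)
  let ?V = "carrier (zvec q n)"
  have q0: "q > 0" using q by simp
  have fin: "finite ?V" by (rule finite_zvec[OF q0])
  have Kc: "K \<subseteq> ?V" by (rule subgroup.subset[OF K])
  define f where "f = (\<lambda>y. \<lambda>x\<in>?V. dot q n x y)"
  have f_in: "f y \<in> mod_homs (zvec q n) q" for y
    using dot_range[OF q0] dot_mult by (auto simp: f_def mod_homs_def)
  have "inj_on f (perp q n K)"
  proof (rule inj_onI)
    fix y z assume y: "y \<in> perp q n K" and z: "z \<in> perp q n K" and eq: "f y = f z"
    have yz: "y \<in> {..<n} \<rightarrow>\<^sub>E {0..<int q}" "z \<in> {..<n} \<rightarrow>\<^sub>E {0..<int q}"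
      using y z by (auto simp: perp_def carrier_zvec[OF q0])
    show "y = z"
    proof (rule PiE_ext[OF yz])
      fix a assume a: "a \<in> {..<n}"
      have "f y (uvec q n a) = f z (uvec q n a)" using eq by simp
      then have "dot q n (uvec q n a) y = dot q n (uvec q n a) z"
        using uvec_in[OF q, of n a] by (simp add: f_def)
      moreover have "y a \<in> {0..<int q}" "z a \<in> {0..<int q}" by (rule PiE_mem[OF yz(1) a], rule PiE_mem[OF yz(2) a])
      ultimately show "y a = z a" using dot_uvec[of a n y q] dot_uvec[of a n z q] a by simp
    qed
  qed
  then have "card (perp q n K) = card (f ` perp q n K)" by (simp add: card_image)
  moreover have "card (f ` perp q n K) * card K \<le> card ?V"
  proof (rule card_mod_homs_agree[OF fin _ K])
    show "f ` perp q n K \<subseteq> mod_homs (zvec q n) q" using f_in by auto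
  qed (use Kc in \<open>auto simp: f_def perp_def\<close>)
  ultimately show "card (perp q n K) * card K \<le> q ^ n" using card_zvec[OF q0] by simp

  let ?K = "(zvec q n)\<lparr>carrier := K\<rparr>"
  interpret K: comm_group ?K by (rule subgroup_comm_group[OF K])
  define g where "g = (\<lambda>y. \<lambda>x\<in>K. dot q n x y)"
  have finK: "finite K" using Kc fin finite_subset by blast
  have g_in: "g y \<in> mod_homs ?K q" for y
    using dot_range[OF q0] dot_mult subgroup.m_closed[OF K] by (auto simp: g_def mod_homs_def)
  have "card ?V \<le> card (perp q n K) * card (g ` ?V)"
  proof (rule card_le_fibres[where f = g])
    fix h assume "h \<in> g ` ?V"
    then obtain y0 where y0: "y0 \<in> ?V" "h = g y0" by auto
    define t where "t = (\<lambda>y. \<lambda>i\<in>{..<n}. (y i - y0 i) mod int q)"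
    have "inj_on t {y \<in> ?V. g y = h}"
    proof (rule inj_onI)
      fix y z assume "y \<in> {y \<in> ?V. g y = h}" "z \<in> {y \<in> ?V. g y = h}" and eq: "t y = t z"
      then have yz: "y \<in> {..<n} \<rightarrow>\<^sub>E {0..<int q}" "z \<in> {..<n} \<rightarrow>\<^sub>E {0..<int q}"
        by (auto simp: carrier_zvec[OF q0])
      show "y = z"
      proof (rule PiE_ext[OF yz])
        fix a assume a: "a \<in> {..<n}"
        have "(y a - y0 a) mod int q = (z a - y0 a) mod int q"
          using fun_cong[OF eq, of a] a by (simp add: t_def)
        then have "int q dvd y a - z a" by (simp add: mod_eq_dvd_iff)
        then have "y a mod int q = z a mod int q" by (simp add: mod_eq_dvd_iff)
        moreover have "y a \<in> {0..<int q}" "z a \<in> {0..<int q}" by (rule PiE_mem[OF yz(1) a], rule PiE_mem[OF yz(2) a])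
        ultimately show "y a = z a" by simp
      qed
    qed
    moreover have "t ` {y \<in> ?V. g y = h} \<subseteq> perp q n K"
    proof (rule image_subsetI)
      fix y assume y: "y \<in> {y \<in> ?V. g y = h}"
      have "dot q n x (t y) = 0" if x: "x \<in> K" for x
      proof -
        have "dot q n x y = dot q n x y0"
        proof -
          have "g y x = g y0 x" using y y0 by simp
          then show ?thesis using x by (simp add: g_def)
        qed
        moreover have "dot q n x (t y) = (dot q n x y - dot q n x y0) mod int q"
        proof -
          have "dot q n (t y) x = dot q n (\<lambda>i. y i - y0 i) x"
            by (rule dot_cong) (simp add: t_def cong_def)
          then show ?thesis
            unfolding dot_commute[of q n x] by (simp add: dot_def left_diff_distrib sum_subtractf mod_simps)
        qed
        ultimately show ?thesis by simp
      qed
      moreover have "t y \<in> ?V" using q0 by (auto simp: t_def carrier_zvec)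
      ultimately show "t y \<in> perp q n K" by (simp add: perp_def)
    qed
    moreover have "finite (perp q n K)" using fin by (simp add: perp_def)
    ultimately show "card {y \<in> ?V. g y = h} \<le> card (perp q n K)" by (rule card_inj_on_le)
  qed (use fin in auto)
  also have "card (g ` ?V) \<le> card (mod_homs ?K q)"
    using g_in finite_mod_homs[of ?K q] finK by (intro card_mono) auto
  also have "\<dots> \<le> card K" using K.card_mod_homs_le[of q] finK by simp
  finally show "q ^ n \<le> card (perp q n K) * card K" using card_zvec[OF q0] by simp
qed

text \<open>One inclusion is immediate, and applying \<open>card_perp\<close> twice shows that both
  sides have the same order.\<close>

lemma perp_perp:
  assumes q: "q > 1" and K: "subgroup K (zvec q n)"
  shows "perp q n (perp q n K) = K"
proof -
  interpret comm_group "zvec q n" by (rule comm_group_zvec)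
  have q0: "q > 0" using q by simp
  have P: "subgroup (perp q n K) (zvec q n)" by (rule subgroup_perp[OF q0])
  have PP: "subgroup (perp q n (perp q n K)) (zvec q n)" by (rule subgroup_perp[OF q0])
  have fin: "finite (perp q n (perp q n K))"
    using subgroup.subset[OF PP] finite_zvec[OF q0] finite_subset by blast
  have "card (perp q n (perp q n K)) * card (perp q n K) = card K * card (perp q n K)"
    using card_perp[OF q K] card_perp[OF q P] by (simp add: mult.commute)
  moreover have "card (perp q n K) > 0"
    using finite_subset[OF subgroup.subset[OF P] finite_zvec[OF q0]] subgroup.one_closed[OF P]
    by (auto simp: card_gt_0_iff)
  ultimately have "card (perp q n (perp q n K)) = card K" by simp
  moreover have "K \<subseteq> perp q n (perp q n K)"
    using subgroup.subset[OF K] by (auto simp: perp_def dot_commute)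
  ultimately show ?thesis using fin by (metis card_subset_eq)
qed

lemma (in group_hom) card_kernel_mult_image:
  assumes "finite (carrier G)"
  shows "card (kernel G H h) * card (h ` carrier G) = card (carrier G)"
proof -
  have "card {x \<in> carrier G. h x = y} = card (kernel G H h)" if "y \<in> h ` carrier G" for y
  proof -
    from that obtain x0 where x0: "y = h x0" "x0 \<in> carrier G" by (rule imageE)
    have "bij_betw (\<lambda>z. z \<otimes>\<^bsub>G\<^esub> x0) (kernel G H h) {x \<in> carrier G. h x = y}"
    proof (rule bij_betw_imageI)
      show "inj_on (\<lambda>z. z \<otimes>\<^bsub>G\<^esub> x0) (kernel G H h)"
        by (rule inj_onI) (use x0 in \<open>simp add: kernel_def\<close>)
      show "(\<lambda>z. z \<otimes>\<^bsub>G\<^esub> x0) ` kernel G H h = {x \<in> carrier G. h x = y}"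
      proof (rule equalityI; rule subsetI)
        fix w assume "w \<in> (\<lambda>z. z \<otimes>\<^bsub>G\<^esub> x0) ` kernel G H h"
        then obtain z where "z \<in> carrier G" "h z = \<one>\<^bsub>H\<^esub>" "w = z \<otimes>\<^bsub>G\<^esub> x0" by (auto simp: kernel_def)
        then show "w \<in> {x \<in> carrier G. h x = y}" using x0 by simp
      next
        fix w assume w: "w \<in> {x \<in> carrier G. h x = y}"
        then have "w \<otimes>\<^bsub>G\<^esub> inv\<^bsub>G\<^esub> x0 \<in> kernel G H h" using x0 by (simp add: kernel_def)
        moreover have "w = (w \<otimes>\<^bsub>G\<^esub> inv\<^bsub>G\<^esub> x0) \<otimes>\<^bsub>G\<^esub> x0" using w x0 by (simp add: G.m_assoc)
        ultimately show "w \<in> (\<lambda>z. z \<otimes>\<^bsub>G\<^esub> x0) ` kernel G H h" by (rule rev_image_eqI)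
      qed
    qed
    then show ?thesis by (rule bij_betw_same_card[symmetric])
  qed
  then have "card (carrier G) = (\<Sum>y\<in>h ` carrier G. card (kernel G H h))"
    using sum.group[where g = h and h = "\<lambda>_. 1::nat", OF assms finite_imageI[OF assms] subset_refl] by simp
  then show ?thesis by (simp add: mult.commute)
qed

section \<open>Independent tuples and a q-series\<close>

text \<open>The order of y modulo E divides p and is not 1. The upper bound comes from the
  translates of E by p powers of y; for the lower bound, a k prime to p with the k-th power of y in
  E would put y itself in E by Bezout.\<close>

lemma (in comm_group) card_generate_insert_prime:
  assumes fin: "finite (carrier G)" and E: "subgroup E G" and y: "y \<in> carrier G" "y \<notin> E"
    and p: "Factorial_Ring.prime (p::nat)" and yp: "y [^] p \<in> E"
  shows "card (generate G (insert y E)) = p * card E"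
proof (rule antisym)
  have Ec: "E \<subseteq> carrier G" by (rule subgroup.subset[OF E])
  have sub: "insert y E \<subseteq> carrier G" using Ec y by auto
  let ?H = "generate G (insert y E)"
  have H: "subgroup ?H G" by (rule generate_is_subgroup[OF sub])
  have p0: "p > 0" using p prime_gt_0_nat by blast
  have pow_E: "y [^] (p * k) \<in> E" for k :: nat
  proof (induction k)
    case 0 then show ?case using subgroup.one_closed[OF E] by simp
  next
    case (Suc k)
    have "y [^] (p * Suc k) = y [^] p \<otimes> y [^] (p * k)" using y by (simp add: nat_pow_mult)
    then show ?case using Suc yp subgroup.m_closed[OF E] by simp
  qed
  define S where "S = (\<lambda>(i, e). y [^] i \<otimes> e) ` ({..<p} \<times> E)"
  have red: "y [^] (i::nat) \<otimes> e \<in> S" if "e \<in> E" for i e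
  proof -
    have ec: "e \<in> carrier G" using that Ec by auto
    have "y [^] i = y [^] (i mod p) \<otimes> y [^] (p * (i div p))" using y by (simp add: nat_pow_mult)
    then have "y [^] i \<otimes> e = y [^] (i mod p) \<otimes> (y [^] (p * (i div p)) \<otimes> e)"
      using y ec by (simp add: m_assoc)
    moreover have "y [^] (p * (i div p)) \<otimes> e \<in> E" using pow_E that subgroup.m_closed[OF E] by blast
    moreover have "i mod p < p" using p0 by simp
    ultimately show ?thesis unfolding S_def by force
  qed
  have "subgroup S G"
  proof (rule finite_subgroupI[OF fin])
    show "S \<subseteq> carrier G" using y Ec by (auto simp: S_def)
    have "y [^] (0::nat) \<otimes> \<one> \<in> S" by (rule red[OF subgroup.one_closed[OF E]])
    then show "\<one> \<in> S" by simp
    fix a b assume "a \<in> S" "b \<in> S"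
    then obtain i e j e' where *: "e \<in> E" "e' \<in> E" "a = y [^] (i::nat) \<otimes> e" "b = y [^] (j::nat) \<otimes> e'"
      by (auto simp: S_def)
    have ec: "e \<in> carrier G" "e' \<in> carrier G" using * Ec by auto
    have "a \<otimes> b = (y [^] i \<otimes> y [^] j) \<otimes> (e \<otimes> e')"
      unfolding * using ec y by (simp add: m_ac)
    then have "a \<otimes> b = y [^] (i + j) \<otimes> (e \<otimes> e')" using y by (simp add: nat_pow_mult)
    then show "a \<otimes> b \<in> S" using red * subgroup.m_closed[OF E] by simp
  qed
  moreover have "insert y E \<subseteq> S"
  proof
    fix x assume "x \<in> insert y E"
    then consider "x = y" | "x \<in> E" by blast
    then show "x \<in> S"
    proof cases
      case 1
      then show ?thesis using red[OF subgroup.one_closed[OF E], of 1] y by simp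
    next
      case 2
      then show ?thesis using red[OF 2, of 0] Ec by auto
    qed
  qed
  ultimately have "?H \<subseteq> S" by (intro generate_subgroup_incl)
  then have "card ?H \<le> card S"
    using finite_subset[OF Ec fin] by (intro card_mono) (auto simp: S_def)
  also have "\<dots> \<le> card ({..<p} \<times> E)"
    unfolding S_def using finite_subset[OF Ec fin] by (intro card_image_le) auto
  finally show "card ?H \<le> p * card E" by (simp add: card_cartesian_product)

  obtain k where k: "k \<ge> 1" "y [^] (k::nat) \<in> E" "k * card E \<le> card ?H"
    using generate_index[OF fin E y(1)] by blast
  have "p dvd k"
  proof (rule ccontr)
    assume "\<not> p dvd k"
    have "k \<noteq> 1" using k(2) y by auto
    then have "\<exists>a b. p * a = k * b + 1"
      by (intro coprime_bezout_strong prime_imp_coprime[OF p] \<open>\<not> p dvd k\<close>)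
    then obtain a b where ab: "p * a = k * b + 1"
      by blast
    have kb: "y [^] (b * k) \<in> E"
    proof (induction b)
      case 0 then show ?case using subgroup.one_closed[OF E] by simp
    next
      case (Suc b)
      have "y [^] (Suc b * k) = y [^] k \<otimes> y [^] (b * k)" using y by (simp add: nat_pow_mult)
      then show ?case using Suc k(2) subgroup.m_closed[OF E] by simp
    qed
    have "y [^] (b * k) \<otimes> y = y [^] (p * a)"
    proof -
      have "y [^] (b * k) \<otimes> y = y [^] Suc (b * k)" by simp
      also have "Suc (b * k) = p * a" using ab by (simp add: mult.commute)
      finally show ?thesis .
    qed
    then have eq: "y = inv (y [^] (b * k)) \<otimes> y [^] (p * a)"
      using y inv_solve_left[of y "y [^] (b * k)" "y [^] (p * a)"] by simp
    have "inv (y [^] (b * k)) \<otimes> y [^] (p * a) \<in> E"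
      by (rule subgroup.m_closed[OF E subgroup.m_inv_closed[OF E kb] pow_E])
    then show False using y eq by simp
  qed
  then have "p \<le> k" using k(1) by (intro dvd_imp_le) auto
  then show "p * card E \<le> card ?H" using k(3) by (meson mult_le_mono1 order_trans)
qed

text \<open>When U / Y has exponent p, these are the ordered tuples of U that are linearly
  independent in the vector space U / Y: each new vector avoids the span of Y and its
  predecessors.\<close>

primrec indep_tuples :: "('a, 'b) monoid_scheme \<Rightarrow> 'a set \<Rightarrow> 'a set \<Rightarrow> nat \<Rightarrow> 'a list set" where
  "indep_tuples G Y U 0 = {[]}"
| "indep_tuples G Y U (Suc j) =
     (\<lambda>(ys, y). ys @ [y]) ` (SIGMA ys:indep_tuples G Y U j. U - generate G (Y \<union> set ys))"

section \<open>Counting independent tuples\<close>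

context comm_group
begin

lemma indep_tuples_props:
  assumes fin: "finite (carrier G)" and Y: "subgroup Y G" and U: "subgroup U G" and YU: "Y \<subseteq> U"
    and p: "Factorial_Ring.prime (p::nat)" and Up: "\<And>x. x \<in> U \<Longrightarrow> x [^] p \<in> Y"
    and ys: "ys \<in> indep_tuples G Y U j"
  shows "length ys = j \<and> set ys \<subseteq> U \<and> generate G (Y \<union> set ys) \<subseteq> U \<and>
    card (generate G (Y \<union> set ys)) = card Y * p ^ j"
  using ys
proof (induction j arbitrary: ys)
  case 0
  then show ?case using generate_of_subgroup[OF Y] YU by simp
next
  case (Suc j)
  then obtain zs z where z: "ys = zs @ [z]" "zs \<in> indep_tuples G Y U j" "z \<in> U" "z \<notin> generate G (Y \<union> set zs)"
    by auto
  note IH = Suc.IH[OF z(2)]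
  have Uc: "U \<subseteq> carrier G" by (rule subgroup.subset[OF U])
  have sub: "Y \<union> set zs \<subseteq> carrier G" using IH YU Uc by auto
  let ?E = "generate G (Y \<union> set zs)"
  have E: "subgroup ?E G" by (rule generate_is_subgroup[OF sub])
  have zc: "z \<in> carrier G" using z Uc by auto
  have "z [^] p \<in> ?E" using Up[OF z(3)] by (auto intro: generate.incl)
  from card_generate_insert_prime[OF fin E zc z(4) p this]
  have "card (generate G (insert z ?E)) = p * card ?E" .
  moreover have "generate G (insert z ?E) = generate G (Y \<union> set ys)"
  proof -
    have 1: "generate G (insert z ?E) \<subseteq> generate G (Y \<union> set ys)"
    proof (rule generate_subgroup_incl)
      have sub2: "Y \<union> set ys \<subseteq> carrier G" using sub zc z(1) by auto
      show "subgroup (generate G (Y \<union> set ys)) G" by (rule generate_is_subgroup[OF sub2])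
      have "?E \<subseteq> generate G (Y \<union> set ys)" by (rule mono_generate) (auto simp: z(1))
      moreover have "z \<in> generate G (Y \<union> set ys)" by (rule generate.incl) (simp add: z(1))
      ultimately show "insert z ?E \<subseteq> generate G (Y \<union> set ys)" by simp
    qed
    have 2: "generate G (Y \<union> set ys) \<subseteq> generate G (insert z ?E)"
    proof (rule mono_generate)
      have "Y \<union> set zs \<subseteq> ?E" by (auto intro: generate.incl)
      then show "Y \<union> set ys \<subseteq> insert z ?E" using z(1) by auto
    qed
    show ?thesis using 1 2 by blast
  qed
  moreover have "generate G (Y \<union> set ys) \<subseteq> U"
    using IH z YU by (intro generate_subgroup_incl[OF _ U]) auto
  ultimately show ?case using IH z by simp
qed

lemma finite_indep_tuples:
  assumes "finite U" shows "finite (indep_tuples G Y U j)"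
  using assms by (induction j) auto

text \<open>The span of Y and i independent vectors has \<open>card Y * p ^ i\<close> elements, all
  of them forbidden for the next vector.\<close>

lemma card_indep_tuples:
  assumes fin: "finite (carrier G)" and Y: "subgroup Y G" and U: "subgroup U G" and YU: "Y \<subseteq> U"
    and p: "Factorial_Ring.prime (p::nat)" and Up: "\<And>x. x \<in> U \<Longrightarrow> x [^] p \<in> Y"
  shows "real (card (indep_tuples G Y U j)) = (\<Prod>i<j. real (card U) - real (card Y) * real p ^ i)"
proof (induction j)
  case (Suc j)
  have finU: "finite U" using subgroup.subset[OF U] fin finite_subset by blast
  have inj: "inj_on (\<lambda>(ys, y). ys @ [y]) X" for X :: "('a list \<times> 'a) set" by (auto simp: inj_on_def)
  have "card (indep_tuples G Y U (Suc j)) =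
      (\<Sum>ys\<in>indep_tuples G Y U j. card (U - generate G (Y \<union> set ys)))"
    using finite_indep_tuples[OF finU] finU by (simp add: card_image[OF inj] card_SigmaI)
  then have "real (card (indep_tuples G Y U (Suc j))) =
      (\<Sum>ys\<in>indep_tuples G Y U j. real (card (U - generate G (Y \<union> set ys))))"
    by (simp only: of_nat_sum)
  also have "\<dots> = (\<Sum>ys\<in>indep_tuples G Y U j. real (card U) - real (card Y) * real p ^ j)"
  proof (rule sum.cong[OF refl])
    fix ys assume "ys \<in> indep_tuples G Y U j"
    from indep_tuples_props[OF fin Y U YU p Up this]
    have *: "generate G (Y \<union> set ys) \<subseteq> U" "card (generate G (Y \<union> set ys)) = card Y * p ^ j" by auto
    then have "card (generate G (Y \<union> set ys)) \<le> card U" using finU card_mono by blast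
    then show "real (card (U - generate G (Y \<union> set ys))) = real (card U) - real (card Y) * real p ^ j"
      using * finite_subset[OF *(1) finU] by (simp add: card_Diff_subset of_nat_diff)
  qed
  finally show ?case using Suc by simp
qed simp

text \<open>Independence over Y does not refer to L. So the independent tuples inside a random L are
  those of a fixed set that happen to lie in L, and the expectation of their number is a sum of
  probabilities.\<close>

lemma indep_tuples_Int:
  assumes "Y \<subseteq> L"
  shows "indep_tuples G Y (U \<inter> L) j = {ys \<in> indep_tuples G Y U j. set ys \<subseteq> L}"
  by (induction j) auto

lemma card_prime_power_quotient:
  assumes fin: "finite (carrier G)" and ord: "card (carrier G) = p ^ N" and p: "Factorial_Ring.prime (p::nat)"
    and Y: "subgroup Y G" and U: "subgroup U G" and YU: "Y \<subseteq> U"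
  shows "\<exists>c. card U = card Y * p ^ c"
proof -
  obtain d where d: "card U = card Y * d" using card_subgroup_dvd[OF Y U YU] by auto
  have "card U dvd p ^ N"
    using lagrange[OF U] ord by (metis dvd_triv_right order_def)
  then have "d dvd p ^ N" using d by (metis dvd_mult_right)
  then obtain c where "d = p ^ c" using p by (auto simp: divides_primepow_nat)
  then show ?thesis using d by blast
qed

text \<open>For y in L outside Y, take the last of its iterated p-th powers that is not in Y. This
  makes c = 0 detect the equality of L and Y.\<close>

lemma exists_pth_power_in:
  assumes fin: "finite (carrier G)" and ord: "card (carrier G) = p ^ N"
    and Y: "subgroup Y G" and L: "subgroup L G" and YL: "Y \<subset> L"
  shows "\<exists>y\<in>L - Y. y [^] (p::nat) \<in> Y"
proof -
  obtain y where y: "y \<in> L" "y \<notin> Y" using YL by auto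
  have yc: "y \<in> carrier G" using y subgroup.subset[OF L] by auto
  have L_pow: "y [^] (i::nat) \<in> L" for i
    by (induction i) (use y L in \<open>auto intro: subgroup.m_closed subgroup.one_closed\<close>)
  define i where "i = (LEAST i. y [^] (p ^ i) \<in> Y)"
  have "y [^] (p ^ N) \<in> Y"
    using pow_order_eq_1[OF yc] ord subgroup.one_closed[OF Y] by (simp add: order_def)
  then have i: "y [^] (p ^ i) \<in> Y" unfolding i_def by (rule LeastI)
  then have "i \<noteq> 0" using y yc by (intro notI) simp
  then obtain i' where i': "i = Suc i'" by (cases i) auto
  have "y [^] (p ^ i') \<notin> Y" using not_less_Least[of i' "\<lambda>i. y [^] (p ^ i) \<in> Y"] i' by (simp add: i_def)
  moreover have "(y [^] (p ^ i')) [^] p \<in> Y" using i yc by (simp add: i' nat_pow_pow mult.commute)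
  ultimately show ?thesis using L_pow by blast
qed

end

text \<open>The coefficients of the q-analogue, for q = p, of the inclusion-exclusion series
  \<open>\<Sum>j. (-1) ^ j * (c choose j)\<close> for the indicator of c = 0.\<close>

definition qwt :: "real \<Rightarrow> nat \<Rightarrow> real" where
  "qwt p j = (-1) ^ j / (\<Prod>i=1..j. p ^ i - 1)"

text \<open>As a polynomial in x the partial sum has degree J, vanishes at \<open>p ^ 1, \<dots>, p ^ J\<close>
  and takes the value 1 at 1.\<close>

lemma qwt_partial_sum:
  fixes p x :: real
  assumes "p > 1"
  shows "(\<Sum>j\<le>J. qwt p j * (\<Prod>i<j. x - p ^ i)) = (\<Prod>i=1..J. (p ^ i - x) / (p ^ i - 1))"
proof (induction J)
  case 0
  then show ?case by (simp add: qwt_def)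
next
  case (Suc J)
  have pos: "p ^ i - 1 > 0" if "i \<ge> 1" for i
    using assms that one_less_power[of p i] by simp
  have "(\<Prod>i<Suc J. x - p ^ i) = (x - 1) * (\<Prod>i=1..J. x - p ^ i)"
    by (simp add: lessThan_Suc_eq_insert_0 prod.reindex image_Suc_lessThan)
  also have "(\<Prod>i=1..J. x - p ^ i) = (\<Prod>i=1..J. (-1) * (p ^ i - x))" by (intro prod.cong) auto
  also have "\<dots> = (-1) ^ J * (\<Prod>i=1..J. p ^ i - x)" by (subst prod.distrib) simp
  finally have e1: "(\<Prod>i<Suc J. x - p ^ i) = (x - 1) * ((-1) ^ J * (\<Prod>i=1..J. p ^ i - x))" .
  have "qwt p (Suc J) * (\<Prod>i<Suc J. x - p ^ i)
      = ((-1) ^ Suc J * (-1) ^ J) * (x - 1) * (\<Prod>i=1..J. p ^ i - x) / ((\<Prod>i=1..J. p ^ i - 1) * (p ^ Suc J - 1))"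
  proof -
    have e2: "(\<Prod>i=1..Suc J. p ^ i - 1) = (\<Prod>i=1..J. p ^ i - 1) * (p ^ Suc J - 1)" by simp
    show ?thesis unfolding e1 qwt_def e2 by (simp only: times_divide_eq_left times_divide_eq_right mult_ac)
  qed
  also have "(-1) ^ Suc J * (-1) ^ J = (-1 :: real)"
    by (simp add: power_add[symmetric] mult_2[symmetric])
  finally have "qwt p (Suc J) * (\<Prod>i<Suc J. x - p ^ i)
      = (\<Prod>i=1..J. (p ^ i - x) / (p ^ i - 1)) * ((1 - x) / (p ^ Suc J - 1))"
    by (simp add: prod_dividef algebra_simps)
  then have "(\<Sum>j\<le>Suc J. qwt p j * (\<Prod>i<j. x - p ^ i))
      = (\<Prod>i=1..J. (p ^ i - x) / (p ^ i - 1)) * (1 + (1 - x) / (p ^ Suc J - 1))"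
    using Suc by (simp add: distrib_left)
  also have "1 + (1 - x) / (p ^ Suc J - 1) = (p ^ Suc J - x) / (p ^ Suc J - 1)"
    using pos[of "Suc J"] by (simp add: field_simps)
  finally show ?case by simp
qed

text \<open>At \<open>x = p ^ c\<close> the closed form of the partial sum is 1 for c = 0 and 0 for
  c between 1 and J; for c > J all its J factors are negative and the sign is that of
  \<open>(-1) ^ J\<close>.\<close>

lemma qwt_bonferroni:
  fixes p :: real
  assumes p: "p > 1"
  shows "even J \<Longrightarrow> of_bool (c = 0) \<le> (\<Sum>j\<le>J. qwt p j * (\<Prod>i<j. p ^ c - p ^ i))"
    and "odd J \<Longrightarrow> (\<Sum>j\<le>J. qwt p j * (\<Prod>i<j. p ^ c - p ^ i)) \<le> of_bool (c = 0)"
proof -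
  have pos: "p ^ i - 1 > 0" if "i \<ge> 1" for i
    using p that one_less_power[of p i] by simp
  define S where "S = (\<Prod>i=1..J. (p ^ i - p ^ c) / (p ^ i - 1))"
  have S0: "S = 1" if "c = 0"
    unfolding S_def using that pos by (intro prod.neutral) force
  have S1: "S = 0" if "1 \<le> c" "c \<le> J"
    unfolding S_def using that by (intro prod_zero) auto
  have S2: "S = (-1) ^ J * (\<Prod>i=1..J. (p ^ c - p ^ i) / (p ^ i - 1))"
  proof -
    have "S = (\<Prod>i=1..J. (-1) * ((p ^ c - p ^ i) / (p ^ i - 1)))"
      unfolding S_def by (intro prod.cong) (auto simp: minus_divide_left)
    then show ?thesis by (simp only: prod.distrib) simp
  qed
  have S3: "(\<Prod>i=1..J. (p ^ c - p ^ i) / (p ^ i - 1)) \<ge> 0" if "c > J"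
  proof (intro prod_nonneg)
    fix i assume "i \<in> {1..J}"
    then have "p ^ i \<le> p ^ c" using p that by (intro power_increasing) auto
    then show "0 \<le> (p ^ c - p ^ i) / (p ^ i - 1)" using pos[of i] \<open>i \<in> {1..J}\<close> by simp
  qed
  show "of_bool (c = 0) \<le> (\<Sum>j\<le>J. qwt p j * (\<Prod>i<j. p ^ c - p ^ i))" if "even J"
    unfolding qwt_partial_sum[OF p] S_def[symmetric]
  proof -
    consider "c = 0" | "1 \<le> c" "c \<le> J" | "c > J" by linarith
    then show "of_bool (c = 0) \<le> S"
    proof cases
      case 3
      then show ?thesis using S2 S3 \<open>even J\<close> by simp
    qed (use S0 S1 in auto)
  qed
  show "(\<Sum>j\<le>J. qwt p j * (\<Prod>i<j. p ^ c - p ^ i)) \<le> of_bool (c = 0)" if "odd J"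
    unfolding qwt_partial_sum[OF p] S_def[symmetric]
  proof -
    consider "c = 0" | "1 \<le> c" "c \<le> J" | "c > J" by linarith
    then show "S \<le> of_bool (c = 0)"
    proof cases
      case 3
      then show ?thesis using S2 S3 \<open>odd J\<close> by simp
    qed (use S0 S1 in auto)
  qed
qed

lemma qwt_Suc:
  fixes p :: real assumes "p > 1"
  shows "qwt p (Suc j) * (p ^ Suc j - 1) = - qwt p j"
  using assms one_less_power[of p "Suc j"] by (simp add: qwt_def)

lemma qwt_summable:
  fixes p :: real
  assumes p: "p \<ge> 2"
  shows "summable (\<lambda>j. \<bar>qwt p j\<bar>)"
proof (rule summable_ratio_test[of "1/2" 1])
  \<comment> \<open>For p = 2 the ratio at j = 0 is 1. From j = 1 on,
    \<open>p ^ Suc j \<ge> 4\<close> makes it at most 1 / 2.\<close>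
  fix j :: nat assume j: "1 \<le> j"
  have "4 \<le> p ^ 2" using power_mono[OF p, of 2] by simp
  also have "\<dots> \<le> p ^ Suc j" using p j by (intro power_increasing) auto
  finally have ge: "p ^ Suc j - 1 \<ge> 2" by simp
  have "\<bar>qwt p (Suc j)\<bar> * 2 \<le> \<bar>qwt p (Suc j)\<bar> * (p ^ Suc j - 1)" using ge by (intro mult_left_mono) auto
  also have "\<dots> = \<bar>qwt p (Suc j) * (p ^ Suc j - 1)\<bar>" using ge by (simp add: abs_mult)
  also have "\<dots> = \<bar>qwt p j\<bar>" using qwt_Suc[of p j] p by simp
  finally show "norm \<bar>qwt p (Suc j)\<bar> \<le> 1 / 2 * norm \<bar>qwt p j\<bar>" by simp
qed simp

text \<open>Euler's product for a q-exponential series. The recursion of the coefficients gives f z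
  = (1 - z / p) * f (z / p) for the power series f. Iterating it from \<open>z = 1 / p ^ u\<close>
  produces the factors one by one, and f tends to 1 at 0.\<close>

lemma qwt_sums_euler:
  fixes p :: real
  assumes p: "p \<ge> 2"
  shows "(\<lambda>j. qwt p j * (1 / p ^ u) ^ j) sums (\<Prod>k. 1 - 1 / p ^ (k + 1 + u))"
proof -
  define f where "f = (\<lambda>z. \<Sum>j. qwt p j * z ^ j)"
  have sumz: "summable (\<lambda>j. qwt p j * z ^ j)" if "0 \<le> z" "z \<le> 1" for z
  proof (rule summable_comparison_test'[OF qwt_summable[OF p]])
    fix j show "norm (qwt p j * z ^ j) \<le> \<bar>qwt p j\<bar>"
      using that power_le_one[of z j] by (simp add: abs_mult mult_left_le)
  qed
  have step: "f z = (1 - z / p) * f (z / p)" if z: "0 \<le> z" "z \<le> 1" for z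
  proof -
    have zp: "0 \<le> z / p" "z / p \<le> 1" using z p by (auto simp: field_simps)
    have "(\<lambda>j. qwt p j * z ^ j - qwt p j * (z / p) ^ j) sums (f z - f (z / p))"
      unfolding f_def by (intro sums_diff summable_sums sumz z zp)
    then have "(\<lambda>j. qwt p (Suc j) * z ^ Suc j - qwt p (Suc j) * (z / p) ^ Suc j) sums (f z - f (z / p))"
      by (subst (asm) sums_Suc_iff[symmetric, of "\<lambda>j. qwt p j * z ^ j - qwt p j * (z / p) ^ j", simplified]) simp
    moreover have "qwt p (Suc j) * z ^ Suc j - qwt p (Suc j) * (z / p) ^ Suc j = - (z / p) * (qwt p j * (z / p) ^ j)" for j
    proof -
      have "z ^ Suc j = p ^ Suc j * (z / p) ^ Suc j" using p by (simp add: power_divide)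
      then have "qwt p (Suc j) * z ^ Suc j - qwt p (Suc j) * (z / p) ^ Suc j
          = (qwt p (Suc j) * (p ^ Suc j - 1)) * (z / p) ^ Suc j" by (simp add: algebra_simps)
      then show ?thesis using qwt_Suc[of p j] p by simp
    qed
    ultimately have "(\<lambda>j. - (z / p) * (qwt p j * (z / p) ^ j)) sums (f z - f (z / p))" by simp
    moreover have "(\<lambda>j. - (z / p) * (qwt p j * (z / p) ^ j)) sums (- (z / p) * f (z / p))"
      unfolding f_def by (intro sums_mult summable_sums sumz zp)
    ultimately have "f z - f (z / p) = - (z / p) * f (z / p)" by (rule sums_unique2)
    then show ?thesis by (simp add: algebra_simps)
  qed
  have le1: "0 \<le> 1 / p ^ k" "1 / p ^ k \<le> 1" for k :: nat using p by (auto simp: field_simps)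
  have iter: "f (1 / p ^ u) = (\<Prod>k<m. 1 - 1 / p ^ (k + 1 + u)) * f (1 / p ^ (m + u))" for m
  proof (induction m)
    case (Suc m)
    have "f (1 / p ^ (m + u)) = (1 - 1 / p ^ (m + 1 + u)) * f (1 / p ^ (Suc m + u))"
      using step[OF le1, of "m + u"] by (simp add: mult.commute)
    then show ?case using Suc by simp
  qed simp
  define C where "C = (\<Sum>j. \<bar>qwt p (Suc j)\<bar>)"
  have near: "\<bar>f z - 1\<bar> \<le> z * C" if z: "0 \<le> z" "z \<le> 1" for z
  proof -
    have "f z = qwt p 0 * z ^ 0 + (\<Sum>j. qwt p (Suc j) * z ^ Suc j)"
      unfolding f_def using suminf_split_head[OF sumz[OF z]] by simp
    then have eq: "f z - 1 = (\<Sum>j. qwt p (Suc j) * z ^ Suc j)" by (simp add: qwt_def)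
    have s1: "summable (\<lambda>j. \<bar>qwt p (Suc j)\<bar>)" using qwt_summable[OF p] by (subst summable_Suc_iff)
    have le: "norm (qwt p (Suc j) * z ^ Suc j) \<le> z * \<bar>qwt p (Suc j)\<bar>" for j
    proof -
      have "z ^ Suc j \<le> z" using z power_le_one[of z j] by (simp add: mult_left_le)
      then have "\<bar>qwt p (Suc j)\<bar> * z ^ Suc j \<le> \<bar>qwt p (Suc j)\<bar> * z" by (intro mult_left_mono) auto
      then show ?thesis using z by (simp add: abs_mult mult.commute)
    qed
    have s2: "summable (\<lambda>j. norm (qwt p (Suc j) * z ^ Suc j))"
      by (rule summable_comparison_test'[OF summable_mult[OF s1, of z]]) (use le in auto)
    have "\<bar>f z - 1\<bar> \<le> (\<Sum>j. norm (qwt p (Suc j) * z ^ Suc j))"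
      unfolding eq using summable_norm[OF s2] by simp
    also have "\<dots> \<le> (\<Sum>j. z * \<bar>qwt p (Suc j)\<bar>)"
      by (rule suminf_le[OF le s2 summable_mult[OF s1]])
    also have "\<dots> = z * C" unfolding C_def by (rule suminf_mult[OF s1])
    finally show ?thesis .
  qed
  have z0: "(\<lambda>m. 1 / p ^ (m + u)) \<longlonglongrightarrow> 0"
  proof -
    have "(\<lambda>m. (1 / p) ^ m * (1 / p ^ u)) \<longlonglongrightarrow> 0 * (1 / p ^ u)"
      using p by (intro tendsto_intros LIMSEQ_realpow_zero) auto
    then show ?thesis by (simp add: power_add power_divide)
  qed
  have "(\<lambda>m. f (1 / p ^ (m + u)) - 1) \<longlonglongrightarrow> 0"
  proof (rule Lim_null_comparison)
    show "\<forall>\<^sub>F m in sequentially. norm (f (1 / p ^ (m + u)) - 1) \<le> 1 / p ^ (m + u) * C"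
      using near[OF le1] by simp
    show "(\<lambda>m. 1 / p ^ (m + u) * C) \<longlonglongrightarrow> 0"
      using tendsto_mult_right[OF z0, of C] by simp
  qed
  then have f1: "(\<lambda>m. f (1 / p ^ (m + u))) \<longlonglongrightarrow> 1" by (simp add: LIM_zero_iff)
  define g where "g = (\<lambda>k. 1 - 1 / p ^ (k + 1 + u))"
  have "summable (\<lambda>k. norm (g k - 1))"
  proof -
    have "summable (\<lambda>k. (1 / p) ^ k * (1 / p ^ (1 + u)))"
      using p by (intro summable_mult2 summable_geometric) auto
    then show ?thesis using p by (simp add: g_def power_add power_divide mult_ac)
  qed
  then have "convergent_prod g"
    by (intro abs_convergent_prod_imp_convergent_prod summable_imp_abs_convergent_prod)
  then have "(\<lambda>m. \<Prod>k\<le>m. g k) \<longlonglongrightarrow> prodinf g" by (rule convergent_prod_LIMSEQ)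
  then have "(\<lambda>m. \<Prod>k<m. g k) \<longlonglongrightarrow> prodinf g"
    by (subst LIMSEQ_lessThan_iff_atMost)
  then have "(\<lambda>m. (\<Prod>k<m. g k) * f (1 / p ^ (m + u))) \<longlonglongrightarrow> prodinf g * 1"
    by (intro tendsto_mult f1)
  then have "(\<lambda>m. f (1 / p ^ u)) \<longlonglongrightarrow> prodinf g" using iter by (simp add: g_def)
  then have "f (1 / p ^ u) = prodinf g" by (simp add: LIMSEQ_const_iff)
  then show ?thesis using summable_sums[OF sumz[OF le1, of u]] by (simp add: f_def g_def)
qed

section \<open>Surjections onto a finite abelian group\<close>

lemma (in group) pow_mod_order:
  assumes "order G dvd q" "g \<in> carrier G"
  shows "g [^] (a mod q) = g [^] (a :: nat)"
proof -
  obtain d where d: "q = order G * d" using assms(1) by auto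
  have "g [^] a = g [^] (a mod q) \<otimes> g [^] (q * (a div q))"
    using assms(2) by (simp add: nat_pow_mult)
  also have "g [^] (q * (a div q)) = (g [^] order G) [^] (d * (a div q))"
    using assms(2) by (simp add: nat_pow_pow d mult.assoc)
  also have "\<dots> = \<one>" using pow_order_eq_1[OF assms(2)] by simp
  finally show ?thesis using assms(2) by simp
qed

lemma zvec_range: "q > 0 \<Longrightarrow> x \<in> carrier (zvec q n) \<Longrightarrow> i < n \<Longrightarrow> x i \<in> {0..<int q}"
  using PiE_mem[of x "{..<n}" "\<lambda>_. {0..<int q}" i] by (simp add: carrier_zvec)

text \<open>The divisibility makes B a module over Z/q. Tuples s in B then correspond to
  homomorphisms \<open>monomial n s\<close> from (Z/q)^n, where s i is the image of the i-th unit
  vector.\<close>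

locale finite_target = comm_group B for B (structure) +
  fixes q :: nat
  assumes fin: "finite (carrier B)" and q: "q > 1" and ord: "order B dvd q"
begin

definition "monomial n s x = finprod B (\<lambda>i. s i [^] nat (x i)) {..<n}"
definition "relations n s = {x \<in> carrier (zvec q n). monomial n s x = \<one>}"
definition "generating n = {s \<in> {..<n} \<rightarrow>\<^sub>E carrier B. monomial n s ` carrier (zvec q n) = carrier B}"

abbreviation "tuples n \<equiv> ({..<n} \<rightarrow>\<^sub>E carrier B)"

lemma q0: "q > 0" using q by simp

lemma tuples_mem: "s \<in> tuples n \<Longrightarrow> i < n \<Longrightarrow> s i \<in> carrier B"
  by (erule PiE_mem) simp

lemma monomial_closed: "s \<in> tuples n \<Longrightarrow> monomial n s x \<in> carrier B"
  unfolding monomial_def by (intro finprod_closed) auto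

lemma monomial_hom: assumes s: "s \<in> tuples n" shows "monomial n s \<in> hom (zvec q n) B"
proof (rule homI)
  fix x y assume x: "x \<in> carrier (zvec q n)" and y: "y \<in> carrier (zvec q n)"
  have sc: "s i \<in> carrier B" if "i < n" for i using s that by auto
  have "monomial n s (x \<otimes>\<^bsub>zvec q n\<^esub> y) = finprod B (\<lambda>i. s i [^] nat (x i) \<otimes> s i [^] nat (y i)) {..<n}"
    unfolding monomial_def
  proof (rule finprod_cong')
    fix i assume i: "i \<in> {..<n}"
    have "x i \<ge> 0" "y i \<ge> 0" using zvec_range[OF q0 x, of i] zvec_range[OF q0 y, of i] i by auto
    then have "nat ((x i + y i) mod int q) = (nat (x i) + nat (y i)) mod q"
      by (simp add: nat_mod_distrib nat_add_distrib)
    then show "s i [^] nat ((x \<otimes>\<^bsub>zvec q n\<^esub> y) i) = s i [^] nat (x i) \<otimes> s i [^] nat (y i)"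
      using i sc pow_mod_order[OF ord] by (simp add: mult_zvec nat_pow_mult)
  qed (use sc in auto)
  also have "\<dots> = monomial n s x \<otimes> monomial n s y"
    unfolding monomial_def using sc by (intro finprod_multf) auto
  finally show "monomial n s (x \<otimes>\<^bsub>zvec q n\<^esub> y) = monomial n s x \<otimes> monomial n s y" .
qed (rule monomial_closed[OF s])

lemma monomial_group_hom: "s \<in> tuples n \<Longrightarrow> group_hom (zvec q n) B (monomial n s)"
  using monomial_hom comm_group_zvec by (simp add: group_hom_def group_hom_axioms_def comm_group.axioms is_group)

lemma monomial_uvec:
  assumes "s \<in> tuples n" "i < n" shows "monomial n s (uvec q n i) = s i"
proof -
  have "monomial n s (uvec q n i) = finprod B (\<lambda>j. if j = i then s j else \<one>) {..<n}"
    unfolding monomial_def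
  proof (rule finprod_cong')
    show "(\<lambda>j. if j = i then s j else \<one>) \<in> {..<n} \<rightarrow> carrier B"
      using tuples_mem[OF assms(1)] by auto
    fix j assume "j \<in> {..<n}"
    then show "s j [^] nat (uvec q n i j) = (if j = i then s j else \<one>)"
      using tuples_mem[OF assms(1), of j] by (cases "j = i") (simp_all add: uvec_def)
  qed simp
  also have "\<dots> = s i"
    by (rule finprod_singleton_swap) (use assms tuples_mem[OF assms(1)] in auto)
  finally show ?thesis .
qed

lemma hom_eq_monomial:
  assumes h: "h \<in> hom (zvec q n) B" and x: "x \<in> carrier (zvec q n)"
  shows "h x = monomial n (\<lambda>i\<in>{..<n}. h (uvec q n i)) x"
proof -
  interpret Z: comm_group "zvec q n" by (rule comm_group_zvec)
  interpret H: group_hom "zvec q n" B h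
    using h Z.is_group is_group by (simp add: group_hom_def group_hom_axioms_def)
  have uc: "uvec q n i \<in> carrier (zvec q n)" for i by (rule uvec_in[OF q])
  have xr: "x i \<in> {0..<int q}" if "i < n" for i
    using zvec_range[OF q0 x that] .
  \<comment> \<open>x cut off after its first m coordinates; going from m to m + 1 adds a multiple
    of one unit vector.\<close>
  define t where "t = (\<lambda>m. \<lambda>i\<in>{..<n}. if i < m then x i else 0)"
  have "t m \<in> carrier (zvec q n) \<and> h (t m) = finprod B (\<lambda>i. h (uvec q n i) [^] nat (x i)) {..<m}" if "m \<le> n" for m
    using that
  proof (induction m)
    case 0
    have "t 0 = \<one>\<^bsub>zvec q n\<^esub>" by (simp add: t_def one_zvec)
    then show ?case by simp
  next
    case (Suc m)
    then have IH: "t m \<in> carrier (zvec q n)" "h (t m) = finprod B (\<lambda>i. h (uvec q n i) [^] nat (x i)) {..<m}" and m: "m < n"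
      by auto
    have x0: "x m \<ge> 0" "x m < int q" using xr[OF m] by auto
    have p: "uvec q n m [^]\<^bsub>zvec q n\<^esub> nat (x m) = (\<lambda>i\<in>{..<n}. (x m * of_bool (i = m)) mod int q)"
      unfolding pow_zvec[OF q0 uc] by (rule restrict_ext) (use x0 in \<open>simp add: uvec_def\<close>)
    have eq: "t (Suc m) = uvec q n m [^]\<^bsub>zvec q n\<^esub> nat (x m) \<otimes>\<^bsub>zvec q n\<^esub> t m"
      unfolding p mult_zvec using xr by (auto simp: t_def fun_eq_iff less_Suc_eq)
    have "h (t (Suc m)) = h (uvec q n m) [^] nat (x m) \<otimes> h (t m)"
      unfolding eq using uc IH by (simp add: H.hom_nat_pow)
    moreover have "finprod B (\<lambda>i. h (uvec q n i) [^] nat (x i)) {..<Suc m}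
        = h (uvec q n m) [^] nat (x m) \<otimes> finprod B (\<lambda>i. h (uvec q n i) [^] nat (x i)) {..<m}"
      unfolding lessThan_Suc using uc by (subst finprod_insert) auto
    moreover have "t (Suc m) \<in> carrier (zvec q n)" unfolding eq using uc IH by simp
    ultimately show ?case using IH by simp
  qed
  from this[of n] have "h (t n) = finprod B (\<lambda>i. h (uvec q n i) [^] nat (x i)) {..<n}" by simp
  moreover have "t n = x"
  proof
    fix i show "t n i = x i"
      using PiE_arb[OF x[unfolded carrier_zvec[OF q0]], of i] by (simp add: t_def)
  qed
  moreover have "monomial n (\<lambda>i\<in>{..<n}. h (uvec q n i)) x = finprod B (\<lambda>i. h (uvec q n i) [^] nat (x i)) {..<n}"
    unfolding monomial_def by (rule finprod_cong') (use uc in auto)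
  ultimately show ?thesis by simp
qed

lemma generating_tuples: "s \<in> generating n \<Longrightarrow> s \<in> tuples n" by (simp add: generating_def)

lemma relations_kernel: "relations n s = kernel (zvec q n) B (monomial n s)"
  by (simp add: relations_def kernel_def)

lemma subgroup_relations: "s \<in> tuples n \<Longrightarrow> subgroup (relations n s) (zvec q n)"
  unfolding relations_kernel by (rule group_hom.subgroup_kernel[OF monomial_group_hom])

lemma card_relations:
  assumes s: "s \<in> generating n" shows "card (relations n s) * order B = q ^ n"
proof -
  interpret group_hom "zvec q n" B "monomial n s" by (rule monomial_group_hom[OF generating_tuples[OF s]])
  show ?thesis
    using card_kernel_mult_image[OF finite_zvec[OF q0]] s card_zvec[OF q0]
    by (simp add: relations_kernel generating_def order_def)
qed

text \<open>A tuple s that does not generate takes values in a proper subgroup.\<close>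

lemma card_not_generating:
  "card (tuples n - generating n) * 2 ^ n \<le> 2 ^ order B * order B ^ n"
proof -
  define H where "H = {U. subgroup U B \<and> U \<noteq> carrier B}"
  have finH: "finite H" unfolding H_def
    by (rule finite_subset[of _ "Pow (carrier B)"]) (use fin subgroup.subset in auto)
  have finU: "finite U" if "U \<in> H" for U
    using that fin finite_subset subgroup.subset unfolding H_def by blast
  have "tuples n - generating n \<subseteq> (\<Union>U\<in>H. {..<n} \<rightarrow>\<^sub>E U)"
  proof
    fix s assume s: "s \<in> tuples n - generating n"
    interpret E: group_hom "zvec q n" B "monomial n s" by (rule monomial_group_hom) (use s in auto)
    let ?U = "monomial n s ` carrier (zvec q n)"
    have "subgroup ?U B" by (rule E.img_is_subgroup)
    then have "?U \<in> H" using s by (auto simp: H_def generating_def)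
    moreover have "s \<in> {..<n} \<rightarrow>\<^sub>E ?U"
    proof (rule PiE_I)
      fix i assume i: "i \<in> {..<n}"
      have "s i = monomial n s (uvec q n i)" using monomial_uvec[of s n i] s i by auto
      then show "s i \<in> ?U" using uvec_in[OF q] by blast
    next
      fix i assume "i \<notin> {..<n}"
      then show "s i = undefined" using s PiE_arb[of s "{..<n}"] by blast
    qed
    ultimately show "s \<in> (\<Union>U\<in>H. {..<n} \<rightarrow>\<^sub>E U)" by blast
  qed
  then have "card (tuples n - generating n) \<le> card (\<Union>U\<in>H. {..<n} \<rightarrow>\<^sub>E U)"
    by (rule card_mono[rotated]) (use finH finU in \<open>auto intro!: finite_PiE\<close>)
  also have "\<dots> \<le> (\<Sum>U\<in>H. card ({..<n} \<rightarrow>\<^sub>E U))" by (rule card_UN_le[OF finH])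
  also have "\<dots> = (\<Sum>U\<in>H. card U ^ n)" by (simp add: card_PiE)
  finally have "card (tuples n - generating n) * 2 ^ n \<le> (\<Sum>U\<in>H. card U ^ n) * 2 ^ n" by (rule mult_le_mono1)
  also have "\<dots> = (\<Sum>U\<in>H. (2 * card U) ^ n)" unfolding sum_distrib_right by (intro sum.cong refl) (simp add: power_mult_distrib)
  also have "\<dots> \<le> (\<Sum>U\<in>H. order B ^ n)"
  proof (intro sum_mono power_mono)
    fix U assume U: "U \<in> H"
    have "subgroup U B" using U by (simp add: H_def)
    then have "card U dvd order B" using lagrange by (metis dvd_triv_right)
    then obtain d where d: "order B = card U * d" by auto
    have "U \<subset> carrier B" using U subgroup.subset by (auto simp: H_def)
    then have "card U < order B" unfolding order_def using fin psubset_card_mono by blast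
    then have "d \<ge> 2" using d by (cases d rule: nat.exhaust; cases "d - 1") auto
    then show "2 * card U \<le> order B" unfolding d by (simp add: mult.commute)
  qed simp
  also have "\<dots> = card H * order B ^ n" by simp
  also have "card H \<le> card (Pow (carrier B))"
    unfolding H_def by (rule card_mono) (use fin subgroup.subset in auto)
  also have "card (Pow (carrier B)) = 2 ^ order B" using fin by (simp add: card_Pow order_def)
  finally show ?thesis by simp
qed

lemma monomial_auto:
  assumes s: "s \<in> tuples n" and a: "a \<in> hom B B" and x: "x \<in> carrier (zvec q n)"
  shows "monomial n (\<lambda>i\<in>{..<n}. a (s i)) x = a (monomial n s x)"
proof -
  have "a \<circ> monomial n s \<in> hom (zvec q n) B"
  proof (rule homI)
    show "(a \<circ> monomial n s) x \<in> carrier B" if "x \<in> carrier (zvec q n)" for x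
      using hom_in_carrier[OF a] monomial_closed[OF s] by simp
    fix x y assume xy: "x \<in> carrier (zvec q n)" "y \<in> carrier (zvec q n)"
    have "monomial n s (x \<otimes>\<^bsub>zvec q n\<^esub> y) = monomial n s x \<otimes> monomial n s y"
      using monomial_hom[OF s] xy by (simp add: hom_def)
    moreover have "a (monomial n s x \<otimes> monomial n s y) = a (monomial n s x) \<otimes> a (monomial n s y)"
      using a monomial_closed[OF s] by (simp add: hom_def)
    ultimately show "(a \<circ> monomial n s) (x \<otimes>\<^bsub>zvec q n\<^esub> y) = (a \<circ> monomial n s) x \<otimes> (a \<circ> monomial n s) y"
      by simp
  qed
  from hom_eq_monomial[OF this x] have "a (monomial n s x) = monomial n (\<lambda>i\<in>{..<n}. a (monomial n s (uvec q n i))) x" by simp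
  also have "(\<lambda>i\<in>{..<n}. a (monomial n s (uvec q n i))) = (\<lambda>i\<in>{..<n}. a (s i))"
    by (rule restrict_ext) (simp add: monomial_uvec[OF s])
  finally show ?thesis by (rule sym)
qed

text \<open>Two surjections with the same kernel differ by an automorphism.\<close>

lemma card_same_relations:
  assumes s0: "s0 \<in> generating n"
  shows "card {s \<in> generating n. relations n s = relations n s0} = card (auto B)"
proof -
  have S0: "s0 \<in> tuples n" by (rule generating_tuples[OF s0])
  let ?V = "carrier (zvec q n)"
  have surj0: "monomial n s0 ` ?V = carrier B" using s0 by (simp add: generating_def)
  define \<Phi> where "\<Phi> = (\<lambda>a :: 'a \<Rightarrow> 'a. \<lambda>i\<in>{..<n}. a (s0 i))"
  have ah: "a \<in> hom B B" "bij_betw a (carrier B) (carrier B)" "a \<in> extensional (carrier B)"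
    if "a \<in> auto B" for a using that by (auto simp: auto_def Bij_def)
  have evP: "monomial n (\<Phi> a) x = a (monomial n s0 x)" if "a \<in> auto B" "x \<in> ?V" for a x
    unfolding \<Phi>_def by (rule monomial_auto[OF S0 ah(1)[OF that(1)] that(2)])
  have "bij_betw \<Phi> (auto B) {s \<in> generating n. relations n s = relations n s0}"
  proof (rule bij_betw_imageI)
    show "inj_on \<Phi> (auto B)"
    proof (rule inj_onI)
      fix a b assume a: "a \<in> auto B" and b: "b \<in> auto B" and eq: "\<Phi> a = \<Phi> b"
      show "a = b"
      proof (rule extensionalityI[OF ah(3)[OF a] ah(3)[OF b]])
        fix y assume "y \<in> carrier B"
        then have "y \<in> monomial n s0 ` ?V" using surj0 by simp
        then obtain x where x: "y = monomial n s0 x" "x \<in> ?V" by (rule imageE)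
        then show "a y = b y" using evP[OF a x(2)] evP[OF b x(2)] eq by simp
      qed
    qed
    show "\<Phi> ` auto B = {s \<in> generating n. relations n s = relations n s0}"
    proof (rule equalityI; rule subsetI)
      fix s assume "s \<in> \<Phi> ` auto B"
      then obtain a where a: "a \<in> auto B" "s = \<Phi> a" by blast
      have ac: "a y \<in> carrier B" if "y \<in> carrier B" for y using ah(1)[OF a(1)] that by (auto simp: hom_def)
      have sS: "s \<in> tuples n"
        unfolding a(2) \<Phi>_def by (intro restrict_PiE_iff[THEN iffD2] ballI ac tuples_mem[OF S0]) simp
      have "monomial n s ` ?V = a ` (monomial n s0 ` ?V)" using evP[OF a(1)] by (auto simp: a(2) image_image)
      also have "\<dots> = carrier B" using surj0 ah(2)[OF a(1)] by (simp add: bij_betw_def)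
      finally have "s \<in> generating n" using sS by (simp add: generating_def)
      moreover have "relations n s = relations n s0"
      proof -
        have "a y = \<one> \<longleftrightarrow> y = \<one>" if "y \<in> carrier B" for y
        proof -
          have "a \<one> = \<one>" using hom_one[OF ah(1)[OF a(1)]] is_group by simp
          then show ?thesis using ah(2)[OF a(1)] that inj_onD[of a "carrier B" y \<one>] by (auto simp: bij_betw_def)
        qed
        then show ?thesis unfolding relations_def using evP[OF a(1)] monomial_closed[OF S0] by (auto simp: a(2))
      qed
      ultimately show "s \<in> {s \<in> generating n. relations n s = relations n s0}" by simp
    next
      fix s assume "s \<in> {s \<in> generating n. relations n s = relations n s0}"
      then have s: "s \<in> generating n" and eqk: "relations n s = relations n s0" by auto
      have sS: "s \<in> tuples n" by (rule generating_tuples[OF s])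
      interpret E0: group_hom "zvec q n" B "monomial n s0" by (rule monomial_group_hom[OF S0])
      interpret E: group_hom "zvec q n" B "monomial n s" by (rule monomial_group_hom[OF sS])
      have iff: "monomial n s x = monomial n s y \<longleftrightarrow> monomial n s0 x = monomial n s0 y" if x: "x \<in> ?V" "y \<in> ?V" for x y
      proof -
        let ?d = "x \<otimes>\<^bsub>zvec q n\<^esub> inv\<^bsub>zvec q n\<^esub> y"
        have "monomial n s x = monomial n s y \<longleftrightarrow> ?d \<in> relations n s"
          using x monomial_closed[OF sS] by (simp add: relations_def inv_solve_right')
        moreover have "monomial n s0 x = monomial n s0 y \<longleftrightarrow> ?d \<in> relations n s0"
          using x monomial_closed[OF S0] by (simp add: relations_def inv_solve_right')
        ultimately show ?thesis using eqk by simp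
      qed
      define l where "l = (\<lambda>y. SOME x. x \<in> ?V \<and> monomial n s0 x = y)"
      have l: "l y \<in> ?V \<and> monomial n s0 (l y) = y" if "y \<in> carrier B" for y
      proof -
        have "y \<in> monomial n s0 ` ?V" using surj0 that by simp
        then have "\<exists>x. x \<in> ?V \<and> monomial n s0 x = y" by (auto elim: imageE)
        then show ?thesis unfolding l_def by (rule someI_ex)
      qed
      \<comment> \<open>\<open>monomial n s\<close> factors through \<open>monomial n s0\<close>
        because the kernels agree; a is the induced map, computed at a chosen preimage.\<close>
      define a where "a = (\<lambda>y\<in>carrier B. monomial n s (l y))"
      have a_monomial: "a (monomial n s0 x) = monomial n s x" if x: "x \<in> ?V" for x
      proof -
        have c: "monomial n s0 x \<in> carrier B" by (rule monomial_closed[OF S0])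
        have "monomial n s0 (l (monomial n s0 x)) = monomial n s0 x" using l[OF c] by simp
        then have "monomial n s (l (monomial n s0 x)) = monomial n s x" using iff[of "l (monomial n s0 x)" x] l[OF c] x by simp
        then show ?thesis using c by (simp add: a_def)
      qed
      have "a \<in> hom B B"
      proof (rule homI)
        show "a y \<in> carrier B" if "y \<in> carrier B" for y using that monomial_closed[OF sS] by (simp add: a_def)
        fix y z assume y: "y \<in> carrier B" and z: "z \<in> carrier B"
        have "a (y \<otimes> z) = a (monomial n s0 (l y \<otimes>\<^bsub>zvec q n\<^esub> l z))" using l[OF y] l[OF z] by simp
        also have "\<dots> = monomial n s (l y \<otimes>\<^bsub>zvec q n\<^esub> l z)" using l[OF y] l[OF z] by (intro a_monomial) simp
        also have "\<dots> = a y \<otimes> a z" using l[OF y] l[OF z] y z by (simp add: a_def)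
        finally show "a (y \<otimes> z) = a y \<otimes> a z" .
      qed
      moreover have "bij_betw a (carrier B) (carrier B)"
      proof (rule bij_betw_imageI)
        show "inj_on a (carrier B)"
        proof (rule inj_onI)
          fix y z assume y: "y \<in> carrier B" and z: "z \<in> carrier B" and eq: "a y = a z"
          then have "monomial n s (l y) = monomial n s (l z)" by (simp add: a_def)
          then have "monomial n s0 (l y) = monomial n s0 (l z)" using iff[of "l y" "l z"] l[OF y] l[OF z] by simp
          then show "y = z" using l[OF y] l[OF z] by simp
        qed
        have "a ` carrier B = (\<lambda>x. a (monomial n s0 x)) ` ?V" unfolding surj0[symmetric] by (simp add: image_image)
        also have "\<dots> = monomial n s ` ?V" using a_monomial by (intro image_cong) auto
        also have "\<dots> = carrier B" using s by (simp add: generating_def)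
        finally show "a ` carrier B = carrier B" .
      qed
      ultimately have "a \<in> auto B" by (simp add: auto_def Bij_def a_def)
      moreover have "s = \<Phi> a"
      proof
        fix i show "s i = \<Phi> a i"
        proof (cases "i < n")
          case True
          have "a (s0 i) = monomial n s (uvec q n i)"
            using a_monomial[OF uvec_in[OF q], of i] monomial_uvec[OF S0 True] by simp
          then show ?thesis using monomial_uvec[OF sS True] True by (simp add: \<Phi>_def)
        next
          case False
          then show ?thesis using PiE_arb[OF sS, of i] by (simp add: \<Phi>_def)
        qed
      qed
      ultimately show "s \<in> \<Phi> ` auto B" by blast
    qed
  qed
  then show ?thesis by (rule bij_betw_same_card[symmetric])
qed

end

section \<open>Cokernels modulo powers of p\<close>

text \<open>x is invertible modulo every power of p. As these inverses are unique, they are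
  compatible and define an element of the inverse limit.\<close>

lemma padic_unit:
  fixes x :: "'p :: prime_card padic_int"
  assumes "\<not> of_nat CARD('p) dvd x"
  shows "\<exists>y. x * y = 1"
proof -
  let ?p = "int CARD('p)"
  have p: "Factorial_Ring.prime ?p" using prime_card[where 'a = 'p] by simp
  have nz: "padic_residue x (Suc 0) \<noteq> 0" using assms p_power_dvd_iff[of "Suc 0" x] by simp
  have r1: "padic_residue x k mod ?p = padic_residue x (Suc 0)" if "k > 0" for k
  proof -
    have "of_nat CARD('p) ^ Suc 0 dvd x - of_int (padic_residue x k)"
      using dvd_diff_of_int_residue[of k x] that
      by (meson Suc_leI dvd_trans le_imp_power_dvd)
    then have "padic_residue x (Suc 0) = padic_residue (of_int (padic_residue x k) :: 'p padic_int) (Suc 0)"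
      by (rule padic_residue_eq_iff[THEN iffD2])
    then show ?thesis by (simp add: padic_residue_of_int)
  qed
  have cop: "coprime (padic_residue x k) (?p ^ k)" for k
  proof (cases "k = 0")
    case False
    then have "\<not> ?p dvd padic_residue x k" using r1[of k] nz by (auto simp: dvd_eq_mod_eq_0)
    then have "coprime ?p (padic_residue x k)" using p by (intro prime_imp_coprime)
    then show ?thesis by (simp add: coprime_commute)
  qed simp
  have "\<exists>z. [padic_residue x k * z = 1] (mod ?p ^ k)" for k
    by (rule cong_solve_coprime_int[OF cop])
  then obtain z where z: "\<And>k. [padic_residue x k * z k = 1] (mod ?p ^ k)" by metis
  define y :: "'p padic_int" where "y = Abs_padic_int (\<lambda>k. z k mod ?p ^ k)"
  have "z (Suc k) mod ?p ^ Suc k mod ?p ^ k = z k mod ?p ^ k" for k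
  proof -
    have "[padic_residue x (Suc k) = padic_residue x k] (mod ?p ^ k)"
      using padic_residue_Suc[of x k] padic_residue_mod[of x k] by (simp add: cong_def)
    then have "[padic_residue x k * z (Suc k) = padic_residue x (Suc k) * z (Suc k)] (mod ?p ^ k)"
      by (intro cong_mult cong_refl) (rule cong_sym)
    also have "[padic_residue x (Suc k) * z (Suc k) = 1] (mod ?p ^ k)"
      using z[of "Suc k"] by (rule cong_dvd_modulus) simp
    also have "[1 = padic_residue x k * z k] (mod ?p ^ k)" using z[of k] by (rule cong_sym)
    finally have "[z (Suc k) = z k] (mod ?p ^ k)"
      using cong_mult_lcancel[OF cop[of k]] by blast
    then show ?thesis unfolding cong_def by (simp only: mod_mod_Suc_power)
  qed
  then have yr: "padic_residue y k = z k mod ?p ^ k" for k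
    unfolding y_def by (subst Abs_padic_int_inverse) auto
  have "x * y = 1"
  proof (rule padic_residue_inject[THEN iffD1], rule ext)
    fix k
    show "padic_residue (x * y) k = padic_residue (1 :: 'p padic_int) k"
      using z[of k] by (simp add: times_padic_int.rep_eq one_padic_int.rep_eq yr cong_def mod_mult_right_eq)
  qed
  then show ?thesis ..
qed

text \<open>The residue is moved to \<open>mod_ring\<close> to have a ring homomorphism, which
  commutes with determinants.\<close>

definition padic_mod_p :: "'p :: prime_card padic_int \<Rightarrow> 'p mod_ring" where
  "padic_mod_p x = of_int (padic_residue x 1)"

lemma of_int_mod_ring_mod: "of_int (a mod int CARD('p)) = (of_int a :: 'p :: prime_card mod_ring)"
proof -
  have "of_int (int CARD('p)) = (0 :: 'p mod_ring)" by simp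
  then show ?thesis
    by (metis (no_types, lifting) add.right_neutral div_mult_mod_eq mult_zero_right of_int_add of_int_mult add.commute)
qed

lemma padic_mod_p_hom: "comm_ring_hom (padic_mod_p :: 'p :: prime_card padic_int \<Rightarrow> 'p mod_ring)"
proof
  show "padic_mod_p (0 :: 'p padic_int) = 0" by (simp add: padic_mod_p_def padic_residue_simps)
  show "padic_mod_p (1 :: 'p padic_int) = 1"
    using of_int_mod_ring_mod[where 'p = 'p, of 1] by (simp add: padic_mod_p_def padic_residue_simps)
  show "padic_mod_p (x + y) = padic_mod_p x + padic_mod_p y" for x y :: "'p padic_int"
    using of_int_mod_ring_mod[where 'p = 'p] by (simp add: padic_mod_p_def padic_residue_simps)
  show "padic_mod_p (x * y) = padic_mod_p x * padic_mod_p y" for x y :: "'p padic_int"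
    using of_int_mod_ring_mod[where 'p = 'p] by (simp add: padic_mod_p_def padic_residue_simps)
qed

lemma padic_mod_p_dvd:
  assumes "of_nat CARD('p) dvd (x :: 'p :: prime_card padic_int)"
  shows "padic_mod_p x = 0"
proof -
  have "padic_residue x (Suc 0) = 0" using assms p_power_dvd_iff[of "Suc 0" x] by simp
  then show ?thesis by (simp add: padic_mod_p_def)
qed

text \<open>A matrix congruent to the identity modulo p has determinant congruent to 1 modulo p.\<close>

lemma invertible_one_minus_p:
  fixes W :: "'p :: prime_card padic_int Matrix.mat"
  assumes W: "W \<in> carrier_mat n n"
  shows "\<exists>U\<in>carrier_mat n n. (1\<^sub>m n - of_nat CARD('p) \<cdot>\<^sub>m W) * U = 1\<^sub>m n"
proof -
  let ?D = "1\<^sub>m n - of_nat CARD('p) \<cdot>\<^sub>m W"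
  interpret h: comm_ring_hom "padic_mod_p :: 'p padic_int \<Rightarrow> 'p mod_ring" by (rule padic_mod_p_hom)
  have D: "?D \<in> carrier_mat n n" using W by auto
  have "map_mat padic_mod_p ?D = (1\<^sub>m n :: 'p mod_ring Matrix.mat)"
  proof (rule eq_matI)
    fix i j assume ij: "i < dim_row (1\<^sub>m n :: 'p mod_ring Matrix.mat)" "j < dim_col (1\<^sub>m n :: 'p mod_ring Matrix.mat)"
    have "padic_mod_p (of_nat CARD('p) * W $$ (i, j)) = 0" by (rule padic_mod_p_dvd) simp
    then show "map_mat padic_mod_p ?D $$ (i, j) = (1\<^sub>m n :: 'p mod_ring Matrix.mat) $$ (i, j)"
      using ij W by (simp add: h.hom_minus)
  qed (use W in auto)
  then have "padic_mod_p (Determinant.det ?D) = 1"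
    using h.hom_det[of ?D] by simp
  then have "\<not> of_nat CARD('p) dvd Determinant.det ?D" using padic_mod_p_dvd by force
  then obtain c where c: "Determinant.det ?D * c = 1" using padic_unit by blast
  have A: "adj_mat ?D \<in> carrier_mat n n" "?D * adj_mat ?D = Determinant.det ?D \<cdot>\<^sub>m 1\<^sub>m n"
    using adj_mat[OF D] by auto
  have "?D * (c \<cdot>\<^sub>m adj_mat ?D) = c \<cdot>\<^sub>m (?D * adj_mat ?D)"
    by (rule mult_smult_distrib[OF D A(1)])
  also have "\<dots> = (c * Determinant.det ?D) \<cdot>\<^sub>m 1\<^sub>m n" unfolding A(2) by (intro eq_matI) auto
  also have "\<dots> = 1\<^sub>m n" using c by (intro eq_matI) (auto simp: mult.commute)
  finally have "?D * (c \<cdot>\<^sub>m adj_mat ?D) = 1\<^sub>m n" .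
  then show ?thesis using A(1) by (intro bexI[of _ "c \<cdot>\<^sub>m adj_mat ?D"]) auto
qed

text \<open>Nakayama's lemma: solving for the unit vectors leaves a matrix congruent to the identity
  modulo p, which is invertible.\<close>

lemma column_module_absorbs:
  fixes R :: "'p :: prime_card padic_int Matrix.mat"
  assumes R: "R \<in> carrier_mat n m"
    and z: "\<And>i. i < n \<Longrightarrow> \<exists>z\<in>carrier_vec m. \<forall>c<n.
      of_nat CARD('p) ^ Suc e dvd of_nat CARD('p) ^ e * unit_vec n i $ c - (R *\<^sub>v z) $ c"
    and x: "x \<in> carrier_vec n"
  shows "\<exists>y\<in>carrier_vec m. of_nat CARD('p) ^ e \<cdot>\<^sub>v x = R *\<^sub>v y"
proof -
  let ?p = "of_nat CARD('p) :: 'p padic_int"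
  have "\<forall>i\<in>{..<n}. \<exists>z. z \<in> carrier_vec m \<and> (\<forall>c<n. ?p ^ Suc e dvd ?p ^ e * unit_vec n i $ c - (R *\<^sub>v z) $ c)"
    using z by blast
  from bchoice[OF this] obtain zz where zz: "\<forall>i\<in>{..<n}. zz i \<in> carrier_vec m \<and>
      (\<forall>c<n. ?p ^ Suc e dvd ?p ^ e * unit_vec n i $ c - (R *\<^sub>v zz i) $ c)" ..
  have "\<forall>ci\<in>{..<n} \<times> {..<n}. \<exists>w. ?p ^ e * unit_vec n (snd ci) $ fst ci - (R *\<^sub>v zz (snd ci)) $ fst ci = ?p ^ Suc e * w"
    using zz by (auto simp: dvd_def)
  from bchoice[OF this] obtain ww where ww: "\<forall>ci\<in>{..<n} \<times> {..<n}.
      ?p ^ e * unit_vec n (snd ci) $ fst ci - (R *\<^sub>v zz (snd ci)) $ fst ci = ?p ^ Suc e * ww ci" ..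
  define Z where "Z = Matrix.mat m n (\<lambda>(j, i). zz i $ j)"
  define W where "W = Matrix.mat n n ww"
  have Z: "Z \<in> carrier_mat m n" and W: "W \<in> carrier_mat n n" by (auto simp: Z_def W_def)
  let ?D = "1\<^sub>m n - ?p \<cdot>\<^sub>m W"
  have D: "?D \<in> carrier_mat n n" using W by auto
  have eq: "?p ^ e \<cdot>\<^sub>m ?D = R * Z"
  proof (rule eq_matI)
    fix c i assume "c < dim_row (R * Z)" "i < dim_col (R * Z)"
    then have ci: "c < n" "i < n" using R Z by auto
    have zc: "zz i \<in> carrier_vec m" using zz ci by simp
    have "col Z i = zz i" using zc ci by (intro eq_vecI) (auto simp: Z_def)
    then have "(R * Z) $$ (c, i) = (R *\<^sub>v zz i) $ c" using R Z ci by simp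
    also have "\<dots> = ?p ^ e * unit_vec n i $ c - ?p ^ Suc e * ww (c, i)"
      using ww[THEN bspec, of "(c, i)"] ci by (simp add: algebra_simps)
    also have "\<dots> = (?p ^ e \<cdot>\<^sub>m ?D) $$ (c, i)"
      using ci W by (auto simp: W_def unit_vec_def algebra_simps)
    finally show "(?p ^ e \<cdot>\<^sub>m ?D) $$ (c, i) = (R * Z) $$ (c, i)" ..
  qed (use R Z W in auto)
  obtain U where U: "U \<in> carrier_mat n n" "?D * U = 1\<^sub>m n"
    using invertible_one_minus_p[OF W] by blast
  have "?p ^ e \<cdot>\<^sub>m 1\<^sub>m n = ?p ^ e \<cdot>\<^sub>m (?D * U)" using U by simp
  also have "\<dots> = (?p ^ e \<cdot>\<^sub>m ?D) * U" by (rule mult_smult_assoc_mat[symmetric, OF D U(1)])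
  also have "\<dots> = R * (Z * U)" unfolding eq by (rule assoc_mult_mat[OF R Z U(1)])
  finally have "(?p ^ e \<cdot>\<^sub>m 1\<^sub>m n) *\<^sub>v x = (R * (Z * U)) *\<^sub>v x" by simp
  moreover have "(?p ^ e \<cdot>\<^sub>m 1\<^sub>m n) *\<^sub>v x = ?p ^ e \<cdot>\<^sub>v x"
    using x by (intro eq_vecI) (auto simp: scalar_prod_smult_left)
  moreover have "(R * (Z * U)) *\<^sub>v x = R *\<^sub>v ((Z * U) *\<^sub>v x)"
    using R Z U x by (intro assoc_mult_mat_vec) auto
  moreover have "(Z * U) *\<^sub>v x \<in> carrier_vec m" using Z U x by auto
  ultimately show ?thesis by metis
qed

section \<open>Cokernels as images of (Z/q)^n\<close>

definition vec_residue :: "nat \<Rightarrow> nat \<Rightarrow> 'p :: prime_card padic_int Matrix.vec \<Rightarrow> nat \<Rightarrow> int" where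
  "vec_residue k n x = (\<lambda>i\<in>{..<n}. padic_residue (x $ i) k)"

definition vec_lift :: "nat \<Rightarrow> (nat \<Rightarrow> int) \<Rightarrow> 'p :: prime_card padic_int Matrix.vec" where
  "vec_lift n v = Matrix.vec n (\<lambda>i. of_int (v i))"

definition column_module :: "'p :: prime_card padic_int Matrix.mat \<Rightarrow> 'p padic_int Matrix.vec set" where
  "column_module R = (*\<^sub>v) R ` carrier_vec (dim_col R)"

lemma vec_residue_in: "vec_residue k n (x :: 'p :: prime_card padic_int Matrix.vec) \<in> carrier (zvec (CARD('p) ^ k) n)"
proof -
  have "CARD('p) ^ k > 0" using p_gt_1[where 'p = 'p] by simp
  then show ?thesis
    unfolding vec_residue_def carrier_zvec[OF \<open>CARD('p) ^ k > 0\<close>]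
    by (intro restrict_PiE_iff[THEN iffD2] ballI) (use padic_residue_range in auto)
qed

lemma vec_residue_add:
  fixes x y :: "'p :: prime_card padic_int Matrix.vec"
  assumes "x \<in> carrier_vec n" "y \<in> carrier_vec n"
  shows "vec_residue k n (x + y) = vec_residue k n x \<otimes>\<^bsub>zvec (CARD('p) ^ k) n\<^esub> vec_residue k n y"
  unfolding mult_zvec vec_residue_def
  by (rule restrict_ext) (use assms in \<open>simp add: plus_padic_int.rep_eq\<close>)

lemma vec_residue_eq_iff:
  fixes x y :: "'p :: prime_card padic_int Matrix.vec"
  shows "vec_residue k n x = vec_residue k n y \<longleftrightarrow> (\<forall>c<n. of_nat CARD('p) ^ k dvd x $ c - y $ c)"
proof -
  have "vec_residue k n x = vec_residue k n y \<longleftrightarrow> (\<forall>c<n. padic_residue (x $ c) k = padic_residue (y $ c) k)"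
    unfolding vec_residue_def by (auto simp: fun_eq_iff restrict_def)
  then show ?thesis by (simp only: padic_residue_eq_iff)
qed

lemma vec_lift_in: "vec_lift n v \<in> carrier_vec n" by (simp add: vec_lift_def)

lemma vec_residue_vec_lift:
  assumes "v \<in> carrier (zvec (CARD('p) ^ k) n)"
  shows "vec_residue k n (vec_lift n v :: 'p :: prime_card padic_int Matrix.vec) = v"
proof
  have q: "CARD('p) ^ k > 0" using p_gt_1[where 'p = 'p] by simp
  fix i show "vec_residue k n (vec_lift n v :: 'p padic_int Matrix.vec) i = v i"
  proof (cases "i < n")
    case True
    then have "v i \<in> {0..<int (CARD('p) ^ k)}" by (rule zvec_range[OF q assms])
    then show ?thesis using True by (simp add: vec_residue_def vec_lift_def padic_residue_of_int)
  next
    case False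
    then show ?thesis using PiE_arb[OF assms[unfolded carrier_zvec[OF q]], of i] by (simp add: vec_residue_def)
  qed
qed

lemma vec_residue_image: "vec_residue k n ` (carrier_vec n :: 'p :: prime_card padic_int Matrix.vec set) = carrier (zvec (CARD('p) ^ k) n)"
proof (rule equalityI; rule subsetI)
  fix v :: "nat \<Rightarrow> int" assume "v \<in> carrier (zvec (CARD('p) ^ k) n)"
  then have "v = vec_residue k n (vec_lift n v :: 'p padic_int Matrix.vec)" by (simp add: vec_residue_vec_lift)
  then show "v \<in> vec_residue k n ` (carrier_vec n :: 'p padic_int Matrix.vec set)"
    using vec_lift_in by (rule image_eqI)
qed (use vec_residue_in in auto)

lemma vec_residue_group_hom:
  "group_hom (monoid_vec TYPE('p :: prime_card padic_int) n) (zvec (CARD('p) ^ k) n) (vec_residue k n)"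
proof -
  interpret V: comm_group "monoid_vec TYPE('p padic_int) n" by (rule comm_group_vec)
  interpret Z: comm_group "zvec (CARD('p) ^ k) n" by (rule comm_group_zvec)
  show ?thesis
    by unfold_locales (auto simp: hom_def monoid_vec_simps vec_residue_add vec_residue_in)
qed

lemma subgroup_column_module:
  fixes R :: "'p :: prime_card padic_int Matrix.mat"
  assumes R: "R \<in> carrier_mat n m"
  shows "subgroup (column_module R) (monoid_vec TYPE('p padic_int) n)"
proof -
  interpret V: comm_group "monoid_vec TYPE('p padic_int) n" by (rule comm_group_vec)
  interpret W: comm_group "monoid_vec TYPE('p padic_int) m" by (rule comm_group_vec)
  interpret h: group_hom "monoid_vec TYPE('p padic_int) m" "monoid_vec TYPE('p padic_int) n" "(*\<^sub>v) R"
    by unfold_locales (use R mult_add_distrib_mat_vec[OF R] in \<open>auto simp: hom_def monoid_vec_simps\<close>)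
  show ?thesis using h.img_is_subgroup R by (simp add: column_module_def monoid_vec_simps)
qed

lemma cok_altdef: "R \<in> carrier_mat n m \<Longrightarrow> cok R = monoid_vec TYPE('p :: prime_card padic_int) n Mod column_module R"
  by (auto simp: cok_def column_module_def)

lemma padic_dvd_vecE:
  fixes x :: "'p :: prime_card padic_int Matrix.vec"
  assumes x: "x \<in> carrier_vec n" and "\<And>c. c < n \<Longrightarrow> d dvd x $ c"
  obtains w where "w \<in> carrier_vec n" "x = d \<cdot>\<^sub>v w"
proof -
  have "\<forall>c\<in>{..<n}. \<exists>w. x $ c = d * w" using assms(2) by (auto simp: dvd_def)
  from bchoice[OF this] obtain f where f: "\<forall>c\<in>{..<n}. x $ c = d * f c" ..
  have "x = d \<cdot>\<^sub>v Matrix.vec n f" using x f by (intro eq_vecI) auto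
  moreover have "Matrix.vec n f \<in> carrier_vec n" by simp
  ultimately show ?thesis using that by blast
qed

context finite_target
begin

text \<open>Reduction modulo q followed by the surjection onto B has as kernel the vectors congruent
  modulo q to some element of the column module. Since \<open>p ^ e\<close> kills B, each unit
  vector times \<open>p ^ e\<close> lies in this kernel. Then \<open>column_module_absorbs\<close>
  puts all multiples of \<open>p ^ e\<close>, in particular those of q, into the column module,
  which is therefore the kernel.\<close>

lemma relations_eq_imp_cok_iso:
  fixes R :: "'p :: prime_card padic_int Matrix.mat"
  assumes qp: "q = CARD('p) ^ Suc e" and ordp: "order B = CARD('p) ^ e"
    and R: "R \<in> carrier_mat n m" and s: "s \<in> generating n"
    and relations: "relations n s = vec_residue (Suc e) n ` column_module R"
  shows "cok R \<cong> B"
proof -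
  let ?V = "monoid_vec TYPE('p padic_int) n"
  interpret V: comm_group ?V by (rule comm_group_vec)
  have S: "s \<in> tuples n" by (rule generating_tuples[OF s])
  interpret r: group_hom ?V "zvec q n" "vec_residue (Suc e) n" unfolding qp by (rule vec_residue_group_hom)
  have vin: "vec_residue (Suc e) n x \<in> carrier (zvec q n)" for x :: "'p padic_int Matrix.vec"
    unfolding qp by (rule vec_residue_in)
  interpret E: group_hom "zvec q n" B "monomial n s" by (rule monomial_group_hom[OF S])
  define f where "f = (\<lambda>x :: 'p padic_int Matrix.vec. monomial n s (vec_residue (Suc e) n x))"
  interpret f: group_hom ?V B f
    by unfold_locales (auto simp: hom_def f_def)
  have "f ` carrier ?V = monomial n s ` (vec_residue (Suc e) n ` (carrier_vec n :: 'p padic_int Matrix.vec set))"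
    by (simp add: f_def image_image monoid_vec_simps)
  also have "\<dots> = carrier B" unfolding vec_residue_image qp[symmetric] using s by (simp add: generating_def)
  finally have surj: "f ` carrier ?V = carrier B" .
  have absorb: "\<exists>y\<in>carrier_vec m. of_nat CARD('p) ^ e \<cdot>\<^sub>v x = R *\<^sub>v y" if "x \<in> carrier_vec n" for x
  proof (rule column_module_absorbs[OF R _ that])
    fix i assume i: "i < n"
    let ?u = "of_nat CARD('p) ^ e \<cdot>\<^sub>v unit_vec n i :: 'p padic_int Matrix.vec"
    have "monomial n s (vec_residue (Suc e) n ?u) = finprod B (\<lambda>i. \<one>) {..<n}"
      unfolding monomial_def
    proof (rule finprod_cong')
      fix j assume j: "j \<in> {..<n}"
      have sj: "s j \<in> carrier B" using tuples_mem[OF S] j by simp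
      have pe: "s j [^] (CARD('p) ^ e) = \<one>" using pow_order_eq_1[OF sj] ordp by simp
      show "s j [^] nat (vec_residue (Suc e) n ?u j) = \<one>"
      proof (cases "j = i")
        case True
        have "vec_residue (Suc e) n ?u j = padic_residue (of_nat (CARD('p) ^ e) :: 'p padic_int) (Suc e)"
          using j True by (simp add: vec_residue_def)
        also have "\<dots> = int (CARD('p) ^ e) mod int CARD('p) ^ Suc e" by (rule padic_residue_of_nat)
        also have "\<dots> = int (CARD('p) ^ e)" using p_gt_1[where 'p = 'p] by simp
        finally have "nat (vec_residue (Suc e) n ?u j) = CARD('p) ^ e" by (simp only: nat_int)
        then show ?thesis by (simp only: pe)
      next
        case False
        then have "unit_vec n i $ j = (0 :: 'p padic_int)" using j by (simp add: unit_vec_def)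
        then have "vec_residue (Suc e) n ?u j = 0" using j by (simp add: vec_residue_def padic_residue_simps)
        then show ?thesis by simp
      qed
    qed auto
    then have "monomial n s (vec_residue (Suc e) n ?u) = \<one>" by simp
    then have "vec_residue (Suc e) n ?u \<in> relations n s" using vin[of ?u] by (simp add: relations_def)
    then obtain y where y: "y \<in> column_module R" "vec_residue (Suc e) n ?u = vec_residue (Suc e) n y" unfolding relations by auto
    then obtain z where z: "z \<in> carrier_vec m" "y = R *\<^sub>v z" using R by (auto simp: column_module_def)
    show "\<exists>z\<in>carrier_vec m. \<forall>c<n. of_nat CARD('p) ^ Suc e dvd
        of_nat CARD('p) ^ e * unit_vec n i $ c - (R *\<^sub>v z) $ c"
    proof (intro bexI[OF _ z(1)] allI impI)
      fix c assume c: "c < n"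
      have "of_nat CARD('p) ^ Suc e dvd ?u $ c - y $ c" using y(2) c unfolding vec_residue_eq_iff by blast
      moreover have "?u $ c = of_nat CARD('p) ^ e * unit_vec n i $ c"
        using c by (intro index_smult_vec) simp
      ultimately show "of_nat CARD('p) ^ Suc e dvd of_nat CARD('p) ^ e * unit_vec n i $ c - (R *\<^sub>v z) $ c"
        using z(2) by simp
    qed
  qed
  have cm: "column_module R \<subseteq> carrier_vec n" using R by (auto simp: column_module_def)
  have "kernel ?V B f = column_module R"
  proof (rule equalityI; rule subsetI)
    fix x assume "x \<in> kernel ?V B f"
    then have x: "x \<in> carrier_vec n" "monomial n s (vec_residue (Suc e) n x) = \<one>"
      by (auto simp: kernel_def f_def monoid_vec_simps)
    then have "vec_residue (Suc e) n x \<in> relations n s" using vin[of x] by (simp add: relations_def)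
    then obtain y where y: "y \<in> column_module R" "vec_residue (Suc e) n x = vec_residue (Suc e) n y" unfolding relations by auto
    then obtain z where z: "z \<in> carrier_vec m" "y = R *\<^sub>v z" using R by (auto simp: column_module_def)
    have yc: "y \<in> carrier_vec n" using y cm by auto
    have "x - y \<in> carrier_vec n" using x yc by simp
    moreover have "of_nat CARD('p) ^ Suc e dvd (x - y) $ c" if "c < n" for c
      using y(2) that x yc unfolding vec_residue_eq_iff by simp
    ultimately obtain w where w: "w \<in> carrier_vec n" "x - y = of_nat CARD('p) ^ Suc e \<cdot>\<^sub>v w"
      by (rule padic_dvd_vecE)
    have "of_nat CARD('p) \<cdot>\<^sub>v w \<in> carrier_vec n" using w by simp
    then obtain y' where y': "y' \<in> carrier_vec m" "of_nat CARD('p) ^ e \<cdot>\<^sub>v (of_nat CARD('p) \<cdot>\<^sub>v w) = R *\<^sub>v y'"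
      using absorb by blast
    have "of_nat CARD('p) ^ e \<cdot>\<^sub>v (of_nat CARD('p) \<cdot>\<^sub>v w) = x - y"
      unfolding w(2) using w(1) by (simp add: smult_smult_assoc mult.commute)
    then have "x - y = R *\<^sub>v y'" using y' by simp
    moreover have "x = y + (x - y)" using x yc by (intro eq_vecI) auto
    ultimately have "x = R *\<^sub>v (z + y')"
      using z y' by (simp add: mult_add_distrib_mat_vec[OF R])
    moreover have "z + y' \<in> carrier_vec (dim_col R)" using z y' R by simp
    ultimately show "x \<in> column_module R" unfolding column_module_def by blast
  next
    fix x assume x: "x \<in> column_module R"
    then have "vec_residue (Suc e) n x \<in> relations n s" unfolding relations by blast
    then show "x \<in> kernel ?V B f" using x cm by (auto simp: kernel_def f_def relations_def monoid_vec_simps)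
  qed
  then show ?thesis
    using f.FactGroup_iso[OF surj] cok_altdef[OF R] by simp
qed

text \<open>As q kills B, the quotient map onto the cokernel, identified with B, depends only on the
  residues modulo q. The induced homomorphism on (Z/q)^n is the surjection sought.\<close>

lemma cok_iso_imp_relations_eq:
  fixes R :: "'p :: prime_card padic_int Matrix.mat"
  assumes qp: "q = CARD('p) ^ Suc e"
    and R: "R \<in> carrier_mat n m" and iso: "cok R \<cong> B"
  shows "\<exists>s\<in>generating n. relations n s = vec_residue (Suc e) n ` column_module R"
proof -
  let ?V = "monoid_vec TYPE('p padic_int) n"
  interpret V: comm_group ?V by (rule comm_group_vec)
  interpret r: group_hom ?V "zvec q n" "vec_residue (Suc e) n" unfolding qp by (rule vec_residue_group_hom)
  have L: "subgroup (column_module R) ?V" by (rule subgroup_column_module[OF R])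
  interpret L: normal "column_module R" ?V by (rule V.subgroup_imp_normal[OF L])
  obtain \<phi> where \<phi>: "\<phi> \<in> iso (?V Mod column_module R) B"
    using iso unfolding is_iso_def cok_altdef[OF R] by blast
  define g where "g = (\<lambda>x. \<phi> (column_module R #>\<^bsub>?V\<^esub> x))"
  have gh: "g \<in> hom ?V B"
  proof -
    have "\<phi> \<in> hom (?V Mod column_module R) B" using \<phi> by (simp add: iso_def)
    then show ?thesis using L.r_coset_hom_Mod by (auto simp: g_def hom_def)
  qed
  interpret g: group_hom ?V B g using gh by unfold_locales
  have cF: "carrier (?V Mod column_module R) = (\<lambda>x. column_module R #>\<^bsub>?V\<^esub> x) ` carrier ?V"
    by (auto simp: FactGroup_def RCOSETS_def)
  have bij: "bij_betw \<phi> (carrier (?V Mod column_module R)) (carrier B)" using \<phi> by (simp add: iso_def)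
  have gsurj: "g ` carrier ?V = carrier B"
    using bij unfolding bij_betw_def cF by (simp add: image_image g_def)
  have oneF: "\<one>\<^bsub>?V Mod column_module R\<^esub> = column_module R" by (simp add: FactGroup_def)
  have gker: "g x = \<one> \<longleftrightarrow> x \<in> column_module R" if x: "x \<in> carrier ?V" for x
  proof -
    have "\<phi> (column_module R) = \<one>"
      using hom_one[of \<phi> "?V Mod column_module R" B] \<phi> L.factorgroup_is_group is_group oneF by (simp add: iso_def)
    then have "g x = \<one> \<longleftrightarrow> \<phi> (column_module R #>\<^bsub>?V\<^esub> x) = \<phi> (column_module R)" by (simp add: g_def)
    also have "\<dots> \<longleftrightarrow> column_module R #>\<^bsub>?V\<^esub> x = column_module R"
    proof (rule inj_on_eq_iff)
      show "inj_on \<phi> (carrier (?V Mod column_module R))" using bij by (simp add: bij_betw_def)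
      show "column_module R #>\<^bsub>?V\<^esub> x \<in> carrier (?V Mod column_module R)" using x cF by blast
      show "column_module R \<in> carrier (?V Mod column_module R)"
        using group.is_monoid[OF L.factorgroup_is_group] monoid.one_closed oneF by metis
    qed
    also have "\<dots> \<longleftrightarrow> x \<in> column_module R"
      using V.coset_join1[OF _ x L] V.coset_join2[OF x L] subgroup.subset[OF L] by blast
    finally show ?thesis .
  qed
  have gres: "g x = g y" if xy: "x \<in> carrier_vec n" "y \<in> carrier_vec n" "vec_residue (Suc e) n x = vec_residue (Suc e) n y" for x y
  proof -
    have "x - y \<in> carrier_vec n" using xy by simp
    moreover have "of_nat CARD('p) ^ Suc e dvd (x - y) $ c" if "c < n" for c
      using xy that unfolding vec_residue_eq_iff by simp
    ultimately obtain w where w: "w \<in> carrier_vec n" "x - y = of_nat CARD('p) ^ Suc e \<cdot>\<^sub>v w"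
      by (rule padic_dvd_vecE)
    have pw: "w [^]\<^bsub>?V\<^esub> (a :: nat) = of_nat a \<cdot>\<^sub>v w" for a
    proof (induction a)
      case 0
      then show ?case using w by (intro eq_vecI) (auto simp: monoid_vec_def)
    next
      case (Suc a)
      then show ?case using w by (intro eq_vecI) (auto simp: monoid_vec_simps algebra_simps)
    qed
    have gw: "g w \<in> carrier B" using w by (simp add: monoid_vec_simps)
    have "x - y = w [^]\<^bsub>?V\<^esub> q" unfolding pw w(2) qp by simp
    then have "g (x - y) = g w [^] q" using w by (simp add: g.hom_nat_pow monoid_vec_simps)
    also have "\<dots> = \<one>" using pow_mod_order[OF ord gw, of q] by simp
    finally have 1: "g (x - y) = \<one>" .
    have "x = (x - y) \<otimes>\<^bsub>?V\<^esub> y" using xy by (intro eq_vecI) (auto simp: monoid_vec_simps)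
    then have "g x = g (x - y) \<otimes> g y" using xy g.hom_mult[of "x - y" y] by (simp add: monoid_vec_simps)
    then show ?thesis using 1 xy by (simp add: monoid_vec_simps)
  qed
  define h where "h = (\<lambda>v. g (vec_lift n v))"
  have hres: "h (vec_residue (Suc e) n x) = g x" if "x \<in> carrier_vec n" for x
    unfolding h_def by (rule gres[OF vec_lift_in that vec_residue_vec_lift[OF vec_residue_in]])
  have vex: "\<exists>x\<in>carrier_vec n. v = vec_residue (Suc e) n (x :: 'p padic_int Matrix.vec)" if "v \<in> carrier (zvec q n)" for v
    using that unfolding qp vec_residue_image[symmetric] by blast
  have hh: "h \<in> hom (zvec q n) B"
  proof (rule homI)
    fix v assume "v \<in> carrier (zvec q n)"
    then obtain x :: "'p padic_int Matrix.vec" where "x \<in> carrier_vec n" "v = vec_residue (Suc e) n x" using vex by blast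
    then show "h v \<in> carrier B" using hres by (simp add: monoid_vec_simps)
  next
    fix v w assume "v \<in> carrier (zvec q n)" "w \<in> carrier (zvec q n)"
    then obtain x y :: "'p padic_int Matrix.vec" where xy: "x \<in> carrier_vec n" "v = vec_residue (Suc e) n x"
      "y \<in> carrier_vec n" "w = vec_residue (Suc e) n y" using vex by metis
    have "v \<otimes>\<^bsub>zvec q n\<^esub> w = vec_residue (Suc e) n (x + y)" using xy by (simp add: vec_residue_add qp)
    then show "h (v \<otimes>\<^bsub>zvec q n\<^esub> w) = h v \<otimes> h w"
      using xy hres g.hom_mult[of x y] by (simp add: monoid_vec_simps)
  qed
  define s where "s = (\<lambda>i\<in>{..<n}. h (uvec q n i))"
  have evs: "monomial n s v = h v" if "v \<in> carrier (zvec q n)" for v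
    using hom_eq_monomial[OF hh that] by (simp add: s_def)
  have S: "s \<in> tuples n"
    unfolding s_def by (intro restrict_PiE_iff[THEN iffD2] ballI hom_in_carrier[OF hh] uvec_in[OF q])
  have "monomial n s ` carrier (zvec q n) = h ` (vec_residue (Suc e) n ` (carrier_vec n :: 'p padic_int Matrix.vec set))"
    unfolding vec_residue_image qp[symmetric] using evs by (intro image_cong) auto
  also have "\<dots> = g ` carrier_vec n" using hres by (simp add: image_image)
  also have "\<dots> = carrier B" using gsurj by (simp add: monoid_vec_simps)
  finally have gen: "s \<in> generating n" using S by (simp add: generating_def)
  have cm: "column_module R \<subseteq> carrier_vec n" using R by (auto simp: column_module_def)
  have "relations n s = vec_residue (Suc e) n ` column_module R"
  proof (rule equalityI; rule subsetI)
    fix v assume "v \<in> relations n s"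
    then have v: "v \<in> carrier (zvec q n)" "h v = \<one>" using evs by (auto simp: relations_def)
    then obtain x :: "'p padic_int Matrix.vec" where x: "x \<in> carrier_vec n" "v = vec_residue (Suc e) n x" using vex by blast
    then have "g x = \<one>" using v hres by simp
    then have "x \<in> column_module R" using gker x by (simp add: monoid_vec_simps)
    then show "v \<in> vec_residue (Suc e) n ` column_module R" using x by blast
  next
    fix v assume "v \<in> vec_residue (Suc e) n ` column_module R"
    then obtain x where x: "x \<in> column_module R" "v = vec_residue (Suc e) n x" by blast
    have xc: "x \<in> carrier_vec n" using x cm by auto
    have "v \<in> carrier (zvec q n)" unfolding x(2) qp by (rule vec_residue_in)
    moreover have "h v = \<one>" using hres[OF xc] gker[of x] x xc by (simp add: monoid_vec_simps)
    ultimately show "v \<in> relations n s" using evs by (simp add: relations_def)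
  qed
  then show ?thesis using gen by blast
qed

end

section \<open>Row vectors killing a matrix\<close>

text \<open>A list of r row vectors read coordinatewise: position c becomes the homomorphism on
  (Z/q)^r that sends g to coordinate c of the combination of the rows with coefficients g. This is
  the shape of F in \<open>random_matrix_limit\<close>.\<close>

definition row_homs :: "nat \<Rightarrow> nat \<Rightarrow> (nat \<Rightarrow> int) list \<Rightarrow> nat \<Rightarrow> (nat \<Rightarrow> int) \<Rightarrow> int" where
  "row_homs q n rs =
     (\<lambda>c\<in>{..<n}. \<lambda>g\<in>carrier (zvec q (length rs)). dot q (length rs) g (\<lambda>a. (rs ! a) c))"

lemma row_homs_in:
  assumes q: "q > 0"
  shows "row_homs q n rs \<in> {..<n} \<rightarrow>\<^sub>E mod_homs (zvec q (length rs)) q"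
proof -
  interpret comm_group "zvec q (length rs)" by (rule comm_group_zvec)
  have "(\<lambda>g\<in>carrier (zvec q (length rs)). dot q (length rs) g y) \<in> mod_homs (zvec q (length rs)) q" for y
    using dot_range[OF q] dot_mult by (auto simp: mod_homs_def)
  then show ?thesis unfolding row_homs_def by (intro restrict_PiE_iff[THEN iffD2] ballI)
qed

lemma pairing_row_homs:
  assumes g: "g \<in> carrier (zvec q (length rs))"
  shows "pairing q n (row_homs q n rs) x g = (\<Sum>a<length rs. g a * dot q n x (rs ! a)) mod int q"
proof -
  let ?r = "length rs"
  have "[(\<Sum>c<n. row_homs q n rs c g * x c) = (\<Sum>c<n. (\<Sum>a<?r. g a * (rs ! a) c) * x c)] (mod int q)"
    by (intro cong_sum cong_mult cong_refl) (simp add: row_homs_def g dot_def cong_def)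
  also have "(\<Sum>c<n. (\<Sum>a<?r. g a * (rs ! a) c) * x c) = (\<Sum>a<?r. g a * (\<Sum>c<n. x c * (rs ! a) c))"
    unfolding sum_distrib_left sum_distrib_right by (subst sum.swap) (simp add: ac_simps)
  also have "[\<dots> = (\<Sum>a<?r. g a * dot q n x (rs ! a))] (mod int q)"
    by (intro cong_sum cong_mult cong_refl) (simp add: dot_def cong_def)
  finally show ?thesis by (simp add: pairing_def cong_def)
qed

lemma row_homs_uvec:
  assumes q: "q > 1" and rs: "set rs \<subseteq> carrier (zvec q n)" and a: "a < length rs" and c: "c < n"
  shows "row_homs q n rs c (uvec q (length rs) a) = (rs ! a) c"
proof -
  have "rs ! a \<in> carrier (zvec q n)" using rs a by auto
  then have "(rs ! a) c \<in> {0..<int q}" using zvec_range[of q "rs ! a" n c] q c by simp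
  then show ?thesis using a c uvec_in[OF q, of "length rs" a] by (simp add: row_homs_def dot_uvec)
qed

lemma pairing_row_homs_zero_iff:
  assumes q: "q > 1" and rs: "set rs \<subseteq> carrier (zvec q n)"
  shows "(\<forall>g\<in>carrier (zvec q (length rs)). pairing q n (row_homs q n rs) x g = 0) \<longleftrightarrow>
    (\<forall>y\<in>set rs. dot q n x y = 0)"
proof
  assume 0: "\<forall>g\<in>carrier (zvec q (length rs)). pairing q n (row_homs q n rs) x g = 0"
  show "\<forall>y\<in>set rs. dot q n x y = 0"
  proof
    fix y assume "y \<in> set rs"
    then obtain a where a: "a < length rs" "y = rs ! a" by (metis in_set_conv_nth)
    have "pairing q n (row_homs q n rs) x (uvec q (length rs) a) = dot q n x y"
      unfolding pairing_def dot_def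
      by (intro arg_cong[where f = "\<lambda>t. t mod int q"] sum.cong refl)
        (simp add: row_homs_uvec[OF q rs a(1)] a(2) mult.commute)
    then show "dot q n x y = 0" using bspec[OF 0 uvec_in[OF q]] by metis
  qed
next
  assume "\<forall>y\<in>set rs. dot q n x y = 0"
  then show "\<forall>g\<in>carrier (zvec q (length rs)). pairing q n (row_homs q n rs) x g = 0"
    by (simp add: pairing_row_homs)
qed

lemma row_homs_inj:
  assumes q: "q > 1" and rs: "set rs \<subseteq> carrier (zvec q n)" "set rs' \<subseteq> carrier (zvec q n)"
    and len: "length rs = length rs'" and eq: "row_homs q n rs = row_homs q n rs'"
  shows "rs = rs'"
proof (rule nth_equalityI[OF len])
  fix a assume a: "a < length rs"
  have q0: "q > 0" using q by simp
  have "rs ! a \<in> carrier (zvec q n)" "rs' ! a \<in> carrier (zvec q n)" using rs a len by auto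
  then have E: "rs ! a \<in> {..<n} \<rightarrow>\<^sub>E {0..<int q}" "rs' ! a \<in> {..<n} \<rightarrow>\<^sub>E {0..<int q}"
    by (simp_all only: carrier_zvec[OF q0])
  show "rs ! a = rs' ! a"
  proof (rule PiE_ext[OF E])
    fix c assume "c \<in> {..<n}"
    then show "(rs ! a) c = (rs' ! a) c"
      using row_homs_uvec[OF q rs(1) a, of c] row_homs_uvec[OF q rs(2), of a c] a len eq by simp
  qed
qed

text \<open>Sending g to the combination of the rows with coefficients g has the annihilator as
  kernel and the span of the rows as image. That a combination belongs to the generated subgroup is
  checked through the double annihilator.\<close>

lemma card_row_homs_kernel:
  assumes q: "q > 1" and rs: "set rs \<subseteq> carrier (zvec q n)"
  shows "card {g \<in> carrier (zvec q (length rs)). \<forall>c<n. row_homs q n rs c g = 0}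
    * card (generate (zvec q n) (set rs)) = q ^ length rs"
proof -
  let ?G = "zvec q (length rs)" and ?V = "zvec q n"
  have q0: "q > 0" using q by simp
  interpret G: comm_group ?G by (rule comm_group_zvec)
  interpret V: comm_group ?V by (rule comm_group_zvec)
  define h where "h = (\<lambda>g. \<lambda>c\<in>{..<n}. row_homs q n rs c g)"
  have hm: "row_homs q n rs c \<in> mod_homs ?G q" if "c \<in> {..<n}" for c
    by (rule PiE_mem[OF row_homs_in[OF q0] that])
  have "h \<in> hom ?G ?V"
  proof (rule homI)
    fix g assume "g \<in> carrier ?G"
    then show "h g \<in> carrier ?V"
      unfolding carrier_zvec[OF q0, of n] h_def
      by (intro restrict_PiE_iff[THEN iffD2] ballI mod_homs_range[OF hm])
  next
    fix g g' assume g: "g \<in> carrier ?G" "g' \<in> carrier ?G"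
    have "h g \<otimes>\<^bsub>?V\<^esub> h g' = (\<lambda>c\<in>{..<n}. (h g c + h g' c) mod int q)" by (rule mult_zvec)
    also have "\<dots> = h (g \<otimes>\<^bsub>?G\<^esub> g')"
      unfolding h_def by (rule restrict_ext) (use mod_homs_mult[OF hm g] in simp)
    finally show "h (g \<otimes>\<^bsub>?G\<^esub> g') = h g \<otimes>\<^bsub>?V\<^esub> h g'" ..
  qed
  then interpret h: group_hom ?G ?V h by unfold_locales
  have ker: "kernel ?G ?V h = {g \<in> carrier ?G. \<forall>c<n. row_homs q n rs c g = 0}"
    unfolding kernel_def one_zvec h_def by (auto simp: fun_eq_iff restrict_def)
  have H: "subgroup (generate ?V (set rs)) ?V" by (rule V.generate_is_subgroup[OF rs])
  have "h ` carrier ?G = generate ?V (set rs)"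
  proof (rule equalityI)
    show "h ` carrier ?G \<subseteq> generate ?V (set rs)"
    proof (rule image_subsetI)
      fix g assume g: "g \<in> carrier ?G"
      have "dot q n x (h g) = 0" if x: "x \<in> perp q n (generate ?V (set rs))" for x
      proof -
        have "\<forall>y\<in>set rs. dot q n x y = 0"
          using x generate.incl[of _ "set rs" ?V] by (simp add: perp_def dot_commute[of q n x])
        then have "pairing q n (row_homs q n rs) x g = 0"
          using pairing_row_homs_zero_iff[OF q rs, of x] g by blast
        moreover have "pairing q n (row_homs q n rs) x g = dot q n x (h g)"
          by (simp add: pairing_def dot_def h_def mult.commute)
        ultimately show ?thesis by simp
      qed
      then have "h g \<in> perp q n (perp q n (generate ?V (set rs)))"
        using h.hom_closed[OF g] unfolding perp_def[of q n "perp q n (generate ?V (set rs))"] by simp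
      then show "h g \<in> generate ?V (set rs)" by (simp only: perp_perp[OF q H])
    qed
    show "generate ?V (set rs) \<subseteq> h ` carrier ?G"
    proof (rule V.generate_subgroup_incl[OF _ h.img_is_subgroup], rule subsetI)
      fix y assume y: "y \<in> set rs"
      then obtain a where a: "a < length rs" "y = rs ! a" by (metis in_set_conv_nth)
      have yE: "y \<in> {..<n} \<rightarrow>\<^sub>E {0..<int q}" using y rs carrier_zvec[OF q0, of n] by blast
      have "y = h (uvec q (length rs) a)"
      proof
        fix c show "y c = h (uvec q (length rs) a) c"
          using row_homs_uvec[OF q rs a(1), of c] a(2) PiE_arb[OF yE, of c] by (cases "c < n") (simp_all add: h_def)
      qed
      then show "y \<in> h ` carrier ?G" using uvec_in[OF q] by (rule image_eqI)
    qed
  qed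
  then show ?thesis
    using h.card_kernel_mult_image[OF finite_zvec[OF q0]] card_zvec[OF q0] by (simp add: ker)
qed

text \<open>The random group \<Lambda>.\<close>

definition col_perp :: "nat \<Rightarrow> nat \<Rightarrow> nat \<Rightarrow> 'p :: prime_card padic_int Matrix.mat \<Rightarrow> (nat \<Rightarrow> int) set" where
  "col_perp k n m R = {y \<in> carrier (zvec (CARD('p) ^ k) n).
     \<forall>j<m. dot (CARD('p) ^ k) n (col_residue k R j) y = 0}"

lemma col_perp_altdef:
  fixes R :: "'p :: prime_card padic_int Matrix.mat"
  assumes R: "R \<in> carrier_mat n m"
  shows "col_perp k n m R = perp (CARD('p) ^ k) n (vec_residue k n ` column_module R)"
proof (rule equalityI; rule subsetI)
  let ?q = "CARD('p) ^ k"
  fix y assume y: "y \<in> col_perp k n m R"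
  have "dot ?q n (vec_residue k n (R *\<^sub>v z)) y = 0" if z: "z \<in> carrier_vec m" for z
  proof -
    let ?Z = "\<lambda>j. padic_residue (z $ j) k"
    have "dot ?q n (vec_residue k n (R *\<^sub>v z)) y = dot ?q n (\<lambda>c. \<Sum>j<m. col_residue k R j c * ?Z j) y"
    proof (rule dot_cong)
      fix c assume c: "c < n"
      have "(R *\<^sub>v z) $ c = (\<Sum>j<m. R $$ (c, j) * z $ j)"
        using R z c by (simp add: scalar_prod_def lessThan_atLeast0)
      then have "vec_residue k n (R *\<^sub>v z) c = (\<Sum>j<m. (col_residue k R j c * ?Z j) mod int CARD('p) ^ k) mod int CARD('p) ^ k"
        using c R by (simp add: vec_residue_def padic_residue_sum times_padic_int.rep_eq col_residue_def)
      then show "[vec_residue k n (R *\<^sub>v z) c = (\<Sum>j<m. col_residue k R j c * ?Z j)] (mod int ?q)"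
        by (simp add: cong_def mod_sum_eq)
    qed
    also have "\<dots> = (\<Sum>j<m. ?Z j * dot ?q n (col_residue k R j) y) mod int ?q"
    proof -
      have "(\<Sum>c<n. (\<Sum>j<m. col_residue k R j c * ?Z j) * y c) = (\<Sum>j<m. ?Z j * (\<Sum>c<n. col_residue k R j c * y c))"
        unfolding sum_distrib_left sum_distrib_right by (subst sum.swap) (simp add: ac_simps)
      also have "[\<dots> = (\<Sum>j<m. ?Z j * dot ?q n (col_residue k R j) y)] (mod int ?q)"
        by (intro cong_sum cong_mult cong_refl) (simp add: dot_def cong_def)
      finally show ?thesis unfolding dot_def[of ?q n "\<lambda>c. \<Sum>j<m. col_residue k R j c * ?Z j"] by (simp only: cong_def)
    qed
    also have "\<dots> = 0" using y by (simp add: col_perp_def)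
    finally show ?thesis .
  qed
  then show "y \<in> perp ?q n (vec_residue k n ` column_module R)"
    using y R by (auto simp: perp_def col_perp_def column_module_def)
next
  let ?q = "CARD('p) ^ k"
  fix y assume y: "y \<in> perp ?q n (vec_residue k n ` column_module R)"
  have "dot ?q n (col_residue k R j) y = 0" if j: "j < m" for j
  proof -
    have "col R j = R *\<^sub>v unit_vec m j" using R j by (intro eq_vecI) auto
    then have "col R j \<in> column_module R" using R by (auto simp: column_module_def)
    then have "dot ?q n (vec_residue k n (col R j)) y = 0" using y by (simp add: perp_def)
    moreover have "dot ?q n (vec_residue k n (col R j)) y = dot ?q n (col_residue k R j) y"
      by (rule dot_cong) (simp add: vec_residue_def col_residue_def)
    ultimately show ?thesis by simp
  qed
  then show "y \<in> col_perp k n m R" using y by (simp add: perp_def col_perp_def)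
qed

section \<open>The possible groups Y and the tuples independent over them\<close>

locale p_group_target = finite_target B q for B (structure) and q :: nat +
  fixes p e :: nat
  assumes p: "Factorial_Ring.prime p" and qp: "q = p ^ Suc e" and ordp: "order B = p ^ e"
begin

text \<open>The values of \<Lambda> for which the cokernel is isomorphic to B. By double
  annihilators Y determines the kernel it comes from.\<close>

definition "duals n = (\<lambda>s. perp q n (relations n s)) ` generating n"
text \<open>In additive terms the x with p x in Y; its trace on \<Lambda> is an elementary abelian
  extension of Y once Y lies in \<Lambda>.\<close>

definition "pth_roots n Y = {x \<in> carrier (zvec q n). x [^]\<^bsub>zvec q n\<^esub> p \<in> Y}"

lemma p1: "p > 1" by (rule prime_gt_1_nat[OF p])

lemma finite_generating: "finite (generating n)"
  unfolding generating_def by (rule finite_subset[of _ "tuples n"]) (auto intro: finite_PiE fin)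

lemma finite_duals: "finite (duals n)"
  unfolding duals_def by (rule finite_imageI[OF finite_generating])

lemma subgroup_duals: "Y \<in> duals n \<Longrightarrow> subgroup Y (zvec q n)"
  unfolding duals_def using subgroup_perp[OF q0] by auto

lemma perp_relations_eq_iff:
  assumes "s \<in> generating n" "t \<in> generating n"
  shows "perp q n (relations n s) = perp q n (relations n t) \<longleftrightarrow> relations n s = relations n t"
  using perp_perp[OF q subgroup_relations[OF generating_tuples[OF assms(1)]]] perp_perp[OF q subgroup_relations[OF generating_tuples[OF assms(2)]]]
  by metis

lemma card_duals_elem: assumes "Y \<in> duals n" shows "card Y = p ^ e"
proof -
  obtain s where s: "s \<in> generating n" "Y = perp q n (relations n s)" using assms by (auto simp: duals_def)
  have K: "subgroup (relations n s) (zvec q n)" by (rule subgroup_relations[OF generating_tuples[OF s(1)]])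
  have "card Y * card (relations n s) = p ^ e * card (relations n s)"
    using card_perp[OF q K] card_relations[OF s(1)] s(2) ordp by (simp add: mult.commute)
  moreover have "card (relations n s) > 0"
    using finite_subset[OF subgroup.subset[OF K] finite_zvec[OF q0]] subgroup.one_closed[OF K]
    by (auto simp: card_gt_0_iff)
  ultimately show ?thesis by simp
qed

lemma card_duals: "card (duals n) * card (auto B) = card (generating n)"
proof -
  have "card (generating n) = (\<Sum>Y\<in>duals n. card {s \<in> generating n. perp q n (relations n s) = Y})"
    using sum.image_gen[OF finite_generating, of "\<lambda>_. 1::nat" n "\<lambda>s. perp q n (relations n s)"] by (simp add: duals_def)
  also have "\<dots> = (\<Sum>Y\<in>duals n. card (auto B))"
  proof (rule sum.cong[OF refl])
    fix Y assume "Y \<in> duals n"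
    then obtain s where s: "s \<in> generating n" "Y = perp q n (relations n s)" by (auto simp: duals_def)
    have "{t \<in> generating n. perp q n (relations n t) = Y} = {t \<in> generating n. relations n t = relations n s}"
      using s perp_relations_eq_iff by auto
    then show "card {t \<in> generating n. perp q n (relations n t) = Y} = card (auto B)" using card_same_relations[OF s(1)] by simp
  qed
  finally show ?thesis by simp
qed

lemma cok_iso_iff:
  fixes R :: "'p :: prime_card padic_int Matrix.mat"
  assumes pC: "p = CARD('p)" and R: "R \<in> carrier_mat n m"
  shows "cok R \<cong> B \<longleftrightarrow> col_perp (Suc e) n m R \<in> duals n"
proof -
  let ?N = "vec_residue (Suc e) n ` column_module R"
  have qC: "q = CARD('p) ^ Suc e" using qp pC by simp
  have oC: "order B = CARD('p) ^ e" using ordp pC by simp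
  interpret r: group_hom "monoid_vec TYPE('p padic_int) n" "zvec q n" "vec_residue (Suc e) n"
    unfolding qC by (rule vec_residue_group_hom)
  have N: "subgroup ?N (zvec q n)" by (rule r.subgroup_img_is_subgroup[OF subgroup_column_module[OF R]])
  have L: "col_perp (Suc e) n m R = perp q n ?N" unfolding qC by (rule col_perp_altdef[OF R])
  show ?thesis
  proof
    assume "cok R \<cong> B"
    from cok_iso_imp_relations_eq[OF qC R this] show "col_perp (Suc e) n m R \<in> duals n"
      unfolding L duals_def by (metis image_eqI)
  next
    assume "col_perp (Suc e) n m R \<in> duals n"
    then obtain s where s: "s \<in> generating n" "perp q n ?N = perp q n (relations n s)" unfolding L duals_def by (rule imageE)
    then have "relations n s = ?N"
      using perp_perp[OF q subgroup_relations[OF generating_tuples[OF s(1)]]] perp_perp[OF q N] by metis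
    then show "cok R \<cong> B" by (rule relations_eq_imp_cok_iso[OF qC oC R s(1)])
  qed
qed

text \<open>Since \<open>p ^ e\<close> kills B, \<open>p ^ e\<close> times a unit vector is a
  relation. Pairing y with it shows that \<open>p ^ Suc e\<close> divides
  \<open>p ^ e * y i\<close>; the factor p by which q exceeds the order of B is decisive
  here.\<close>

lemma duals_dvd:
  assumes Y: "Y \<in> duals n" and y: "y \<in> Y" and i: "i < n"
  shows "int p dvd y i"
proof -
  obtain s where s: "s \<in> generating n" "Y = perp q n (relations n s)" using Y by (auto simp: duals_def)
  interpret E: group_hom "zvec q n" B "monomial n s" by (rule monomial_group_hom[OF generating_tuples[OF s(1)]])
  let ?x = "uvec q n i [^]\<^bsub>zvec q n\<^esub> (p ^ e)"
  have u: "uvec q n i \<in> carrier (zvec q n)" by (rule uvec_in[OF q])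
  have "monomial n s ?x = monomial n s (uvec q n i) [^] (p ^ e)" by (rule E.hom_nat_pow[OF u])
  also have "\<dots> = \<one>" using pow_order_eq_1[OF E.hom_closed[OF u]] by (simp add: ordp)
  finally have "?x \<in> relations n s" using u by (simp add: relations_def)
  then have "dot q n ?x y = 0" using y s(2) by (simp add: perp_def)
  moreover have "dot q n ?x y = dot q n (\<lambda>j. int (p ^ e) * uvec q n i j) y"
    by (rule dot_cong) (simp add: pow_zvec[OF q0 u] cong_def)
  moreover have "(\<Sum>j<n. int (p ^ e) * uvec q n i j * y j) = (\<Sum>j\<in>{i}. int (p ^ e) * y j)"
    using i by (intro sum.mono_neutral_cong_right) (auto simp: uvec_def)
  ultimately have "int q dvd int (p ^ e) * y i" by (simp add: dot_def dvd_eq_mod_eq_0)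
  then have "int (p ^ e) * int p dvd int (p ^ e) * y i" by (simp add: qp mult.commute)
  then show ?thesis using p1 by (subst (asm) dvd_mult_cancel_left) auto
qed

lemma subgroup_pth_roots:
  assumes Y: "subgroup Y (zvec q n)"
  shows "subgroup (pth_roots n Y) (zvec q n)" "Y \<subseteq> pth_roots n Y"
proof -
  interpret V: comm_group "zvec q n" by (rule comm_group_zvec)
  show "subgroup (pth_roots n Y) (zvec q n)"
    by (rule V.finite_subgroupI[OF finite_zvec[OF q0]])
      (use subgroup.one_closed[OF Y] subgroup.m_closed[OF Y] in \<open>auto simp: pth_roots_def V.pow_mult_distrib V.m_comm\<close>)
  have "y [^]\<^bsub>zvec q n\<^esub> (k::nat) \<in> Y" if "y \<in> Y" for y k
    using that by (induction k) (use Y in \<open>auto intro: subgroup.m_closed subgroup.one_closed\<close>)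
  then show "Y \<subseteq> pth_roots n Y" using subgroup.subset[OF Y] by (auto simp: pth_roots_def)
qed

text \<open>Multiplication by p maps this group onto Y, by dividing coordinates with
  \<open>duals_dvd\<close>, and its kernel is the p-torsion of (Z/q)^n, of order
  \<open>p ^ n\<close>.\<close>

lemma card_pth_roots:
  assumes Y: "Y \<in> duals n"
  shows "card (pth_roots n Y) = p ^ e * p ^ n"
proof -
  let ?V = "zvec q n"
  interpret V: comm_group ?V by (rule comm_group_zvec)
  note Ys = subgroup_duals[OF Y]
  have U: "subgroup (pth_roots n Y) ?V" by (rule subgroup_pth_roots[OF Ys])
  let ?U = "?V\<lparr>carrier := pth_roots n Y\<rparr>"
  interpret U: group ?U by (rule V.subgroup_imp_group[OF U])
  interpret h: group_hom ?U ?V "\<lambda>x. x [^]\<^bsub>?V\<^esub> p"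
    by unfold_locales (auto simp: hom_def pth_roots_def V.pow_mult_distrib V.m_comm)
  have fU: "finite (carrier ?U)" using finite_zvec[OF q0, of n] by (simp add: pth_roots_def)
  have "(\<lambda>x. x [^]\<^bsub>?V\<^esub> p) ` carrier ?U = Y"
  proof (rule equalityI; rule subsetI)
    fix y assume y: "y \<in> Y"
    define x where "x = (\<lambda>i\<in>{..<n}. y i div int p)"
    have yE: "y \<in> {..<n} \<rightarrow>\<^sub>E {0..<int q}" using y subgroup.subset[OF Ys] carrier_zvec[OF q0, of n] by blast
    have yr: "0 \<le> y i \<and> y i < int q" if "i \<in> {..<n}" for i using PiE_mem[OF yE that] by simp
    have "y i div int p \<in> {0..<int q}" if "i \<in> {..<n}" for i
    proof -
      have "y i div int p \<le> y i div 1" using yr[OF that] p1 by (intro zdiv_mono2) auto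
      moreover have "0 \<le> y i div int p" using yr[OF that] p1 by (simp add: pos_imp_zdiv_nonneg_iff)
      ultimately show ?thesis using yr[OF that] by simp
    qed
    then have xc: "x \<in> carrier ?V" unfolding x_def carrier_zvec[OF q0] by (intro restrict_PiE_iff[THEN iffD2] ballI)
    have xy: "x [^]\<^bsub>?V\<^esub> p = y"
      unfolding pow_zvec[OF q0 xc]
    proof
      fix i show "(\<lambda>i\<in>{..<n}. (int p * x i) mod int q) i = y i"
        using duals_dvd[OF Y y, of i] yr[of i] PiE_arb[OF yE, of i] by (cases "i < n") (simp_all add: x_def)
    qed
    then have "x \<in> carrier ?U" using xc y by (simp add: pth_roots_def)
    then show "y \<in> (\<lambda>x. x [^]\<^bsub>?V\<^esub> p) ` carrier ?U" by (rule image_eqI[where x = x, rotated]) (rule xy[symmetric])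
  qed (auto simp: pth_roots_def)
  moreover have "card (kernel ?U ?V (\<lambda>x. x [^]\<^bsub>?V\<^esub> p)) = p ^ n"
  proof -
    let ?T = "{t \<in> {0..<int q}. (int p * t) mod int q = 0}"
    have "kernel ?U ?V (\<lambda>x. x [^]\<^bsub>?V\<^esub> p) = {..<n} \<rightarrow>\<^sub>E ?T"
    proof (rule Set.set_eqI)
      fix x
      have "x \<in> kernel ?U ?V (\<lambda>x. x [^]\<^bsub>?V\<^esub> p) \<longleftrightarrow> x \<in> carrier ?V \<and> x [^]\<^bsub>?V\<^esub> p = \<one>\<^bsub>?V\<^esub>"
        using subgroup.one_closed[OF Ys] by (auto simp: kernel_def pth_roots_def)
      also have "\<dots> \<longleftrightarrow> x \<in> carrier ?V \<and> (\<forall>i<n. (int p * x i) mod int q = 0)"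
      proof (rule conj_cong[OF refl])
        assume x: "x \<in> carrier ?V"
        show "x [^]\<^bsub>?V\<^esub> p = \<one>\<^bsub>?V\<^esub> \<longleftrightarrow> (\<forall>i<n. (int p * x i) mod int q = 0)"
          unfolding pow_zvec[OF q0 x] one_zvec by (auto simp: fun_eq_iff restrict_def)
      qed
      also have "\<dots> \<longleftrightarrow> x \<in> {..<n} \<rightarrow>\<^sub>E ?T" unfolding carrier_zvec[OF q0] PiE_iff by auto
      finally show "x \<in> kernel ?U ?V (\<lambda>x. x [^]\<^bsub>?V\<^esub> p) \<longleftrightarrow> x \<in> {..<n} \<rightarrow>\<^sub>E ?T" .
    qed
    moreover have "card ?T = p"
    proof -
      have "?T = (\<lambda>s. int (p ^ e) * s) ` {0..<int p}"
      proof (rule Set.set_eqI)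
        fix t
        have pe: "int (p ^ e) > 0" using p1 by simp
        have q_eq: "int q = int p * int (p ^ e)" by (simp add: qp)
        have "(int p * t) mod int q = 0 \<longleftrightarrow> int (p ^ e) dvd t"
          unfolding q_eq mod_eq_0_iff_dvd using p1 by (subst dvd_mult_cancel_left) auto
        then have "t \<in> ?T \<longleftrightarrow> (0 \<le> t \<and> t < int p * int (p ^ e)) \<and> int (p ^ e) dvd t" by (auto simp: q_eq)
        also have "\<dots> \<longleftrightarrow> (\<exists>s. t = int (p ^ e) * s \<and> 0 \<le> s \<and> s < int p)"
          using pe by (auto simp: dvd_def zero_le_mult_iff mult.commute[of "int p"] simp del: of_nat_power)
        finally show "t \<in> ?T \<longleftrightarrow> t \<in> (\<lambda>s. int (p ^ e) * s) ` {0..<int p}" by auto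
      qed
      moreover have "inj_on (\<lambda>s. int (p ^ e) * s) {0..<int p}" using p1 by (auto simp: inj_on_def)
      ultimately show ?thesis by (simp add: card_image)
    qed
    ultimately show ?thesis by (simp add: card_PiE)
  qed
  ultimately show ?thesis using h.card_kernel_mult_image[OF fU] card_duals_elem[OF Y] by (simp add: mult.commute)
qed

definition "free_tuples n Y j = indep_tuples (zvec q n) Y (pth_roots n Y) j"

lemma finite_free_tuples: "finite (free_tuples n Y j)"
  unfolding free_tuples_def
  by (rule comm_group.finite_indep_tuples[OF comm_group_zvec]) (simp add: pth_roots_def finite_zvec[OF q0])

lemma free_tuples_props:
  assumes Y: "Y \<in> duals n" and ys: "ys \<in> free_tuples n Y j"
  shows "length ys = j" "set ys \<subseteq> carrier (zvec q n)" "card (generate (zvec q n) (Y \<union> set ys)) = p ^ (e + j)"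
proof -
  interpret V: comm_group "zvec q n" by (rule comm_group_zvec)
  note Ys = subgroup_duals[OF Y]
  have "length ys = j \<and> set ys \<subseteq> pth_roots n Y \<and> generate (zvec q n) (Y \<union> set ys) \<subseteq> pth_roots n Y \<and>
      card (generate (zvec q n) (Y \<union> set ys)) = card Y * p ^ j"
    by (rule V.indep_tuples_props[OF finite_zvec[OF q0] Ys subgroup_pth_roots[OF Ys] p _ ys[unfolded free_tuples_def]])
      (simp add: pth_roots_def)
  then show "length ys = j" "set ys \<subseteq> carrier (zvec q n)" "card (generate (zvec q n) (Y \<union> set ys)) = p ^ (e + j)"
    by (auto simp: pth_roots_def card_duals_elem[OF Y] power_add)
qed

lemma card_free_tuples:
  assumes Y: "Y \<in> duals n"
  shows "real (card (free_tuples n Y j)) = real p ^ (e * j) * (\<Prod>i<j. real p ^ n - real p ^ i)"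
proof -
  interpret V: comm_group "zvec q n" by (rule comm_group_zvec)
  note Ys = subgroup_duals[OF Y]
  have "real (card (free_tuples n Y j)) = (\<Prod>i<j. real (card (pth_roots n Y)) - real (card Y) * real p ^ i)"
    unfolding free_tuples_def
    by (rule V.card_indep_tuples[OF finite_zvec[OF q0] Ys subgroup_pth_roots[OF Ys] p]) (simp add: pth_roots_def)
  also have "\<dots> = (\<Prod>i<j. real p ^ e * (real p ^ n - real p ^ i))"
    by (simp add: card_pth_roots[OF Y] card_duals_elem[OF Y] right_diff_distrib)
  also have "\<dots> = real p ^ (e * j) * (\<Prod>i<j. real p ^ n - real p ^ i)"
    by (simp add: prod.distrib power_mult)
  finally show ?thesis .
qed

text \<open>If Y lies in L and \<open>pth_roots n Y \<inter> L\<close> has order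
  \<open>card Y * p ^ c\<close>, then T J is the partial sum of the q-series at
  \<open>p ^ c\<close>, and c = 0 exactly when L = Y. If Y is not contained in L, both sides are
  0.\<close>

lemma duals_bonferroni:
  assumes Y: "Y \<in> duals n" and L: "subgroup L (zvec q n)"
  defines "T \<equiv> \<lambda>J. \<Sum>j\<le>J. qwt p j / real p ^ (e * j) * real (card {ys \<in> free_tuples n Y j. Y \<union> set ys \<subseteq> L})"
  shows "even J \<Longrightarrow> of_bool (L = Y) \<le> T J" and "odd J \<Longrightarrow> T J \<le> of_bool (L = Y)"
proof -
  let ?V = "zvec q n"
  interpret V: comm_group ?V by (rule comm_group_zvec)
  note Ys = subgroup_duals[OF Y]
  note fV = finite_zvec[OF q0, of n]
  have ordV: "card (carrier ?V) = p ^ (Suc e * n)"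
    unfolding card_zvec[OF q0] unfolding qp by (rule power_mult[symmetric])
  have pr: "real p > 1" using p1 by simp
  have "(even J \<longrightarrow> of_bool (L = Y) \<le> T J) \<and> (odd J \<longrightarrow> T J \<le> of_bool (L = Y))"
  proof (cases "Y \<subseteq> L")
    case False
    then have "{ys \<in> free_tuples n Y j. Y \<union> set ys \<subseteq> L} = {}" for j by auto
    then have "T J = 0" unfolding T_def by (simp only: card.empty of_nat_0 mult_zero_right sum.neutral_const)
    then show ?thesis using False by auto
  next
    case True
    define U where "U = pth_roots n Y \<inter> L"
    have U: "subgroup U ?V" unfolding U_def by (rule V.subgroups_Inter_pair[OF subgroup_pth_roots(1)[OF Ys] L])
    have YU: "Y \<subseteq> U" using True subgroup_pth_roots(2)[OF Ys] by (simp add: U_def)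
    have Up: "x [^]\<^bsub>?V\<^esub> p \<in> Y" if "x \<in> U" for x using that by (simp add: U_def pth_roots_def)
    obtain c where c: "card U = card Y * p ^ c"
      using V.card_prime_power_quotient[OF fV ordV p Ys U YU] by blast
    have fU: "finite U" using finite_subset[OF subgroup.subset[OF U] fV] .
    have "L = Y \<longleftrightarrow> c = 0"
    proof
      assume "L = Y"
      then have "U = Y" using YU by (auto simp: U_def)
      then have "p ^ e * p ^ c = p ^ e * 1"
        using c[symmetric] card_duals_elem[OF Y] by (simp only: mult_1_right)
      then have "p ^ c = 1" using p1 by (subst (asm) mult_cancel_left) auto
      then show "c = 0" using one_less_power[OF p1, of c] by (cases "c = 0") auto
    next
      assume "c = 0"
      then have "U = Y" using c card_subset_eq[OF fU YU] by simp
      show "L = Y"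
      proof (rule ccontr)
        assume "L \<noteq> Y"
        then have "Y \<subset> L" using True by blast
        from V.exists_pth_power_in[OF fV ordV Ys L this]
        obtain y where y: "y \<in> L" "y \<notin> Y" "y [^]\<^bsub>?V\<^esub> p \<in> Y" by blast
        then have "y \<in> U" using subgroup.subset[OF L] by (auto simp: U_def pth_roots_def)
        then show False using y \<open>U = Y\<close> by simp
      qed
    qed
    moreover have "real (card {ys \<in> free_tuples n Y j. Y \<union> set ys \<subseteq> L}) = real p ^ (e * j) * (\<Prod>i<j. real p ^ c - real p ^ i)" for j
    proof -
      have "{ys \<in> free_tuples n Y j. Y \<union> set ys \<subseteq> L} = indep_tuples ?V Y U j"
        unfolding U_def free_tuples_def V.indep_tuples_Int[OF True] using True by auto
      then have "real (card {ys \<in> free_tuples n Y j. Y \<union> set ys \<subseteq> L}) = (\<Prod>i<j. real (card U) - real (card Y) * real p ^ i)"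
        using V.card_indep_tuples[OF fV Ys U YU p Up, of j] by simp
      also have "\<dots> = (\<Prod>i<j. real p ^ e * (real p ^ c - real p ^ i))"
        by (simp add: c card_duals_elem[OF Y] right_diff_distrib)
      also have "\<dots> = real p ^ (e * j) * (\<Prod>i<j. real p ^ c - real p ^ i)"
        by (simp add: prod.distrib power_mult)
      finally show ?thesis .
    qed
    then have "T J = (\<Sum>j\<le>J. qwt p j * (\<Prod>i<j. real p ^ c - real p ^ i))"
      unfolding T_def using p1 by (intro sum.cong refl) simp
    ultimately show ?thesis using qwt_bonferroni[OF pr, of J c] by simp
  qed
  then show "even J \<Longrightarrow> of_bool (L = Y) \<le> T J" and "odd J \<Longrightarrow> T J \<le> of_bool (L = Y)" by auto
qed

end

section \<open>Convergence\<close>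

context random_matrix
begin

lemma rows_event:
  assumes k: "k > 0" and rs: "set rs \<subseteq> carrier (zvec (CARD('p) ^ k) n)"
  shows "{\<omega> \<in> space P. set rs \<subseteq> col_perp k n (n + u) (M \<omega>)} =
      {\<omega> \<in> space P. \<forall>j<n + u. \<forall>g\<in>carrier (zvec (CARD('p) ^ k) (length rs)).
        pairing (CARD('p) ^ k) n (row_homs (CARD('p) ^ k) n rs) (col_residue k (M \<omega>) j) g = 0}"
    and "{\<omega> \<in> space P. set rs \<subseteq> col_perp k n (n + u) (M \<omega>)} \<in> events"
proof -
  let ?q = "CARD('p) ^ k"
  have q: "?q > 1" by (rule one_less_power[OF p_gt_1 k])
  show eq: "{\<omega> \<in> space P. set rs \<subseteq> col_perp k n (n + u) (M \<omega>)} =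
      {\<omega> \<in> space P. \<forall>j<n + u. \<forall>g\<in>carrier (zvec ?q (length rs)).
        pairing ?q n (row_homs ?q n rs) (col_residue k (M \<omega>) j) g = 0}"
    unfolding pairing_row_homs_zero_iff[OF q rs] using rs by (auto simp: col_perp_def)
  have "{\<omega> \<in> space P. set rs \<subseteq> col_perp k n (n + u) (M \<omega>)} =
      (\<Inter>j\<in>{..<n + u}. kills k (zvec ?q (length rs)) (row_homs ?q n rs) j)"
    unfolding eq using n by (auto simp: kills_def)
  also have "\<dots> \<in> events" using n by (intro sets.finite_INT kills_sets) auto
  finally show "{\<omega> \<in> space P. set rs \<subseteq> col_perp k n (n + u) (M \<omega>)} \<in> events" .
qed

lemma subset_col_perp_event:
  assumes k: "k > 0" and Z: "Z \<subseteq> carrier (zvec (CARD('p) ^ k) n)"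
  shows "{\<omega> \<in> space P. Z \<subseteq> col_perp k n (n + u) (M \<omega>)} \<in> events"
proof -
  have "CARD('p) ^ k > 0" using p_gt_1[where 'p = 'p] by simp
  then have "finite Z" using Z finite_zvec finite_subset by blast
  then obtain rs where "set rs = Z" using finite_list by blast
  then show ?thesis using rows_event(2)[OF k, of rs] Z by simp
qed

text \<open>The event is that Z lies in \<Lambda>, minus the finitely many events that some vector
  outside Z does.\<close>

lemma col_perp_eq_event:
  assumes k: "k > 0" and Z: "Z \<subseteq> carrier (zvec (CARD('p) ^ k) n)"
  shows "{\<omega> \<in> space P. col_perp k n (n + u) (M \<omega>) = Z} \<in> events"
proof -
  let ?C = "carrier (zvec (CARD('p) ^ k) n)" and ?L = "\<lambda>\<omega>. col_perp k n (n + u) (M \<omega>)"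
  have "CARD('p) ^ k > 0" using p_gt_1[where 'p = 'p] by simp
  then have fin: "finite ?C" by (rule finite_zvec)
  have "{\<omega> \<in> space P. ?L \<omega> = Z} = {\<omega> \<in> space P. Z \<subseteq> ?L \<omega>} - (\<Union>y\<in>?C - Z. {\<omega> \<in> space P. {y} \<subseteq> ?L \<omega>})"
    by (auto simp: col_perp_def)
  also have "\<dots> \<in> events"
    using fin Z by (intro sets.Diff sets.finite_UN subset_col_perp_event[OF k]) auto
  finally show ?thesis .
qed

end

text \<open>The case G = (Z/q)^r of \<open>random_matrix_limit\<close>. As \<open>row_homs\<close>
  is injective, the sum over lists of rows is part of the sum over all F, whose terms are
  nonnegative.\<close>

lemma rows_limit:
  assumes k: "k > 0" and \<epsilon>: "\<epsilon> > 0"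
    and ab: "0 \<le> \<alpha>" "0 \<le> \<beta>" "\<alpha> + \<beta> < 1" and \<kappa>: "\<kappa> > 0"
  shows "\<exists>n0. \<forall>n\<ge>n0. \<forall>(P :: 'w measure) (M :: 'w \<Rightarrow> 'p :: prime_card padic_int Matrix.mat) A.
     random_matrix P n u M A \<epsilon> \<alpha> \<beta> \<longrightarrow>
     (\<Sum>rs | set rs \<subseteq> carrier (zvec (CARD('p) ^ k) n) \<and> length rs = r.
        \<bar>measure P {\<omega> \<in> space P. set rs \<subseteq> col_perp k n (n + u) (M \<omega>)}
         - (1 / real (card (generate (zvec (CARD('p) ^ k) n) (set rs)))) ^ (n + u)\<bar>) \<le> \<kappa>"
proof -
  let ?q = "CARD('p) ^ k"
  let ?G = "zvec ?q r"
  have q: "?q > 1" by (rule one_less_power[OF p_gt_1 k])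
  then have q0: "?q > 0" by simp
  from random_matrix_limit[OF comm_group_zvec finite_zvec[OF q0] k \<epsilon> ab \<kappa>, of u r]
  obtain n0 where n0: "\<forall>n\<ge>n0. \<forall>(P :: 'w measure) (M :: 'w \<Rightarrow> 'p padic_int Matrix.mat) A.
     random_matrix P n u M A \<epsilon> \<alpha> \<beta> \<longrightarrow>
     (\<Sum>F\<in>{..<n} \<rightarrow>\<^sub>E mod_homs ?G ?q.
        \<bar>measure P {\<omega> \<in> space P. \<forall>j<n + u. \<forall>g\<in>carrier ?G.
             pairing ?q n F (col_residue k (M \<omega>) j) g = 0}
         - (real (card {g \<in> carrier ?G. \<forall>c<n. F c g = 0}) / real (card (carrier ?G))) ^ (n + u)\<bar>) \<le> \<kappa>" ..
  show ?thesis
  proof (intro exI[of _ n0] allI impI)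
    fix n and P :: "'w measure" and M :: "'w \<Rightarrow> 'p padic_int Matrix.mat" and A
    assume nn: "n \<ge> n0" and R: "random_matrix P n u M A \<epsilon> \<alpha> \<beta>"
    interpret random_matrix P n u M A \<epsilon> \<alpha> \<beta> by (rule R)
    interpret V: comm_group "zvec ?q n" by (rule comm_group_zvec)
    define D where "D = (\<lambda>F. \<bar>measure P {\<omega> \<in> space P. \<forall>j<n + u. \<forall>g\<in>carrier ?G.
             pairing ?q n F (col_residue k (M \<omega>) j) g = 0}
         - (real (card {g \<in> carrier ?G. \<forall>c<n. F c g = 0}) / real (card (carrier ?G))) ^ (n + u)\<bar>)"
    let ?R = "{rs. set rs \<subseteq> carrier (zvec ?q n) \<and> length rs = r}"
    have "(\<Sum>rs\<in>?R. \<bar>measure P {\<omega> \<in> space P. set rs \<subseteq> col_perp k n (n + u) (M \<omega>)}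
         - (1 / real (card (generate (zvec ?q n) (set rs)))) ^ (n + u)\<bar>) = (\<Sum>rs\<in>?R. D (row_homs ?q n rs))"
    proof (rule sum.cong[OF refl])
      fix rs assume "rs \<in> ?R"
      then have rs: "set rs \<subseteq> carrier (zvec ?q n)" and len: "length rs = r" by auto
      have gpos: "card (generate (zvec ?q n) (set rs)) > 0"
        using finite_subset[OF V.generate_incl[OF rs] finite_zvec[OF q0]] generate.one[of "zvec ?q n" "set rs"]
        by (auto simp: card_gt_0_iff)
      have "real (card {g \<in> carrier ?G. \<forall>c<n. row_homs ?q n rs c g = 0})
          * real (card (generate (zvec ?q n) (set rs))) = real (card (carrier ?G))"
        unfolding of_nat_mult[symmetric] card_row_homs_kernel[OF q rs, unfolded len] card_zvec[OF q0] ..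
      moreover have "real (card (carrier ?G)) > 0" unfolding card_zvec[OF q0] using q0 by simp
      ultimately have "real (card {g \<in> carrier ?G. \<forall>c<n. row_homs ?q n rs c g = 0}) / real (card (carrier ?G))
          = 1 / real (card (generate (zvec ?q n) (set rs)))"
        using gpos by (simp add: frac_eq_eq)
      then show "\<bar>measure P {\<omega> \<in> space P. set rs \<subseteq> col_perp k n (n + u) (M \<omega>)}
         - (1 / real (card (generate (zvec ?q n) (set rs)))) ^ (n + u)\<bar> = D (row_homs ?q n rs)"
        unfolding D_def rows_event(1)[OF k rs, unfolded len] by simp
    qed
    also have "\<dots> = sum D (row_homs ?q n ` ?R)"
      by (rule sum.reindex_cong[symmetric, OF _ refl refl]) (auto intro!: inj_onI row_homs_inj[OF q])
    also have "\<dots> \<le> sum D ({..<n} \<rightarrow>\<^sub>E mod_homs ?G ?q)"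
    proof (rule sum_mono2)
      show "finite ({..<n} \<rightarrow>\<^sub>E mod_homs ?G ?q)"
        by (intro finite_PiE finite_mod_homs finite_zvec[OF q0]) simp
      show "row_homs ?q n ` ?R \<subseteq> {..<n} \<rightarrow>\<^sub>E mod_homs ?G ?q"
      proof (rule image_subsetI)
        fix rs assume "rs \<in> ?R"
        then show "row_homs ?q n rs \<in> {..<n} \<rightarrow>\<^sub>E mod_homs ?G ?q" using row_homs_in[OF q0, of n rs] by simp
      qed
    qed (simp add: D_def)
    also have "\<dots> \<le> \<kappa>" unfolding D_def by (rule n0[rule_format, OF nn R])
    finally show "(\<Sum>rs\<in>?R. \<bar>measure P {\<omega> \<in> space P. set rs \<subseteq> col_perp k n (n + u) (M \<omega>)}
         - (1 / real (card (generate (zvec ?q n) (set rs)))) ^ (n + u)\<bar>) \<le> \<kappa>" .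
  qed
qed

section \<open>From expected numbers of tuples to the probability\<close>

context p_group_target
begin

text \<open>Listing the \<open>p ^ e\<close> elements of Y in front of ys turns the pairs (Y, ys)
  into distinct lists of \<open>p ^ e + j\<close> rows, so that \<open>rows_limit\<close>
  applies.\<close>

lemma sum_free_tuples_le:
  fixes D :: "(nat \<Rightarrow> int) set \<Rightarrow> real"
  assumes D: "\<And>Z. D Z \<ge> 0"
  shows "(\<Sum>Y\<in>duals n. \<Sum>ys\<in>free_tuples n Y j. D (Y \<union> set ys))
    \<le> (\<Sum>rs | set rs \<subseteq> carrier (zvec q n) \<and> length rs = p ^ e + j. D (set rs))"
proof -
  let ?R = "{rs. set rs \<subseteq> carrier (zvec q n) \<and> length rs = p ^ e + j}"
  have "\<forall>Y\<in>duals n. \<exists>xs. set xs = Y \<and> length xs = p ^ e"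
  proof
    fix Y assume Y: "Y \<in> duals n"
    have "finite Y" using finite_subset[OF subgroup.subset[OF subgroup_duals[OF Y]] finite_zvec[OF q0]] .
    then obtain xs where "set xs = Y" "distinct xs" using finite_distinct_list by blast
    then show "\<exists>xs. set xs = Y \<and> length xs = p ^ e" using card_duals_elem[OF Y] distinct_card by metis
  qed
  from bchoice[OF this] obtain l where "\<forall>Y\<in>duals n. set (l Y) = Y \<and> length (l Y) = p ^ e" ..
  then have l: "set (l Y) = Y" "length (l Y) = p ^ e" if "Y \<in> duals n" for Y using that by simp_all
  define \<phi> where "\<phi> = (\<lambda>(Y, ys). l Y @ ys)"
  let ?S = "Sigma (duals n) (\<lambda>Y. free_tuples n Y j)"
  have inj: "inj_on \<phi> ?S"
  proof (rule inj_onI)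
    fix x y assume xy: "x \<in> ?S" "y \<in> ?S" "\<phi> x = \<phi> y"
    obtain Y ys Z zs where d: "x = (Y, ys)" "y = (Z, zs)" by fastforce
    have Y: "Y \<in> duals n" and Z: "Z \<in> duals n" using xy d by auto
    have "l Y @ ys = l Z @ zs" using xy(3) d by (simp add: \<phi>_def)
    moreover have "length (l Y) = length (l Z)" by (simp only: l(2)[OF Y] l(2)[OF Z])
    ultimately have *: "l Y = l Z \<and> ys = zs" by (simp only: append_eq_append_conv simp_thms)
    have "Y = set (l Y)" by (rule l(1)[OF Y, symmetric])
    also have "\<dots> = set (l Z)" by (rule arg_cong[OF conjunct1[OF *]])
    also have "\<dots> = Z" by (rule l(1)[OF Z])
    finally show "x = y" using d * by simp
  qed
  have "(\<Sum>Y\<in>duals n. \<Sum>ys\<in>free_tuples n Y j. D (Y \<union> set ys)) = (\<Sum>(Y, ys)\<in>?S. D (Y \<union> set ys))"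
    by (rule sum.Sigma) (simp_all add: finite_duals finite_free_tuples)
  also have "\<dots> = (\<Sum>x\<in>?S. D (set (\<phi> x)))"
    by (rule sum.cong[OF refl]) (clarsimp simp: \<phi>_def l(1) set_append simp del: Un_iff)
  also have "\<dots> = (\<Sum>rs\<in>\<phi> ` ?S. D (set rs))" by (simp add: sum.reindex[OF inj])
  also have "\<dots> \<le> (\<Sum>rs\<in>?R. D (set rs))"
  proof (rule sum_mono2)
    show "finite ?R" by (rule finite_lists_length_eq[OF finite_zvec[OF q0]])
    show "\<phi> ` ?S \<subseteq> ?R"
    proof (rule image_subsetI)
      fix x assume "x \<in> ?S"
      then obtain Y ys where d: "x = (Y, ys)" "Y \<in> duals n" "ys \<in> free_tuples n Y j" by auto
      show "\<phi> x \<in> ?R"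
        using free_tuples_props(1,2)[OF d(2,3)] subgroup.subset[OF subgroup_duals[OF d(2)]]
        by (simp add: \<phi>_def d(1) l[OF d(2)])
    qed
  qed (rule D)
  finally show ?thesis .
qed

text \<open>Y and j vectors independent over it always generate a subgroup of order
  \<open>p ^ (e + j)\<close>, so the main terms of \<open>rows_limit\<close> are all equal and add
  up to a product.\<close>

lemma duals_limit:
  assumes pC: "p = CARD('p :: prime_card)" and \<epsilon>: "\<epsilon> > 0"
    and ab: "0 \<le> \<alpha>" "0 \<le> \<beta>" "\<alpha> + \<beta> < 1" and \<kappa>: "\<kappa> > 0"
  shows "\<exists>n0. \<forall>n\<ge>n0. \<forall>(P :: 'w measure) (M :: 'w \<Rightarrow> 'p padic_int Matrix.mat) A.
     random_matrix P n u M A \<epsilon> \<alpha> \<beta> \<longrightarrow>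
     \<bar>(\<Sum>Y\<in>duals n. \<Sum>ys\<in>free_tuples n Y j.
          measure P {\<omega> \<in> space P. Y \<union> set ys \<subseteq> col_perp (Suc e) n (n + u) (M \<omega>)})
       - real (card (duals n)) * (real p ^ (e * j) * (\<Prod>i<j. real p ^ n - real p ^ i)) *
           (1 / real p ^ (e + j)) ^ (n + u)\<bar> \<le> \<kappa>"
proof -
  have qC: "CARD('p) ^ Suc e = q" using qp pC by simp
  from rows_limit[where 'p = 'p and 'w = 'w, OF zero_less_Suc[of e] \<epsilon> ab \<kappa>, of u "p ^ e + j", unfolded qC]
  obtain n0 where n0: "\<forall>n\<ge>n0. \<forall>(P :: 'w measure) (M :: 'w \<Rightarrow> 'p padic_int Matrix.mat) A.
     random_matrix P n u M A \<epsilon> \<alpha> \<beta> \<longrightarrow>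
     (\<Sum>rs | set rs \<subseteq> carrier (zvec q n) \<and> length rs = p ^ e + j.
        \<bar>measure P {\<omega> \<in> space P. set rs \<subseteq> col_perp (Suc e) n (n + u) (M \<omega>)}
         - (1 / real (card (generate (zvec q n) (set rs)))) ^ (n + u)\<bar>) \<le> \<kappa>" ..
  show ?thesis
  proof (intro exI[of _ n0] allI impI)
    fix n and P :: "'w measure" and M :: "'w \<Rightarrow> 'p padic_int Matrix.mat" and A
    assume nn: "n \<ge> n0" and R: "random_matrix P n u M A \<epsilon> \<alpha> \<beta>"
    define pr where "pr = (\<lambda>Z. measure P {\<omega> \<in> space P. Z \<subseteq> col_perp (Suc e) n (n + u) (M \<omega>)})"
    define c where "c = (1 / real p ^ (e + j)) ^ (n + u)"
    define g where "g = (\<lambda>Z. (1 / real (card (generate (zvec q n) Z))) ^ (n + u))"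
    have gc: "g (Y \<union> set ys) = c" if "Y \<in> duals n" "ys \<in> free_tuples n Y j" for Y ys
      using free_tuples_props(3)[OF that] by (simp add: g_def c_def)
    have "(\<Sum>Y\<in>duals n. \<Sum>ys\<in>free_tuples n Y j. c)
        = real (card (duals n)) * (real p ^ (e * j) * (\<Prod>i<j. real p ^ n - real p ^ i)) * c"
      by (simp add: card_free_tuples)
    then have "(\<Sum>Y\<in>duals n. \<Sum>ys\<in>free_tuples n Y j. pr (Y \<union> set ys))
       - real (card (duals n)) * (real p ^ (e * j) * (\<Prod>i<j. real p ^ n - real p ^ i)) * c
       = (\<Sum>Y\<in>duals n. \<Sum>ys\<in>free_tuples n Y j. pr (Y \<union> set ys) - c)"
      by (simp only: sum_subtractf)
    also have "\<dots> = (\<Sum>Y\<in>duals n. \<Sum>ys\<in>free_tuples n Y j. pr (Y \<union> set ys) - g (Y \<union> set ys))"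
      by (intro sum.cong refl) (simp add: gc)
    also have "\<bar>\<dots>\<bar> \<le> (\<Sum>Y\<in>duals n. \<Sum>ys\<in>free_tuples n Y j. \<bar>pr (Y \<union> set ys) - g (Y \<union> set ys)\<bar>)"
      by (rule order_trans[OF sum_abs sum_mono[OF sum_abs]])
    also have "\<dots> \<le> (\<Sum>rs | set rs \<subseteq> carrier (zvec q n) \<and> length rs = p ^ e + j. \<bar>pr (set rs) - g (set rs)\<bar>)"
      by (rule sum_free_tuples_le) simp
    also have "\<dots> \<le> \<kappa>" unfolding pr_def g_def by (rule n0[rule_format, OF nn R])
    finally show "\<bar>(\<Sum>Y\<in>duals n. \<Sum>ys\<in>free_tuples n Y j.
          measure P {\<omega> \<in> space P. Y \<union> set ys \<subseteq> col_perp (Suc e) n (n + u) (M \<omega>)})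
       - real (card (duals n)) * (real p ^ (e * j) * (\<Prod>i<j. real p ^ n - real p ^ i)) *
           (1 / real p ^ (e + j)) ^ (n + u)\<bar> \<le> \<kappa>"
      by (simp only: pr_def c_def)
  qed
qed

text \<open>By \<open>card_not_generating\<close> the proportion of tuples that do not generate B is
  at most \<open>2 ^ order B / 2 ^ n\<close>.\<close>

lemma card_generating_asymp: "(\<lambda>n. real (card (generating n)) / (real p ^ e) ^ n) \<longlonglongrightarrow> 1"
proof -
  have pe: "real p ^ e > 0" using p1 by simp
  have cS: "real (card (tuples n)) = (real p ^ e) ^ n" for n
    using ordp by (simp add: card_PiE order_def)
  have finS: "finite (tuples n)" for n :: nat by (intro finite_PiE fin) simp
  have sub: "generating n \<subseteq> tuples n" for n by (auto simp: generating_def)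
  have up: "real (card (generating n)) / (real p ^ e) ^ n \<le> 1" for n
    using card_mono[OF finS sub, of n] cS[of n] pe by (simp add: divide_le_eq_1)
  have lo: "1 - 2 ^ (p ^ e) * (1 / 2) ^ n \<le> real (card (generating n)) / (real p ^ e) ^ n" for n
  proof -
    have "real (card (tuples n - generating n) * 2 ^ n) \<le> real (2 ^ order B * order B ^ n)"
      using card_not_generating[of n] by (simp only: of_nat_le_iff)
    then have "real (card (tuples n - generating n)) * 2 ^ n \<le> 2 ^ (p ^ e) * (real p ^ e) ^ n"
      by (simp add: ordp)
    then have "real (card (tuples n - generating n)) / (real p ^ e) ^ n \<le> 2 ^ (p ^ e) * (1 / 2) ^ n"
      using pe by (simp add: field_simps)
    moreover have "real (card (tuples n - generating n)) = (real p ^ e) ^ n - real (card (generating n))"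
      using cS[of n] card_mono[OF finS sub, of n] finite_subset[OF sub finS]
      by (simp add: card_Diff_subset[OF _ sub] of_nat_diff)
    moreover have "((real p ^ e) ^ n - real (card (generating n))) / (real p ^ e) ^ n = 1 - real (card (generating n)) / (real p ^ e) ^ n"
      using p1 by (simp add: diff_divide_distrib)
    ultimately show ?thesis by simp
  qed
  have "(\<lambda>n. 1 - 2 ^ (p ^ e) * (1 / 2) ^ n :: real) \<longlonglongrightarrow> 1 - 2 ^ (p ^ e) * 0"
    by (intro tendsto_diff tendsto_mult tendsto_const LIMSEQ_power_zero) simp
  then have "(\<lambda>n. 1 - 2 ^ (p ^ e) * (1 / 2) ^ n :: real) \<longlonglongrightarrow> 1" by (simp only: mult_zero_right diff_0_right)
  from tendsto_sandwich[OF always_eventually[OF allI[OF lo]] always_eventually[OF allI[OF up]] this tendsto_const]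
  show ?thesis .
qed

lemma auto_pos: "card (auto B) > 0"
proof -
  obtain n where "real (card (generating n)) / (real p ^ e) ^ n > 0"
    using order_tendstoD(1)[OF card_generating_asymp, of 0] by (auto simp: eventually_sequentially)
  then have "card (generating n) \<noteq> 0" by (intro notI) simp
  then show ?thesis using card_duals[of n] by (metis gr0I mult_0_right)
qed

text \<open>There are about \<open>p ^ (e * n) / card (auto B)\<close> groups Y and about
  \<open>p ^ (e * j) * p ^ (n * j)\<close> tuples for each. The powers depending on n cancel against
  those in the probability, which leaves its part with exponent u.\<close>

lemma main_term_limit:
  "(\<lambda>n. real (card (duals n)) * (real p ^ (e * j) * (\<Prod>i<j. real p ^ n - real p ^ i)) *
      (1 / real p ^ (e + j)) ^ (n + u) / real p ^ (e * j))
    \<longlonglongrightarrow> (1 / real p ^ u) ^ j / (real (order B) ^ u * real (card (auto B)))"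
proof -
  have P: "real p > 0" "real p > 1" using p1 by auto
  have a: "real (card (auto B)) > 0" using auto_pos by simp
  have "real (card (duals n)) * (real p ^ (e * j) * (\<Prod>i<j. real p ^ n - real p ^ i)) *
      (1 / real p ^ (e + j)) ^ (n + u) / real p ^ (e * j)
    = real (card (generating n)) / (real p ^ e) ^ n * (\<Prod>i<j. 1 - real p ^ i * (1 / real p) ^ n) *
      ((1 / real p ^ u) ^ j / (real (order B) ^ u * real (card (auto B))))" for n
  proof -
    have 1: "real (card (duals n)) = real (card (generating n)) / real (card (auto B))"
      using a arg_cong[OF card_duals[of n], of real] by (simp add: field_simps)
    have "(\<Prod>i<j. real p ^ n - real p ^ i) = (\<Prod>i<j. real p ^ n * (1 - real p ^ i * (1 / real p) ^ n))"
      using P by (intro prod.cong refl) (simp add: field_simps)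
    also have "\<dots> = real p ^ (n * j) * (\<Prod>i<j. 1 - real p ^ i * (1 / real p) ^ n)"
      by (simp add: prod.distrib power_mult)
    finally have 2: "(\<Prod>i<j. real p ^ n - real p ^ i) = real p ^ (n * j) * (\<Prod>i<j. 1 - real p ^ i * (1 / real p) ^ n)" .
    have 3: "(1 / real p ^ (e + j)) ^ (n + u) = 1 / ((real p ^ e) ^ n * real p ^ (n * j) * (real p ^ e) ^ u * (real p ^ u) ^ j)"
      by (simp add: power_one_over power_mult_distrib power_add power_mult[symmetric] algebra_simps)
    show ?thesis unfolding 1 2 3 using P a by (simp add: ordp power_one_over)
  qed
  moreover have "(\<lambda>n. real (card (generating n)) / (real p ^ e) ^ n * (\<Prod>i<j. 1 - real p ^ i * (1 / real p) ^ n) *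
      ((1 / real p ^ u) ^ j / (real (order B) ^ u * real (card (auto B)))))
    \<longlonglongrightarrow> 1 * (\<Prod>i<j. 1 - real p ^ i * 0) * ((1 / real p ^ u) ^ j / (real (order B) ^ u * real (card (auto B))))"
  proof -
    have "(\<lambda>n. (1 / real p) ^ n) \<longlonglongrightarrow> 0" using P by (intro LIMSEQ_power_zero) simp
    then show ?thesis
      by (intro tendsto_mult tendsto_prod tendsto_diff tendsto_const card_generating_asymp)
  qed
  ultimately show ?thesis by simp
qed

text \<open>The cokernel is isomorphic to B on the disjoint union of the events that \<Lambda>
  equals some Y. The pointwise inequalities \<open>duals_bonferroni\<close> are integrated for each
  Y and then summed.\<close>

lemma prob_cok_bounds:
  fixes M :: "'w \<Rightarrow> 'p :: prime_card padic_int Matrix.mat"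
  assumes pC: "p = CARD('p)" and R: "random_matrix P n u M A \<epsilon> \<alpha> \<beta>"
  defines "T \<equiv> \<lambda>J. \<Sum>j\<le>J. qwt p j / real p ^ (e * j) * (\<Sum>Y\<in>duals n. \<Sum>ys\<in>free_tuples n Y j.
       measure P {\<omega> \<in> space P. Y \<union> set ys \<subseteq> col_perp (Suc e) n (n + u) (M \<omega>)})"
  shows "even J \<Longrightarrow> \<P>(\<omega> in P. cok (M \<omega>) \<cong> B) \<le> T J" and "odd J \<Longrightarrow> T J \<le> \<P>(\<omega> in P. cok (M \<omega>) \<cong> B)"
proof -
  interpret R: random_matrix P n u M A \<epsilon> \<alpha> \<beta> by (rule R)
  have qC: "CARD('p) ^ Suc e = q" using qp pC by simp
  let ?L = "\<lambda>\<omega>. col_perp (Suc e) n (n + u) (M \<omega>)"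
  have dc: "Y \<subseteq> carrier (zvec q n)" if "Y \<in> duals n" for Y by (rule subgroup.subset[OF subgroup_duals[OF that]])
  have E1: "{\<omega> \<in> space P. ?L \<omega> = Y} \<in> R.events" if "Y \<in> duals n" for Y
    by (rule R.col_perp_eq_event) (simp_all only: qC dc[OF that] zero_less_Suc)
  have E2: "{\<omega> \<in> space P. Y \<union> set ys \<subseteq> ?L \<omega>} \<in> R.events" if "Y \<in> duals n" "ys \<in> free_tuples n Y j" for Y ys j
    by (rule R.subset_col_perp_event) (simp_all only: qC Un_subset_iff dc[OF that(1)] free_tuples_props(2)[OF that] zero_less_Suc simp_thms)
  have Ls: "subgroup (?L \<omega>) (zvec q n)" if "\<omega> \<in> space P" for \<omega>
    unfolding col_perp_altdef[OF R.M[OF that]] qC by (rule subgroup_perp[OF q0])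
  have "{\<omega> \<in> space P. cok (M \<omega>) \<cong> B} = (\<Union>Y\<in>duals n. {\<omega> \<in> space P. ?L \<omega> = Y})"
    using cok_iso_iff[OF pC R.M] by auto
  then have prob: "\<P>(\<omega> in P. cok (M \<omega>) \<cong> B) = (\<Sum>Y\<in>duals n. R.prob {\<omega> \<in> space P. ?L \<omega> = Y})"
    using R.finite_measure_finite_Union[OF finite_duals, of "\<lambda>Y. {\<omega> \<in> space P. ?L \<omega> = Y}" n] E1
    by (auto simp: disjoint_family_on_def)
  define t where "t = (\<lambda>J Y. \<Sum>j\<le>J. qwt p j / real p ^ (e * j) * (\<Sum>ys\<in>free_tuples n Y j.
       R.prob {\<omega> \<in> space P. Y \<union> set ys \<subseteq> ?L \<omega>}))"
  have T: "T J = (\<Sum>Y\<in>duals n. t J Y)" for J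
    unfolding T_def t_def sum_distrib_left by (rule sum.swap)
  define f where "f = (\<lambda>J Y \<omega>. \<Sum>j\<le>J. qwt p j / real p ^ (e * j) * (\<Sum>ys\<in>free_tuples n Y j.
       indicat_real {\<omega> \<in> space P. Y \<union> set ys \<subseteq> ?L \<omega>} \<omega>))"
  have int1: "integrable P (indicat_real {\<omega> \<in> space P. ?L \<omega> = Y})" if "Y \<in> duals n" for Y
    by (intro integrable_real_indicator E1[OF that]) (simp add: R.emeasure_eq_measure)
  have int2: "integrable P (indicat_real {\<omega> \<in> space P. Y \<union> set ys \<subseteq> ?L \<omega>})"
    if "Y \<in> duals n" "ys \<in> free_tuples n Y j" for Y ys j
    by (intro integrable_real_indicator E2[OF that]) (simp add: R.emeasure_eq_measure)
  have intf: "integrable P (f J Y)" if "Y \<in> duals n" for J Y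
    unfolding f_def by (intro Bochner_Integration.integrable_sum integrable_mult_right int2[OF that])
  have exp1: "R.expectation (indicat_real {\<omega> \<in> space P. Q \<omega>}) = R.prob {\<omega> \<in> space P. Q \<omega>}" for Q
  proof -
    have "{\<omega> \<in> space P. Q \<omega>} \<inter> space P = {\<omega> \<in> space P. Q \<omega>}" by auto
    then show ?thesis by (simp only: Bochner_Integration.integral_indicator)
  qed
  have expf: "R.expectation (f J Y) = t J Y" if Y: "Y \<in> duals n" for J Y
  proof -
    have "R.expectation (f J Y) = (\<Sum>j\<le>J. R.expectation (\<lambda>\<omega>. qwt p j / real p ^ (e * j) *
        (\<Sum>ys\<in>free_tuples n Y j. indicat_real {\<omega> \<in> space P. Y \<union> set ys \<subseteq> ?L \<omega>} \<omega>)))"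
      unfolding f_def
      by (intro Bochner_Integration.integral_sum Bochner_Integration.integrable_sum integrable_mult_right int2[OF Y])
    also have "\<dots> = t J Y"
      unfolding t_def
    proof (rule sum.cong[OF refl])
      fix j
      have "R.expectation (\<lambda>\<omega>. \<Sum>ys\<in>free_tuples n Y j. indicat_real {\<omega> \<in> space P. Y \<union> set ys \<subseteq> ?L \<omega>} \<omega>)
          = (\<Sum>ys\<in>free_tuples n Y j. R.expectation (indicat_real {\<omega> \<in> space P. Y \<union> set ys \<subseteq> ?L \<omega>}))"
        by (intro Bochner_Integration.integral_sum int2[OF Y])
      then show "R.expectation (\<lambda>\<omega>. qwt p j / real p ^ (e * j) *
          (\<Sum>ys\<in>free_tuples n Y j. indicat_real {\<omega> \<in> space P. Y \<union> set ys \<subseteq> ?L \<omega>} \<omega>))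
        = qwt p j / real p ^ (e * j) * (\<Sum>ys\<in>free_tuples n Y j. R.prob {\<omega> \<in> space P. Y \<union> set ys \<subseteq> ?L \<omega>})"
        by (simp only: integral_mult_right_zero exp1)
    qed
    finally show ?thesis .
  qed
  have fval: "f J Y \<omega> = (\<Sum>j\<le>J. qwt p j / real p ^ (e * j) * real (card {ys \<in> free_tuples n Y j. Y \<union> set ys \<subseteq> ?L \<omega>}))"
    if "\<omega> \<in> space P" for J Y \<omega>
  proof -
    have "(\<Sum>ys\<in>free_tuples n Y j. indicat_real {\<omega> \<in> space P. Y \<union> set ys \<subseteq> ?L \<omega>} \<omega>)
        = real (card {ys \<in> free_tuples n Y j. Y \<union> set ys \<subseteq> ?L \<omega>})" for j
    proof -
      have "(\<Sum>ys\<in>free_tuples n Y j. indicat_real {\<omega> \<in> space P. Y \<union> set ys \<subseteq> ?L \<omega>} \<omega>)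
        = (\<Sum>ys\<in>free_tuples n Y j. if Y \<union> set ys \<subseteq> ?L \<omega> then 1 else 0)"
        using that by (intro sum.cong refl) (simp add: indicator_def)
      also have "\<dots> = real (card {ys \<in> free_tuples n Y j. Y \<union> set ys \<subseteq> ?L \<omega>})"
        using finite_free_tuples by (subst sum.inter_filter[symmetric]) simp_all
      finally show ?thesis .
    qed
    then show ?thesis unfolding f_def by simp
  qed
  have ind: "indicat_real {\<omega> \<in> space P. ?L \<omega> = Y} \<omega> = of_bool (?L \<omega> = Y)" if "\<omega> \<in> space P" for Y \<omega>
    using that by simp
  show "\<P>(\<omega> in P. cok (M \<omega>) \<cong> B) \<le> T J" if J: "even J"
    unfolding prob T
  proof (rule sum_mono)
    fix Y assume Y: "Y \<in> duals n"
    show "R.prob {\<omega> \<in> space P. ?L \<omega> = Y} \<le> t J Y"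
      unfolding exp1[symmetric] expf[OF Y, symmetric]
    proof (rule integral_mono[OF int1[OF Y] intf[OF Y]])
      fix \<omega> assume \<omega>: "\<omega> \<in> space P"
      show "indicat_real {\<omega> \<in> space P. ?L \<omega> = Y} \<omega> \<le> f J Y \<omega>"
        unfolding fval[OF \<omega>] ind[OF \<omega>] by (rule duals_bonferroni(1)[OF Y Ls[OF \<omega>] J])
    qed
  qed
  show "T J \<le> \<P>(\<omega> in P. cok (M \<omega>) \<cong> B)" if J: "odd J"
    unfolding prob T
  proof (rule sum_mono)
    fix Y assume Y: "Y \<in> duals n"
    show "t J Y \<le> R.prob {\<omega> \<in> space P. ?L \<omega> = Y}"
      unfolding exp1[symmetric] expf[OF Y, symmetric]
    proof (rule integral_mono[OF intf[OF Y] int1[OF Y]])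
      fix \<omega> assume \<omega>: "\<omega> \<in> space P"
      show "f J Y \<omega> \<le> indicat_real {\<omega> \<in> space P. ?L \<omega> = Y} \<omega>"
        unfolding fval[OF \<omega>] ind[OF \<omega>] by (rule duals_bonferroni(2)[OF Y Ls[OF \<omega>] J])
    qed
  qed
qed

end

text \<open>First n tends to infinity with J fixed, then J with one parity. The bounds for finite J
  replace a domination argument, so termwise convergence of a j suffices.\<close>

lemma squeeze_partial_sums:
  fixes x :: "nat \<Rightarrow> real" and a :: "nat \<Rightarrow> nat \<Rightarrow> real"
  assumes up: "\<And>n J. n > 0 \<Longrightarrow> even J \<Longrightarrow> x n \<le> (\<Sum>j\<le>J. a j n)"
    and lo: "\<And>n J. n > 0 \<Longrightarrow> odd J \<Longrightarrow> (\<Sum>j\<le>J. a j n) \<le> x n"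
    and a: "\<And>j. a j \<longlonglongrightarrow> b j" and b: "b sums s"
  shows "x \<longlonglongrightarrow> s"
proof -
  have bs: "(\<lambda>J. \<Sum>j\<le>J. b j) \<longlonglongrightarrow> s" using b by (simp add: sums_def_le)
  have lim: "(\<lambda>n. \<Sum>j\<le>J. a j n) \<longlonglongrightarrow> (\<Sum>j\<le>J. b j)" for J by (intro tendsto_sum a)
  show ?thesis
  proof (rule order_tendstoI)
    fix c assume "c < s"
    then obtain N where N: "\<And>J. J \<ge> N \<Longrightarrow> c < (\<Sum>j\<le>J. b j)"
      using order_tendstoD(1)[OF bs] by (auto simp: eventually_sequentially)
    define J where "J = 2 * N + 1"
    have "c < (\<Sum>j\<le>J. b j)" using N[of J] by (simp add: J_def)
    from order_tendstoD(1)[OF lim this] eventually_gt_at_top[of 0]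
    show "eventually (\<lambda>n. c < x n) sequentially"
    proof eventually_elim
      case (elim n)
      then show ?case using lo[of n J] by (simp add: J_def)
    qed
  next
    fix c assume "s < c"
    then obtain N where N: "\<And>J. J \<ge> N \<Longrightarrow> (\<Sum>j\<le>J. b j) < c"
      using order_tendstoD(2)[OF bs] by (auto simp: eventually_sequentially)
    define J where "J = 2 * N"
    have "(\<Sum>j\<le>J. b j) < c" using N[of J] by (simp add: J_def)
    from order_tendstoD(2)[OF lim this] eventually_gt_at_top[of 0]
    show "eventually (\<lambda>n. x n < c) sequentially"
    proof eventually_elim
      case (elim n)
      then show ?case using up[of n J] by (simp add: J_def)
    qed
  qed
qed

lemma (in p_group_target) cok_limit:
  fixes M :: "nat \<Rightarrow> 'w \<Rightarrow> 'p :: prime_card padic_int Matrix.mat"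
  assumes pC: "p = CARD('p)" and \<epsilon>: "\<epsilon> > 0" and ab: "0 \<le> \<alpha>" "0 \<le> \<beta>" "\<alpha> + \<beta> < 1"
    and R: "\<And>n. n > 0 \<Longrightarrow> random_matrix (\<Omega> n) n u (M n) (A n) \<epsilon> \<alpha> \<beta>"
  shows "(\<lambda>n. \<P>(\<omega> in \<Omega> n. cok (M n \<omega>) \<cong> B))
    \<longlonglongrightarrow> (\<Prod>k. 1 - 1 / real p ^ (k + 1 + u)) / (real (order B) ^ u * real (card (auto B)))"
proof -
  let ?C = "real (order B) ^ u * real (card (auto B))"
  define S where "S = (\<lambda>j n. \<Sum>Y\<in>duals n. \<Sum>ys\<in>free_tuples n Y j.
       measure (\<Omega> n) {\<omega> \<in> space (\<Omega> n). Y \<union> set ys \<subseteq> col_perp (Suc e) n (n + u) (M n \<omega>)})"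
  define m where "m = (\<lambda>j n. real (card (duals n)) * (real p ^ (e * j) * (\<Prod>i<j. real p ^ n - real p ^ i)) *
           (1 / real p ^ (e + j)) ^ (n + u))"
  have "(\<lambda>n. S j n - m j n) \<longlonglongrightarrow> 0" for j
  proof (rule LIMSEQ_I)
    fix r :: real assume r: "r > 0"
    then have "r / 2 > 0" by simp
    from duals_limit[where 'p = 'p and 'w = 'w, OF pC \<epsilon> ab this, of u j] obtain n0 where
      n0: "\<forall>n\<ge>n0. \<forall>(P :: 'w measure) (M :: 'w \<Rightarrow> 'p padic_int Matrix.mat) A.
     random_matrix P n u M A \<epsilon> \<alpha> \<beta> \<longrightarrow>
     \<bar>(\<Sum>Y\<in>duals n. \<Sum>ys\<in>free_tuples n Y j.
          measure P {\<omega> \<in> space P. Y \<union> set ys \<subseteq> col_perp (Suc e) n (n + u) (M \<omega>)}) - m j n\<bar> \<le> r / 2"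
      unfolding m_def ..
    show "\<exists>no. \<forall>n\<ge>no. norm (S j n - m j n - 0) < r"
    proof (intro exI[of _ "max n0 1"] allI impI)
      fix n assume "n \<ge> max n0 1"
      then have n: "n \<ge> n0" "n > 0" by auto
      have "\<bar>S j n - m j n\<bar> \<le> r / 2" unfolding S_def by (rule n0[rule_format, OF n(1) R[OF n(2)]])
      then show "norm (S j n - m j n - 0) < r" using r by simp
    qed
  qed
  then have "(\<lambda>n. (S j n - m j n) / real p ^ (e * j) + m j n / real p ^ (e * j)) \<longlonglongrightarrow>
      0 / real p ^ (e * j) + (1 / real p ^ u) ^ j / ?C" for j
    unfolding m_def using p1 by (intro tendsto_add tendsto_divide tendsto_const main_term_limit) auto
  then have S: "(\<lambda>n. S j n / real p ^ (e * j)) \<longlonglongrightarrow> (1 / real p ^ u) ^ j / ?C" for j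
    by (simp add: diff_divide_distrib)
  have sl: "(\<lambda>n. qwt p j / real p ^ (e * j) * S j n) \<longlonglongrightarrow> qwt p j * (1 / real p ^ u) ^ j / ?C" for j
    using tendsto_mult[OF tendsto_const[of "qwt p j"] S[of j]] by simp
  have p2: "real p \<ge> 2" using p1 by simp
  show ?thesis
  proof (rule squeeze_partial_sums[OF _ _ sl sums_divide[OF qwt_sums_euler[OF p2]]])
    fix n J :: nat assume n: "n > 0"
    show "\<P>(\<omega> in \<Omega> n. cok (M n \<omega>) \<cong> B) \<le> (\<Sum>j\<le>J. qwt p j / real p ^ (e * j) * S j n)" if "even J"
      unfolding S_def by (rule prob_cok_bounds(1)[OF pC R[OF n] that])
    show "(\<Sum>j\<le>J. qwt p j / real p ^ (e * j) * S j n) \<le> \<P>(\<omega> in \<Omega> n. cok (M n \<omega>) \<cong> B)" if "odd J"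
      unfolding S_def by (rule prob_cok_bounds(2)[OF pC R[OF n] that])
  qed
qed

theorem theorem1p6:
  fixes u :: nat and \<epsilon> \<alpha> \<beta> :: real
    and B :: "('b, 'c) monoid_scheme"
    and \<Omega> :: "nat \<Rightarrow> 'w measure"
    and M :: "nat \<Rightarrow> 'w \<Rightarrow> 'p :: prime_card padic_int Matrix.mat"
    and A :: "nat \<Rightarrow> nat \<Rightarrow> 'p padic_int Matrix.mat"
  assumes "\<epsilon> > 0" and "\<alpha> > 0" and "\<beta> > 0" and "\<alpha> + \<beta> < 1"
    and "comm_group B" and "finite (carrier B)" and "\<exists>r. order B = CARD('p) ^ r"
    and "\<And>n. n > 0 \<Longrightarrow> prob_space (\<Omega> n)"
    and "\<And>n \<omega>. n > 0 \<Longrightarrow> \<omega> \<in> space (\<Omega> n) \<Longrightarrow> M n \<omega> \<in> carrier_mat n (n + u)"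
    and "\<And>n. n > 0 \<Longrightarrow>
           prob_space.indep_vars (\<Omega> n) (\<lambda>_. \<Pi>\<^sub>M i\<in>{..<n}. borel)
             (\<lambda>j \<omega>. \<lambda>i\<in>{..<n}. col (M n \<omega>) j $ i) {..<n + u}"
    and "\<And>n j. n > 0 \<Longrightarrow> j < n + u \<Longrightarrow> A n j \<in> GL n"
    and "\<And>n j. n > 0 \<Longrightarrow> j < n + u \<Longrightarrow>
           prob_space.indep_vars (\<Omega> n) (\<lambda>_. borel)
             (\<lambda>i \<omega>. (A n j *\<^sub>v col (M n \<omega>) j) $ i) {..<n}"
    and "\<And>n j. n > 0 \<Longrightarrow> j < n + u \<Longrightarrow>
           real (card {i \<in> {..<n}.
             \<not> eps_balanced (\<Omega> n) \<epsilon> (\<lambda>\<omega>. (A n j *\<^sub>v col (M n \<omega>) j) $ i)}) \<le> \<alpha> * real n"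
    and "\<And>n. n > 0 \<Longrightarrow> \<exists>b. is_basis n b \<and>
           (\<forall>i<n. real (card {j \<in> {..<n + u}.
              b i \<notin> balanced_locus (\<Omega> n) \<epsilon> n (A n j) (\<lambda>\<omega>. col (M n \<omega>) j)}) \<le> \<beta> * real n)"
  shows "(\<lambda>n. \<P>(\<omega> in \<Omega> n. cok (M n \<omega>) \<cong> B))
           \<longlonglongrightarrow> (\<Prod>k. 1 - 1 / real CARD('p) ^ (k + 1 + u)) /
               (real (order B) ^ u * real (card (auto B)))"
proof -
  obtain e where e: "order B = CARD('p) ^ e" using assms(7) by blast
  have p: "Factorial_Ring.prime CARD('p)" by (rule prime_card)
  have q: "CARD('p) ^ Suc e > 1" using p_gt_1[where 'p = 'p] by (rule one_less_power) simp
  interpret p_group_target B "CARD('p) ^ Suc e" "CARD('p)" e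
  proof (intro p_group_target.intro finite_target.intro finite_target_axioms.intro p_group_target_axioms.intro)
    show "order B dvd CARD('p) ^ Suc e" unfolding e by (rule le_imp_power_dvd) simp
  qed (rule assms(5,6) p q e refl)+
  have R: "random_matrix (\<Omega> n) n u (M n) (A n) \<epsilon> \<alpha> \<beta>" if "n > 0" for n
  proof (rule random_matrix.intro)
    show "prob_space (\<Omega> n)" by (rule assms(8)[OF that])
    show "random_matrix_axioms (\<Omega> n) n u (M n) (A n) \<epsilon> \<alpha> \<beta>"
      by (rule random_matrix_axioms.intro) (assumption | rule that assms(1,9-14))+
  qed
  show ?thesis
    by (rule cok_limit[OF refl assms(1) less_imp_le[OF assms(2)] less_imp_le[OF assms(3)] assms(4)]) (rule R)
qed

end
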